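(* Let $p\in(0,1]$ and $t\ge0$. Let $\mathrm{CC}^*_{p,n}(m)$ denote the connected component of $F_{p,n}(m)$ containing the vertex $1$, with its vertices relabeled in increasing order from $1$ to $\#\mathrm{CC}^*_{p,n}(m)$ (its number of vertices). Then, as $n\to\infty$, the conditional law of $\mathrm{CC}^*_{p,n}(\lfloor nt\rfloor)$ given that $\mathrm{CC}^*_{p,n}(\lfloor nt\rfloor)$ is a tree converges in distribution to $\mathrm{GW}_{\mathrm{Poi}(2t(1-g_p(t)))}$, where $\mathrm{GW}_{\mathrm{Poi}(\lambda)}$ designates a Galton–Watson tree whose offspring distribution is Poisson with mean $\lambda$, equipped with uniform random labels from $1$ to $\#\mathrm{GW}_{\mathrm{Poi}(\lambda)}$ on its vertices, and where the original (planar) order is forgotten, as well as the root. In a related way, for every $k\in\mathbb N=\{1,2,\dots\}$, $$\mathbb P\big(\mathrm{CC}^*_{p,n}(\lfloor nt\rfloor)\text{ is a tree of size }k\big)\ \longrightarrow\ k\,t_{p,k}(t)\quad\text{as }n\to\infty.$$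
   Context: Discrete $p$-frozen model. Fix $p\in(0,1]$. For an integer $n\ge 2$ the random (multi)graph process $(F_{p,n}(m))_{m\in\mathbb Z_+}$ on vertex set $\{1,\dots,n\}$ is defined recursively. All its connected components are either trees (number of edges = number of vertices minus one) or unicycles (number of edges = number of vertices); vertices of unicycles are called frozen. $F_{p,n}(0)$ has $n$ isolated non-frozen vertices. At step $m\ge 1$, given $F_{p,n}(m-1)$, one of the $n(n-1)/2$ possible edges is selected uniformly at random, independently of the past (the same edge may be selected several times), and: (i) if it connects two vertices of trees of $F_{p,n}(m-1)$ (possibly the same tree), it is added; if two different trees are involved this produces a new tree (non-frozen), otherwise it produces a unicycle whose vertices become frozen (if the selected edge is already present in the tree, it is added as a parallel edge, creating a cycle of length two); (ii) if it connects two vertices of unicycles (possibly the same), it is discarded; (iii) if it connects a tree and a unicycle, it is added with probability $p$ (the tree is glued to the unicycle and all its vertices become frozen) and discarded with probability $1-p$. The size of a tree is its number of vertices. Convergence in distribution is for random variables in the countable discrete set of finite labeled trees (unrooted, unordered, labels $1,\dots,k$ on $k$ vertices). Limit functions: let $f_p:[0,1)\to[1/2,\infty)$, $f_p(s)=\frac12\sum_{j=0}^\infty \frac{s^j}{1+pj}$, an increasing bijection. The function $g_p:[0,\infty)\to[0,1)$ is $0$ on $[0,1/2]$ and is the inverse of $f_p$ on $[1/2,\infty)$. For $k\ge1$ and $t\ge0$, $t_{p,k}(t)=\frac{k^{k-2}}{k!}(2t)^{k-1}(1-g_p(t))^k e^{-2kt(1-g_p(t))}$ (with $0^0=1$). 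*)

theory Defs
  imports "HOL-Probability.Probability"
begin

text \<open>An edge is its set of endpoints; parallel edges are recorded by multiplicity.\<close>

datatype 'v multigraph = Multigraph (verts: "'v set") (edges: "'v set multiset")

definition adjacency :: "'v multigraph \<Rightarrow> ('v \<times> 'v) set" where
  "adjacency G = {(u, v). {u, v} \<in># edges G}"

definition connected_graph :: "'v multigraph \<Rightarrow> bool" where
  "connected_graph G \<longleftrightarrow>
     verts G \<noteq> {} \<and> (\<forall>u\<in>verts G. \<forall>v\<in>verts G. (u, v) \<in> (adjacency G)\<^sup>*)"

definition is_tree :: "'v multigraph \<Rightarrow> bool" where
  "is_tree G \<longleftrightarrow>
     finite (verts G) \<and> connected_graph G \<and> size (edges G) + 1 = card (verts G)"

definition is_unicycle :: "'v multigraph \<Rightarrow> bool" where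
  "is_unicycle G \<longleftrightarrow>
     finite (verts G) \<and> connected_graph G \<and> size (edges G) = card (verts G)"

definition component :: "'v multigraph \<Rightarrow> 'v \<Rightarrow> 'v multigraph" where
  "component G v =
     (let C = {w \<in> verts G. (v, w) \<in> (adjacency G)\<^sup>*}
      in Multigraph C (filter_mset (\<lambda>e. e \<subseteq> C) (edges G)))"

definition relabel :: "('v \<Rightarrow> 'w) \<Rightarrow> 'v multigraph \<Rightarrow> 'w multigraph" where
  "relabel \<sigma> G = Multigraph (\<sigma> ` verts G) (image_mset ((`) \<sigma>) (edges G))"

definition relabel_increasing :: "nat multigraph \<Rightarrow> nat multigraph" where
  "relabel_increasing G = relabel (\<lambda>v. card {w \<in> verts G. w \<le> v}) G"

definition possible_edges :: "nat \<Rightarrow> nat set set" where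
  "possible_edges n = {e. e \<subseteq> {1..n} \<and> card e = 2}"

definition add_edge :: "'v set \<Rightarrow> 'v multigraph \<Rightarrow> 'v multigraph" where
  "add_edge e G = Multigraph (verts G) (add_mset e (edges G))"

definition frozen_step :: "real \<Rightarrow> nat \<Rightarrow> nat multigraph \<Rightarrow> nat multigraph pmf" where
  "frozen_step p n G =
     bind_pmf (pmf_of_set (possible_edges n)) (\<lambda>e.
       if \<forall>v\<in>e. is_tree (component G v) then return_pmf (add_edge e G)
       else if \<forall>v\<in>e. is_unicycle (component G v) then return_pmf G
       else map_pmf (\<lambda>b. if b then add_edge e G else G) (bernoulli_pmf p))"

text \<open>\<open>frozen_graph p n m\<close> is the law of the Markov chain \<open>F\<^sub>p\<^sub>,\<^sub>n\<close> at time \<open>m\<close>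
  (meaningful for \<open>n \<ge> 2\<close>).\<close>

primrec frozen_graph :: "real \<Rightarrow> nat \<Rightarrow> nat \<Rightarrow> nat multigraph pmf" where
  "frozen_graph p n 0 = return_pmf (Multigraph {1..n} {#})"
| "frozen_graph p n (Suc m) = bind_pmf (frozen_graph p n m) (frozen_step p n)"

definition CC_star :: "real \<Rightarrow> nat \<Rightarrow> nat \<Rightarrow> nat multigraph pmf" where
  "CC_star p n m = map_pmf (\<lambda>G. relabel_increasing (component G 1)) (frozen_graph p n m)"

definition f_fun :: "real \<Rightarrow> real \<Rightarrow> real" where
  "f_fun p s = 1 / 2 * (\<Sum>j. s ^ j / (1 + p * real j))"

definition g_fun :: "real \<Rightarrow> real \<Rightarrow> real" where
  "g_fun p t = (if t \<le> 1 / 2 then 0 else inv_into {0..<1} (f_fun p) t)"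

definition t_fun :: "real \<Rightarrow> nat \<Rightarrow> real \<Rightarrow> real" where
  "t_fun p k t = real k powi (int k - 2) / fact k * (2 * t) ^ (k - 1)
     * (1 - g_fun p t) ^ k * exp (- 2 * real k * t * (1 - g_fun p t))"

text \<open>The library's \<^const>\<open>poisson_pmf\<close> requires a positive mean; the mean \<open>0\<close> is needed
  for \<open>t = 0\<close>.\<close>

definition poisson_law :: "real \<Rightarrow> nat pmf" where
  "poisson_law c = (if c = 0 then return_pmf 0 else poisson_pmf c)"

text \<open>Ulam--Harris encoding: the root is \<^term>\<open>[]\<close>, the children of \<open>u\<close> are \<open>u @ [i]\<close> for
  \<open>i < K u\<close>, where \<open>K u\<close> is the number of children attributed to \<open>u\<close>.\<close>

definition plane_tree :: "(nat list \<Rightarrow> nat) \<Rightarrow> nat list set" where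
  "plane_tree K = {u. \<forall>i<length u. u ! i < K (take i u)}"

text \<open>The underlying unrooted unordered graph; the edges join the non-root vertices to their
  parents.\<close>

definition underlying_graph :: "nat list set \<Rightarrow> nat list multigraph" where
  "underlying_graph T = Multigraph T (mset_set ((\<lambda>u. {butlast u, u}) ` (T - {[]})))"

text \<open>An infinite tree cannot be labelled by \<open>{1..k}\<close> and is sent to the empty graph, which is
  not a tree.\<close>

definition random_labelling :: "nat list set \<Rightarrow> nat multigraph pmf" where
  "random_labelling T =
     (if finite T
      then map_pmf (\<lambda>\<sigma>. relabel \<sigma> (underlying_graph T))
             (pmf_of_set {\<sigma> \<in> T \<rightarrow>\<^sub>E {1..card T}. bij_betw \<sigma> T {1..card T}})
      else return_pmf (Multigraph {} {#}))"

definition GW_offspring :: "nat pmf \<Rightarrow> (nat list \<Rightarrow> nat) measure" where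
  "GW_offspring \<mu> = (\<Pi>\<^sub>M u\<in>UNIV. measure_pmf \<mu>)"

definition GW :: "nat pmf \<Rightarrow> nat multigraph measure" where
  "GW \<mu> = Giry_Monad.bind (GW_offspring \<mu>) (\<lambda>K. measure_pmf (random_labelling (plane_tree K)))"

text \<open>Every function on a discrete space is continuous, so the test functions are all bounded
  real functions.\<close>

definition converges_in_distribution :: "(nat \<Rightarrow> 'a measure) \<Rightarrow> 'a measure \<Rightarrow> bool" where
  "converges_in_distribution M N \<longleftrightarrow>
     (\<forall>h :: 'a \<Rightarrow> real. bounded (range h) \<longrightarrow>
        (\<lambda>n. \<integral>x. h x \<partial>M n) \<longlonglongrightarrow> (\<integral>x. h x \<partial>N))"

end

(* Outside the discarded edges, trees disappear at a rate governed by b = (tree vertices + p * frozen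
   vertices) / n, and with a := the time integral of b, the quantities exp (2 k a) * (fraction of
   vertices in trees of size k) satisfy in the limit a closed triangular system that does not involve
   the frozen part; its solution is alpha_k (2 t)^(k-1) with alpha_k = k^(k-1) / k!. The square of the
   deviation from this solution is a Lyapunov function, so that no path-wise argument is needed.

   To identify a, one must exclude that mass escapes to large trees before being frozen. Every accepted
   edge lowers the number of trees by exactly one. Comparing the number of trees with its version
   weighted by z^size shows that the mean square of sum over tree vertices of (1 - z^size) is at most
   1 - z, up to O(1/n), which is the required tightness. Then a solves approximately
   a' = p + (1 - p) u(t, a), where u(t, a) = sum_k alpha_k (2 t)^(k-1) exp (- 2 k a) is decreasing in
   a: the equation is contracting, and its solution A is explicit in terms of g_p because f_p solves
   2 f + 2 p s f' = 1 / (1 - s).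

   Given its size, the tree component is uniform: the probability of a configuration depends on its
   forest part only through the vertex set and the number of edges. On the Galton-Watson side, the
   plane trees with labels that produce a given labelled tree with a given root correspond to the
   orderings of the children of every vertex, which cancels the factorials of the Poisson weights. *)

theory Submission
  imports Defs
begin

section \<open>Components of multigraphs\<close>

text \<open>Two difficulties shape the argument: the rates involve the total number of tree
  vertices, which no finite set of sizes controls, and g_p is given only as the inverse of f_p. For
  the first, the integrated rate a is carried along with the graph. Its next value is known before
  each step, so the factor exp (2 k a) comes out of the one-step expectation and cancels the loss
  term. For the second, A' = b is read as secant inequalities for the monotone b, whose errors
  telescope over the steps.

  The formula for A comes from the tree series. For v = 1 - g and 2 t v \<le> 1, the sum of alpha_k
  (2 t)^(k-1) exp (- 2 k a) equals v as soon as exp (- 2 a) = v exp (- 2 t v), because the Borel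
  weights of parameter 2 t v sum to 1. Solving for a gives A, and A' = p + (1 - p) v becomes, with t
  = f s, the differential equation of f_p.

  Tightness is available only on average over time. This suffices for a, which is an integral; at a
  fixed time it is recovered because the number of tree vertices never increases.\<close>

definition reach :: "'v multigraph \<Rightarrow> 'v \<Rightarrow> 'v set" where
  "reach G v = {w \<in> verts G. (v, w) \<in> (adjacency G)\<^sup>*}"

text \<open>Loops are excluded but multiplicities are free: a doubled edge is a cycle of length
  two.\<close>

definition wf_graph :: "'v multigraph \<Rightarrow> bool" where
  "wf_graph G \<longleftrightarrow> finite (verts G) \<and> (\<forall>e\<in>#edges G. e \<subseteq> verts G \<and> card e = 2)"

lemma component_altdef:
  "component G v = Multigraph (reach G v) (filter_mset (\<lambda>e. e \<subseteq> reach G v) (edges G))"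
  by (simp add: component_def reach_def Let_def)

lemma verts_component [simp]: "verts (component G v) = reach G v"
  and edges_component: "edges (component G v) = filter_mset (\<lambda>e. e \<subseteq> reach G v) (edges G)"
  by (simp_all add: component_altdef)

lemma sym_adjacency: "sym (adjacency G)"
  by (auto simp: sym_def adjacency_def insert_commute)

lemma adj_rtrancl_sym: "(u, v) \<in> (adjacency G)\<^sup>* \<Longrightarrow> (v, u) \<in> (adjacency G)\<^sup>*"
  using sym_rtrancl[OF sym_adjacency] by (metis symD)

lemma wf_graph_finite: "wf_graph G \<Longrightarrow> finite (verts G)"
  by (simp add: wf_graph_def)

lemma finite_reach [simp]: "wf_graph G \<Longrightarrow> finite (reach G v)"
  by (simp add: wf_graph_def reach_def)

lemma reach_subset: "reach G v \<subseteq> verts G"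
  by (auto simp: reach_def)

lemma reach_self: "v \<in> verts G \<Longrightarrow> v \<in> reach G v"
  by (simp add: reach_def)

lemma reach_eq: "w \<in> reach G v \<Longrightarrow> reach G w = reach G v"
proof -
  assume "w \<in> reach G v"
  then have "(v, w) \<in> (adjacency G)\<^sup>*" by (simp add: reach_def)
  then have "(w, x) \<in> (adjacency G)\<^sup>* \<longleftrightarrow> (v, x) \<in> (adjacency G)\<^sup>*" for x
    using adj_rtrancl_sym[of v w G] by (meson rtrancl_trans)
  then show ?thesis by (simp add: reach_def)
qed

lemma reach_sym: "w \<in> reach G v \<Longrightarrow> v \<in> verts G \<Longrightarrow> v \<in> reach G w"
  using reach_eq reach_self by fastforce

lemma reach_disjoint: "reach G u \<inter> reach G v = {} \<or> reach G u = reach G v"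
  using reach_eq by (metis disjoint_iff)

lemma component_eq: "w \<in> reach G v \<Longrightarrow> component G w = component G v"
  by (simp add: component_altdef reach_eq)

lemma reach_edge:
  assumes "{u, v} \<in># edges G" "wf_graph G"
  shows "v \<in> reach G u"
proof -
  have "{u, v} \<subseteq> verts G" using assms by (auto simp: wf_graph_def)
  moreover have "(u, v) \<in> adjacency G" using assms by (auto simp: adjacency_def)
  ultimately show ?thesis by (auto simp: reach_def)
qed

lemma edge_subset_reach:
  assumes "wf_graph G" "e \<in># edges G" "x \<in> e" "x \<in> reach G v"
  shows "e \<subseteq> reach G v"
proof -
  have "card e = 2" using assms by (auto simp: wf_graph_def)
  then obtain a b where e: "e = {a, b}" by (meson card_2_iff)
  have "b \<in> reach G a" "a \<in> reach G b"
    using reach_edge[of a b G] reach_edge[of b a G] assms e by (auto simp: insert_commute)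
  then show ?thesis using assms e reach_eq by fastforce
qed

lemma wf_component: "wf_graph G \<Longrightarrow> wf_graph (component G v)"
  by (auto simp: wf_graph_def component_altdef intro: finite_subset[OF reach_subset])

lemma adj_component:
  assumes "wf_graph G" "(v, w) \<in> (adjacency G)\<^sup>*" "v \<in> verts G"
  shows "(v, w) \<in> (adjacency (component G v))\<^sup>*"
  using assms(2)
proof (induction rule: rtrancl_induct)
  case base then show ?case by simp
next
  case (step y z)
  then have e: "{y, z} \<in># edges G" by (auto simp: adjacency_def)
  then have "y \<in> verts G" using assms by (auto simp: wf_graph_def)
  then have "y \<in> reach G v" using step by (auto simp: reach_def)
  then have "{y, z} \<subseteq> reach G v" using edge_subset_reach[OF assms(1) e] by auto
  then have "(y, z) \<in> adjacency (component G v)"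
    using e by (auto simp: adjacency_def edges_component)
  then show ?case using step by auto
qed

lemma connected_component:
  assumes "wf_graph G" "v \<in> verts G"
  shows "connected_graph (component G v)"
  unfolding connected_graph_def
proof (intro conjI ballI)
  show "verts (component G v) \<noteq> {}" using reach_self[OF assms(2)] by auto
  fix a b assume "a \<in> verts (component G v)" "b \<in> verts (component G v)"
  then have ab: "a \<in> reach G v" "b \<in> reach G v" by auto
  then have "b \<in> reach G a" using reach_eq by fastforce
  then have "(a, b) \<in> (adjacency (component G a))\<^sup>*"
    using adj_component[OF assms(1)] ab reach_subset by (fastforce simp: reach_def)
  then show "(a, b) \<in> (adjacency (component G v))\<^sup>*" using component_eq[OF ab(1)] by simp
qed

lemma is_tree_component_iff:
  assumes "wf_graph G" "v \<in> verts G"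
  shows "is_tree (component G v) \<longleftrightarrow> size (edges (component G v)) + 1 = card (reach G v)"
  using assms by (simp add: is_tree_def connected_component)

lemma is_unicycle_component_iff:
  assumes "wf_graph G" "v \<in> verts G"
  shows "is_unicycle (component G v) \<longleftrightarrow> size (edges (component G v)) = card (reach G v)"
  using assms by (simp add: is_unicycle_def connected_component)

lemma component_connected:
  assumes "wf_graph G" "connected_graph G" "v \<in> verts G"
  shows "component G v = G"
proof -
  have "reach G v = verts G" using assms by (auto simp: reach_def connected_graph_def)
  moreover have "filter_mset (\<lambda>e. e \<subseteq> verts G) (edges G) = edges G"
    using assms(1) by (simp add: wf_graph_def filter_mset_eq_conv)
  ultimately show ?thesis by (simp add: component_altdef)
qed

text \<open>A breadth-first spanning tree, with \<open>d\<close> the distance from \<open>r\<close>.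
  The strictly decreasing \<open>d\<close> replaces reasoning on paths and cycles in the edge counts
  below.\<close>

lemma parent_function_exists:
  assumes "wf_graph G" "connected_graph G" "r \<in> verts G"
  obtains par :: "'v \<Rightarrow> 'v" and d :: "'v \<Rightarrow> nat" where
    "\<And>v. v \<in> verts G - {r} \<Longrightarrow> par v \<in> verts G \<and> {par v, v} \<in># edges G \<and> d (par v) < d v"
proof -
  define d where "d v = (LEAST n. (r, v) \<in> adjacency G ^^ n)" for v
  have "\<exists>x. x \<in> verts G \<and> {x, v} \<in># edges G \<and> d x < d v" if v: "v \<in> verts G - {r}" for v
  proof -
    have "(r, v) \<in> (adjacency G)\<^sup>*" using v assms by (auto simp: connected_graph_def)
    then have "\<exists>n. (r, v) \<in> adjacency G ^^ n" by (simp add: rtrancl_power)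
    then have dv: "(r, v) \<in> adjacency G ^^ d v" unfolding d_def by (rule LeastI_ex)
    then obtain m where m: "d v = Suc m" using v by (cases "d v") auto
    then obtain x where x: "(r, x) \<in> adjacency G ^^ m" "(x, v) \<in> adjacency G"
      using dv by auto
    have "d x \<le> m" unfolding d_def using x(1) by (rule Least_le)
    moreover have "{x, v} \<in># edges G" using x by (auto simp: adjacency_def)
    moreover have "x \<in> verts G" using calculation assms(1) by (auto simp: wf_graph_def)
    ultimately show ?thesis using m by auto
  qed
  then have "\<forall>v\<in>verts G - {r}. \<exists>x. x \<in> verts G \<and> {x, v} \<in># edges G \<and> d x < d v" by blast
  from bchoice[OF this] obtain par where
    "\<forall>v\<in>verts G - {r}. par v \<in> verts G \<and> {par v, v} \<in># edges G \<and> d (par v) < d v" by auto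
  then show thesis using that[of par d] by blast
qed

text \<open>Two vertices with the same parent edge would be parents of each other, and
  \<open>d\<close> would decrease both ways.\<close>

lemma inj_on_parent_edge:
  fixes d :: "'v \<Rightarrow> nat"
  assumes "\<And>v. v \<in> S \<Longrightarrow> d (par v) < d v"
  shows "inj_on (\<lambda>v. {par v, v}) S"
proof (rule inj_onI)
  fix v w assume vw: "v \<in> S" "w \<in> S" "{par v, v} = {par w, w}"
  show "v = w"
  proof (rule ccontr)
    assume "v \<noteq> w"
    then have "par v = w" "par w = v" using vw(3) by (auto simp: doubleton_eq_iff)
    then show False using assms[OF vw(1)] assms[OF vw(2)] by simp
  qed
qed

text \<open>The parent edges of the vertices other than the root are pairwise distinct.\<close>

lemma connected_card_le:
  assumes "wf_graph G" "connected_graph G"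
  shows "card (verts G) \<le> size (edges G) + 1"
proof -
  obtain r where r: "r \<in> verts G" using assms(2) by (auto simp: connected_graph_def)
  obtain par and d :: "'a \<Rightarrow> nat" where p: "\<And>v. v \<in> verts G - {r} \<Longrightarrow>
      par v \<in> verts G \<and> {par v, v} \<in># edges G \<and> d (par v) < d v"
    using parent_function_exists[OF assms r] by blast
  let ?I = "(\<lambda>v. {par v, v}) ` (verts G - {r})"
  have "card ?I = card (verts G - {r})"
    by (rule card_image, rule inj_on_parent_edge[where d = d]) (use p in auto)
  moreover have "?I \<subseteq> set_mset (edges G)" using p by auto
  then have "card ?I \<le> card (set_mset (edges G))" by (intro card_mono) auto
  moreover have "card (set_mset (edges G)) \<le> size (edges G)"
    using size_mset_mono[OF mset_set_set_mset_msubset[of "edges G"]] by simp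
  ultimately show ?thesis using r assms(1) by (simp add: wf_graph_def)
qed

text \<open>In a tree the edge count leaves no room beside the parent edges. In particular no edge
  is doubled, so a set of edges describes the multiset.\<close>

lemma tree_parent_function:
  assumes "wf_graph G" "is_tree G" "r \<in> verts G"
  obtains par :: "'v \<Rightarrow> 'v" and d :: "'v \<Rightarrow> nat" where
    "\<And>v. v \<in> verts G - {r} \<Longrightarrow> par v \<in> verts G \<and> d (par v) < d v"
    "edges G = mset_set ((\<lambda>v. {par v, v}) ` (verts G - {r}))"
proof -
  have con: "connected_graph G" using assms by (simp add: is_tree_def)
  obtain par and d :: "'v \<Rightarrow> nat" where p: "\<And>v. v \<in> verts G - {r} \<Longrightarrow>
      par v \<in> verts G \<and> {par v, v} \<in># edges G \<and> d (par v) < d v"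
    using parent_function_exists[OF assms(1) con assms(3)] by blast
  let ?I = "(\<lambda>v. {par v, v}) ` (verts G - {r})"
  have fin: "finite (verts G)" using assms by (simp add: wf_graph_def)
  have c: "card ?I = card (verts G - {r})"
    by (rule card_image, rule inj_on_parent_edge[where d = d]) (use p in auto)
  have "mset_set ?I \<subseteq># edges G"
  proof -
    have "?I \<subseteq> set_mset (edges G)" using p by auto
    then have "mset_set ?I \<subseteq># mset_set (set_mset (edges G))"
      by (simp add: subset_imp_msubset_mset_set)
    also have "\<dots> \<subseteq># edges G" by (rule mset_set_set_mset_msubset)
    finally show ?thesis .
  qed
  moreover have "size (mset_set ?I) = size (edges G)"
    using c assms fin by (simp add: is_tree_def) linarith
  ultimately have "mset_set ?I = edges G"
    by (metis nat_less_le mset_subset_size subset_mset.le_less)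
  then show thesis using that[of par d] p by auto
qed

section \<open>Adding or deleting one edge\<close>

lemma adjacency_add_edge:
  "adjacency (add_edge {u, v} G) = insert (u, v) (insert (v, u) (adjacency G))"
  by (auto simp: adjacency_def add_edge_def doubleton_eq_iff)

lemma verts_add_edge [simp]: "verts (add_edge e G) = verts G"
  and edges_add_edge [simp]: "edges (add_edge e G) = add_mset e (edges G)"
  by (simp_all add: add_edge_def)

lemma wf_add_edge:
  "wf_graph G \<Longrightarrow> e \<subseteq> verts G \<Longrightarrow> card e = 2 \<Longrightarrow> wf_graph (add_edge e G)"
  by (auto simp: wf_graph_def)

lemma reach_add_edge_internal:
  assumes "v \<in> reach G u"
  shows "reach (add_edge {u, v} G) w = reach G w"
proof -
  have "(u, v) \<in> (adjacency G)\<^sup>*" "(v, u) \<in> (adjacency G)\<^sup>*"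
    using assms by (auto simp: reach_def intro: adj_rtrancl_sym)
  then have "(adjacency (add_edge {u, v} G))\<^sup>* = (adjacency G)\<^sup>*"
    unfolding adjacency_add_edge by (intro rtrancl_subset) auto
  then show ?thesis by (simp add: reach_def)
qed

lemma reach_add_edge_merge:
  assumes "u \<in> verts G" "v \<in> verts G"
  shows "w \<in> reach G u \<union> reach G v \<Longrightarrow> reach (add_edge {u, v} G) w = reach G u \<union> reach G v"
    and "w \<in> verts G \<Longrightarrow> w \<notin> reach G u \<union> reach G v \<Longrightarrow> reach (add_edge {u, v} G) w = reach G w"
proof -
  let ?r = "adjacency G"
  have s: "(adjacency (add_edge {u, v} G))\<^sup>* = (insert (v,u) ?r)\<^sup>* \<union>
     {(x, y). (x, u) \<in> (insert (v,u) ?r)\<^sup>* \<and> (v, y) \<in> (insert (v,u) ?r)\<^sup>*}"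
    by (simp add: adjacency_add_edge rtrancl_insert)
  have s2: "(insert (v,u) ?r)\<^sup>* = ?r\<^sup>* \<union> {(x, y). (x, v) \<in> ?r\<^sup>* \<and> (u, y) \<in> ?r\<^sup>*}"
    by (simp add: rtrancl_insert)
  have sy: "(x, y) \<in> ?r\<^sup>* \<longleftrightarrow> (y, x) \<in> ?r\<^sup>*" for x y using adj_rtrancl_sym by metis
  have tr: "(x, y) \<in> ?r\<^sup>* \<Longrightarrow> (y, z) \<in> ?r\<^sup>* \<Longrightarrow> (x, z) \<in> ?r\<^sup>*" for x y z by auto
  have r: "(x, y) \<in> (adjacency (add_edge {u, v} G))\<^sup>* \<longleftrightarrow>
     (x, y) \<in> ?r\<^sup>* \<or> ((u, x) \<in> ?r\<^sup>* \<or> (v, x) \<in> ?r\<^sup>*) \<and> ((u, y) \<in> ?r\<^sup>* \<or> (v, y) \<in> ?r\<^sup>*)" for x y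
    unfolding s s2 using sy[of x u] sy[of x v] by auto
  show "reach (add_edge {u, v} G) w = reach G u \<union> reach G v" if "w \<in> reach G u \<union> reach G v"
  proof -
    have w: "(u, w) \<in> ?r\<^sup>* \<or> (v, w) \<in> ?r\<^sup>*" using that by (auto simp: reach_def)
    then have "(w, y) \<in> ?r\<^sup>* \<Longrightarrow> (u, y) \<in> ?r\<^sup>* \<or> (v, y) \<in> ?r\<^sup>*" for y
      using tr by blast
    then show ?thesis unfolding reach_def using r[of w] w by auto
  qed
  show "reach (add_edge {u, v} G) w = reach G w" if "w \<in> verts G" "w \<notin> reach G u \<union> reach G v"
    using that r[of w] by (auto simp: reach_def)
qed

lemma component_add_edge_internal:
  assumes "u \<in> verts G" "v \<in> reach G u" "w \<in> verts G"
  shows "w \<in> reach G u \<Longrightarrow>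
      component (add_edge {u, v} G) w = add_edge {u, v} (component G u)"
    and "w \<notin> reach G u \<Longrightarrow> component (add_edge {u, v} G) w = component G w"
proof -
  show "component (add_edge {u, v} G) w = add_edge {u, v} (component G u)" if "w \<in> reach G u"
    using assms reach_self[OF assms(1)] reach_eq[OF that]
    by (intro multigraph.expand) (simp add: edges_component reach_add_edge_internal)
  show "component (add_edge {u, v} G) w = component G w" if "w \<notin> reach G u"
  proof -
    have "u \<notin> reach G w" using that assms reach_sym by metis
    then show ?thesis using assms
      by (intro multigraph.expand) (simp add: edges_component reach_add_edge_internal)
  qed
qed

lemma component_add_edge_merge:
  assumes "wf_graph G" "u \<in> verts G" "v \<in> verts G" "v \<notin> reach G u" "w \<in> verts G"
  shows "w \<in> reach G u \<union> reach G v \<Longrightarrow> component (add_edge {u, v} G) w =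
      Multigraph (reach G u \<union> reach G v)
        (add_mset {u, v} (edges (component G u) + edges (component G v)))"
    and "w \<notin> reach G u \<union> reach G v \<Longrightarrow> component (add_edge {u, v} G) w = component G w"
proof -
  show "component (add_edge {u, v} G) w =
      Multigraph (reach G u \<union> reach G v)
        (add_mset {u, v} (edges (component G u) + edges (component G v)))"
    if w: "w \<in> reach G u \<union> reach G v"
  proof -
    have dis: "reach G u \<inter> reach G v = {}"
      using reach_disjoint assms reach_self by metis
    \<comment> \<open>No edge of \<open>G\<close> joins the two classes and no edge lies in both, so
      the edges inside the union split into two multisets.\<close>
    have "filter_mset (\<lambda>e. e \<subseteq> reach G u \<union> reach G v) (edges G) =
          filter_mset (\<lambda>e. e \<subseteq> reach G u \<or> e \<subseteq> reach G v) (edges G)"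
    proof (rule filter_mset_cong[OF refl])
      fix e assume e: "e \<in># edges G"
      then have "e \<noteq> {}" using assms(1) by (auto simp: wf_graph_def)
      then obtain x where "x \<in> e" by auto
      then show "(e \<subseteq> reach G u \<union> reach G v) = (e \<subseteq> reach G u \<or> e \<subseteq> reach G v)"
        using edge_subset_reach[OF assms(1) e] by blast
    qed
    also have "\<dots> = filter_mset (\<lambda>e. e \<subseteq> reach G u) (edges G)
                   + filter_mset (\<lambda>e. e \<subseteq> reach G v) (edges G)"
    proof -
      have "\<not> (e \<subseteq> reach G u \<and> e \<subseteq> reach G v)" if "e \<in># edges G" for e
      proof -
        have "card e = 2" using that assms(1) by (auto simp: wf_graph_def)
        then have "e \<noteq> {}" by auto
        then show ?thesis using dis by blast
      qed
      then show ?thesis by (intro multiset_eqI) (metis (mono_tags, lifting) add.right_neutral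
        add_0 count_eq_zero_iff count_filter_mset count_union)
    qed
    finally show ?thesis
      using assms(2,3) reach_add_edge_merge(1)[OF assms(2,3) w] reach_self[of u G] reach_self[of v G]
      by (simp add: component_altdef)
  qed
  show "component (add_edge {u, v} G) w = component G w" if w: "w \<notin> reach G u \<union> reach G v"
  proof -
    have "u \<notin> reach G w" using w assms reach_sym by fastforce
    then show ?thesis using assms reach_add_edge_merge(2)[OF assms(2,3,5) w]
      by (simp add: component_altdef)
  qed
qed


definition valid_graph :: "'v multigraph \<Rightarrow> bool" where
  "valid_graph G \<longleftrightarrow>
     wf_graph G \<and> (\<forall>v\<in>verts G. is_tree (component G v) \<or> is_unicycle (component G v))"

lemma valid_graph_wf: "valid_graph G \<Longrightarrow> wf_graph G"
  by (simp add: valid_graph_def)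

lemma not_tree_and_unicycle: "\<not> (is_tree G \<and> is_unicycle G)"
  by (auto simp: is_tree_def is_unicycle_def)

context
  fixes G :: "'v multigraph" and u v :: 'v
  assumes wf: "wf_graph G" and u: "u \<in> verts G" and v: "v \<in> verts G" and uv: "u \<noteq> v"
begin

lemma wf_add_edge2: "wf_graph (add_edge {u, v} G)"
  using wf u v uv by (intro wf_add_edge) auto

text \<open>Components are connected by construction, so this case and the next two are counts of
  the excess of vertices over edges: it is 1 for a tree and 0 for a unicycle, it adds up when
  components are joined, and the new edge lowers it by 1.\<close>

lemma add_edge_two_trees:
  assumes "v \<notin> reach G u" "is_tree (component G u)" "is_tree (component G v)"
    and w: "w \<in> reach G u \<union> reach G v"
  shows "is_tree (component (add_edge {u, v} G) w)"
    and "card (reach (add_edge {u, v} G) w) = card (reach G u) + card (reach G v)"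
proof -
  have wV: "w \<in> verts G" using w by (auto simp: reach_def)
  have dis: "reach G u \<inter> reach G v = {}"
    using reach_disjoint assms(1) reach_self[OF v] by metis
  show c: "card (reach (add_edge {u, v} G) w) = card (reach G u) + card (reach G v)"
    using reach_add_edge_merge(1)[OF u v w] dis wf by (simp add: card_Un_disjoint)
  show "is_tree (component (add_edge {u, v} G) w)"
    using assms(2,3) c component_add_edge_merge(1)[OF wf u v assms(1) wV w] wV wf u v
    by (subst is_tree_component_iff[OF wf_add_edge2]) (auto simp: is_tree_component_iff)
qed

lemma add_edge_same_tree:
  assumes "v \<in> reach G u" "is_tree (component G u)" and w: "w \<in> reach G u"
  shows "is_unicycle (component (add_edge {u, v} G) w)"
proof -
  have wV: "w \<in> verts G" using w by (auto simp: reach_def)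
  have "reach (add_edge {u, v} G) w = reach G u"
    using reach_add_edge_internal[OF assms(1)] reach_eq[OF w] by simp
  then show ?thesis
    using assms(2) component_add_edge_internal(1)[OF u assms(1) wV w] wV wf u v
    by (subst is_unicycle_component_iff[OF wf_add_edge2]) (auto simp: is_tree_component_iff)
qed

lemma add_edge_tree_unicycle:
  assumes "is_tree (component G u)" "is_unicycle (component G v)"
    and w: "w \<in> reach G u \<union> reach G v"
  shows "is_unicycle (component (add_edge {u, v} G) w)"
proof -
  have wV: "w \<in> verts G" using w by (auto simp: reach_def)
  have nin: "v \<notin> reach G u"
    using assms component_eq not_tree_and_unicycle by metis
  then have dis: "reach G u \<inter> reach G v = {}"
    using reach_disjoint reach_self[OF v] by metis
  then have "card (reach (add_edge {u, v} G) w) = card (reach G u) + card (reach G v)"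
    using reach_add_edge_merge(1)[OF u v w] dis wf by (simp add: card_Un_disjoint)
  then show "is_unicycle (component (add_edge {u, v} G) w)"
    using assms(1,2) component_add_edge_merge(1)[OF wf u v nin wV w] wV wf u v
    by (subst is_unicycle_component_iff[OF wf_add_edge2])
      (auto simp: is_tree_component_iff is_unicycle_component_iff)
qed

end

text \<open>The remaining pieces obey \<open>connected_card_le\<close>. If the endpoints stayed
  connected, their component would have too few edges; otherwise the two inequalities add up to an
  equality, so both are sharp.\<close>

lemma delete_tree_edge:
  assumes wf: "wf_graph G" and e: "{u, v} \<in># edges G" and tree: "is_tree (component G u)"
  defines "G0 \<equiv> Multigraph (verts G) (edges G - {#{u, v}#})"
  shows "v \<notin> reach G0 u" "is_tree (component G0 u)" "is_tree (component G0 v)"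
proof -
  have G: "G = add_edge {u, v} G0" using e by (simp add: G0_def add_edge_def)
  have wf0: "wf_graph G0" using wf by (auto simp: wf_graph_def G0_def dest: in_diffD)
  have "card {u, v} = 2" using wf e by (auto simp: wf_graph_def)
  then have uv: "u \<noteq> v" by auto
  have u: "u \<in> verts G0" and v: "v \<in> verts G0" using wf e by (auto simp: wf_graph_def G0_def)
  have le: "card (reach G0 x) \<le> size (edges (component G0 x)) + 1" if "x \<in> verts G0" for x
    using connected_card_le[OF wf_component[OF wf0] connected_component[OF wf0 that]] by simp
  have sz: "size (edges (component G u)) + 1 = card (reach G u)"
    using tree is_tree_component_iff[OF wf] u by (simp add: G0_def)
  show nin: "v \<notin> reach G0 u"
  proof
    assume a: "v \<in> reach G0 u"
    have "reach G u = reach G0 u"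
      using reach_add_edge_internal[OF a] G by simp
    moreover have "component G u = add_edge {u, v} (component G0 u)"
      using component_add_edge_internal(1)[OF u a u reach_self[OF u]] G by simp
    ultimately show False using sz le[OF u] by simp
  qed
  have dis: "reach G0 u \<inter> reach G0 v = {}"
    using reach_disjoint nin reach_self[OF v] by metis
  have "reach G u = reach G0 u \<union> reach G0 v"
    using reach_add_edge_merge(1)[OF u v, of u] reach_self[OF u] G by simp
  moreover have "edges (component G u) =
      add_mset {u, v} (edges (component G0 u) + edges (component G0 v))"
    using component_add_edge_merge(1)[OF wf0 u v nin u] reach_self[OF u] G by simp
  ultimately have "size (edges (component G0 u)) + size (edges (component G0 v)) + 2 =
      card (reach G0 u) + card (reach G0 v)"
    using sz dis wf0 by (simp add: card_Un_disjoint)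
  then show "is_tree (component G0 u)" "is_tree (component G0 v)"
    using le[OF u] le[OF v] by (simp_all add: is_tree_component_iff wf0 u v)
qed

section \<open>One step of the process\<close>

definition treev :: "'v multigraph \<Rightarrow> 'v set" where
  "treev G = {v \<in> verts G. is_tree (component G v)}"

definition csize :: "'v multigraph \<Rightarrow> 'v \<Rightarrow> nat" where
  "csize G v = card (reach G v)"

text \<open>The sum of \<open>\<psi>\<close> over the sizes of the tree components, written as a sum over vertices.\<close>

definition tree_sum :: "(nat \<Rightarrow> real) \<Rightarrow> 'v multigraph \<Rightarrow> real" where
  "tree_sum \<psi> G = (\<Sum>v\<in>treev G. \<psi> (csize G v) / real (csize G v))"

lemma finite_treev [simp]: "wf_graph G \<Longrightarrow> finite (treev G)"
  by (auto simp: treev_def wf_graph_def)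

lemma treev_subset: "treev G \<subseteq> verts G"
  by (auto simp: treev_def)

lemma csize_pos: "wf_graph G \<Longrightarrow> v \<in> verts G \<Longrightarrow> csize G v > 0"
  unfolding csize_def using reach_self by (metis card_gt_0_iff empty_iff finite_reach)

lemma csize_reach: "w \<in> reach G v \<Longrightarrow> csize G w = csize G v"
  by (simp add: csize_def reach_eq)

lemma treev_reach: "w \<in> reach G v \<Longrightarrow> w \<in> treev G \<longleftrightarrow> is_tree (component G v)"
  using component_eq[of w G v] reach_subset[of G v] by (auto simp: treev_def)

lemma sum_over_reach:
  assumes "wf_graph G" "v \<in> verts G"
  shows "(\<Sum>w\<in>reach G v. \<psi> (csize G w) / real (csize G w)) = (\<psi> (csize G v) :: real)"
proof -
  have "(\<Sum>w\<in>reach G v. \<psi> (csize G w) / real (csize G w)) =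
        (\<Sum>w\<in>reach G v. \<psi> (csize G v) / real (csize G v))"
    by (rule sum.cong) (simp_all add: csize_reach)
  also have "\<dots> = \<psi> (csize G v)"
    using csize_pos[OF assms] by (simp add: csize_def)
  finally show ?thesis .
qed

lemma valid_graph_cases:
  "valid_graph G \<Longrightarrow> v \<in> verts G \<Longrightarrow> v \<notin> treev G \<longleftrightarrow> is_unicycle (component G v)"
  using not_tree_and_unicycle by (fastforce simp: valid_graph_def treev_def)

context
  fixes G :: "'v multigraph" and u v :: 'v
  assumes val: "valid_graph G" and u: "u \<in> verts G" and v: "v \<in> verts G" and uv: "u \<noteq> v"
begin

lemmas wfG = valid_graph_wf[OF val]

lemma two_trees_step:
  assumes "u \<in> treev G" "v \<in> treev G" "v \<notin> reach G u"
  shows "valid_graph (add_edge {u, v} G)" "treev (add_edge {u, v} G) = treev G"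
    "tree_sum \<psi> (add_edge {u, v} G) = tree_sum \<psi> G
       + \<psi> (csize G u + csize G v) - \<psi> (csize G u) - \<psi> (csize G v)"
proof -
  let ?G = "add_edge {u, v} G" and ?C = "reach G u \<union> reach G v"
  have t: "is_tree (component G u)" "is_tree (component G v)" using assms by (auto simp: treev_def)
  have inC: "is_tree (component ?G w)" "csize ?G w = csize G u + csize G v" if "w \<in> ?C" for w
    using add_edge_two_trees[OF wfG u v uv assms(3) t that] by (auto simp: csize_def)
  have outC: "component ?G w = component G w" "csize ?G w = csize G w"
    if "w \<notin> ?C" "w \<in> verts G" for w
    using component_add_edge_merge(2)[OF wfG u v assms(3) that(2,1)]
    by (auto simp: csize_def dest: arg_cong[where f = verts])
  show "valid_graph ?G"
  proof -
    have "is_tree (component ?G w) \<or> is_unicycle (component ?G w)" if "w \<in> verts G" for w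
      using inC(1)[of w] outC(1)[of w] that val
      by (cases "w \<in> ?C") (auto simp: valid_graph_def)
    then show ?thesis using wf_add_edge2[OF wfG u v uv] by (simp add: valid_graph_def)
  qed
  have sub: "?C \<subseteq> treev G" using t treev_reach[of _ G u] treev_reach[of _ G v] by auto
  show tv: "treev ?G = treev G"
    using inC(1) outC(1) sub by (fastforce simp: treev_def)
  have dis: "reach G u \<inter> reach G v = {}" using reach_disjoint assms reach_self[OF v] by metis
  have split: "sum g (treev G) = sum g (treev G - ?C) + sum g ?C" for g :: "'v \<Rightarrow> real"
    using sub wfG by (simp add: sum.subset_diff)
  have pos: "csize G u + csize G v > 0" using csize_pos[OF wfG u] by simp
  have "(\<Sum>w\<in>?C. \<psi> (csize ?G w) / real (csize ?G w)) =
        (\<Sum>w\<in>?C. \<psi> (csize G u + csize G v) / real (csize G u + csize G v))"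
    using inC by (intro sum.cong) auto
  also have "\<dots> = real (card ?C) * (\<psi> (csize G u + csize G v) / real (csize G u + csize G v))"
    by simp
  also have "card ?C = csize G u + csize G v"
    using dis wfG by (simp add: csize_def card_Un_disjoint)
  finally have 1: "(\<Sum>w\<in>?C. \<psi> (csize ?G w) / real (csize ?G w)) = \<psi> (csize G u + csize G v)"
    using pos by (auto simp del: of_nat_add)
  have 2: "(\<Sum>w\<in>?C. \<psi> (csize G w) / real (csize G w)) = \<psi> (csize G u) + \<psi> (csize G v)"
    using dis wfG by (simp add: sum.union_disjoint sum_over_reach u v)
  have 3: "(\<Sum>w\<in>treev G - ?C. \<psi> (csize ?G w) / real (csize ?G w)) =
        (\<Sum>w\<in>treev G - ?C. \<psi> (csize G w) / real (csize G w))"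
    using outC(2) by (intro sum.cong refl) (auto simp: treev_def)
  show "tree_sum \<psi> ?G = tree_sum \<psi> G
       + \<psi> (csize G u + csize G v) - \<psi> (csize G u) - \<psi> (csize G v)"
    unfolding tree_sum_def tv split 1 2 3 by simp
qed

text \<open>Common to the two ways of freezing a tree: closing a cycle in it and gluing it to a
  unicycle.\<close>

lemma tree_sum_remove:
  assumes "u \<in> treev G" "treev H = treev G - reach G u"
    "\<And>w. w \<in> treev H \<Longrightarrow> reach H w = reach G w"
  shows "tree_sum \<psi> H = tree_sum \<psi> G - \<psi> (csize G u)"
proof -
  have sub: "reach G u \<subseteq> treev G" using assms(1) treev_reach[of _ G u] by (auto simp: treev_def)
  have "tree_sum \<psi> G = (\<Sum>w\<in>treev H. \<psi> (csize G w) / real (csize G w)) +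
     (\<Sum>w\<in>reach G u. \<psi> (csize G w) / real (csize G w))"
    unfolding tree_sum_def assms(2) using sub wfG by (simp add: sum.subset_diff)
  moreover have "(\<Sum>w\<in>treev H. \<psi> (csize G w) / real (csize G w)) = tree_sum \<psi> H"
    unfolding tree_sum_def using assms(3) by (intro sum.cong) (auto simp: csize_def)
  ultimately show ?thesis using sum_over_reach[OF wfG u] by simp
qed

lemma same_tree_step:
  assumes "u \<in> treev G" "v \<in> reach G u"
  shows "valid_graph (add_edge {u, v} G)" "treev (add_edge {u, v} G) = treev G - reach G u"
    "tree_sum \<psi> (add_edge {u, v} G) = tree_sum \<psi> G - \<psi> (csize G u)"
proof -
  let ?G = "add_edge {u, v} G"
  have t: "is_tree (component G u)" using assms by (auto simp: treev_def)
  have inC: "is_unicycle (component ?G w)" if "w \<in> reach G u" for w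
    using add_edge_same_tree[OF wfG u v uv assms(2) t that] .
  have outC: "component ?G w = component G w" if "w \<notin> reach G u" "w \<in> verts G" for w
    using component_add_edge_internal(2)[OF u assms(2) that(2,1)] .
  show "valid_graph ?G"
    using val inC outC wf_add_edge2[OF wfG u v uv] by (fastforce simp: valid_graph_def)
  show tv: "treev ?G = treev G - reach G u"
    using inC outC not_tree_and_unicycle by (fastforce simp: treev_def)
  show "tree_sum \<psi> ?G = tree_sum \<psi> G - \<psi> (csize G u)"
    using reach_add_edge_internal[OF assms(2)] by (intro tree_sum_remove tv assms) auto
qed

lemma tree_unicycle_step:
  assumes "u \<in> treev G" "v \<notin> treev G"
  shows "valid_graph (add_edge {u, v} G)" "treev (add_edge {u, v} G) = treev G - reach G u"
    "tree_sum \<psi> (add_edge {u, v} G) = tree_sum \<psi> G - \<psi> (csize G u)"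
proof -
  let ?G = "add_edge {u, v} G" and ?C = "reach G u \<union> reach G v"
  have t: "is_tree (component G u)" "is_unicycle (component G v)"
    using assms valid_graph_cases[OF val v] by (auto simp: treev_def)
  have nin: "v \<notin> reach G u" using t component_eq not_tree_and_unicycle by metis
  have inC: "is_unicycle (component ?G w)" if "w \<in> ?C" for w
    using add_edge_tree_unicycle[OF wfG u v uv t that] .
  have outC: "component ?G w = component G w" if "w \<notin> ?C" "w \<in> verts G" for w
    using component_add_edge_merge(2)[OF wfG u v nin that(2,1)] .
  show "valid_graph ?G"
    using val inC outC wf_add_edge2[OF wfG u v uv] by (fastforce simp: valid_graph_def)
  have rv: "w \<notin> treev G" if "w \<in> reach G v" for w
    using that t(2) treev_reach not_tree_and_unicycle by metis
  show tv: "treev ?G = treev G - reach G u"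
  proof (intro set_eqI iffI)
    fix w assume "w \<in> treev ?G"
    then have w: "w \<in> verts G" "is_tree (component ?G w)" by (auto simp: treev_def)
    then have "w \<notin> ?C" using inC not_tree_and_unicycle by blast
    then show "w \<in> treev G - reach G u" using w outC by (auto simp: treev_def)
  next
    fix w assume w: "w \<in> treev G - reach G u"
    then have "w \<notin> ?C" "w \<in> verts G" using rv by (auto simp: treev_def)
    then show "w \<in> treev ?G" using w outC by (auto simp: treev_def)
  qed
  have "reach ?G w = reach G w" if "w \<in> treev ?G" for w
  proof -
    have "w \<notin> ?C" "w \<in> verts G" using that rv tv by (auto simp: treev_def)
    from outC[OF this] show ?thesis by (metis verts_component)
  qed
  then show "tree_sum \<psi> ?G = tree_sum \<psi> G - \<psi> (csize G u)"
    by (intro tree_sum_remove tv assms)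
qed

end

section \<open>Averaging over the random edge\<close>

lemma finite_possible_edges [simp]: "finite (possible_edges n)"
  by (rule finite_subset[of _ "Pow {1..n}"]) (auto simp: possible_edges_def)

lemma card_possible_edges: "card (possible_edges n) = n choose 2"
  unfolding possible_edges_def using n_subsets[of "{1..n}" 2] by simp

lemma possible_edges_nonempty: "n \<ge> 2 \<Longrightarrow> possible_edges n \<noteq> {}"
proof -
  assume "n \<ge> 2"
  then have "{1, 2} \<in> possible_edges n" by (auto simp: possible_edges_def)
  then show ?thesis by blast
qed

lemma two_card_possible_edges: "2 * real (card (possible_edges n)) = real n * (real n - 1)"
  by (cases n) (simp_all add: card_possible_edges choose_two algebra_simps
      real_of_nat_div)

text \<open>Each edge has two orientations. Ordered pairs are used because double sums over tree
  vertices then factor.\<close>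

lemma sum_possible_edges:
  fixes F :: "nat set \<Rightarrow> real"
  shows "2 * (\<Sum>e\<in>possible_edges n. F e) = (\<Sum>u\<in>{1..n}. \<Sum>v\<in>{1..n} - {u}. F {u, v})"
proof -
  let ?P = "SIGMA u:{1..n}. {1..n} - {u}"
  have "(\<Sum>u\<in>{1..n}. \<Sum>v\<in>{1..n} - {u}. F {u, v}) = (\<Sum>(u,v)\<in>?P. F {u, v})"
    by (subst sum.Sigma) auto
  also have "\<dots> = (\<Sum>e\<in>possible_edges n. \<Sum>x\<in>{x\<in>?P. (\<lambda>(u,v). {u,v}) x = e}. (\<lambda>(u,v). F {u, v}) x)"
    by (subst sum.group) (auto simp: possible_edges_def)
  also have "\<dots> = (\<Sum>e\<in>possible_edges n. 2 * F e)"
  proof (rule sum.cong[OF refl])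
    fix e assume e: "e \<in> possible_edges n"
    then obtain a b where ab: "e = {a, b}" "a \<noteq> b" "a \<in> {1..n}" "b \<in> {1..n}"
      by (auto simp: possible_edges_def card_2_iff)
    then have "{x\<in>?P. (\<lambda>(u,v). {u,v}) x = e} = {(a,b), (b,a)}"
      by (auto simp: doubleton_eq_iff)
    then show "(\<Sum>x\<in>{x\<in>?P. (\<lambda>(u,v). {u,v}) x = e}. (\<lambda>(u,v). F {u, v}) x) = 2 * F e"
      using ab by (simp add: insert_commute)
  qed
  finally show ?thesis by (simp add: sum_distrib_left)
qed

text \<open>The coin of parameter p is already integrated out, so that only the choice of the edge
  remains random.\<close>

definition edge_mean :: "real \<Rightarrow> nat multigraph \<Rightarrow> (nat multigraph \<Rightarrow> real) \<Rightarrow> nat set \<Rightarrow> real" where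
  "edge_mean p G f e =
     (if \<forall>v\<in>e. is_tree (component G v) then f (add_edge e G)
      else if \<forall>v\<in>e. is_unicycle (component G v) then f G
      else p * f (add_edge e G) + (1 - p) * f G)"

lemma finite_set_pmf_frozen_step: "n \<ge> 2 \<Longrightarrow> finite (set_pmf (frozen_step p n G))"
  by (auto simp: frozen_step_def possible_edges_nonempty)

lemma expectation_frozen_step:
  assumes "n \<ge> 2" "0 \<le> p" "p \<le> 1"
  shows "measure_pmf.expectation (frozen_step p n G) f =
    (\<Sum>e\<in>possible_edges n. edge_mean p G f e) / real (card (possible_edges n))"
proof -
  have "measure_pmf.expectation (frozen_step p n G) f = (\<Sum>e\<in>possible_edges n.
      edge_mean p G f e / real (card (possible_edges n)))"
    unfolding frozen_step_def
    by (subst pmf_expectation_bind_pmf_of_set)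
       (use assms in \<open>auto simp: possible_edges_nonempty edge_mean_def field_simps intro!: sum.cong\<close>)
  then show ?thesis by (simp add: sum_divide_distrib)
qed


lemma tree_sum_edge_mean:
  assumes "valid_graph G" "u \<in> verts G" "v \<in> verts G" "u \<noteq> v"
  shows "edge_mean p G (tree_sum \<psi>) {u, v} - tree_sum \<psi> G =
    (if u \<in> treev G \<and> v \<in> treev G then
       if v \<in> reach G u then - \<psi> (csize G u)
       else \<psi> (csize G u + csize G v) - \<psi> (csize G u) - \<psi> (csize G v)
     else if u \<in> treev G then - p * \<psi> (csize G u)
     else if v \<in> treev G then - p * \<psi> (csize G v) else 0)"
proof -
  have t: "is_tree (component G w) \<longleftrightarrow> w \<in> treev G" if "w \<in> verts G" for w
    using that by (simp add: treev_def)
  have c: "is_unicycle (component G w) \<longleftrightarrow> w \<notin> treev G" if "w \<in> verts G" for w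
    using valid_graph_cases[OF assms(1) that] by simp
  note s = two_trees_step(3)[OF assms, of \<psi>] same_tree_step(3)[OF assms, of \<psi>]
    tree_unicycle_step(3)[OF assms, of \<psi>]
    tree_unicycle_step(3)[OF assms(1,3,2) assms(4)[symmetric], of \<psi>]
  show ?thesis
    using assms s t[OF assms(2)] t[OF assms(3)] c[OF assms(2)] c[OF assms(3)]
    by (auto simp: edge_mean_def insert_commute; simp add: algebra_simps)
qed

text \<open>The factor 3 covers a merger, where the value of the new tree replaces those of two old
  ones.\<close>

lemma frozen_step_support:
  assumes "valid_graph G" "verts G = {1..n}" "n \<ge> 2" "G' \<in> set_pmf (frozen_step p n G)"
  shows "valid_graph G'" "verts G' = {1..n}" "treev G' \<subseteq> treev G"
    "(\<And>k. \<bar>\<psi> k\<bar> \<le> B) \<Longrightarrow> \<bar>tree_sum \<psi> G' - tree_sum \<psi> G\<bar> \<le> 3 * B"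
proof -
  obtain e where e: "e \<in> possible_edges n" and G': "G' = G \<or> G' = add_edge e G"
    and not: "(\<forall>v\<in>e. is_unicycle (component G v)) \<Longrightarrow> G' = G"
  proof -
    from assms(4) obtain e where "e \<in> possible_edges n" and "G' \<in> set_pmf
      (if \<forall>v\<in>e. is_tree (component G v) then return_pmf (add_edge e G)
       else if \<forall>v\<in>e. is_unicycle (component G v) then return_pmf G
       else map_pmf (\<lambda>b. if b then add_edge e G else G) (bernoulli_pmf p))"
      using assms(3) by (auto simp: frozen_step_def possible_edges_nonempty)
    moreover have "\<not> ((\<forall>v\<in>e. is_tree (component G v)) \<and> (\<forall>v\<in>e. is_unicycle (component G v)))"
      if "e \<in> possible_edges n" for e
    proof -
      have "e \<noteq> {}" using that by (auto simp: possible_edges_def)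
      then show ?thesis using not_tree_and_unicycle by blast
    qed
    ultimately show thesis using that[of e] by (auto split: if_splits)
  qed
  obtain u v where uv: "e = {u, v}" "u \<in> verts G" "v \<in> verts G" "u \<noteq> v"
    using e assms(2) by (auto simp: possible_edges_def card_2_iff)
  have vu: "{v, u} = {u, v}" by auto
  have goal: "valid_graph G' \<and> verts G' = {1..n} \<and> treev G' \<subseteq> treev G \<and>
     ((\<forall>k. \<bar>\<psi> k\<bar> \<le> B) \<longrightarrow> \<bar>tree_sum \<psi> G' - tree_sum \<psi> G\<bar> \<le> 3 * B)"
  proof (cases "G' = G")
    case True
    have "(\<forall>k. \<bar>\<psi> k\<bar> \<le> B) \<Longrightarrow> 0 \<le> B" by (metis abs_ge_zero order_trans)
    then show ?thesis using True assms by auto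
  next
    case False
    then have A: "G' = add_edge {u, v} G" using G' uv by simp
    have "\<not> (u \<notin> treev G \<and> v \<notin> treev G)"
      using False not valid_graph_cases[OF assms(1)] uv by auto
    then consider "u \<in> treev G" "v \<in> treev G" "v \<notin> reach G u" | "u \<in> treev G" "v \<in> reach G u"
      | "u \<in> treev G" "v \<notin> treev G" | "v \<in> treev G" "u \<notin> treev G" by blast
    then show ?thesis
    proof cases
      case 1
      have "\<bar>x - y - z\<bar> \<le> 3 * B" if "\<bar>x\<bar> \<le> B" "\<bar>y\<bar> \<le> B" "\<bar>z\<bar> \<le> B" for x y z :: real
        using that by linarith
      from this[of "\<psi> (csize G u + csize G v)" "\<psi> (csize G u)" "\<psi> (csize G v)"]
      moreover have "tree_sum \<psi> G' - tree_sum \<psi> G =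
          \<psi> (csize G u + csize G v) - \<psi> (csize G u) - \<psi> (csize G v)"
        using two_trees_step(3)[OF assms(1) uv(2-4) 1] A by simp
      ultimately show ?thesis using two_trees_step(1,2)[OF assms(1) uv(2-4) 1] A assms(2) by auto
    next
      case 2
      have "\<bar>x\<bar> \<le> B \<Longrightarrow> \<bar>x\<bar> \<le> 3 * B" for x :: real by linarith
      then show ?thesis using same_tree_step[OF assms(1) uv(2-4) 2] A assms(2) by auto
    next
      case 3
      have "\<bar>x\<bar> \<le> B \<Longrightarrow> \<bar>x\<bar> \<le> 3 * B" for x :: real by linarith
      then show ?thesis using tree_unicycle_step[OF assms(1) uv(2-4) 3] A assms(2) by auto
    next
      case 4
      have "\<bar>x\<bar> \<le> B \<Longrightarrow> \<bar>x\<bar> \<le> 3 * B" for x :: real by linarith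
      then show ?thesis using tree_unicycle_step[OF assms(1) uv(3,2) uv(4)[symmetric] 4] A assms(2)
        by (auto simp: vu)
    qed
  qed
  then show "valid_graph G'" "verts G' = {1..n}" "treev G' \<subseteq> treev G" by auto
  show "\<bar>tree_sum \<psi> G' - tree_sum \<psi> G\<bar> \<le> 3 * B" if "\<And>k. \<bar>\<psi> k\<bar> \<le> B" using goal that by blast
qed

text \<open>Divided by n, the probability that a uniform partner accepts an edge offered by a tree
  vertex.\<close>

definition merge_rate :: "real \<Rightarrow> nat multigraph \<Rightarrow> real" where
  "merge_rate p G = real (card (treev G)) + p * real (card (verts G - treev G))"

text \<open>The random edge is compared with an ordered pair of independent uniform vertices that
  never share a tree. For fixed u the error comes from the partners inside the tree of u, of size s,
  each costing at most B / s by the second bound on \<psi>, and from the diagonal, costing at most 3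
  B. This makes 4 B per vertex.\<close>

lemma expectation_tree_sum_step:
  assumes val: "valid_graph G" and V: "verts G = {1..n}" and n: "n \<ge> 2" and p: "0 \<le> p" "p \<le> 1"
    and B: "\<And>k. \<bar>\<psi> k\<bar> \<le> B" "\<And>k. real k * \<bar>\<psi> (2 * k) - \<psi> k\<bar> \<le> B"
  shows "\<bar>measure_pmf.expectation (frozen_step p n G) (tree_sum \<psi>) - tree_sum \<psi> G
     - ((\<Sum>u\<in>treev G. \<Sum>v\<in>treev G. \<psi> (csize G u + csize G v))
        - 2 * merge_rate p G * (\<Sum>u\<in>treev G. \<psi> (csize G u))) / (real n * (real n - 1))\<bar>
     \<le> 4 * B / (real n - 1)"
proof -
  let ?L = "tree_sum \<psi>" and ?T = "treev G" and ?s = "csize G" and ?V = "{1..n}"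
  let ?c = "real n * (real n - 1)"
  have wf: "wf_graph G" using val by (rule valid_graph_wf)
  have TV: "?T \<subseteq> ?V" using treev_subset[of G] V by simp
  have finT: "finite ?T" using wf by simp
  have B0: "0 \<le> B" using B(1)[of 0] by linarith
  have c0: "?c > 0" using n by simp
  define D where "D u v = edge_mean p G ?L {u, v} - ?L G" for u v
  \<comment> \<open>The idealised increment: every pair of tree vertices counts as a merger, even
    within one tree or on the diagonal.\<close>
  define R where "R u v = (if u \<in> ?T \<and> v \<in> ?T then \<psi> (?s u + ?s v) - \<psi> (?s u) - \<psi> (?s v)
     else if u \<in> ?T then - p * \<psi> (?s u) else if v \<in> ?T then - p * \<psi> (?s v) else 0)" for u v
  define I where "I = (\<Sum>u\<in>?T. \<Sum>v\<in>?T. \<psi> (?s u + ?s v))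
        - 2 * merge_rate p G * (\<Sum>u\<in>?T. \<psi> (?s u))"
  have "measure_pmf.expectation (frozen_step p n G) ?L - ?L G =
      (\<Sum>e\<in>possible_edges n. edge_mean p G ?L e - ?L G) / real (card (possible_edges n))"
    using n p by (simp add: expectation_frozen_step sum_subtractf diff_divide_distrib
        possible_edges_nonempty)
  also have "\<dots> = (2 * (\<Sum>e\<in>possible_edges n. edge_mean p G ?L e - ?L G)) / ?c"
    unfolding two_card_possible_edges[symmetric] by simp
  also have "\<dots> = (\<Sum>u\<in>?V. \<Sum>v\<in>?V - {u}. D u v) / ?c"
    unfolding sum_possible_edges D_def ..
  finally have E: "measure_pmf.expectation (frozen_step p n G) ?L - ?L G =
      (\<Sum>u\<in>?V. \<Sum>v\<in>?V - {u}. D u v) / ?c" .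
  \<comment> \<open>Collected by the tree endpoint, the losses have weight 1 for each tree partner
    and \<open>p\<close> for each frozen one, hence \<open>merge_rate\<close>. The factor 2 is the
    choice of the endpoint.\<close>
  have I: "(\<Sum>u\<in>?V. \<Sum>v\<in>?V. R u v) = I"
  proof -
    have Vs: "sum g ?V = sum g ?T + sum g (?V - ?T)" for g :: "nat \<Rightarrow> real"
      using TV by (simp add: sum.subset_diff add.commute)
    have "(\<Sum>u\<in>?V. \<Sum>v\<in>?V. R u v) =
       (\<Sum>u\<in>?T. \<Sum>v\<in>?T. \<psi> (?s u + ?s v) - \<psi> (?s u) - \<psi> (?s v))
       + (\<Sum>u\<in>?T. \<Sum>v\<in>?V - ?T. - p * \<psi> (?s u)) + (\<Sum>u\<in>?V - ?T. \<Sum>v\<in>?T. - p * \<psi> (?s v))"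
      unfolding Vs sum.distrib by (simp add: R_def)
    also have "\<dots> = I"
      unfolding I_def merge_rate_def V
      by (simp add: sum_subtractf sum.swap[of _ "?V - ?T"] sum_distrib_left sum_distrib_right
          sum_negf algebra_simps)
         (simp add: sum.distrib flip: sum_distrib_left)
    finally show ?thesis .
  qed
  have DR: "\<bar>D u v - R u v\<bar> \<le> (if v \<in> reach G u \<and> u \<in> ?T then B / real (?s u) else 0)"
    if "u \<in> ?V" "v \<in> ?V" "u \<noteq> v" for u v
  proof -
    \<comment> \<open>Inside one tree of size s, the true increment - \<psi> s stands against \<psi>
      (2 s) - 2 \<psi> s.\<close>
    have "D u v - R u v = (if v \<in> reach G u \<and> u \<in> ?T then \<psi> (?s u) - \<psi> (2 * ?s u) else 0)"
    proof -
      have *: "v \<in> reach G u \<Longrightarrow> v \<in> ?T \<longleftrightarrow> u \<in> ?T" "v \<in> reach G u \<Longrightarrow> ?s v = ?s u"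
        using treev_reach[of v G u] csize_reach[of v G u] that V by (auto simp: treev_def)
      have "D u v = (if u \<in> ?T \<and> v \<in> ?T then
           if v \<in> reach G u then - \<psi> (?s u) else \<psi> (?s u + ?s v) - \<psi> (?s u) - \<psi> (?s v)
         else if u \<in> ?T then - p * \<psi> (?s u) else if v \<in> ?T then - p * \<psi> (?s v) else 0)"
        unfolding D_def using that V by (intro tree_sum_edge_mean[OF val]) auto
      then show ?thesis using * by (cases "v \<in> reach G u") (simp_all add: R_def flip: mult_2)
    qed
    moreover have "\<bar>\<psi> (?s u) - \<psi> (2 * ?s u)\<bar> \<le> B / real (?s u)"
      using B(2)[of "?s u"] csize_pos[OF wf, of u] that V
      by (simp add: field_simps abs_minus_commute)
    ultimately show ?thesis by auto
  qed
  have "(\<Sum>v\<in>?V - {u}. \<bar>D u v - R u v\<bar>) + \<bar>R u u\<bar> \<le> 4 * B" if u: "u \<in> ?V" for u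
  proof -
    have "(\<Sum>v\<in>?V - {u}. \<bar>D u v - R u v\<bar>) \<le>
        (\<Sum>v\<in>?V - {u}. (if v \<in> reach G u \<and> u \<in> ?T then B / real (?s u) else 0))"
      using DR u by (intro sum_mono) auto
    also have "\<dots> \<le> (\<Sum>v\<in>?V. (if v \<in> reach G u then B / real (?s u) else 0))"
      using B0 by (intro order_trans[OF sum_mono2[of ?V "?V - {u}"] sum_mono]) auto
    also have "\<dots> = (\<Sum>v\<in>reach G u. B / real (?s u))"
      using reach_subset[of G u] V by (intro sum.mono_neutral_cong_right) auto
    also have "\<dots> = B" using csize_pos[OF wf, of u] u V by (simp add: csize_def)
    finally have 1: "(\<Sum>v\<in>?V - {u}. \<bar>D u v - R u v\<bar>) \<le> B" .
    have "\<bar>x - y - y\<bar> \<le> 3 * B" if "\<bar>x\<bar> \<le> B" "\<bar>y\<bar> \<le> B" for x y :: real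
      using that by linarith
    from this[OF B(1)[of "2 * ?s u"] B(1)[of "?s u"]]
    have "\<bar>R u u\<bar> \<le> 3 * B" using B0 by (auto simp: R_def simp flip: mult_2)
    with 1 show ?thesis by simp
  qed
  then have "(\<Sum>u\<in>?V. (\<Sum>v\<in>?V - {u}. \<bar>D u v - R u v\<bar>) + \<bar>R u u\<bar>) \<le> (\<Sum>u\<in>?V. 4 * B)"
    by (rule sum_mono)
  moreover have "\<bar>(\<Sum>u\<in>?V. \<Sum>v\<in>?V - {u}. D u v) - I\<bar> \<le>
      (\<Sum>u\<in>?V. (\<Sum>v\<in>?V - {u}. \<bar>D u v - R u v\<bar>) + \<bar>R u u\<bar>)"
  proof -
    have "(\<Sum>u\<in>?V. \<Sum>v\<in>?V - {u}. D u v) - I =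
      (\<Sum>u\<in>?V. (\<Sum>v\<in>?V - {u}. D u v - R u v) - R u u)"
    proof -
      have "(\<Sum>v\<in>?V. R u v) = R u u + (\<Sum>v\<in>?V - {u}. R u v)" if "u \<in> ?V" for u
        using that by (simp add: sum.remove)
      then show ?thesis unfolding I[symmetric] by (simp add: sum_subtractf sum.distrib)
    qed
    also have "\<bar>\<dots>\<bar> \<le> (\<Sum>u\<in>?V. \<bar>(\<Sum>v\<in>?V - {u}. D u v - R u v) - R u u\<bar>)" by (rule sum_abs)
    also have "\<dots> \<le> (\<Sum>u\<in>?V. (\<Sum>v\<in>?V - {u}. \<bar>D u v - R u v\<bar>) + \<bar>R u u\<bar>)"
      by (intro sum_mono order_trans[OF abs_triangle_ineq4] add_mono sum_abs order_refl)
    finally show ?thesis .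
  qed
  ultimately have "\<bar>(\<Sum>u\<in>?V. \<Sum>v\<in>?V - {u}. D u v) - I\<bar> \<le> real n * (4 * B)" by simp
  then have "\<bar>(\<Sum>u\<in>?V. \<Sum>v\<in>?V - {u}. D u v) - I\<bar> / ?c \<le> real n * (4 * B) / ?c"
    using c0 by (intro divide_right_mono) auto
  also have "\<dots> = 4 * B / (real n - 1)" using n by simp
  finally have "\<bar>((\<Sum>u\<in>?V. \<Sum>v\<in>?V - {u}. D u v) - I) / ?c\<bar> \<le> 4 * B / (real n - 1)"
    using c0 by simp
  then show ?thesis unfolding I_def[symmetric] using E by (simp add: diff_divide_distrib)
qed

section \<open>The limit functions\<close>

lemma alternating_binomial_power_sum:
  "j < n \<Longrightarrow> (\<Sum>k\<le>n. (-1) ^ k * real (n choose k) * real k ^ j) = 0"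
proof (induction n arbitrary: j)
  case 0
  then show ?case by simp
next
  case (Suc n)
  show ?case
  proof (cases j)
    case 0
    then show ?thesis using choose_alternating_sum[of "Suc n", where 'a = real] by simp
  next
    case (Suc l)
    then have l: "l < n" using Suc.prems by simp
    \<comment> \<open>An alternating binomial sum is a finite difference and kills lower degrees.
      Absorbing one factor k into the binomial coefficient lowers order and degree together.\<close>
    have "(\<Sum>k\<le>Suc n. (-1) ^ k * real (Suc n choose k) * real k ^ j) =
        (\<Sum>k\<le>n. (-1) ^ Suc k * (real (Suc k) * real (Suc n choose Suc k)) * real (Suc k) ^ l)"
      by (subst sum.atMost_Suc_shift) (simp add: Suc mult_ac)
    also have "\<dots> = (\<Sum>k\<le>n. - real (Suc n) * ((-1) ^ k * real (n choose k) * (real k + 1) ^ l))"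
    proof (rule sum.cong[OF refl])
      fix k
      have e: "real (Suc k) * real (Suc n choose Suc k) = real (Suc n) * real (n choose k)"
        using Suc_times_binomial_eq[of n k] by (metis mult.commute of_nat_mult)
      have "(-1) ^ Suc k * X * Y = - N * ((-1) ^ k * C * Y)" if "X = N * C" for X N C Y :: real
        using that by simp
      from this[OF e] show "(-1) ^ Suc k * (real (Suc k) * real (Suc n choose Suc k)) * real (Suc k) ^ l =
          - real (Suc n) * ((-1) ^ k * real (n choose k) * (real k + 1) ^ l)"
        by (simp only: of_nat_Suc add.commute)
    qed
    also have "\<dots> = - real (Suc n) * (\<Sum>k\<le>n. \<Sum>i\<le>l. real (l choose i) *
        ((-1) ^ k * real (n choose k) * real k ^ i))"
      by (simp add: sum_distrib_left binomial_ring mult_ac)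
    also have "\<dots> = - real (Suc n) * (\<Sum>i\<le>l. real (l choose i) *
        (\<Sum>k\<le>n. (-1) ^ k * real (n choose k) * real k ^ i))"
      by (subst sum.swap) (simp add: sum_distrib_left)
    also have "\<dots> = 0" using Suc.IH l by simp
    finally show ?thesis .
  qed
qed

text \<open>A case of Abel's binomial identity. Both sides have proportional derivatives in \<open>y\<close> by
  induction and vanish at \<open>y = - n\<close>.\<close>

lemma abel_identity:
  "n \<ge> 1 \<Longrightarrow> (\<Sum>k=1..n. real (n choose k) * real k ^ (k - 1) * (y + real n - real k) ^ (n - k))
     = real n * (y + real n) ^ (n - 1)"
proof (induction n arbitrary: y)
  case 0
  then show ?case by simp
next
  case (Suc n)
  show ?case
  proof (cases "n = 0")
    case True
    then show ?thesis by simp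
  next
    case False
    let ?N = "real (Suc n)"
    define h where "h y = (\<Sum>k=1..Suc n. real (Suc n choose k) * real k ^ (k - 1) *
        (y + ?N - real k) ^ (Suc n - k)) - ?N * (y + ?N) ^ n" for y
    have "(h has_real_derivative 0) (at y)" for y
    proof -
      have "(h has_real_derivative (\<Sum>k=1..Suc n. real (Suc n choose k) * real k ^ (k - 1) *
          (real (Suc n - k) * (y + ?N - real k) ^ (Suc n - k - 1))) - ?N * (real n * (y + ?N) ^ (n - 1))) (at y)"
        unfolding h_def by (auto intro!: derivative_eq_intros sum.cong simp: mult_ac)
      \<comment> \<open>Absorbing \<open>Suc n - k\<close> into the binomial coefficient leaves the
        identity of order n at y + 1.\<close>
      moreover have "(\<Sum>k=1..Suc n. real (Suc n choose k) * real k ^ (k - 1) *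
          (real (Suc n - k) * (y + ?N - real k) ^ (Suc n - k - 1))) =
          (\<Sum>k=1..n. ?N * (real (n choose k) * real k ^ (k - 1) * ((y + 1) + real n - real k) ^ (n - k)))"
      proof -
        have "real (Suc n choose k) * real (Suc n - k) = ?N * real (n choose k)" if "k \<le> n" for k
        proof -
          have "(Suc n - k) * (Suc n choose k) = Suc n * (n choose k)"
            using binomial_absorb_comp[of "Suc n" k] by simp
          then show ?thesis by (metis mult.commute of_nat_mult)
        qed
        then have "real (Suc n choose k) * P * (real (Suc n - k) * Q) =
            ?N * (real (n choose k) * P * Q)" if "k \<le> n" for k P Q
          using that by (metis (no_types, lifting) mult.assoc mult.commute)
        moreover have "y + ?N - real k = (y + 1) + real n - real k" "Suc n - k - 1 = n - k" for k
          by simp_all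
        ultimately have "(\<Sum>k=1..n. real (Suc n choose k) * real k ^ (k - 1) *
            (real (Suc n - k) * (y + ?N - real k) ^ (Suc n - k - 1))) =
            (\<Sum>k=1..n. ?N * (real (n choose k) * real k ^ (k - 1) * ((y + 1) + real n - real k) ^ (n - k)))"
          by (intro sum.cong) (simp_all only: atLeastAtMost_iff)
        then show ?thesis by (subst sum.cl_ivl_Suc) (simp del: of_nat_diff)
      qed
      moreover have "\<dots> = ?N * (real n * (y + ?N) ^ (n - 1))"
        unfolding sum_distrib_left[symmetric] using Suc.IH[of "y + 1"] False
        by (simp add: algebra_simps)
      ultimately show ?thesis by simp
    qed
    then have "h y = h (- ?N)" for y
      using DERIV_isconst_all by blast
    moreover have "h (- ?N) = 0"
    proof -
      \<comment> \<open>At y = - N the two powers of k combine to \<open>k ^ n\<close> up to sign,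
        whose degree is below the order of the alternating sum.\<close>
      have "(\<Sum>k=1..Suc n. real (Suc n choose k) * real k ^ (k - 1) * (- real k) ^ (Suc n - k)) =
          (\<Sum>k=1..Suc n. (-1) ^ Suc n * ((-1) ^ k * real (Suc n choose k) * real k ^ n))"
      proof (rule sum.cong[OF refl])
        fix k assume k: "k \<in> {1..Suc n}"
        then have "n = (k - 1) + (Suc n - k)" by auto
        then have "real k ^ n = real k ^ (k - 1) * real k ^ (Suc n - k)" by (metis power_add)
        moreover have "(-1 :: real) ^ (Suc n - k) = (-1) ^ Suc n * (-1) ^ k"
          using k by (simp add: power_diff' minus_one_power_iff)
        moreover have "(- real k) ^ (Suc n - k) = (-1) ^ (Suc n - k) * real k ^ (Suc n - k)"
          by (rule power_minus)
        ultimately show "real (Suc n choose k) * real k ^ (k - 1) * (- real k) ^ (Suc n - k) =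
          (-1) ^ Suc n * ((-1) ^ k * real (Suc n choose k) * real k ^ n)"
          by (simp only: mult_ac)
      qed
      also have "\<dots> = (-1) ^ Suc n * (\<Sum>k\<le>Suc n. (-1) ^ k * real (Suc n choose k) * real k ^ n)"
        unfolding sum_distrib_left using False
        by (intro sum.mono_neutral_left) (auto simp: not_less_eq_eq)
      also have "\<dots> = 0" using alternating_binomial_power_sum[of n "Suc n"] by simp
      finally show ?thesis using False by (simp add: h_def)
    qed
    ultimately have "h y = 0" by (rule trans)
    then show ?thesis unfolding h_def by (simp only: diff_Suc_1 right_minus_eq)
  qed
qed

text \<open>The coefficients of the tree function: \<open>k ^ (k - 1)\<close> counts the rooted
  labelled trees on k vertices.\<close>

definition alpha :: "nat \<Rightarrow> real" where
  "alpha k = real k ^ (k - 1) / fact k"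

lemma alpha_nonneg: "alpha k \<ge> 0" by (simp add: alpha_def)

lemma alpha_1 [simp]: "alpha (Suc 0) = 1" by (simp add: alpha_def)

text \<open>Abel's identity at y = 0 without its term k = n, symmetrised by exchanging k and n - k:
  the extra factors k and n - k add up to n, which cancels.\<close>

lemma cayley_convolution:
  assumes "n \<ge> 2"
  shows "(\<Sum>k\<in>{1..<n}. real (n choose k) * real k ^ (k - 1) * real (n - k) ^ (n - k - 1)) =
    2 * (real n - 1) * real n ^ (n - 2)"
proof -
  let ?S = "\<Sum>k\<in>{1..<n}. real (n choose k) * real k ^ (k - 1) * real (n - k) ^ (n - k - 1)"
  define u where "u k = real (n choose k) * real k ^ (k - 1) * real (n - k) ^ (n - k)" for k
  have "(\<Sum>k=1..n. u k) = real n ^ n"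
  proof -
    have "(\<Sum>k=1..n. u k) = (\<Sum>k=1..n. real (n choose k) * real k ^ (k - 1) * (0 + real n - real k) ^ (n - k))"
      unfolding u_def by (intro sum.cong) (auto simp: of_nat_diff)
    also have "\<dots> = real n ^ n" using abel_identity[of n 0] assms by (simp flip: power_Suc)
    finally show ?thesis .
  qed
  moreover have "{1..n} = insert n {1..<n}" using assms by auto
  ultimately have u: "(\<Sum>k\<in>{1..<n}. u k) = real n ^ n - real n ^ (n - 1)"
    by (simp add: u_def)
  have "(\<Sum>k\<in>{1..<n}. u (n - k)) = (\<Sum>k\<in>{1..<n}. u k)"
    by (rule sum.reindex_bij_witness[where i = "\<lambda>k. n - k" and j = "\<lambda>k. n - k"]) auto
  then have "2 * (real n ^ n - real n ^ (n - 1)) = (\<Sum>k\<in>{1..<n}. u k + u (n - k))"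
    using u by (simp add: sum.distrib)
  also have "\<dots> = (\<Sum>k\<in>{1..<n}. real n * (real (n choose k) * real k ^ (k - 1) * real (n - k) ^ (n - k - 1)))"
  proof (rule sum.cong[OF refl])
    fix k assume k: "k \<in> {1..<n}"
    have p: "real j ^ j = real j * real j ^ (j - 1)" if "j \<ge> 1" for j
      using that by (cases j) auto
    have "u k = real (n choose k) * real k ^ (k - 1) * (real (n - k) * real (n - k) ^ (n - k - 1))"
      unfolding u_def using p[of "n - k"] k by (subst p) auto
    moreover have "u (n - k) = real (n choose k) * real (n - k) ^ (n - k - 1) * (real k * real k ^ (k - 1))"
      unfolding u_def using p[of k] k binomial_symmetric[of k n] by simp
    moreover have n: "real n = real k + real (n - k)" using k by (simp add: of_nat_diff)
    ultimately show "u k + u (n - k) =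
        real n * (real (n choose k) * real k ^ (k - 1) * real (n - k) ^ (n - k - 1))"
      by (simp only: n distrib_right) (simp only: mult_ac)
  qed
  finally have "real n * ?S = 2 * (real n ^ n - real n ^ (n - 1))"
    by (simp add: sum_distrib_left)
  also obtain m where "n = Suc (Suc m)" using assms
    by (metis add_2_eq_Suc le_Suc_ex)
  then have "2 * (real n ^ n - real n ^ (n - 1)) = real n * (2 * (real n - 1) * real n ^ (n - 2))"
    by (simp add: algebra_simps)
  finally show ?thesis using assms by simp
qed

text \<open>In this form the identity balances the merging equations: n times the convolution is the
  rate at which vertices join trees of size n, and 2 (n - 1) comes from differentiating (2
  t)^(n-1).\<close>

lemma alpha_convolution:
  assumes "n \<ge> 1"
  shows "real n * (\<Sum>k\<in>{1..<n}. alpha k * alpha (n - k)) = 2 * (real n - 1) * alpha n"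
proof (cases "n = 1")
  case False
  then have n: "n \<ge> 2" using assms by simp
  have "(\<Sum>k\<in>{1..<n}. alpha k * alpha (n - k)) =
      (\<Sum>k\<in>{1..<n}. real (n choose k) * real k ^ (k - 1) * real (n - k) ^ (n - k - 1)) / fact n"
    unfolding sum_divide_distrib
    by (intro sum.cong) (auto simp: alpha_def binomial_fact field_simps)
  then show ?thesis
    using n cayley_convolution[OF n] by (cases n) (auto simp: alpha_def numeral_2_eq_2 Suc_diff_Suc
      power_eq_if)
qed simp


section \<open>The tree series and the Borel distribution\<close>

definition tree_fps :: "real \<Rightarrow> real" where
  "tree_fps z = (\<Sum>k. alpha (Suc k) * z ^ k)"

text \<open>\<open>k ^ k / fact k\<close> is a single term of the series of exp k. The radius of
  convergence is therefore at least exp (-1).\<close>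

lemma alpha_le_exp: "alpha k \<le> exp (real k)"
proof (cases "k = 0")
  case True then show ?thesis by (simp add: alpha_def)
next
  case False
  have "real k ^ k / fact k \<le> (\<Sum>n. real k ^ n /\<^sub>R fact n)"
    using sum_le_suminf[OF summable_exp_generic[of "real k"], of "{k}"]
    by (simp add: divide_inverse mult.commute)
  then have "real k ^ k / fact k \<le> exp (real k)" by (simp add: exp_def)
  moreover have "real k ^ (k - 1) \<le> real k ^ k" using False by (intro power_increasing) auto
  ultimately show ?thesis unfolding alpha_def
    by (meson divide_right_mono fact_ge_zero order_trans)
qed

lemma summable_tree_fps:
  assumes "norm (z::real) < exp (-1)"
  shows "summable (\<lambda>k. alpha (Suc k) * z ^ k)"
proof (rule summable_comparison_test')
  have "exp 1 * \<bar>z\<bar> < 1" using assms by (simp add: exp_minus field_simps)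
  then show "summable (\<lambda>k. exp 1 * (exp 1 * \<bar>z\<bar>) ^ k)"
    by (intro summable_mult summable_geometric) simp
  fix k :: nat
  have "alpha (Suc k) \<le> exp 1 * exp 1 ^ k"
    using alpha_le_exp[of "Suc k"] by (simp add: exp_add flip: exp_of_nat_mult)
  then show "norm (alpha (Suc k) * z ^ k) \<le> exp 1 * (exp 1 * \<bar>z\<bar>) ^ k"
    using alpha_nonneg[of "Suc k"] by (simp add: power_mult_distrib abs_mult power_abs
      mult_right_mono flip: mult.assoc)
qed

text \<open>The convolution identity for \<open>alpha\<close> turns into the differential equation
  \<open>Q' = z Q Q' + Q\<^sup>2\<close>, by which \<open>Q e\<^sup>-\<^sup>z\<^sup>Q\<close> is constant.\<close>

lemma tree_fps_functional_equation:
  assumes z: "0 \<le> z" "z < exp (-1)"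
  shows "tree_fps z * exp (- z * tree_fps z) = 1"
proof -
  let ?r = "exp (-1) :: real"
  let ?Q = tree_fps
  define c where "c k = alpha (Suc k)" for k
  define Q' where "Q' z = (\<Sum>k. diffs c k * z ^ k)" for z :: real
  define r where "r k = (\<Sum>i\<le>k. c i * c (k - i))" for k
  have sc: "summable (\<lambda>k. c k * z ^ k)" if "norm (z::real) < ?r" for z
    using summable_tree_fps[OF that] by (simp add: c_def)
  have Q: "?Q z = (\<Sum>k. c k * z ^ k)" for z by (simp add: tree_fps_def c_def)
  have dQ: "(?Q has_real_derivative Q' z) (at z)" if "norm z < ?r" for z
    unfolding Q[abs_def] Q'_def using termdiffs_strong'[OF sc that] by simp
  have sr: "(\<lambda>k. r k * z ^ k) sums (?Q z)\<^sup>2" if "norm (z::real) < ?r" for z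
  proof -
    have "summable (\<lambda>k. norm (c k * z ^ k))"
      using sc[of "norm z"] that alpha_nonneg by (simp add: c_def abs_mult power_abs)
    then have "(\<lambda>k. \<Sum>i\<le>k. (c i * z ^ i) * (c (k - i) * z ^ (k - i))) sums (?Q z * ?Q z)"
      unfolding Q by (intro Cauchy_product_sums)
    moreover have "(\<Sum>i\<le>k. (c i * z ^ i) * (c (k - i) * z ^ (k - i))) = r k * z ^ k" for k
    proof -
      have "z ^ i * z ^ (k - i) = z ^ k" if "i \<le> k" for i
        using that by (simp flip: power_add)
      then have "(c i * z ^ i) * (c (k - i) * z ^ (k - i)) = c i * c (k - i) * z ^ k" if "i \<le> k" for i
        using that by (metis (no_types, lifting) mult.assoc mult.commute mult.left_commute)
      then show ?thesis unfolding r_def sum_distrib_right by (intro sum.cong) auto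
    qed
    ultimately show ?thesis by (simp add: power2_eq_square)
  qed
  \<comment> \<open>This is \<open>alpha_convolution\<close> at k + 2, since both factors of the
    product are shifted by one.\<close>
  have rc: "real (k + 2) * r k = 2 * real (k + 1) * c (Suc k)" for k
  proof -
    have "(\<Sum>i\<in>{1..<k + 2}. alpha i * alpha (k + 2 - i)) = r k"
      unfolding r_def c_def
      by (rule sum.reindex_bij_witness[where i = Suc and j = "\<lambda>i. i - 1"]) (auto simp: Suc_diff_le)
    then show ?thesis using alpha_convolution[of "k + 2"] by (simp add: c_def)
  qed
  have dR: "((\<lambda>z. (?Q z)\<^sup>2) has_real_derivative (\<Sum>k. diffs r k * z ^ k)) (at z)"
    if "norm z < ?r" for z
  proof -
    have "((\<lambda>z. \<Sum>k. r k * z ^ k) has_real_derivative (\<Sum>k. diffs r k * z ^ k)) (at z)"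
      by (rule termdiffs_strong'[OF _ that]) (use sr sums_summable in blast)
    moreover have ev: "\<forall>\<^sub>F x in nhds z. (\<Sum>k. r k * x ^ k) = (?Q x)\<^sup>2"
    proof -
      have "\<forall>\<^sub>F x in nhds z. x \<in> ball 0 ?r"
        using that by (intro eventually_nhds_in_open) auto
      then show ?thesis by eventually_elim (use sr sums_unique in force)
    qed
    ultimately show ?thesis using DERIV_cong_ev[OF refl ev refl] by blast
  qed
  have ode: "Q' z = z * ?Q z * Q' z + (?Q z)\<^sup>2" if z: "norm z < ?r" for z
  proof -
    have "((\<lambda>z. (?Q z)\<^sup>2) has_real_derivative 2 * ?Q z * Q' z) (at z)"
      by (auto intro!: derivative_eq_intros dQ z)
    then have eq: "(\<Sum>k. diffs r k * z ^ k) = 2 * ?Q z * Q' z"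
      using dR[OF z] DERIV_unique by blast
    have "summable (\<lambda>k. diffs r k * z ^ k)"
      by (rule termdiff_converges[OF z]) (use sr sums_summable in blast)
    then have "(\<lambda>k. diffs r k * z ^ k) sums (2 * ?Q z * Q' z)" using eq summable_sums by metis
    then have "(\<lambda>k. z * (diffs r k * z ^ k)) sums (z * (2 * ?Q z * Q' z))" by (rule sums_mult)
    then have "(\<lambda>k. real (Suc k) * r (Suc k) * z ^ Suc k) sums (z * (2 * ?Q z * Q' z))"
      by (simp add: diffs_def mult_ac)
    then have "(\<lambda>k. real k * r k * z ^ k) sums (z * (2 * ?Q z * Q' z))"
      by (subst (asm) sums_Suc_iff) simp
    \<comment> \<open>z Q Q' is half of z times the derivative of Q squared, so the right-hand side
      has coefficients (k / 2 + 1) times those of Q squared.\<close>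
    from sums_add[OF sums_mult[OF this, of "1/2"] sr[OF z]]
    have "(\<lambda>k. 1 / 2 * (real k * r k * z ^ k) + r k * z ^ k) sums (z * ?Q z * Q' z + (?Q z)\<^sup>2)"
      by (simp add: mult_ac)
    moreover have "1 / 2 * (real k * r k * z ^ k) + r k * z ^ k = diffs c k * z ^ k" for k
    proof -
      have "1 / 2 * (real k * r k * z ^ k) + r k * z ^ k = (real (k + 2) * r k) / 2 * z ^ k"
        by (simp add: field_simps)
      also have "\<dots> = diffs c k * z ^ k" unfolding rc by (simp add: diffs_def)
      finally show ?thesis .
    qed
    ultimately show ?thesis by (simp add: Q'_def sums_iff)
  qed
  define h where "h z = ?Q z * exp (- z * ?Q z)" for z
  have dh: "(h has_real_derivative 0) (at z)" if z: "norm z < ?r" for z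
  proof -
    have "(h has_real_derivative (Q' z - ?Q z * (?Q z + z * Q' z)) * exp (- z * ?Q z)) (at z)"
      unfolding h_def by (auto intro!: derivative_eq_intros dQ z simp: algebra_simps)
    moreover have "Q' z - ?Q z * (?Q z + z * Q' z) = 0"
      using ode[OF z] by (simp add: algebra_simps power2_eq_square)
    ultimately show ?thesis by simp
  qed
  have "h z = h 0"
  proof (cases "z = 0")
    case False
    have "\<forall>x. 0 \<le> x \<and> x \<le> z \<longrightarrow> (h has_real_derivative 0) (at x)" using dh z by auto
    then show ?thesis using False z
      by (intro DERIV_isconst_end) (auto intro!: DERIV_isCont DERIV_continuous_on
          continuous_at_imp_continuous_on)
  qed simp
  moreover have "h 0 = 1" using powser_zero[of c] by (simp add: h_def Q c_def)
  ultimately show ?thesis by (simp add: h_def)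
qed

lemma mult_exp_neg_le: "x * exp (- x) \<le> exp (-1 :: real)"
proof -
  have "x * exp (- x) \<le> exp (x - 1) * exp (- x)"
    using exp_ge_add_one_self[of "x - 1"] by (intro mult_right_mono) auto
  then show ?thesis by (simp flip: exp_add)
qed

lemma mult_exp_neg_strict_mono:
  assumes "0 \<le> x" "x < y" "y \<le> (1::real)"
  shows "x * exp (- x) < y * exp (- y)"
proof (rule DERIV_pos_imp_increasing_open[OF assms(2)])
  fix z assume z: "x < z" "z < y"
  have "((\<lambda>x. x * exp (- x)) has_real_derivative (1 - z) * exp (- z)) (at z)"
    by (auto intro!: derivative_eq_intros simp: algebra_simps)
  moreover have "(1 - z) * exp (- z) > 0" using z assms by simp
  ultimately show "\<exists>d. ((\<lambda>x. x * exp (- x)) has_real_derivative d) (at z) \<and> d > 0" by blast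
qed (intro continuous_intros)

text \<open>Selection of the branch: x exp (- x) takes every positive value below exp (-1) on both
  sides of 1. Along z the product starts at 0, and where it reached 1 the functional equation would
  give z = exp (-1).\<close>

lemma mult_tree_fps_less_1:
  assumes z: "0 \<le> z" "z < exp (-1)"
  shows "z * tree_fps z < 1"
proof (rule ccontr)
  assume "\<not> z * tree_fps z < 1"
  moreover have "continuous_on {0..z} (\<lambda>z. z * tree_fps z)"
  proof -
    have "isCont tree_fps x" if "x \<in> {0..z}" for x
      unfolding tree_fps_def[abs_def]
      by (rule DERIV_isCont[OF termdiffs_strong'[OF summable_tree_fps, of "exp (-1)"]])
        (use that z in auto)
    then show ?thesis
      by (intro continuous_intros continuous_at_imp_continuous_on ballI) auto
  qed
  ultimately obtain y where y: "0 \<le> y" "y \<le> z" "y * tree_fps y = 1"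
    using IVT'[of "\<lambda>z. z * tree_fps z" 0 1 z] z by auto
  have "tree_fps y * exp (- (y * tree_fps y)) = 1"
    using tree_fps_functional_equation[of y] y z by simp
  then have "tree_fps y = exp 1" using y by (simp add: exp_minus field_simps)
  then have "y = exp (-1)" using y by (simp add: exp_minus field_simps)
  then show False using y z by simp
qed

text \<open>x exp (- x) is injective on [0, 1), so the product z Q must be \<open>l\<close>
  itself.\<close>

lemma tree_fps_borel_aux:
  assumes "0 \<le> l" "l < 1"
  shows "(\<lambda>k. alpha (Suc k) * (l * exp (- l)) ^ k) sums exp l"
proof -
  let ?z = "l * exp (- l)"
  have z: "0 \<le> ?z" "?z < exp (-1)"
    using assms mult_exp_neg_strict_mono[of l 1] by auto
  let ?F = "?z * tree_fps ?z"
  have feq: "tree_fps ?z * exp (- ?F) = 1"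
    using tree_fps_functional_equation[OF z] by simp
  then have F: "?F * exp (- ?F) = ?z" by (simp add: mult.assoc)
  have "tree_fps ?z > 0" using feq by (metis exp_gt_zero zero_less_mult_pos2 zero_less_one)
  then have F0: "0 \<le> ?F" using z by simp
  have F1: "?F < 1" by (rule mult_tree_fps_less_1[OF z])
  have "?F = l"
    using mult_exp_neg_strict_mono[OF F0, of l] mult_exp_neg_strict_mono[OF assms(1), of ?F] assms F F1
    by (metis less_eq_real_def linorder_neqE_linordered_idom order_less_irrefl)
  then have "tree_fps ?z * exp (- l) = 1" using feq by (simp only:)
  then have "tree_fps ?z = exp l" by (simp add: exp_minus field_simps)
  then show ?thesis
    using summable_sums[OF summable_tree_fps, of ?z] z unfolding tree_fps_def by simp
qed

text \<open>For l < 1 the partial sums are at most exp l \<le> exp 1, and a finite sum is continuous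
  in l. Letting l tend to 1 replaces an appeal to Stirling's formula.\<close>

lemma summable_alpha_critical: "summable (\<lambda>k. alpha (Suc k) * exp (-1) ^ k)"
proof (rule summableI_nonneg_bounded)
  show "0 \<le> alpha (Suc k) * exp (-1) ^ k" for k using alpha_nonneg by simp
  fix n
  have "((\<lambda>l. \<Sum>k<n. alpha (Suc k) * (l * exp (- l)) ^ k) \<longlongrightarrow>
      (\<Sum>k<n. alpha (Suc k) * (1 * exp (- 1)) ^ k)) (at_left (1::real))"
    by (intro tendsto_intros)
  then have "((\<lambda>l. \<Sum>k<n. alpha (Suc k) * (l * exp (- l)) ^ k) \<longlongrightarrow>
      (\<Sum>k<n. alpha (Suc k) * exp (- 1) ^ k)) (at_left (1::real))" by simp
  moreover have "\<forall>\<^sub>F l in at_left (1::real). (\<Sum>k<n. alpha (Suc k) * (l * exp (- l)) ^ k) \<le> exp 1"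
  proof -
    have "\<forall>\<^sub>F l in at_left (1::real). l \<in> {0<..<1}" by (rule eventually_at_left_real) simp
    then show ?thesis
    proof eventually_elim
      case (elim l)
      then have s: "(\<lambda>k. alpha (Suc k) * (l * exp (- l)) ^ k) sums exp l"
        by (intro tree_fps_borel_aux) auto
      have "(\<Sum>k<n. alpha (Suc k) * (l * exp (- l)) ^ k) \<le> exp l"
        using elim alpha_nonneg sum_le_suminf[OF sums_summable[OF s], of "{..<n}"] s
        by (simp add: sums_iff)
      also have "\<dots> \<le> exp 1" using elim by simp
      finally show ?case .
    qed
  qed
  ultimately show "(\<Sum>k<n. alpha (Suc k) * exp (- 1) ^ k) \<le> exp 1"
    by (rule tendsto_upperbound) simp
qed

text \<open>For k \<ge> 1 and 0 \<le> l \<le> 1, the Borel distribution: the law of the total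
  progeny of a Galton-Watson tree with Poisson offspring of mean l.\<close>

definition borel_mass :: "real \<Rightarrow> nat \<Rightarrow> real" where
  "borel_mass l k = alpha k * l ^ (k - 1) * exp (- real k * l)"

lemma borel_mass_Suc: "borel_mass l (Suc k) = exp (- l) * (alpha (Suc k) * (l * exp (- l)) ^ k)"
proof -
  have "exp (- real (Suc k) * l) = exp (- l) * exp (- l) ^ k"
    unfolding exp_of_nat_mult[symmetric] exp_add[symmetric] by (simp add: algebra_simps)
  then show ?thesis by (simp add: borel_mass_def power_mult_distrib)
qed

lemma borel_mass_nonneg: "0 \<le> l \<Longrightarrow> borel_mass l k \<ge> 0"
  using alpha_nonneg by (simp add: borel_mass_def)

text \<open>One summable sequence, free of l, dominates all Borel weights. It gives continuity at l
  = 1 and, later, tails that are small uniformly in time.\<close>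

lemma borel_mass_le:
  assumes "0 \<le> l"
  shows "borel_mass l (Suc k) \<le> alpha (Suc k) * exp (-1) ^ k"
proof -
  have "(l * exp (- l)) ^ k \<le> exp (-1) ^ k"
    using assms mult_exp_neg_le by (intro power_mono) auto
  then have "alpha (Suc k) * (l * exp (- l)) ^ k \<le> alpha (Suc k) * exp (-1) ^ k"
    using alpha_nonneg by (intro mult_left_mono)
  moreover have "exp (- l) * (alpha (Suc k) * (l * exp (- l)) ^ k) \<le>
      1 * (alpha (Suc k) * (l * exp (- l)) ^ k)"
    using assms alpha_nonneg by (intro mult_right_mono) auto
  ultimately show ?thesis by (simp add: borel_mass_Suc)
qed

text \<open>The critical value l = 1, attained at t = 1 / 2, lies on the boundary of the disc of
  convergence and is reached from l < 1 by uniform convergence.\<close>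

lemma borel_mass_sums:
  assumes "0 \<le> l" "l \<le> 1"
  shows "(\<lambda>k. borel_mass l (Suc k)) sums 1"
proof (cases "l = 1")
  case False
  then have "(\<lambda>k. exp (- l) * (alpha (Suc k) * (l * exp (- l)) ^ k)) sums (exp (- l) * exp l)"
    using assms by (intro sums_mult tree_fps_borel_aux) auto
  then show ?thesis by (simp add: borel_mass_Suc flip: exp_add)
next
  case True
  have un: "uniform_limit {0..1::real} (\<lambda>n l. \<Sum>k<n. borel_mass l (Suc k))
      (\<lambda>l. \<Sum>k. borel_mass l (Suc k)) sequentially"
    by (rule Weierstrass_m_test[OF _ summable_alpha_critical])
       (use borel_mass_le borel_mass_nonneg in auto)
  have "continuous_on {0..1::real} (\<lambda>l. \<Sum>k. borel_mass l (Suc k))"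
    by (rule uniform_limit_theorem[OF _ un])
       (auto simp: borel_mass_def intro!: continuous_intros always_eventually)
  then have "((\<lambda>l. \<Sum>k. borel_mass l (Suc k)) \<longlongrightarrow> (\<Sum>k. borel_mass 1 (Suc k))) (at 1 within {0..1})"
    by (simp add: continuous_on_def)
  moreover have "((\<lambda>l. \<Sum>k. borel_mass l (Suc k)) \<longlongrightarrow> 1) (at 1 within {0..1})"
  proof (rule tendsto_eventually)
    have "(\<lambda>k. borel_mass l (Suc k)) sums 1" if "0 \<le> l" "l < 1" for l
    proof -
      have "(\<lambda>k. exp (- l) * (alpha (Suc k) * (l * exp (- l)) ^ k)) sums (exp (- l) * exp l)"
        using that by (intro sums_mult tree_fps_borel_aux) auto
      then show ?thesis by (simp add: borel_mass_Suc flip: exp_add)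
    qed
    then show "\<forall>\<^sub>F l in at 1 within {0..1}. (\<Sum>k. borel_mass l (Suc k)) = 1"
      unfolding eventually_at_filter by (intro always_eventually) (auto simp: sums_iff)
  qed
  moreover have "at (1::real) within {0..1} \<noteq> bot"
    by (simp add: at_within_Icc_at_left)
  ultimately have "(\<Sum>k. borel_mass 1 (Suc k)) = 1" using tendsto_unique by blast
  moreover have "summable (\<lambda>k. borel_mass 1 (Suc k))"
    by (rule summable_comparison_test'[OF summable_alpha_critical])
       (use borel_mass_le[of 1] borel_mass_nonneg[of 1] in auto)
  ultimately show ?thesis using True by (simp add: sums_iff)
qed


section \<open>The functions f_p and g_p and the integrated rate\<close>

locale frozen_parameter =
  fixes p :: real
  assumes p_pos: "0 < p" and p_le_1: "p \<le> 1"
begin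

abbreviation "f \<equiv> f_fun p"
abbreviation "g \<equiv> g_fun p"

definition f_deriv :: "real \<Rightarrow> real" where
  "f_deriv s = 1 / 2 * (\<Sum>j. diffs (\<lambda>j. 1 / (1 + p * real j)) j * s ^ j)"

lemma f_coeff_pos: "1 + p * real j > 0"
  using p_pos by (intro add_pos_nonneg) auto

lemma f_coeff_le_1: "1 / (1 + p * real j) \<le> 1"
  using f_coeff_pos[of j] p_pos by (simp add: field_simps)

lemma f_coeff_bound: "norm (s ^ j / (1 + p * real j)) \<le> \<bar>s\<bar> ^ j"
  using mult_left_mono[OF f_coeff_le_1[of j], of "\<bar>s\<bar> ^ j"] f_coeff_pos[of j]
  by (simp add: power_abs abs_mult)

lemma summable_f: "\<bar>s\<bar> < 1 \<Longrightarrow> summable (\<lambda>j. s ^ j / (1 + p * real j))"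
  by (rule summable_comparison_test'[OF summable_geometric[of "\<bar>s\<bar>"] f_coeff_bound]) simp

lemma f_has_derivative:
  assumes "\<bar>s\<bar> < 1"
  shows "(f has_real_derivative f_deriv s) (at s)"
proof -
  have "((\<lambda>s. \<Sum>j. 1 / (1 + p * real j) * s ^ j) has_real_derivative
      (\<Sum>j. diffs (\<lambda>j. 1 / (1 + p * real j)) j * s ^ j)) (at s)"
    by (rule termdiffs_strong'[of 1]) (use summable_f assms in auto)
  from DERIV_cmult[OF this, of "1/2"] show ?thesis
    by (simp add: f_fun_def[abs_def] f_deriv_def)
qed

text \<open>Termwise, \<open>(1 + p j) / (1 + p j) = 1\<close>: the coefficients of \<open>f\<close> are chosen for this
  differential equation.\<close>

lemma f_ode:
  assumes "\<bar>s\<bar> < 1"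
  shows "2 * f s + 2 * p * s * f_deriv s = 1 / (1 - s)"
proof -
  let ?c = "\<lambda>j. 1 / (1 + p * real j)"
  have "(\<lambda>j. diffs ?c j * s ^ j) sums (2 * f_deriv s)"
    unfolding f_deriv_def
    by (simp, rule summable_sums, rule termdiff_converges[of _ 1])
       (use summable_f assms in auto)
  from sums_mult[OF this, of s] have "(\<lambda>j. real (Suc j) * ?c (Suc j) * s ^ Suc j) sums (s * (2 * f_deriv s))"
    by (simp add: diffs_def mult_ac)
  then have "(\<lambda>j. real j * ?c j * s ^ j) sums (s * (2 * f_deriv s))"
    by (subst (asm) sums_Suc_iff) simp
  from sums_mult[OF this, of p]
  have 1: "(\<lambda>j. p * (real j * ?c j * s ^ j)) sums (p * (s * (2 * f_deriv s)))" .
  have 2: "(\<lambda>j. s ^ j / (1 + p * real j)) sums (2 * f s)"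
    using summable_sums[OF summable_f[OF assms]] by (simp add: f_fun_def)
  have "s ^ j / (1 + p * real j) + p * (real j * ?c j * s ^ j) = s ^ j" for j
  proof -
    have "s ^ j / (1 + p * real j) + p * (real j * ?c j * s ^ j) =
        s ^ j * ((1 + p * real j) / (1 + p * real j))"
      by (simp only: divide_inverse) (simp only: algebra_simps mult_1_left)
    then show ?thesis using f_coeff_pos[of j] by simp
  qed
  with sums_add[OF 2 1] have "(\<lambda>j. s ^ j) sums (2 * f s + p * (s * (2 * f_deriv s)))" by simp
  then show ?thesis using geometric_sums[of s] assms by (simp add: sums_iff mult_ac)
qed

lemma f_deriv_pos:
  assumes "0 \<le> s" "s < 1"
  shows "f_deriv s > 0"
proof -
  have "summable (\<lambda>j. diffs (\<lambda>j. 1 / (1 + p * real j)) j * s ^ j)"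
    by (rule termdiff_converges[of _ 1]) (use summable_f assms in auto)
  moreover have "diffs (\<lambda>j. 1 / (1 + p * real j)) j * s ^ j \<ge> 0" for j
    using assms f_coeff_pos[of "Suc j"] by (simp add: diffs_def)
  moreover have "diffs (\<lambda>j. 1 / (1 + p * real j)) 0 * s ^ 0 > 0"
    using f_coeff_pos[of 1] by (simp add: diffs_def)
  ultimately show ?thesis unfolding f_deriv_def using suminf_pos2 by fastforce
qed

lemma f_strict_mono: "0 \<le> s \<Longrightarrow> s < s' \<Longrightarrow> s' < 1 \<Longrightarrow> f s < f s'"
proof (rule DERIV_pos_imp_increasing[of s s' f])
  fix x assume "0 \<le> s" "s' < 1" "s \<le> x" "x \<le> s'"
  then have "(f has_real_derivative f_deriv x) (at x)" "f_deriv x > 0"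
    by (auto intro: f_has_derivative f_deriv_pos)
  then show "\<exists>d. (f has_real_derivative d) (at x) \<and> d > 0" by blast
qed

lemma f_mono: "0 \<le> s \<Longrightarrow> s \<le> s' \<Longrightarrow> s' < 1 \<Longrightarrow> f s \<le> f s'"
  using f_strict_mono[of s s'] by (cases "s = s'") auto

lemma f_0: "f 0 = 1 / 2"
  using powser_zero[of "\<lambda>j. 1 / (1 + p * real j)"] by (simp add: f_fun_def)

text \<open>Drops the derivative term of \<open>f_ode\<close>, which is nonnegative. Composed with g
  it says that the Poisson mean 2 t (1 - g t) never exceeds 1.\<close>

lemma f_le: "0 \<le> s \<Longrightarrow> s < 1 \<Longrightarrow> 2 * f s * (1 - s) \<le> 1"
proof -
  assume s: "0 \<le> s" "s < 1"
  have "2 * f s \<le> 1 / (1 - s)"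
  proof -
    have "0 \<le> 2 * p * s * f_deriv s" using f_deriv_pos[OF s] s p_pos by simp
    then show ?thesis using f_ode[of s] s by simp
  qed
  then show ?thesis using s by (simp add: field_simps)
qed

text \<open>For p \<le> 1 the coefficients dominate the harmonic ones, so the series diverges at s =
  1, and already a partial sum exceeds any given bound near 1.\<close>

lemma f_unbounded: "\<exists>s. 0 \<le> s \<and> s < 1 \<and> f s \<ge> t"
proof -
  have "\<not> summable (\<lambda>j. 1 / (1 + p * real j))"
  proof
    assume sum: "summable (\<lambda>j. 1 / (1 + p * real j))"
    have "norm (inverse (real (Suc j))) \<le> 1 / (1 + p * real j)" for j
      using f_coeff_pos[of j] p_le_1 mult_right_mono[of p 1 "real j"] by (simp add: field_simps)
    then have "summable (\<lambda>j. inverse (real (Suc j)))"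
      by (rule summable_comparison_test'[OF sum])
    then have "summable (\<lambda>j. inverse (real j))" by (subst (asm) summable_Suc_iff)
    then show False using not_summable_harmonic[where 'a = real] by simp
  qed
  then have "\<not> (\<forall>n. (\<Sum>j<n. 1 / (1 + p * real j)) \<le> 2 * t + 1)"
    using summableI_nonneg_bounded[of "\<lambda>j. 1 / (1 + p * real j)" "2 * t + 1"] f_coeff_pos
    by (auto simp: less_imp_le)
  then obtain n where n: "(\<Sum>j<n. 1 / (1 + p * real j)) > 2 * t + 1"
    by (meson not_le)
  have "((\<lambda>s. \<Sum>j<n. s ^ j / (1 + p * real j)) \<longlongrightarrow> (\<Sum>j<n. 1 ^ j / (1 + p * real j))) (at_left 1)"
    by (intro tendsto_intros) (use f_coeff_pos in \<open>auto simp: less_imp_neq[symmetric]\<close>)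
  then have "\<forall>\<^sub>F s in at_left 1. (\<Sum>j<n. s ^ j / (1 + p * real j)) > 2 * t + 1"
    using n by (intro order_tendstoD) auto
  moreover have "\<forall>\<^sub>F s in at_left (1::real). s \<in> {0<..<1}" by (rule eventually_at_left_real) simp
  ultimately have "\<forall>\<^sub>F s in at_left (1::real). s \<in> {0<..<1} \<and>
      (\<Sum>j<n. s ^ j / (1 + p * real j)) > 2 * t + 1" by eventually_elim auto
  then obtain s where s: "s \<in> {0<..<1}" "(\<Sum>j<n. s ^ j / (1 + p * real j)) > 2 * t + 1"
    using eventually_happens'[OF trivial_limit_at_left_real] by blast
  have "(\<Sum>j<n. s ^ j / (1 + p * real j)) \<le> 2 * f s"
    using sum_le_suminf[OF summable_f[of s], of "{..<n}"] s f_coeff_pos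
    by (simp add: f_fun_def less_imp_le)
  then show ?thesis using s by (intro exI[of _ s]) auto
qed

lemma f_isCont: "\<bar>s\<bar> < 1 \<Longrightarrow> isCont f s"
  using f_has_derivative DERIV_isCont by blast

lemma f_surj:
  assumes "t \<ge> 1 / 2"
  shows "t \<in> f ` {0..<1}"
proof -
  obtain s where s: "0 \<le> s" "s < 1" "f s \<ge> t" using f_unbounded by blast
  then obtain x where "0 \<le> x" "x \<le> s" "f x = t"
    using IVT[of f 0 t s] assms f_isCont f_0 by auto
  then show ?thesis using s by auto
qed

lemma g_range: "0 \<le> g t" "g t < 1"
  using inv_into_into[OF f_surj[of t]] by (auto simp: g_fun_def)

lemma f_g: "t \<ge> 1 / 2 \<Longrightarrow> f (g t) = t"
  using f_inv_into_f[OF f_surj[of t]] f_0 by (auto simp: g_fun_def)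

lemma g_eq_0: "t \<le> 1 / 2 \<Longrightarrow> g t = 0"
  by (simp add: g_fun_def)

lemma g_mono:
  assumes "s \<le> t" shows "g s \<le> g t"
proof (cases "s \<le> 1 / 2")
  case True then show ?thesis using g_range by (simp add: g_eq_0)
next
  case False
  show ?thesis
  proof (rule ccontr)
    assume "\<not> g s \<le> g t"
    then have "f (g t) < f (g s)" using g_range by (intro f_strict_mono) auto
    then show False using f_g[of s] f_g[of t] False assms by simp
  qed
qed

lemma mult_g_le_1:
  assumes "0 \<le> t" shows "2 * t * (1 - g t) \<le> 1"
proof (cases "t \<le> 1 / 2")
  case True then show ?thesis using assms by (simp add: g_eq_0)
next
  case False
  then show ?thesis using f_le[of "g t"] g_range[of t] f_g[of t] by simp
qed

text \<open>Left continuity, extended to all later times by monotonicity. It allows passing from a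
  short time interval before t to the time t itself.\<close>

lemma g_left_continuous:
  assumes "\<epsilon> > 0"
  obtains s where "s < t" "\<And>x. s < x \<Longrightarrow> g t - \<epsilon> \<le> g x"
proof (cases "g t - \<epsilon> \<le> 0")
  case True
  then have "g t - \<epsilon> \<le> g x" for x using g_range(1)[of x] by linarith
  then show ?thesis using that[of "t - 1"] by simp
next
  case False
  let ?s = "g t - \<epsilon>"
  have t: "t > 1 / 2" using False assms g_eq_0[of t] by (cases "t \<le> 1 / 2") auto
  have "f ?s < f (g t)" using False assms g_range[of t] by (intro f_strict_mono) auto
  then have less: "f ?s < t" using f_g[of t] t by simp
  have "?s \<le> g x" if "f ?s < x" for x
  proof (rule ccontr)
    assume "\<not> ?s \<le> g x"
    then have "f (g x) \<le> f ?s" using g_range[of x] g_range[of t] assms by (intro f_mono) auto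
    moreover have "f ?s \<ge> f 0" using False g_range[of t] assms by (intro f_mono) auto
    ultimately show False using that f_g[of x] f_0 by simp
  qed
  then show ?thesis using that less by blast
qed

text \<open>\<open>A t\<close> is the integral over \<open>[0, t]\<close> of the rate \<open>b\<close> at which a tree vertex is offered an
  accepted edge, up to a factor 2.\<close>

definition A :: "real \<Rightarrow> real" where
  "A t = t * (1 - g t) - ln (1 - g t) / 2"

text \<open>The same as p + (1 - p) (1 - g t): tree vertices count 1, frozen ones p.\<close>

definition b :: "real \<Rightarrow> real" where
  "b t = 1 - (1 - p) * g t"

lemma b_range: "0 \<le> b t" "b t \<le> 1"
proof -
  have "(1 - p) * g t \<le> 1 * 1" using p_pos p_le_1 g_range[of t] by (intro mult_mono) auto
  then show "0 \<le> b t" by (simp add: b_def)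
  show "b t \<le> 1" using p_le_1 g_range[of t] by (simp add: b_def)
qed

lemma A_le_half: "t \<le> 1 / 2 \<Longrightarrow> A t = t"
  by (simp add: A_def g_eq_0)

text \<open>\<open>H\<close> is A in the variable s with t = f s, and its derivative is 1 - (1 - p)
  s times that of f. This factor is monotone, so subtracting its value at an endpoint leaves a
  derivative of constant sign. In this way no derivative of the inverse g is taken.\<close>

lemma A_secant_f:
  assumes "0 \<le> x" "x \<le> y" "y < 1"
  defines "H \<equiv> \<lambda>s. f s * (1 - s) - ln (1 - s) / 2"
  shows "(1 - (1 - p) * y) * (f y - f x) \<le> H y - H x"
    and "H y - H x \<le> (1 - (1 - p) * x) * (f y - f x)"
proof -
  have dH: "((\<lambda>s. H s - c * f s) has_real_derivative f_deriv s * (1 - (1 - p) * s - c)) (at s)"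
    if "0 \<le> s" "s < 1" for s c
  proof -
    have "((\<lambda>s. H s - c * f s) has_real_derivative
        f_deriv s * (1 - s) - f s + 1 / (1 - s) / 2 - c * f_deriv s) (at s)"
      unfolding H_def using that
      by (auto intro!: derivative_eq_intros f_has_derivative simp: field_simps)
    \<comment> \<open>Here the differential equation of f enters: it trades \<open>f s\<close> for
      its derivative.\<close>
    moreover have "f_deriv s * (1 - s) - f s + 1 / (1 - s) / 2 - c * f_deriv s =
        f_deriv s * (1 - (1 - p) * s - c)"
      using f_ode[of s, symmetric] that by (simp add: algebra_simps)
    ultimately show ?thesis by simp
  qed
  have "H x - (1 - (1 - p) * y) * f x \<le> H y - (1 - (1 - p) * y) * f y"
  proof (rule DERIV_nonneg_imp_nondecreasing[OF assms(2)])
    fix s assume s: "x \<le> s" "s \<le> y"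
    have "f_deriv s * (1 - (1 - p) * s - (1 - (1 - p) * y)) \<ge> 0"
      using s assms f_deriv_pos[of s] p_le_1 mult_left_mono[of s y "1 - p"]
      by (intro mult_nonneg_nonneg) auto
    then show "\<exists>d. ((\<lambda>s. H s - (1 - (1 - p) * y) * f s) has_real_derivative d) (at s) \<and> 0 \<le> d"
      using dH[of s] s assms by (meson le_less_trans order_trans)
  qed
  then show "(1 - (1 - p) * y) * (f y - f x) \<le> H y - H x" by (simp add: algebra_simps)
  have "H y - (1 - (1 - p) * x) * f y \<le> H x - (1 - (1 - p) * x) * f x"
  proof (rule DERIV_nonpos_imp_nonincreasing[OF assms(2)])
    fix s assume s: "x \<le> s" "s \<le> y"
    have "f_deriv s * (1 - (1 - p) * s - (1 - (1 - p) * x)) \<le> 0"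
      using s assms f_deriv_pos[of s] p_le_1 mult_left_mono[of x s "1 - p"]
      by (intro mult_nonneg_nonpos) auto
    then show "\<exists>d. ((\<lambda>s. H s - (1 - (1 - p) * x) * f s) has_real_derivative d) (at s) \<and> d \<le> 0"
      using dH[of s] s assms by (meson le_less_trans order_trans)
  qed
  then show "H y - H x \<le> (1 - (1 - p) * x) * (f y - f x)" by (simp add: algebra_simps)
qed

text \<open>Expresses A' = b without differentiating: the secant slopes of A lie between the values
  of the antitone b at the endpoints. The formulas before and after time 1 / 2 are glued there,
  where b = 1.\<close>

lemma A_secant:
  assumes "0 \<le> s" "s \<le> t"
  shows "b t * (t - s) \<le> A t - A s" "A t - A s \<le> b s * (t - s)"
proof -
  have upper: "b t * (t - s) \<le> A t - A s \<and> A t - A s \<le> b s * (t - s)"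
    if "1 / 2 \<le> s" "s \<le> t" for s t
    using A_secant_f[of "g s" "g t"] g_range[of s] g_range[of t] g_mono[OF that(2)]
      f_g[of s] f_g[of t] that by (simp add: A_def b_def)
  have "b t * (t - s) \<le> A t - A s \<and> A t - A s \<le> b s * (t - s)"
  proof -
    consider "1 / 2 \<le> s" | "t \<le> 1 / 2" | "s < 1 / 2" "1 / 2 < t" by linarith
    then show ?thesis
    proof cases
      case 1 then show ?thesis using upper assms by blast
    next
      case 2 then show ?thesis using assms by (simp add: A_le_half b_def g_eq_0)
    next
      case 3
      have b1: "b s = 1" "b (1 / 2) = 1" using 3 by (simp_all add: b_def g_eq_0)
      have 1: "b t * (1 / 2 - s) \<le> 1 * (1 / 2 - s)"
        using b_range[of t] 3 by (intro mult_right_mono) auto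
      have 2: "b t * (t - 1 / 2) \<le> A t - A (1 / 2)" "A t - A (1 / 2) \<le> t - 1 / 2"
        using upper[of "1/2" t] 3 by (simp_all add: b1)
      have 4: "A s = s" "A (1 / 2) = 1 / 2" using 3 A_le_half by auto
      have "b t * (t - s) = b t * (t - 1 / 2) + b t * (1 / 2 - s)"
        by (simp add: algebra_simps)
      also have "\<dots> \<le> (A t - A (1 / 2)) + 1 * (1 / 2 - s)" using 1 2 by (intro add_mono)
      also have "\<dots> = A t - A s" using 4 by simp
      finally have "b t * (t - s) \<le> A t - A s" .
      moreover have "A t - A s \<le> 1 * (t - s)" using 2(2) 4 by simp
      ultimately have "b t * (t - s) \<le> A t - A s \<and> A t - A s \<le> 1 * (t - s)" ..
      then show ?thesis unfolding b1 .
    qed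
  qed
  then show "b t * (t - s) \<le> A t - A s" "A t - A s \<le> b s * (t - s)" by auto
qed

lemma A_0 [simp]: "A 0 = 0"
  by (simp add: A_le_half)

lemma A_range:
  assumes "0 \<le> t" shows "0 \<le> A t" "A t \<le> t"
proof -
  have "0 \<le> b t * t" using assms b_range[of t] by simp
  then show "0 \<le> A t" using A_secant(1)[of 0 t] assms by simp
  have "b 0 * t \<le> 1 * t" using assms b_range[of 0] by (intro mult_right_mono) auto
  then show "A t \<le> t" using A_secant(2)[of 0 t] assms by simp
qed

text \<open>Solves the merging equations without loss: for k \<ge> 1 the derivative of
  \<open>xi k\<close> is k times the convolution of the smaller ones, and at time 0 only
  \<open>xi 1\<close> is nonzero, with value 1.\<close>

definition xi :: "nat \<Rightarrow> real \<Rightarrow> real" where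
  "xi k t = alpha k * (2 * t) ^ (k - 1)"

text \<open>The property for which A is made: it turns the weighted \<open>xi\<close> into 1 - g t
  times Borel weights.\<close>

lemma exp_A: "exp (- 2 * A t) = (1 - g t) * exp (- (2 * t * (1 - g t)))"
proof -
  have "- 2 * A t = ln (1 - g t) + - (2 * t * (1 - g t))" by (simp add: A_def algebra_simps)
  then show ?thesis using g_range[of t] by (simp only: exp_add) simp
qed

lemma xi_exp_A:
  assumes "1 \<le> k"
  shows "xi k t * exp (- 2 * real k * A t) = (1 - g t) * borel_mass (2 * t * (1 - g t)) k"
proof -
  have "exp (- 2 * real k * A t) = exp (- 2 * A t) ^ k"
    by (simp add: mult_ac flip: exp_of_nat_mult)
  also have "\<dots> = (1 - g t) ^ k * exp (- real k * (2 * t * (1 - g t)))"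
    unfolding exp_A by (simp add: power_mult_distrib mult_ac flip: exp_of_nat_mult)
  finally have e: "exp (- 2 * real k * A t) = (1 - g t) ^ k * exp (- real k * (2 * t * (1 - g t)))" .
  define u where "u = 1 - g t"
  show ?thesis using assms unfolding e u_def[symmetric]
    by (cases k) (simp_all add: xi_def borel_mass_def power_mult_distrib mult_ac)
qed

lemma xi_sum_eq: "(\<Sum>k\<in>{1..K}. xi k t * exp (- 2 * real k * A t)) =
    (1 - g t) * (\<Sum>k\<in>{1..K}. borel_mass (2 * t * (1 - g t)) k)"
  unfolding sum_distrib_left by (intro sum.cong refl xi_exp_A) auto

lemma xi_exp_A_eq_t_fun:
  assumes "1 \<le> k"
  shows "xi k t * exp (- 2 * real k * A t) = real k * t_fun p k t"
proof -
  have "real k * real k powi (int k - 2) = real k ^ (k - 1)"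
  proof -
    have "real k * real k powi (int k - 2) = real k powi (int k - 2 + 1)"
      using assms by (subst power_int_add) auto
    also have "int k - 2 + 1 = int (k - 1)" using assms by simp
    finally show ?thesis by (simp only: power_int_of_nat)
  qed
  then have "alpha k = real k * (real k powi (int k - 2) / fact k)" by (simp add: alpha_def)
  then have "(1 - g t) * borel_mass (2 * t * (1 - g t)) k = real k * (real k powi (int k - 2) /
      fact k * (2 * t) ^ (k - 1) * (1 - g t) ^ k * exp (- 2 * real k * t * (1 - g t)))"
    using assms unfolding borel_mass_def power_mult_distrib
    by (cases k) (simp_all only: diff_Suc_1 power_Suc mult_ac mult_minus_left mult_minus_right)
  then show ?thesis unfolding xi_exp_A[OF assms] t_fun_def .
qed

lemma xi_sum_le:
  assumes "0 \<le> t"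
  shows "(\<Sum>k\<in>{1..K}. xi k t * exp (- 2 * real k * A t)) \<le> 1 - g t"
proof -
  let ?l = "2 * t * (1 - g t)"
  have l: "0 \<le> ?l" "?l \<le> 1" using assms g_range[of t] mult_g_le_1 by auto
  note s = borel_mass_sums[OF l]
  have "(\<Sum>k\<in>{1..K}. borel_mass ?l k) = (\<Sum>k<K. borel_mass ?l (Suc k))"
    by (simp add: sum.atLeast1_atMost_eq)
  also have "\<dots> \<le> 1"
    using sum_le_suminf[OF sums_summable[OF s], of "{..<K}"] borel_mass_nonneg[OF l(1)] s
    by (simp add: sums_iff)
  finally have "(1 - g t) * (\<Sum>k\<in>{1..K}. borel_mass ?l k) \<le> (1 - g t) * 1"
    using g_range[of t] by (intro mult_left_mono) auto
  then show ?thesis by (simp only: xi_sum_eq mult_1_right)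
qed

text \<open>The bound \<open>borel_mass_le\<close> does not involve t, so one \<open>K0\<close>
  serves all times.\<close>

lemma xi_tail:
  assumes "\<epsilon> > 0"
  obtains K0 where "\<And>K t. K0 \<le> K \<Longrightarrow> 0 \<le> t \<Longrightarrow>
    1 - g t - (\<Sum>k\<in>{1..K}. xi k t * exp (- 2 * real k * A t)) \<le> \<epsilon>"
proof -
  let ?c = "\<lambda>k. alpha (Suc k) * exp (-1) ^ k"
  obtain K0 where K0: "\<And>n. n \<ge> K0 \<Longrightarrow> norm (\<Sum>i. ?c (i + n)) < \<epsilon>"
    using suminf_exist_split[OF assms summable_alpha_critical] by blast
  show ?thesis
  proof (rule that)
    fix K and t :: real assume K: "K0 \<le> K" and t: "0 \<le> t"
    let ?l = "2 * t * (1 - g t)"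
    have l: "0 \<le> ?l" "?l \<le> 1" using t g_range[of t] mult_g_le_1 by auto
    note s = borel_mass_sums[OF l]
    have "1 - (\<Sum>k<K. borel_mass ?l (Suc k)) = (\<Sum>i. borel_mass ?l (Suc (i + K)))"
      using suminf_minus_initial_segment[OF sums_summable[OF s], of K] s by (simp add: sums_iff)
    also have "\<dots> \<le> (\<Sum>i. ?c (i + K))"
      using borel_mass_le[OF l(1)] s summable_alpha_critical
      by (intro suminf_le) (auto simp: sums_iff intro!: summable_ignore_initial_segment)
    also have "\<dots> \<le> \<epsilon>" using K0[OF K] by simp
    finally have *: "1 - (\<Sum>k<K. borel_mass ?l (Suc k)) \<le> \<epsilon>" .
    have "1 - g t - (\<Sum>k\<in>{1..K}. xi k t * exp (- 2 * real k * A t)) =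
        (1 - g t) * (1 - (\<Sum>k\<in>{1..K}. borel_mass ?l k))"
      unfolding xi_sum_eq by (simp add: right_diff_distrib)
    also have "(\<Sum>k\<in>{1..K}. borel_mass ?l k) = (\<Sum>k<K. borel_mass ?l (Suc k))"
      by (simp add: sum.atLeast1_atMost_eq)
    also have "(1 - g t) * (1 - (\<Sum>k<K. borel_mass ?l (Suc k))) \<le> (1 - g t) * \<epsilon>"
      using * g_range[of t] by (intro mult_left_mono) auto
    also have "\<dots> \<le> 1 * \<epsilon>" using g_range[of t] assms by (intro mult_right_mono) auto
    finally show "1 - g t - (\<Sum>k\<in>{1..K}. xi k t * exp (- 2 * real k * A t)) \<le> \<epsilon>" by simp
  qed
qed

end

section \<open>The augmented process\<close>

lemma integrable_finite_pmf:
  "finite (set_pmf M) \<Longrightarrow> integrable (measure_pmf M) (f :: 'a \<Rightarrow> real)"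
  by (rule integrable_measure_pmf_finite)

lemma expectation_mono:
  fixes f h :: "'a \<Rightarrow> real"
  assumes "finite (set_pmf M)" "\<And>x. x \<in> set_pmf M \<Longrightarrow> f x \<le> h x"
  shows "measure_pmf.expectation M f \<le> measure_pmf.expectation M h"
  using assms by (intro integral_mono_AE integrable_finite_pmf) (auto simp: AE_measure_pmf_iff)

lemma expectation_le_const:
  fixes f :: "'a \<Rightarrow> real"
  assumes "finite (set_pmf M)" "\<And>x. x \<in> set_pmf M \<Longrightarrow> f x \<le> c"
  shows "measure_pmf.expectation M f \<le> c"
  using expectation_mono[OF assms(1), of f "\<lambda>_. c"] assms(2) by simp

lemma expectation_nonneg:
  fixes f :: "'a \<Rightarrow> real"
  assumes "\<And>x. x \<in> set_pmf M \<Longrightarrow> 0 \<le> f x"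
  shows "0 \<le> measure_pmf.expectation M f"
  using assms by (intro integral_nonneg_AE) (auto simp: AE_measure_pmf_iff)

text \<open>The second coordinate integrates \<open>merge_rate / n\<close> over time steps of length
  1 / n. Its increment depends only on the graph before the step and is thus common to all outcomes
  of the step.\<close>

primrec augmented :: "real \<Rightarrow> nat \<Rightarrow> nat \<Rightarrow> (nat multigraph \<times> real) pmf" where
  "augmented p n 0 = return_pmf (Multigraph {1..n} {#}, 0)"
| "augmented p n (Suc m) = bind_pmf (augmented p n m) (\<lambda>x.
     map_pmf (\<lambda>G'. (G', snd x + merge_rate p (fst x) / (real n)\<^sup>2)) (frozen_step p n (fst x)))"

lemma map_fst_augmented: "map_pmf fst (augmented p n m) = frozen_graph p n m"
proof (induction m)
  case (Suc m)
  have "map_pmf fst (augmented p n (Suc m)) =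
      bind_pmf (augmented p n m) (\<lambda>x. frozen_step p n (fst x))"
    by (simp add: map_bind_pmf pmf.map_comp comp_def pmf.map_ident)
  also have "\<dots> = bind_pmf (map_pmf fst (augmented p n m)) (frozen_step p n)"
    by (simp add: bind_map_pmf)
  finally show ?case using Suc by simp
qed simp

lemma finite_set_pmf_augmented: "n \<ge> 2 \<Longrightarrow> finite (set_pmf (augmented p n m))"
  by (induction m) (auto simp: finite_set_pmf_frozen_step)

lemma expectation_augmented_Suc:
  assumes "n \<ge> 2"
  shows "measure_pmf.expectation (augmented p n (Suc m)) f =
    measure_pmf.expectation (augmented p n m) (\<lambda>x. measure_pmf.expectation (frozen_step p n (fst x))
      (\<lambda>G'. f (G', snd x + merge_rate p (fst x) / (real n)\<^sup>2) :: real))"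
  unfolding augmented.simps
  by (subst pmf_expectation_bind[where A = "set_pmf (augmented p n m)"],
      use assms in \<open>auto simp: finite_set_pmf_augmented finite_set_pmf_frozen_step\<close>,
      subst integral_measure_pmf[where A = "set_pmf (augmented p n m)"],
      use assms in \<open>auto simp: finite_set_pmf_augmented\<close>)

lemma wf_empty_graph: "wf_graph (Multigraph {1..n::nat} {#})"
  by (simp add: wf_graph_def)

lemma reach_empty_graph: "v \<in> {1..n} \<Longrightarrow> reach (Multigraph {1..n::nat} {#}) v = {v}"
  by (auto simp: reach_def adjacency_def)

lemma is_tree_empty_graph: "v \<in> {1..n} \<Longrightarrow> is_tree (component (Multigraph {1..n::nat} {#}) v)"
  using wf_empty_graph[of n] reach_empty_graph[of v n] by (simp add: is_tree_component_iff edges_component)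

lemma valid_empty_graph: "valid_graph (Multigraph {1..n::nat} {#})"
  unfolding valid_graph_def using wf_empty_graph[of n] is_tree_empty_graph[of _ n] by (metis multigraph.sel(1))

lemma treev_empty_graph: "treev (Multigraph {1..n::nat} {#}) = {1..n}"
  using is_tree_empty_graph by (auto simp: treev_def)

lemma csize_empty_graph: "v \<in> {1..n} \<Longrightarrow> csize (Multigraph {1..n::nat} {#}) v = 1"
  using reach_empty_graph[of v n] by (simp add: csize_def)

lemma merge_rate_bounds:
  assumes "verts G = {1..n}" "0 \<le> p" "p \<le> 1"
  shows "0 \<le> merge_rate p G" "merge_rate p G \<le> real n"
proof -
  have fin: "finite (treev G)" using treev_subset[of G] assms(1) by (auto intro: finite_subset)
  show "0 \<le> merge_rate p G" using assms by (simp add: merge_rate_def)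
  have "p * real (card (verts G - treev G)) \<le> 1 * real (card (verts G - treev G))"
    using assms by (intro mult_right_mono) auto
  moreover have "card (treev G) + card (verts G - treev G) = n"
    using fin treev_subset[of G] assms(1) by (simp add: card_Diff_subset card_mono
        ordered_cancel_comm_monoid_diff_class.add_diff_inverse)
      (metis assms(1) card_atLeastAtMost card_mono diff_Suc_1 finite_atLeastAtMost le_add_diff_inverse)
  ultimately show "merge_rate p G \<le> real n" by (simp add: merge_rate_def flip: of_nat_add)
qed

lemma augmented_support:
  assumes "n \<ge> 2" "0 \<le> p" "p \<le> 1" "x \<in> set_pmf (augmented p n m)"
  shows "valid_graph (fst x)" "verts (fst x) = {1..n}" "0 \<le> snd x" "snd x \<le> real m / real n"
proof -
  have "valid_graph (fst x) \<and> verts (fst x) = {1..n} \<and> 0 \<le> snd x \<and> snd x \<le> real m / real n"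
    using assms(4)
  proof (induction m arbitrary: x)
    case 0 then show ?case using valid_empty_graph by auto
  next
    case (Suc m)
    then obtain y G' where y: "y \<in> set_pmf (augmented p n m)" and G': "G' \<in> set_pmf (frozen_step p n (fst y))"
      and x: "x = (G', snd y + merge_rate p (fst y) / (real n)\<^sup>2)" by auto
    note IH = Suc.IH[OF y]
    note b = merge_rate_bounds[of "fst y" n p]
    have "merge_rate p (fst y) / (real n)\<^sup>2 \<le> real n / (real n)\<^sup>2"
      using b IH assms by (intro divide_right_mono) auto
    also have "\<dots> = 1 / real n" using assms by (simp add: power2_eq_square)
    finally have "snd x \<le> real (Suc m) / real n" using IH x by (simp add: add_divide_distrib)
    then show ?case
      using frozen_step_support(1,2)[OF _ _ assms(1) G'] IH b assms x by auto
  qed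
  then show "valid_graph (fst x)" "verts (fst x) = {1..n}" "0 \<le> snd x" "snd x \<le> real m / real n"
    by auto
qed

text \<open>Counts vertices rather than trees, so that each tree is weighted by its size: this is
  what a uniform vertex sees.\<close>

definition tree_count :: "nat \<Rightarrow> 'v multigraph \<Rightarrow> real" where
  "tree_count k G = real (card {u \<in> treev G. csize G u = k})"

lemma tree_count_eq_sum:
  "wf_graph G \<Longrightarrow> tree_count k G = (\<Sum>u\<in>treev G. if csize G u = k then 1 else 0)"
  by (simp add: tree_count_def sum.If_cases Int_def)

lemma tree_sum_indicator:
  "wf_graph G \<Longrightarrow> 1 \<le> k \<Longrightarrow> tree_sum (\<lambda>j. if j = k then real k else 0) G = tree_count k G"
  unfolding tree_sum_def tree_count_eq_sum by (intro sum.cong) auto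

lemma card_treev_split:
  assumes "wf_graph G"
  shows "real (card (treev G)) =
    (\<Sum>k\<in>{1..K}. tree_count k G) + real (card {u \<in> treev G. K < csize G u})"
proof -
  have "real (card (treev G)) = (\<Sum>u\<in>treev G. (\<Sum>k\<in>{1..K}. if csize G u = k then 1 else 0)
      + (if K < csize G u then 1 else 0))"
  proof -
    have "(\<Sum>k\<in>{1..K}. if csize G u = k then 1 else 0) + (if K < csize G u then 1 else 0) = (1::real)"
      if "u \<in> treev G" for u
      using csize_pos[OF assms, of u] that treev_subset[of G] by (auto simp: Suc_le_eq)
    then show ?thesis by simp
  qed
  also have "\<dots> = (\<Sum>k\<in>{1..K}. tree_count k G) + real (card {u \<in> treev G. K < csize G u})"
    unfolding sum.distrib tree_count_eq_sum[OF assms]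
    using assms by (subst sum.swap) (simp add: sum.If_cases Int_def)
  finally show ?thesis .
qed

lemma card_treev_le: "verts G = {1..n} \<Longrightarrow> card (treev G) \<le> n"
  using treev_subset[of G] card_mono[of "{1..n}" "treev G"] by simp

lemma sum_tree_count_le:
  assumes "wf_graph G" "verts G = {1..n}"
  shows "(\<Sum>k\<in>{1..K}. tree_count k G) \<le> real n"
  using card_treev_split[OF assms(1), of K] card_treev_le[OF assms(2)] by simp

lemma tree_count_nonneg: "tree_count k G \<ge> 0"
  by (simp add: tree_count_def)

lemma tree_count_le:
  assumes "wf_graph G" "verts G = {1..n}"
  shows "tree_count k G \<le> real n"
proof -
  have "card {u \<in> treev G. csize G u = k} \<le> card (treev G)"
    using assms by (intro card_mono) auto
  then show ?thesis using card_treev_le[OF assms(2)] by (simp add: tree_count_def)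
qed

lemma merge_pairs_count:
  assumes "wf_graph G"
  shows "(\<Sum>u\<in>treev G. \<Sum>v\<in>treev G. if csize G u + csize G v = k then real k else 0) =
    real k * (\<Sum>i\<in>{1..<k}. tree_count i G * tree_count (k - i) G)"
proof -
  have "(if csize G u + csize G v = k then real k else 0) = real k *
      (\<Sum>i\<in>{1..<k}. (if csize G u = i then 1 else 0) * (if csize G v = k - i then 1 else 0))"
    if "u \<in> treev G" "v \<in> treev G" for u v
  proof -
    have pos: "csize G u > 0" "csize G v > 0"
      using csize_pos[OF assms] that treev_subset[of G] by auto
    have "(\<Sum>i\<in>{1..<k}. (if csize G u = i then 1 else 0) * (if csize G v = k - i then 1 else 0)) =
        (\<Sum>i\<in>{1..<k}. if csize G u = i then (if csize G v = k - csize G u then 1 else (0::real)) else 0)"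
      by (intro sum.cong) auto
    also have "\<dots> = (if csize G u + csize G v = k then 1 else 0)"
      using pos by (auto simp: sum.delta)
    finally show ?thesis by simp
  qed
  then have "(\<Sum>u\<in>treev G. \<Sum>v\<in>treev G. if csize G u + csize G v = k then real k else 0) =
      real k * (\<Sum>u\<in>treev G. \<Sum>v\<in>treev G. \<Sum>i\<in>{1..<k}.
        (if csize G u = i then 1 else 0) * (if csize G v = k - i then 1 else 0))"
    by (simp add: sum_distrib_left cong: sum.cong)
  also have "(\<Sum>u\<in>treev G. \<Sum>v\<in>treev G. \<Sum>i\<in>{1..<k}.
        (if csize G u = i then 1 else 0) * (if csize G v = k - i then 1 else 0)) =
      (\<Sum>i\<in>{1..<k}. \<Sum>u\<in>treev G. \<Sum>v\<in>treev G.
        (if csize G u = i then 1 else 0) * (if csize G v = k - i then 1 else (0::real)))"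
    by (subst sum.swap[of _ "{1..<k}"], subst (2) sum.swap) simp
  also have "\<dots> = (\<Sum>i\<in>{1..<k}. tree_count i G * tree_count (k - i) G)"
    unfolding tree_count_eq_sum[OF assms] sum_product ..
  finally show ?thesis .
qed

section \<open>Tightness of the tree sizes\<close>

lemma mult_power_le_geometric:
  fixes z :: real
  assumes "0 < z" "z < 1"
  shows "real k * z ^ k \<le> 1 / (1 - z)"
proof -
  have "real k * z ^ k = (\<Sum>j<k. z ^ k)" by simp
  also have "\<dots> \<le> (\<Sum>j<k. z ^ j)" using assms by (intro sum_mono power_decreasing) auto
  also have "\<dots> = (1 - z ^ k) / (1 - z)" using assms by (simp add: sum_gp_strict)
  also have "\<dots> \<le> 1 / (1 - z)" using assms by (intro divide_right_mono) auto
  finally show ?thesis .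
qed

text \<open>For z near 1 this is nearly blind to trees much smaller than 1 / (1 - z), while a vertex
  in a much larger tree counts almost 1.\<close>

definition spread :: "real \<Rightarrow> 'v multigraph \<Rightarrow> real" where
  "spread z G = (\<Sum>u\<in>treev G. 1 - z ^ csize G u)"

lemma spread_pairs:
  "(\<Sum>u\<in>treev G. \<Sum>v\<in>treev G. 1 - z ^ (csize G u + csize G v)) =
     real (card (treev G)) ^ 2 - (real (card (treev G)) - spread z G) ^ 2"
proof -
  have "(\<Sum>u\<in>treev G. \<Sum>v\<in>treev G. z ^ (csize G u + csize G v)) = (\<Sum>u\<in>treev G. z ^ csize G u) ^ 2"
    by (simp add: power_add power2_eq_square sum_product)
  moreover have "(\<Sum>u\<in>treev G. z ^ csize G u) = real (card (treev G)) - spread z G"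
    by (simp add: spread_def sum_subtractf)
  ultimately show ?thesis by (simp add: sum_subtractf power2_eq_square)
qed

context frozen_parameter
begin

abbreviation EE :: "nat \<Rightarrow> nat \<Rightarrow> (nat multigraph \<times> real \<Rightarrow> real) \<Rightarrow> real" where
  "EE n m h \<equiv> measure_pmf.expectation (augmented p n m) h"

lemma p0: "0 \<le> p" using p_pos by simp

lemmas aug_support = augmented_support[OF _ p0 p_le_1]

lemma EE_mono: "n \<ge> 2 \<Longrightarrow> (\<And>x. x \<in> set_pmf (augmented p n m) \<Longrightarrow> F x \<le> H x) \<Longrightarrow> EE n m F \<le> EE n m H"
  by (rule expectation_mono[OF finite_set_pmf_augmented])

lemma EE_add: "n \<ge> 2 \<Longrightarrow> EE n m (\<lambda>x. F x + H x) = EE n m F + EE n m H"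
  by (intro Bochner_Integration.integral_add integrable_finite_pmf finite_set_pmf_augmented)

lemma EE_diff: "n \<ge> 2 \<Longrightarrow> EE n m (\<lambda>x. F x - H x) = EE n m F - EE n m H"
  by (intro Bochner_Integration.integral_diff integrable_finite_pmf finite_set_pmf_augmented)

lemma EE_sum: "n \<ge> 2 \<Longrightarrow> EE n m (\<lambda>x. \<Sum>i\<in>I. F i x) = (\<Sum>i\<in>I. EE n m (F i))"
  by (intro Bochner_Integration.integral_sum integrable_finite_pmf finite_set_pmf_augmented)

lemma EE_step_le:
  assumes "n \<ge> 2"
    "\<And>x. x \<in> set_pmf (augmented p n m) \<Longrightarrow> measure_pmf.expectation (frozen_step p n (fst x))
      (\<lambda>G'. F (G', snd x + merge_rate p (fst x) / (real n)\<^sup>2)) \<le> H x"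
  shows "EE n (Suc m) F \<le> EE n m H"
  unfolding expectation_augmented_Suc[OF assms(1)] by (intro EE_mono assms)

text \<open>A potential argument. The sum of 1 - z^size over the trees is nonnegative and starts at
  n (1 - z). With T tree vertices and spread S, its drift is at most T^2 - (T - S)^2 - 2 T S = -
  S^2, divided by n (n - 1), up to the error of \<open>expectation_tree_sum_step\<close>. Hence the
  squares cannot add up to more than the initial value and the errors.\<close>

lemma spread_energy:
  assumes n: "n \<ge> 2" and z: "0 < z" "z < 1"
  shows "(\<Sum>m<M. EE n m (\<lambda>x. (spread z (fst x))\<^sup>2)) \<le>
    real n ^ 2 * (real n * (1 - z)) + 4 / (1 - z) * real n * real M"
proof -
  let ?\<psi> = "\<lambda>k. 1 - z ^ k" and ?c = "real n * (real n - 1)" and ?B = "1 / (1 - z)"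
  let ?L = "tree_sum ?\<psi>"
  have c: "?c > 0" using n by simp
  have step: "EE n (Suc m) (\<lambda>x. ?L (fst x)) \<le>
      EE n m (\<lambda>x. ?L (fst x) - (spread z (fst x))\<^sup>2 / ?c + 4 * ?B / (real n - 1))" for m
  proof (rule EE_step_le[OF n])
    fix x assume x: "x \<in> set_pmf (augmented p n m)"
    note s = aug_support[OF n x]
    have B1: "\<bar>?\<psi> k\<bar> \<le> ?B" for k
    proof -
      have "0 \<le> z ^ k" "z ^ k \<le> 1" using z by (auto intro: power_le_one)
      moreover have "1 \<le> ?B" using z by (simp add: field_simps)
      ultimately show ?thesis by linarith
    qed
    \<comment> \<open>The quantity is k z^k (1 - z^k) \<le> k z^k, which is below the geometric
      series.\<close>
    have B2: "real k * \<bar>?\<psi> (2 * k) - ?\<psi> k\<bar> \<le> ?B" for k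
    proof -
      have zk: "0 \<le> z ^ k" "z ^ k \<le> 1" using z by (auto intro: power_le_one)
      have "z ^ (2 * k) = z ^ k * z ^ k" by (metis mult_2 power_add)
      then have "?\<psi> (2 * k) - ?\<psi> k = z ^ k * (1 - z ^ k)"
        by (simp add: right_diff_distrib)
      then have "\<bar>?\<psi> (2 * k) - ?\<psi> k\<bar> \<le> z ^ k"
        using zk mult_left_mono[of "1 - z ^ k" 1 "z ^ k"] by (simp add: abs_mult)
      then have "real k * \<bar>?\<psi> (2 * k) - ?\<psi> k\<bar> \<le> real k * z ^ k" by (intro mult_left_mono) auto
      then show ?thesis using mult_power_le_geometric[OF z, of k] by linarith
    qed
    let ?T = "real (card (treev (fst x)))" and ?S = "spread z (fst x)"
    let ?I = "?T\<^sup>2 - (?T - ?S)\<^sup>2 - 2 * merge_rate p (fst x) * ?S"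
    have "?S \<ge> 0" unfolding spread_def using z by (intro sum_nonneg) (simp add: power_le_one)
    \<comment> \<open>Frozen partners only add to the losses.\<close>
    moreover have "merge_rate p (fst x) \<ge> ?T" using p0 by (simp add: merge_rate_def)
    ultimately have "merge_rate p (fst x) * ?S \<ge> ?T * ?S" by (intro mult_right_mono)
    then have "?I \<le> - ?S\<^sup>2" by (simp add: power2_eq_square algebra_simps)
    then have "?I / ?c \<le> - ?S\<^sup>2 / ?c" using c by (intro divide_right_mono) auto
    moreover have "\<bar>measure_pmf.expectation (frozen_step p n (fst x)) ?L - ?L (fst x) - ?I / ?c\<bar>
        \<le> 4 * ?B / (real n - 1)"
      using expectation_tree_sum_step[OF s(1,2) n p0 p_le_1 B1 B2]
      unfolding spread_pairs by (simp add: spread_def)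
    ultimately show "measure_pmf.expectation (frozen_step p n (fst x))
       (\<lambda>G'. ?L (fst (G', snd x + merge_rate p (fst x) / (real n)\<^sup>2))) \<le>
       ?L (fst x) - ?S\<^sup>2 / ?c + 4 * ?B / (real n - 1)"
      by simp
  qed
  have tele: "EE n M (\<lambda>x. ?L (fst x)) + (\<Sum>m<M. EE n m (\<lambda>x. (spread z (fst x))\<^sup>2)) / ?c \<le>
      real n * (1 - z) + real M * (4 * ?B / (real n - 1))"
  proof (induction M)
    case 0
    have "?L (Multigraph {1..n} {#}) = real n * (1 - z)"
    proof -
      have "?L (Multigraph {1..n} {#}) = (\<Sum>v\<in>{1..n}. 1 - z)"
        unfolding tree_sum_def treev_empty_graph
        by (intro sum.cong refl) (simp only: csize_empty_graph power_one_right of_nat_1 div_by_1)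
      then show ?thesis by simp
    qed
    then show ?case by simp
  next
    case (Suc M)
    have "EE n M (\<lambda>x. ?L (fst x) - (spread z (fst x))\<^sup>2 / ?c + 4 * ?B / (real n - 1)) =
      EE n M (\<lambda>x. ?L (fst x)) - EE n M (\<lambda>x. (spread z (fst x))\<^sup>2) / ?c + 4 * ?B / (real n - 1)"
      by (simp add: EE_add[OF n] EE_diff[OF n])
    then show ?case using Suc step[of M] by (simp add: add_divide_distrib algebra_simps)
  qed
  have "EE n M (\<lambda>x. ?L (fst x)) \<ge> 0"
  proof (rule expectation_nonneg)
    show "0 \<le> ?L (fst x)" for x :: "nat multigraph \<times> real"
      unfolding tree_sum_def using z by (intro sum_nonneg divide_nonneg_nonneg) (auto simp: power_le_one)
  qed
  then have "(\<Sum>m<M. EE n m (\<lambda>x. (spread z (fst x))\<^sup>2)) / ?c \<le>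
      real n * (1 - z) + real M * (4 * ?B / (real n - 1))" using tele by linarith
  then have "(\<Sum>m<M. EE n m (\<lambda>x. (spread z (fst x))\<^sup>2)) \<le>
      (real n * (1 - z) + real M * (4 * ?B / (real n - 1))) * ?c"
    using c by (simp add: pos_divide_le_eq)
  also have "\<dots> = real n * (real n - 1) * (real n * (1 - z)) + real M * (4 * ?B) * real n"
  proof -
    have "(X + real M * (Y / w)) * (real n * w) = real n * w * X + real M * Y * real n"
      if "w \<noteq> 0" for X Y w :: real
      using that by (simp add: field_simps)
    moreover have "real n - 1 \<noteq> 0" using n by simp
    ultimately show ?thesis by blast
  qed
  also have "\<dots> \<le> real n ^ 2 * (real n * (1 - z)) + real M * (4 * ?B) * real n"
    using n z by (intro add_right_mono mult_right_mono) (auto simp: power2_eq_square)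
  finally show ?thesis by (simp add: mult_ac)
qed

end

text \<open>A second-order Taylor estimate for powers. The range \<open>d \<le> 2\<close> is that of
  2 h with h \<le> 1.\<close>

lemma power_increment_bound:
  fixes S :: real
  assumes "0 \<le> S"
  shows "\<exists>C\<ge>0. \<forall>s d. 0 \<le> s \<longrightarrow> s \<le> S \<longrightarrow> 0 \<le> d \<longrightarrow> d \<le> 2 \<longrightarrow>
    \<bar>(s + d) ^ j - s ^ j - real j * d * s ^ (j - 1)\<bar> \<le> C * d\<^sup>2"
proof (induction j)
  case 0
  show ?case by (intro exI[of _ 0]) simp
next
  case (Suc j)
  then obtain C where C: "C \<ge> 0" "\<And>s d. 0 \<le> s \<Longrightarrow> s \<le> S \<Longrightarrow> 0 \<le> d \<Longrightarrow> d \<le> 2 \<Longrightarrow>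
    \<bar>(s + d) ^ j - s ^ j - real j * d * s ^ (j - 1)\<bar> \<le> C * d\<^sup>2" by blast
  show ?case
  proof (intro exI conjI allI impI)
    show "0 \<le> (S + 2) * C + real j * S ^ (j - 1)" using C assms by simp
    fix s d :: real assume sd: "0 \<le> s" "s \<le> S" "0 \<le> d" "d \<le> 2"
    let ?R = "(s + d) ^ j - s ^ j - real j * d * s ^ (j - 1)"
    have "(s + d) ^ Suc j - s ^ Suc j - real (Suc j) * d * s ^ (Suc j - 1) =
        (s + d) * ?R + real j * d\<^sup>2 * s ^ (j - 1)"
      by (cases j) (simp_all add: algebra_simps power2_eq_square)
    also have "\<bar>\<dots>\<bar> \<le> (s + d) * \<bar>?R\<bar> + real j * d\<^sup>2 * s ^ (j - 1)"
      using sd by (intro order_trans[OF abs_triangle_ineq]) (simp add: abs_mult)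
    also have "\<dots> \<le> (S + 2) * (C * d\<^sup>2) + real j * d\<^sup>2 * S ^ (j - 1)"
      using sd C(2)[OF sd] by (intro add_mono mult_mono power_mono mult_nonneg_nonneg) auto
    finally show "\<bar>(s + d) ^ Suc j - s ^ Suc j - real (Suc j) * d * s ^ (Suc j - 1)\<bar>
        \<le> ((S + 2) * C + real j * S ^ (j - 1)) * d\<^sup>2" by (simp add: algebra_simps)
  qed
qed

context frozen_parameter
begin

text \<open>Taking z close to 1 makes the bound of \<open>spread_energy\<close> small; then K with
  z^K \<le> 1 / 2 makes every vertex counted here contribute at least 1 / 2 to the spread.\<close>

lemma expectation_large_trees:
  assumes "\<epsilon> > 0" "0 \<le> T0"
  obtains K where "K \<ge> 1" "\<forall>\<^sub>F n in sequentially. \<forall>M. real M \<le> T0 * real n \<longrightarrow>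
    (\<Sum>m<M. EE n m (\<lambda>x. real (card {u \<in> treev (fst x). K < csize (fst x) u}))) \<le> \<epsilon> * (real n)\<^sup>2"
proof -
  \<comment> \<open>The final bound has three terms of at most \<epsilon> / 4, controlled in turn by
    \<eta>, by z and by n.\<close>
  define \<eta> where "\<eta> = \<epsilon> / (8 * (T0 + 1))"
  have \<eta>: "\<eta> > 0" "T0 * \<eta> \<le> \<epsilon> / 8" using assms by (auto simp: \<eta>_def field_simps)
  obtain z :: real where z: "0 < z" "z < 1" "(1 - z) / (4 * \<eta>) \<le> \<epsilon> / 8"
  proof -
    define z where "z = max (1/2) (1 - \<epsilon> * \<eta> / 2)"
    have "1 - \<epsilon> * \<eta> / 2 \<le> z" unfolding z_def by (rule max.cobounded2)
    then have z: "1 - z \<le> \<epsilon> * \<eta> / 2" by linarith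
    have z01: "0 < z" "z < 1" using \<eta> assms by (auto simp: z_def)
    have "(1 - z) / (4 * \<eta>) \<le> (\<epsilon> * \<eta> / 2) / (4 * \<eta>)"
      by (rule divide_right_mono[OF z]) (use \<eta> in simp)
    also have "\<dots> = \<epsilon> / 8" using \<eta> by simp
    finally show ?thesis using that z01 by blast
  qed
  obtain K where K: "z ^ K \<le> 1 / 2" "K \<ge> 1"
  proof -
    obtain K where "z ^ K < 1 / 2" using real_arch_pow_inv[of "1/2" z] z by auto
    then show ?thesis using that[of K] by (cases K) auto
  qed
  define B where "B = 4 / (1 - z)"
  have B: "B \<ge> 0" using z by (simp add: B_def)
  show ?thesis
  proof (rule that[OF K(2)])
    have "\<forall>\<^sub>F n in sequentially. B * T0 / (4 * \<eta>) / real n \<le> \<epsilon> / 8"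
    proof -
      have "(\<lambda>n. B * T0 / (4 * \<eta>) / real n) \<longlonglongrightarrow> 0"
        by (intro real_tendsto_divide_at_top[OF tendsto_const] filterlim_real_sequentially)
      then show ?thesis using assms by (intro order_tendstoD(2)[THEN eventually_mono, of _ 0 _ "\<epsilon> / 8"]) auto
    qed
    then show "\<forall>\<^sub>F n in sequentially. \<forall>M. real M \<le> T0 * real n \<longrightarrow>
      (\<Sum>m<M. EE n m (\<lambda>x. real (card {u \<in> treev (fst x). K < csize (fst x) u}))) \<le> \<epsilon> * (real n)\<^sup>2"
      using eventually_ge_at_top[of 2]
    proof eventually_elim
      case (elim n)
      then have n: "n \<ge> 2" and small: "B * T0 / (4 * \<eta>) / real n \<le> \<epsilon> / 8" by auto
      show ?case
      proof (intro allI impI)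
        fix M assume M: "real M \<le> T0 * real n"
        have "EE n m (\<lambda>x. real (card {u \<in> treev (fst x). K < csize (fst x) u})) \<le>
            EE n m (\<lambda>x. 2 * (real n * \<eta>) + (spread z (fst x))\<^sup>2 * (2 / (4 * \<eta> * real n)))" for m
        proof (rule EE_mono[OF n])
          fix x assume "x \<in> set_pmf (augmented p n m)"
          note s = aug_support[OF n this]
          let ?V = "{u \<in> treev (fst x). K < csize (fst x) u}" and ?S = "spread z (fst x)"
          have wf: "wf_graph (fst x)" using s valid_graph_wf by blast
          have "real (card ?V) * (1 / 2) = (\<Sum>u\<in>?V. 1 / 2)" by simp
          also have "\<dots> \<le> (\<Sum>u\<in>?V. 1 - z ^ csize (fst x) u)"
          proof (rule sum_mono)
            fix u assume "u \<in> ?V"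
            then have "z ^ csize (fst x) u \<le> z ^ K" using z by (intro power_decreasing) auto
            then show "1 / 2 \<le> 1 - z ^ csize (fst x) u" using K by simp
          qed
          also have "\<dots> \<le> ?S" unfolding spread_def
            using wf z by (intro sum_mono2) (auto simp: power_le_one)
          finally have 1: "real (card ?V) \<le> 2 * ?S" by simp
          have pos: "real n * \<eta> > 0" using n \<eta> by simp
          \<comment> \<open>Mean squares are controlled but means are wanted. The inequality is used
            with c = n \<eta>.\<close>
          have "?S \<le> c + ?S\<^sup>2 / (4 * c)" if "c > 0" for c
          proof -
            have "0 \<le> (?S - 2 * c)\<^sup>2 / (4 * c)" using that by simp
            also have "\<dots> = ?S\<^sup>2 / (4 * c) - ?S + c"
              using that by (simp add: power2_diff field_simps power2_eq_square)
            finally show ?thesis by simp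
          qed
          from this[OF pos] show "real (card ?V) \<le> 2 * (real n * \<eta>) + ?S\<^sup>2 * (2 / (4 * \<eta> * real n))"
            using 1 by (simp add: mult_ac)
        qed
        then have "(\<Sum>m<M. EE n m (\<lambda>x. real (card {u \<in> treev (fst x). K < csize (fst x) u}))) \<le>
          (\<Sum>m<M. EE n m (\<lambda>x. 2 * (real n * \<eta>) + (spread z (fst x))\<^sup>2 * (2 / (4 * \<eta> * real n))))"
          by (rule sum_mono)
        also have "\<dots> = real M * (2 * (real n * \<eta>)) +
            (\<Sum>m<M. EE n m (\<lambda>x. (spread z (fst x))\<^sup>2)) * (2 / (4 * \<eta> * real n))"
          by (simp add: EE_add[OF n] sum.distrib sum_distrib_right del: times_divide_eq_right)
        also have "\<dots> \<le> (T0 * real n) * (2 * (real n * \<eta>)) +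
            (real n ^ 2 * (real n * (1 - z)) + B * real n * (T0 * real n)) * (2 / (4 * \<eta> * real n))"
        proof -
          have "(\<Sum>m<M. EE n m (\<lambda>x. (spread z (fst x))\<^sup>2)) \<le>
              real n ^ 2 * (real n * (1 - z)) + B * real n * real M"
            using spread_energy[OF n z(1,2), of M] by (simp add: B_def)
          also have "\<dots> \<le> real n ^ 2 * (real n * (1 - z)) + B * real n * (T0 * real n)"
            using M B by (intro add_left_mono mult_left_mono) auto
          finally show ?thesis using M \<eta> by (intro add_mono mult_right_mono) auto
        qed
        also have "\<dots> = (real n)\<^sup>2 * (2 * (T0 * \<eta>) + 2 * ((1 - z) / (4 * \<eta>)) + 2 * (B * T0 / (4 * \<eta>) / real n))"
          using n \<eta> by (simp add: field_simps power2_eq_square)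
        also have "\<dots> \<le> (real n)\<^sup>2 * \<epsilon>"
        proof (rule mult_left_mono)
          show "2 * (T0 * \<eta>) + 2 * ((1 - z) / (4 * \<eta>)) + 2 * (B * T0 / (4 * \<eta>) / real n) \<le> \<epsilon>"
            using \<eta>(2) z(3) small assms(1) by linarith
        qed simp
        finally show "(\<Sum>m<M. EE n m (\<lambda>x. real (card {u \<in> treev (fst x). K < csize (fst x) u}))) \<le> \<epsilon> * (real n)\<^sup>2"
          by (simp add: mult.commute)
      qed
    qed
  qed
qed

text \<open>In each product \<open>xi i t * xi (k - i) t\<close> the powers of 2 t multiply to the
  same (2 t)^(k-2), so \<open>alpha_convolution\<close> evaluates the sum. What remains is the
  Taylor estimate for one power.\<close>

lemma xi_increment_bound:
  assumes k: "1 \<le> k" and T0: "0 \<le> T0"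
  obtains C where "C \<ge> 0" "\<And>t h. 0 \<le> t \<Longrightarrow> t \<le> T0 \<Longrightarrow> 0 \<le> h \<Longrightarrow> h \<le> 1 \<Longrightarrow>
      \<bar>xi k (t + h) - xi k t - h * real k * (\<Sum>i\<in>{1..<k}. xi i t * xi (k - i) t)\<bar> \<le> C * h\<^sup>2 \<and>
      \<bar>xi k (t + h) - xi k t\<bar> \<le> C * h"
proof -
  obtain C where C: "C \<ge> 0" "\<And>s d. 0 \<le> s \<Longrightarrow> s \<le> 2 * T0 \<Longrightarrow> 0 \<le> d \<Longrightarrow> d \<le> 2 \<Longrightarrow>
    \<bar>(s + d) ^ (k - 1) - s ^ (k - 1) - real (k - 1) * d * s ^ (k - 1 - 1)\<bar> \<le> C * d\<^sup>2"
    using power_increment_bound[of "2 * T0" "k - 1"] T0 by auto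
  have conv: "real k * (\<Sum>i\<in>{1..<k}. xi i t * xi (k - i) t) =
      alpha k * (real (k - 1) * 2 * (2 * t) ^ (k - 1 - 1))" for t
  proof -
    have "xi i t * xi (k - i) t = alpha i * alpha (k - i) * (2 * t) ^ (k - 2)" if "i \<in> {1..<k}" for i
    proof -
      have "(i - 1) + (k - i - 1) = k - 2" using that by auto
      then show ?thesis unfolding xi_def by (metis (no_types, lifting) mult.assoc mult.left_commute power_add)
    qed
    then have "(\<Sum>i\<in>{1..<k}. xi i t * xi (k - i) t) =
        (\<Sum>i\<in>{1..<k}. alpha i * alpha (k - i)) * (2 * t) ^ (k - 2)"
      unfolding sum_distrib_right by (rule sum.cong[OF refl])
    then have "real k * (\<Sum>i\<in>{1..<k}. xi i t * xi (k - i) t) =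
        real k * (\<Sum>i\<in>{1..<k}. alpha i * alpha (k - i)) * (2 * t) ^ (k - 2)"
      by (simp only: mult.assoc)
    also have "\<dots> = 2 * (real k - 1) * alpha k * (2 * t) ^ (k - 2)"
      unfolding alpha_convolution[OF k] ..
    also have "\<dots> = alpha k * (real (k - 1) * 2 * (2 * t) ^ (k - 1 - 1))"
      using k by (simp add: of_nat_diff numeral_2_eq_2)
    finally show ?thesis .
  qed
  let ?C1 = "alpha k * C * 4" and ?C2 = "alpha k * (real (k - 1) * 2 * (2 * T0) ^ (k - 1 - 1))"
  have nn: "?C1 \<ge> 0" "?C2 \<ge> 0" using C alpha_nonneg T0 by auto
  show ?thesis
  proof (rule that[of "?C1 + ?C2"], use nn in simp, intro conjI)
    fix t h :: real assume t: "0 \<le> t" "t \<le> T0" "0 \<le> h" "h \<le> 1"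
    let ?R = "(2 * t + 2 * h) ^ (k - 1) - (2 * t) ^ (k - 1) - real (k - 1) * (2 * h) * (2 * t) ^ (k - 1 - 1)"
    let ?J = "h * real k * (\<Sum>i\<in>{1..<k}. xi i t * xi (k - i) t)"
    have J: "?J = h * (alpha k * (real (k - 1) * 2 * (2 * t) ^ (k - 1 - 1)))"
      using conv[of t] by (simp add: mult.assoc)
    have R: "xi k (t + h) - xi k t - ?J = alpha k * ?R"
      unfolding J by (simp add: xi_def algebra_simps)
    have "\<bar>?R\<bar> \<le> C * (2 * h)\<^sup>2" using t by (intro C(2)) auto
    then have "\<bar>alpha k * ?R\<bar> \<le> alpha k * (C * (2 * h)\<^sup>2)"
      using alpha_nonneg by (simp add: abs_mult mult_left_mono)
    then have 1: "\<bar>xi k (t + h) - xi k t - ?J\<bar> \<le> ?C1 * h\<^sup>2"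
      unfolding R by (simp add: power_mult_distrib mult_ac)
    then show "\<bar>xi k (t + h) - xi k t - ?J\<bar> \<le> (?C1 + ?C2) * h\<^sup>2"
    proof -
      have "0 \<le> ?C2 * h\<^sup>2" by (rule mult_nonneg_nonneg[OF nn(2)]) simp
      then show ?thesis using 1 unfolding distrib_right by linarith
    qed
    have "?C1 * h\<^sup>2 \<le> ?C1 * h" using t nn(1) by (intro mult_left_mono) (auto simp: power2_eq_square mult_left_le)
    moreover have "\<bar>?J\<bar> \<le> ?C2 * h"
    proof -
      have "(2 * t) ^ (k - 1 - 1) \<le> (2 * T0) ^ (k - 1 - 1)" using t by (intro power_mono) auto
      then have "alpha k * (real (k - 1) * 2 * (2 * t) ^ (k - 1 - 1)) \<le> ?C2"
        using alpha_nonneg by (intro mult_left_mono) auto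
      then have "h * (alpha k * (real (k - 1) * 2 * (2 * t) ^ (k - 1 - 1))) \<le> h * ?C2"
        by (rule mult_left_mono[OF _ t(3)])
      moreover have "0 \<le> h * (alpha k * (real (k - 1) * 2 * (2 * t) ^ (k - 1 - 1)))"
        using t alpha_nonneg by simp
      ultimately show ?thesis unfolding J by (simp add: mult.commute)
    qed
    ultimately show "\<bar>xi k (t + h) - xi k t\<bar> \<le> (?C1 + ?C2) * h"
      using 1 unfolding distrib_right by linarith
  qed
qed

section \<open>Drift of the rescaled tree counts\<close>

definition yfrac :: "nat \<Rightarrow> nat \<Rightarrow> nat multigraph \<Rightarrow> real" where
  "yfrac n k G = tree_count k G / real n"

text \<open>The exponential factor compensates the rate at which trees of size \<open>k\<close> disappear.\<close>

definition xval :: "nat \<Rightarrow> nat \<Rightarrow> nat multigraph \<times> real \<Rightarrow> real" where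
  "xval n k x = exp (2 * real k * snd x) * yfrac n k (fst x)"

lemma yfrac_range:
  assumes "wf_graph G" "verts G = {1..n}" "n \<ge> 1"
  shows "0 \<le> yfrac n k G" "yfrac n k G \<le> 1"
  using tree_count_le[OF assms(1,2), of k] tree_count_nonneg[of k G] assms(3)
  by (auto simp: yfrac_def)

lemma sum_yfrac_products:
  assumes "wf_graph G" "verts G = {1..n}" "n \<ge> 1"
  shows "0 \<le> (\<Sum>i\<in>{1..<k}. yfrac n i G * yfrac n (k - i) G)"
    "(\<Sum>i\<in>{1..<k}. yfrac n i G * yfrac n (k - i) G) \<le> 1"
proof -
  note y = yfrac_range[OF assms]
  show "0 \<le> (\<Sum>i\<in>{1..<k}. yfrac n i G * yfrac n (k - i) G)" using y by (intro sum_nonneg) simp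
  have "(\<Sum>i\<in>{1..<k}. yfrac n i G * yfrac n (k - i) G) \<le> (\<Sum>i\<in>{1..k}. yfrac n i G)"
    using y by (intro order_trans[OF sum_mono[of _ _ "\<lambda>i. yfrac n i G"] sum_mono2]) (auto simp: mult_left_le)
  also have "\<dots> = (\<Sum>i\<in>{1..k}. tree_count i G) / real n"
    by (simp add: yfrac_def sum_divide_distrib)
  also have "\<dots> \<le> 1" using sum_tree_count_le[OF assms(1,2), of k] assms(3) by simp
  finally show "(\<Sum>i\<in>{1..<k}. yfrac n i G * yfrac n (k - i) G) \<le> 1" .
qed

text \<open>Uses \<open>expectation_tree_sum_step\<close> for the function that is k at k and 0
  elsewhere. The constant 14 is 2 (4 + 3): 4 from that lemma, 3 from replacing n - 1 by n under the
  drift, and 2 from n^2 \<le> 2 n (n - 1).\<close>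

lemma yfrac_step:
  assumes G: "valid_graph G" "verts G = {1..n}" and n: "n \<ge> 2" and k: "1 \<le> k"
  defines "r \<equiv> merge_rate p G / real n" and "y \<equiv> \<lambda>i. yfrac n i G"
  defines "J \<equiv> real k * (\<Sum>i\<in>{1..<k}. y i * y (k - i)) - 2 * r * real k * y k"
  shows "\<bar>measure_pmf.expectation (frozen_step p n G) (yfrac n k) - y k - J / real n\<bar>
      \<le> 14 * (real k)\<^sup>2 / (real n)\<^sup>2"
    and "\<bar>J\<bar> \<le> 3 * real k"
    and "G' \<in> set_pmf (frozen_step p n G) \<Longrightarrow> \<bar>yfrac n k G' - y k\<bar> \<le> 3 * (real k)\<^sup>2 / real n"
proof -
  have wf: "wf_graph G" using G valid_graph_wf by blast
  have n1: "n \<ge> 1" using n by simp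
  let ?\<psi> = "\<lambda>j. if j = k then real k else 0" and ?B = "(real k)\<^sup>2"
  have kk: "real k \<le> ?B" using k by (simp add: power2_eq_square)
  then have B1: "\<bar>?\<psi> j\<bar> \<le> ?B" for j by simp
  \<comment> \<open>The difference vanishes unless j = k or 2 j = k, so only j \<le> k
    matters.\<close>
  have B2: "real j * \<bar>?\<psi> (2 * j) - ?\<psi> j\<bar> \<le> ?B" for j
  proof -
    have "j \<le> k \<Longrightarrow> real j * real k \<le> ?B" by (simp add: power2_eq_square mult_right_mono)
    then show ?thesis by (auto split: if_splits)
  qed
  have Ty: "tree_count i G = real n * y i" for i using n by (simp add: y_def yfrac_def)
  have r: "0 \<le> r" "r \<le> 1" using merge_rate_bounds[OF G(2) p0 p_le_1] n by (auto simp: r_def)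
  have mr: "merge_rate p G = real n * r" using n by (simp add: r_def)
  have S: "0 \<le> (\<Sum>i\<in>{1..<k}. y i * y (k - i))" "(\<Sum>i\<in>{1..<k}. y i * y (k - i)) \<le> 1"
    unfolding y_def using sum_yfrac_products[OF wf G(2) n1] by auto
  have y: "0 \<le> y k" "y k \<le> 1" unfolding y_def using yfrac_range[OF wf G(2) n1] by auto
  have "0 \<le> real k * (\<Sum>i\<in>{1..<k}. y i * y (k - i))"
    by (rule mult_nonneg_nonneg[OF _ S(1)]) simp
  moreover have "real k * (\<Sum>i\<in>{1..<k}. y i * y (k - i)) \<le> real k * 1"
    by (rule mult_left_mono[OF S(2)]) simp
  moreover have "0 \<le> real k * (r * y k)" using r y by simp
  moreover have "real k * (r * y k) \<le> real k * (1 * 1)"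
    by (intro mult_left_mono mult_mono) (use r y in auto)
  ultimately show J: "\<bar>J\<bar> \<le> 3 * real k" unfolding J_def by (simp add: mult_ac)
  have I: "(\<Sum>u\<in>treev G. \<Sum>v\<in>treev G. ?\<psi> (csize G u + csize G v))
        - 2 * merge_rate p G * (\<Sum>u\<in>treev G. ?\<psi> (csize G u)) = (real n)\<^sup>2 * J"
  proof -
    have "(\<Sum>u\<in>treev G. ?\<psi> (csize G u)) = real k * tree_count k G"
      unfolding tree_count_eq_sum[OF wf] sum_distrib_left by (intro sum.cong) auto
    then show ?thesis unfolding merge_pairs_count[OF wf] mr Ty J_def
      by (simp add: sum_distrib_left algebra_simps power2_eq_square)
  qed
  define E where "E = measure_pmf.expectation (frozen_step p n G) (yfrac n k)"
  have supp: "valid_graph H" if "H \<in> set_pmf (frozen_step p n G)" for H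
    using frozen_step_support(1)[OF G n that] .
  have "measure_pmf.expectation (frozen_step p n G) (tree_sum ?\<psi>) = real n * E"
  proof -
    have "measure_pmf.expectation (frozen_step p n G) (tree_sum ?\<psi>) =
        measure_pmf.expectation (frozen_step p n G) (\<lambda>H. real n * yfrac n k H)"
      using n by (intro integral_cong_AE)
        (auto simp: AE_measure_pmf_iff yfrac_def intro!: tree_sum_indicator[OF valid_graph_wf[OF supp] k])
    then show ?thesis by (simp add: E_def)
  qed
  moreover have "tree_sum ?\<psi> G = real n * y k" using tree_sum_indicator[OF wf k] Ty by simp
  ultimately have "\<bar>real n * E - real n * y k - (real n)\<^sup>2 * J / (real n * (real n - 1))\<bar> \<le> 4 * ?B / (real n - 1)"
    using expectation_tree_sum_step[OF G n p0 p_le_1 B1 B2] unfolding I by simp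
  moreover have "real n * E - real n * y k - (real n)\<^sup>2 * J / (real n * (real n - 1)) =
      real n * (E - y k - J / (real n - 1))"
    using n by (simp add: field_simps power2_eq_square)
  ultimately have "real n * \<bar>E - y k - J / (real n - 1)\<bar> \<le> 4 * ?B / (real n - 1)"
    by (simp add: abs_mult)
  then have 1: "\<bar>E - y k - J / (real n - 1)\<bar> \<le> 4 * ?B / (real n * (real n - 1))"
    using n by (simp add: field_simps)
  have "J / (real n - 1) - J / real n = J / (real n * (real n - 1))"
    using n by (simp add: field_simps)
  then have "\<bar>J / (real n - 1) - J / real n\<bar> = \<bar>J\<bar> / (real n * (real n - 1))"
    using n by (simp add: abs_mult)
  also have "\<dots> \<le> 3 * ?B / (real n * (real n - 1))" proof (rule divide_right_mono)
    show "\<bar>J\<bar> \<le> 3 * ?B" using J kk by linarith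
  qed (use n in simp)
  finally have "\<bar>E - y k - J / real n\<bar> \<le> 4 * ?B / (real n * (real n - 1)) + 3 * ?B / (real n * (real n - 1))"
    using 1 by linarith
  also have "\<dots> = 7 * ?B / (real n * (real n - 1))" by (simp add: add_divide_distrib[symmetric])
  also have "\<dots> \<le> 7 * ?B / ((real n)\<^sup>2 / 2)"
  proof (rule divide_left_mono)
    have "2 * real n \<le> real n * real n" using n by (intro mult_right_mono) auto
    then show "(real n)\<^sup>2 / 2 \<le> real n * (real n - 1)"
      by (simp add: power2_eq_square algebra_simps)
  qed (use n in auto)
  finally show "\<bar>measure_pmf.expectation (frozen_step p n G) (yfrac n k) - y k - J / real n\<bar>
      \<le> 14 * (real k)\<^sup>2 / (real n)\<^sup>2" by (simp add: E_def)
  show "\<bar>yfrac n k G' - y k\<bar> \<le> 3 * (real k)\<^sup>2 / real n" if "G' \<in> set_pmf (frozen_step p n G)"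
  proof -
    have "\<bar>tree_sum ?\<psi> G' - tree_sum ?\<psi> G\<bar> \<le> 3 * ?B"
      using frozen_step_support(4)[OF G n that, of ?\<psi> ?B] B1 by blast
    then have "\<bar>tree_count k G' - tree_count k G\<bar> \<le> 3 * ?B"
      using tree_sum_indicator k wf valid_graph_wf[OF supp[OF that]] by metis
    then have "\<bar>tree_count k G' - tree_count k G\<bar> / real n \<le> 3 * ?B / real n"
      by (intro divide_right_mono) auto
    moreover have "\<bar>yfrac n k G' - y k\<bar> = \<bar>tree_count k G' - tree_count k G\<bar> / real n"
      using n by (simp add: yfrac_def y_def diff_divide_distrib[symmetric])
    ultimately show ?thesis by simp
  qed
qed


lemma exp_quadratic_bound:
  fixes q :: real
  assumes "0 \<le> q" "q \<le> 1"
  shows "\<bar>exp q - 1 - q\<bar> \<le> q\<^sup>2" "exp q - 1 \<le> 2 * q"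
proof -
  have "exp q \<le> 1 + q + q\<^sup>2" using assms by (intro exp_bound) auto
  moreover have "1 + q \<le> exp q" by (rule exp_ge_add_one_self)
  ultimately show "\<bar>exp q - 1 - q\<bar> \<le> q\<^sup>2" by linarith
  have "q\<^sup>2 \<le> q" using assms by (simp add: power2_eq_square mult_left_le)
  then show "exp q - 1 \<le> 2 * q" using \<open>exp q \<le> 1 + q + q\<^sup>2\<close> by linarith
qed

text \<open>With rate r and step h = 1 / n, the factor exp (2 k a) grows by q = 2 k r h to first
  order. This cancels the loss term of \<open>yfrac_step\<close> and leaves only the creation by
  smaller trees. The condition n \<ge> 2 k gives q \<le> 1.\<close>

lemma xval_step:
  assumes x: "x \<in> set_pmf (augmented p n m)" and n: "n \<ge> 2" "n \<ge> 2 * k" and k: "1 \<le> k"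
    and T0: "real m \<le> T0 * real n"
  defines "a' \<equiv> snd x + merge_rate p (fst x) / (real n)\<^sup>2"
  shows "\<bar>measure_pmf.expectation (frozen_step p n (fst x)) (\<lambda>G'. xval n k (G', a')) - xval n k x
      - 1 / real n * real k * (\<Sum>i\<in>{1..<k}. xval n i x * xval n (k - i) x)\<bar>
      \<le> exp (2 * real k * T0) * 38 * (real k)\<^sup>2 * (1 / real n)\<^sup>2" (is ?thesis1)
    and "G' \<in> set_pmf (frozen_step p n (fst x)) \<Longrightarrow>
      \<bar>xval n k (G', a') - xval n k x\<bar> \<le> exp (2 * real k * T0) * 7 * (real k)\<^sup>2 * (1 / real n)"
proof -
  note s = aug_support[OF n(1) x]
  have wf: "wf_graph (fst x)" using s valid_graph_wf by blast
  have n1: "n \<ge> 1" using n by simp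
  define h where "h = 1 / real n"
  define r where "r = merge_rate p (fst x) / real n"
  define y where "y i = yfrac n i (fst x)" for i
  define S where "S = (\<Sum>i\<in>{1..<k}. y i * y (k - i))"
  define J where "J = real k * S - 2 * r * real k * y k"
  define E where "E = measure_pmf.expectation (frozen_step p n (fst x)) (yfrac n k)"
  define q where "q = 2 * real k * (r * h)"
  define ea where "ea = exp (2 * real k * snd x)"
  have h: "0 < h" using n by (simp add: h_def)
  have r: "0 \<le> r" "r \<le> 1" using merge_rate_bounds[OF s(2) p0 p_le_1] n by (auto simp: r_def)
  have a': "a' = snd x + r * h" by (simp add: a'_def r_def h_def power2_eq_square)
  have y: "0 \<le> y k" "y k \<le> 1" unfolding y_def using yfrac_range[OF wf s(2) n1] by auto
  have step: "\<bar>E - y k - J * h\<bar> \<le> 14 * (real k)\<^sup>2 * h\<^sup>2" "\<bar>J\<bar> \<le> 3 * real k"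
    using yfrac_step(1,2)[OF s(1,2) n(1) k] unfolding E_def J_def S_def y_def r_def h_def
    by (simp_all add: power_divide)
  have kh: "2 * real k * h \<le> 1" using n by (simp add: h_def field_simps)
  have rh: "r * h \<le> h" using r h by simp
  have q: "0 \<le> q" "q \<le> 2 * real k * h"
    using r h rh unfolding q_def by (auto intro!: mult_left_mono)
  then have q1: "q \<le> 1" using kh by linarith
  note eq = exp_quadratic_bound[OF q(1) q1]
  have ea: "0 < ea" "ea \<le> exp (2 * real k * T0)"
  proof -
    have "real m / real n \<le> T0" using T0 n by (simp add: field_simps)
    then have "snd x \<le> T0" using s(4) by linarith
    then show "0 < ea" "ea \<le> exp (2 * real k * T0)" unfolding ea_def by (auto intro!: mult_left_mono)
  qed
  have xval': "xval n k (G', a') = ea * exp q * yfrac n k G'" for G'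
    by (simp add: xval_def a' ea_def q_def exp_add[symmetric] algebra_simps)
  have E01: "0 \<le> E" "E \<le> 1"
  proof -
    have ys: "0 \<le> yfrac n k H \<and> yfrac n k H \<le> 1" if "H \<in> set_pmf (frozen_step p n (fst x))" for H
      using frozen_step_support(1,2)[OF s(1,2) n(1) that] valid_graph_wf yfrac_range[of H n k] n1 by blast
    show "0 \<le> E" unfolding E_def by (rule expectation_nonneg) (use ys in auto)
    show "E \<le> 1" unfolding E_def
      by (rule expectation_le_const[OF finite_set_pmf_frozen_step[OF n(1)]]) (use ys in auto)
  qed
  \<comment> \<open>The exponents for i and k - i add up to the one for k: this is why the weights
    are compatible with mergers.\<close>
  have sumx: "(\<Sum>i\<in>{1..<k}. xval n i x * xval n (k - i) x) = ea * S"
  proof -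
    have "xval n i x * xval n (k - i) x = ea * (y i * y (k - i))" if "i \<in> {1..<k}" for i
    proof -
      have "exp (2 * real i * snd x) * exp (2 * real (k - i) * snd x) = ea"
        using that unfolding ea_def exp_add[symmetric] by (simp add: of_nat_diff algebra_simps)
      moreover have "xval n i x * xval n (k - i) x =
          (exp (2 * real i * snd x) * exp (2 * real (k - i) * snd x)) * (y i * y (k - i))"
        by (simp only: xval_def y_def mult_ac)
      ultimately show ?thesis by simp
    qed
    then show ?thesis unfolding S_def sum_distrib_left by (rule sum.cong[OF refl])
  qed
  \<comment> \<open>Since J h = h k S - q y_k, the terms of first order cancel, and all three
    summands are of second order in h.\<close>
  have R: "exp q * E - y k - h * real k * S =
      (exp q - 1 - q) * E + (1 + q) * (E - y k - J * h) + q * (J * h)"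
    by (simp add: J_def q_def algebra_simps)
  have "\<bar>exp q * E - y k - h * real k * S\<bar> \<le> q\<^sup>2 * 1 + 2 * (14 * (real k)\<^sup>2 * h\<^sup>2) + q * (3 * real k * h)"
  proof -
    have "\<bar>(exp q - 1 - q) * E\<bar> \<le> q\<^sup>2 * 1"
      unfolding abs_mult using eq E01 by (intro mult_mono) auto
    moreover have "\<bar>(1 + q) * (E - y k - J * h)\<bar> \<le> 2 * (14 * (real k)\<^sup>2 * h\<^sup>2)"
      unfolding abs_mult using step q q1 by (intro mult_mono) auto
    moreover have "\<bar>q * (J * h)\<bar> \<le> q * (3 * real k * h)"
      unfolding abs_mult using step q h by (intro mult_mono mult_right_mono) auto
    ultimately show ?thesis unfolding R by linarith
  qed
  \<comment> \<open>The three bounds give 4 + 28 + 6 = 38.\<close>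
  also have "\<dots> \<le> 38 * (real k)\<^sup>2 * h\<^sup>2"
  proof -
    have "q\<^sup>2 \<le> (2 * real k * h)\<^sup>2" using q by (intro power_mono)
    moreover have "q * (3 * real k * h) \<le> (2 * real k * h) * (3 * real k * h)"
      using q h by (intro mult_right_mono) auto
    moreover have "(2 * real k * h)\<^sup>2 = 4 * ((real k)\<^sup>2 * h\<^sup>2)" by (simp add: power_mult_distrib)
    moreover have "(2 * real k * h) * (3 * real k * h) = 6 * ((real k)\<^sup>2 * h\<^sup>2)"
      by (simp add: power2_eq_square)
    ultimately show ?thesis by (simp only: mult.assoc)
  qed
  finally have fin: "\<bar>exp q * E - y k - h * real k * S\<bar> \<le> 38 * (real k)\<^sup>2 * h\<^sup>2" .
  have "measure_pmf.expectation (frozen_step p n (fst x)) (\<lambda>G'. xval n k (G', a')) = ea * exp q * E"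
    unfolding xval' E_def by simp
  moreover have "xval n k x = ea * y k" by (simp add: xval_def ea_def y_def)
  ultimately have "measure_pmf.expectation (frozen_step p n (fst x)) (\<lambda>G'. xval n k (G', a')) - xval n k x
      - h * real k * (\<Sum>i\<in>{1..<k}. xval n i x * xval n (k - i) x) = ea * (exp q * E - y k - h * real k * S)"
    unfolding sumx by (simp add: algebra_simps)
  moreover have "ea * \<bar>exp q * E - y k - h * real k * S\<bar> \<le>
      exp (2 * real k * T0) * (38 * (real k)\<^sup>2 * h\<^sup>2)"
    using fin ea by (intro mult_mono) auto
  ultimately show ?thesis1 using ea unfolding h_def by (simp add: abs_mult mult_ac)
  show "\<bar>xval n k (G', a') - xval n k x\<bar> \<le> exp (2 * real k * T0) * 7 * (real k)\<^sup>2 * (1 / real n)"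
    if G': "G' \<in> set_pmf (frozen_step p n (fst x))"
  proof -
    define y' where "y' = yfrac n k G'"
    have y': "0 \<le> y'" "y' \<le> 1"
      using frozen_step_support(1,2)[OF s(1,2) n(1) G'] valid_graph_wf yfrac_range[of G' n k] n1
      unfolding y'_def by blast+
    have d: "\<bar>y' - y k\<bar> \<le> 3 * (real k)\<^sup>2 * h"
      using yfrac_step(3)[OF s(1,2) n(1) k G'] by (simp add: y'_def y_def h_def)
    have "xval n k (G', a') - xval n k x = ea * ((exp q - 1) * y' + (y' - y k))"
      unfolding xval' by (simp add: xval_def ea_def y_def y'_def algebra_simps)
    then have "\<bar>xval n k (G', a') - xval n k x\<bar> = ea * \<bar>(exp q - 1) * y' + (y' - y k)\<bar>"
      using ea by (simp add: abs_mult)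
    also have "\<dots> \<le> exp (2 * real k * T0) * (7 * (real k)\<^sup>2 * h)"
    proof (intro mult_mono ea(2))
      have "(exp q - 1) * y' \<le> (4 * real k * h) * 1"
        using eq(2) q y' h by (intro mult_mono) auto
      moreover have "0 \<le> (exp q - 1) * y'" using q y' by simp
      moreover have "real k * h \<le> (real k)\<^sup>2 * h"
        using k h by (intro mult_right_mono) (auto simp: power2_eq_square)
      ultimately show "\<bar>(exp q - 1) * y' + (y' - y k)\<bar> \<le> 7 * (real k)\<^sup>2 * h"
        using d by linarith
    qed auto
    finally show ?thesis by (simp add: h_def)
  qed
qed

lemma xval_range:
  assumes "x \<in> set_pmf (augmented p n m)" "n \<ge> 2" "real m \<le> T0 * real n" "i \<le> k"
  shows "0 \<le> xval n i x" "xval n i x \<le> exp (2 * real k * T0)"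
proof -
  note s = aug_support[OF assms(2,1)]
  have y: "0 \<le> yfrac n i (fst x)" "yfrac n i (fst x) \<le> 1"
    using yfrac_range[of "fst x" n i] s valid_graph_wf assms(2) by auto
  then show "0 \<le> xval n i x" by (simp add: xval_def)
  have "real m / real n \<le> T0" using assms by (simp add: field_simps)
  then have "snd x \<le> T0" using s(4) by linarith
  then have "2 * real i * snd x \<le> 2 * real k * T0" using s(3) assms(4) by (intro mult_mono) auto
  then have "xval n i x \<le> exp (2 * real k * T0) * 1"
    unfolding xval_def using y by (intro mult_mono) auto
  then show "xval n i x \<le> exp (2 * real k * T0)" by simp
qed

end

section \<open>Convergence to the limit dynamics\<close>

context frozen_parameter
begin

definition xdev :: "nat \<Rightarrow> nat \<Rightarrow> nat \<Rightarrow> nat multigraph \<times> real \<Rightarrow> real" where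
  "xdev n k m x = xval n k x - xi k (real m / real n)"

lemma xi_nonneg: "0 \<le> t \<Longrightarrow> 0 \<le> xi k t"
  using alpha_nonneg by (simp add: xi_def)

text \<open>With e the deviation and D its increment, expand (e + D)^2. The square of D is of order
  1 / n^2. Up to that order the mean of D is a difference of convolutions over sizes below k, in
  which the deviation at k itself does not occur.\<close>

lemma xdev_L2_step:
  assumes k: "1 \<le> k" and T0: "0 \<le> T0"
  obtains C where "C \<ge> 0" "\<And>n m. n \<ge> 2 \<Longrightarrow> n \<ge> 2 * k \<Longrightarrow> real (Suc m) \<le> T0 * real n \<Longrightarrow>
    EE n (Suc m) (\<lambda>x. (xdev n k (Suc m) x)\<^sup>2) \<le>
    EE n m (\<lambda>x. (xdev n k m x)\<^sup>2 + (C / real n * (\<Sum>i\<in>{1..<k}. \<bar>xdev n i m x\<bar>) + C / (real n)\<^sup>2))"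
proof -
  obtain Cx where Cx: "Cx \<ge> 0" "\<And>t h. 0 \<le> t \<Longrightarrow> t \<le> T0 \<Longrightarrow> 0 \<le> h \<Longrightarrow> h \<le> 1 \<Longrightarrow>
      \<bar>xi k (t + h) - xi k t - h * real k * (\<Sum>i\<in>{1..<k}. xi i t * xi (k - i) t)\<bar> \<le> Cx * h\<^sup>2 \<and>
      \<bar>xi k (t + h) - xi k t\<bar> \<le> Cx * h"
    using xi_increment_bound[OF k T0] by blast
  \<comment> \<open>A common bound for the random values and for their limits, for all sizes up to k
    and all times up to T0.\<close>
  define M where "M = exp (2 * real k * T0) + (\<Sum>i\<in>{1..k}. xi i T0)"
  define c1 where "c1 = exp (2 * real k * T0) * 38 * (real k)\<^sup>2 + Cx"
  define c2 where "c2 = exp (2 * real k * T0) * 7 * (real k)\<^sup>2 + Cx"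
  define C where "C = 4 * M\<^sup>2 * real k + (2 * M * c1 + c2\<^sup>2)"
  have c: "0 \<le> c1" "0 \<le> c2" using Cx by (auto simp: c1_def c2_def)
  have sxi: "0 \<le> (\<Sum>i\<in>{1..k}. xi i T0)" using xi_nonneg T0 by (intro sum_nonneg)
  then have M: "0 \<le> M" by (simp add: M_def add_nonneg_nonneg)
  have xiM: "0 \<le> xi i t" "xi i t \<le> M" if "i \<in> {1..k}" "0 \<le> t" "t \<le> T0" for i t
  proof -
    show "0 \<le> xi i t" using xi_nonneg that by simp
    have "xi i t \<le> xi i T0" unfolding xi_def using that alpha_nonneg
      by (intro mult_left_mono power_mono) auto
    also have "\<dots> \<le> (\<Sum>i\<in>{1..k}. xi i T0)" using that xi_nonneg T0 by (intro member_le_sum) auto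
    also have "\<dots> \<le> M" by (simp add: M_def)
    finally show "xi i t \<le> M" .
  qed
  show thesis
  proof (rule that[of C])
    show "0 \<le> C" using M c by (simp add: C_def)
    fix n m assume n: "n \<ge> 2" "n \<ge> 2 * k" and m: "real (Suc m) \<le> T0 * real n"
    define h where "h = 1 / real n"
    define t where "t = real m / real n"
    have h: "0 < h" "h \<le> 1" using n by (auto simp: h_def)
    have t: "0 \<le> t" "t \<le> T0" using m n by (auto simp: t_def field_simps)
    have mT: "real m \<le> T0 * real n" using m by simp
    have t': "real (Suc m) / real n = t + h" by (simp add: t_def h_def add_divide_distrib)
    show "EE n (Suc m) (\<lambda>x. (xdev n k (Suc m) x)\<^sup>2) \<le>
      EE n m (\<lambda>x. (xdev n k m x)\<^sup>2 + (C / real n * (\<Sum>i\<in>{1..<k}. \<bar>xdev n i m x\<bar>) + C / (real n)\<^sup>2))"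
    proof (rule EE_step_le[OF n(1)])
      fix x assume x: "x \<in> set_pmf (augmented p n m)"
      define a' where "a' = snd x + merge_rate p (fst x) / (real n)\<^sup>2"
      let ?P = "frozen_step p n (fst x)"
      have finP: "finite (set_pmf ?P)" by (rule finite_set_pmf_frozen_step[OF n(1)])
      define e where "e = xdev n k m x"
      define D where "D G' = xval n k (G', a') - xval n k x - (xi k (t + h) - xi k t)" for G'
      define SX where "SX = (\<Sum>i\<in>{1..<k}. xval n i x * xval n (k - i) x)"
      define SY where "SY = (\<Sum>i\<in>{1..<k}. xi i t * xi (k - i) t)"
      define SD where "SD = (\<Sum>i\<in>{1..<k}. \<bar>xdev n i m x\<bar>)"
      define ED where "ED = measure_pmf.expectation ?P D"
      have SD: "0 \<le> SD" unfolding SD_def by (intro sum_nonneg) auto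
      have xM: "0 \<le> xval n i x" "xval n i x \<le> M" if "i \<le> k" for i
        using xval_range[OF x n(1) mT that] sxi by (auto simp: M_def)
      have eM: "\<bar>e\<bar> \<le> M"
        using xM[of k] xiM[of k t] k t by (auto simp: e_def xdev_def t_def[symmetric])
      have dev: "xdev n k (Suc m) (G', a') = e + D G'" for G'
        unfolding xdev_def e_def D_def t' t_def[symmetric] by simp
      have Db: "\<bar>D G'\<bar> \<le> c2 * h" if "G' \<in> set_pmf ?P" for G'
      proof -
        have "\<bar>xval n k (G', a') - xval n k x\<bar> \<le> exp (2 * real k * T0) * 7 * (real k)\<^sup>2 * h"
          using xval_step(2)[OF x n k mT that] by (simp add: a'_def h_def)
        moreover have "\<bar>xi k (t + h) - xi k t\<bar> \<le> Cx * h" using Cx(2)[of t h] t h by auto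
        ultimately show ?thesis unfolding D_def c2_def distrib_right by linarith
      qed
      have "\<bar>ED - h * real k * (SX - SY)\<bar> \<le> c1 * h\<^sup>2"
      proof -
        have "ED = measure_pmf.expectation ?P (\<lambda>G'. xval n k (G', a')) - xval n k x - (xi k (t + h) - xi k t)"
          unfolding ED_def D_def using finP by (simp add: integrable_finite_pmf)
        moreover have "\<bar>measure_pmf.expectation ?P (\<lambda>G'. xval n k (G', a')) - xval n k x - h * real k * SX\<bar>
            \<le> exp (2 * real k * T0) * 38 * (real k)\<^sup>2 * h\<^sup>2"
          using xval_step(1)[OF x n k mT] unfolding a'_def h_def SX_def .
        moreover have "\<bar>xi k (t + h) - xi k t - h * real k * SY\<bar> \<le> Cx * h\<^sup>2"
          using Cx(2)[of t h] t h by (auto simp: SY_def)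
        ultimately show ?thesis unfolding c1_def distrib_right right_diff_distrib by linarith
      qed
      moreover have "\<bar>SX - SY\<bar> \<le> 2 * M * SD"
      proof -
        have "\<bar>xval n i x * xval n (k - i) x - xi i t * xi (k - i) t\<bar> \<le>
            M * \<bar>xdev n (k - i) m x\<bar> + M * \<bar>xdev n i m x\<bar>" if i: "i \<in> {1..<k}" for i
        proof -
          have "xval n i x * xval n (k - i) x - xi i t * xi (k - i) t =
              xval n i x * xdev n (k - i) m x + xi (k - i) t * xdev n i m x"
            unfolding xdev_def t_def[symmetric] by (simp add: algebra_simps)
          moreover have "\<bar>xval n i x * xdev n (k - i) m x\<bar> \<le> M * \<bar>xdev n (k - i) m x\<bar>"
            unfolding abs_mult using xM[of i] i by (intro mult_right_mono) auto
          moreover have "\<bar>xi (k - i) t * xdev n i m x\<bar> \<le> M * \<bar>xdev n i m x\<bar>"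
            unfolding abs_mult using xiM[of "k - i" t] i t by (intro mult_right_mono) auto
          ultimately show ?thesis by linarith
        qed
        then have "\<bar>SX - SY\<bar> \<le> (\<Sum>i\<in>{1..<k}. M * \<bar>xdev n (k - i) m x\<bar> + M * \<bar>xdev n i m x\<bar>)"
          unfolding SX_def SY_def sum_subtractf[symmetric] by (intro order_trans[OF sum_abs sum_mono])
        also have "\<dots> = M * (\<Sum>i\<in>{1..<k}. \<bar>xdev n (k - i) m x\<bar>) + M * SD"
          by (simp add: SD_def sum.distrib sum_distrib_left)
        also have "(\<Sum>i\<in>{1..<k}. \<bar>xdev n (k - i) m x\<bar>) = SD"
          unfolding SD_def by (rule sum.reindex_bij_witness[where i = "\<lambda>i. k - i" and j = "\<lambda>i. k - i"]) auto
        finally show ?thesis by simp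
      qed
      then have "\<bar>h * real k * (SX - SY)\<bar> \<le> h * real k * (2 * M * SD)"
        unfolding abs_mult using h by (intro mult_mono) auto
      ultimately have ED: "\<bar>ED\<bar> \<le> h * real k * (2 * M * SD) + c1 * h\<^sup>2" by linarith
      have "measure_pmf.expectation ?P (\<lambda>G'. (xdev n k (Suc m) (G', a'))\<^sup>2) =
          measure_pmf.expectation ?P (\<lambda>G'. e\<^sup>2 + 2 * e * D G' + (D G')\<^sup>2)"
        unfolding dev by (simp add: power2_sum algebra_simps)
      also have "\<dots> = e\<^sup>2 + 2 * e * ED + measure_pmf.expectation ?P (\<lambda>G'. (D G')\<^sup>2)"
        using finP by (simp add: ED_def integrable_finite_pmf)
      also have "\<dots> \<le> e\<^sup>2 + 2 * M * (h * real k * (2 * M * SD) + c1 * h\<^sup>2) + (c2 * h)\<^sup>2"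
      proof (intro add_mono order_refl)
        have "2 * e * ED \<le> \<bar>2 * e\<bar> * \<bar>ED\<bar>" by (metis abs_ge_self abs_mult)
        also have "\<dots> \<le> 2 * M * (h * real k * (2 * M * SD) + c1 * h\<^sup>2)"
          using eM ED M by (intro mult_mono) auto
        finally show "2 * e * ED \<le> 2 * M * (h * real k * (2 * M * SD) + c1 * h\<^sup>2)" .
        show "measure_pmf.expectation ?P (\<lambda>G'. (D G')\<^sup>2) \<le> (c2 * h)\<^sup>2"
        proof (rule expectation_le_const[OF finP])
          fix G' assume "G' \<in> set_pmf ?P"
          from power_mono[OF Db[OF this], of 2] show "(D G')\<^sup>2 \<le> (c2 * h)\<^sup>2" by simp
        qed
      qed
      also have "\<dots> = e\<^sup>2 + (4 * M\<^sup>2 * real k * h * SD + (2 * M * c1 + c2\<^sup>2) * h\<^sup>2)"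
        by (simp add: algebra_simps power2_eq_square)
      also have "\<dots> \<le> e\<^sup>2 + (C * h * SD + C * h\<^sup>2)"
        using M c h SD by (intro add_mono mult_right_mono order_refl) (auto simp: C_def)
      finally show "measure_pmf.expectation ?P (\<lambda>G'. (xdev n k (Suc m)
          (G', snd x + merge_rate p (fst x) / (real n)\<^sup>2))\<^sup>2) \<le>
          (xdev n k m x)\<^sup>2 + (C / real n * (\<Sum>i\<in>{1..<k}. \<bar>xdev n i m x\<bar>) + C / (real n)\<^sup>2)"
        unfolding a'_def e_def SD_def h_def by (simp add: power_divide)
    qed
  qed
qed

lemma abs_le_square: "0 < \<epsilon> \<Longrightarrow> \<bar>x\<bar> \<le> \<epsilon> / 2 + x\<^sup>2 / (2 * \<epsilon>)" for x :: real
proof -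
  assume e: "0 < \<epsilon>"
  have "0 \<le> (\<bar>x\<bar> - \<epsilon>)\<^sup>2 / (2 * \<epsilon>)" using e by simp
  also have "\<dots> = \<epsilon> / 2 + x\<^sup>2 / (2 * \<epsilon>) - \<bar>x\<bar>"
    using e by (simp add: power2_diff field_simps power2_eq_square)
  finally show ?thesis by simp
qed

text \<open>The square inequality at level \<epsilon> gives the same bound as
  Cauchy-Schwarz.\<close>

lemma EE_abs_le:
  assumes "n \<ge> 2" "0 < \<epsilon>" "EE n m (\<lambda>x. (F x)\<^sup>2) \<le> \<epsilon>\<^sup>2"
  shows "EE n m (\<lambda>x. \<bar>F x\<bar>) \<le> \<epsilon>"
proof -
  have "EE n m (\<lambda>x. \<bar>F x\<bar>) \<le> EE n m (\<lambda>x. \<epsilon> / 2 + (F x)\<^sup>2 / (2 * \<epsilon>))"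
    by (rule EE_mono[OF assms(1)]) (rule abs_le_square[OF assms(2)])
  also have "\<dots> = \<epsilon> / 2 + EE n m (\<lambda>x. (F x)\<^sup>2) / (2 * \<epsilon>)"
    by (simp add: EE_add[OF assms(1)])
  also have "\<dots> \<le> \<epsilon> / 2 + \<epsilon>\<^sup>2 / (2 * \<epsilon>)"
    using assms by (intro add_left_mono divide_right_mono) auto
  also have "\<dots> = \<epsilon>" using assms(2) by (simp add: power2_eq_square)
  finally show ?thesis .
qed

lemma eventually_const_over_n: "0 < \<epsilon> \<Longrightarrow> \<forall>\<^sub>F n in sequentially. c / real n \<le> \<epsilon>"
proof -
  assume "0 < \<epsilon>"
  moreover have "(\<lambda>n. c / real n) \<longlonglongrightarrow> 0"
    by (intro real_tendsto_divide_at_top[OF tendsto_const] filterlim_real_sequentially)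
  ultimately have "\<forall>\<^sub>F n in sequentially. c / real n < \<epsilon>" by (intro order_tendstoD)
  then show ?thesis by (rule eventually_mono) simp
qed

lemma xdev_0: "xdev n k 0 (Multigraph {1..n} {#}, 0) = 0" if "n \<ge> 2" "1 \<le> k"
proof -
  have "tree_count k (Multigraph {1..n::nat} {#}) = (if k = 1 then real n else 0)"
    unfolding tree_count_eq_sum[OF wf_empty_graph] treev_empty_graph
    by (subst sum.cong[OF refl, of _ _ "\<lambda>_. if k = 1 then 1 else 0"])
       (simp_all only: csize_empty_graph, auto)
  then show ?thesis using that
    by (cases k) (auto simp: xdev_def xval_def yfrac_def xi_def)
qed

text \<open>Strong induction on the size. As the deviation at k does not feed its own drift, the
  errors of at most T0 n steps simply add up, and no Gronwall factor arises.\<close>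

proposition xval_converges:
  assumes "1 \<le> k" "0 \<le> T0" "0 < \<epsilon>"
  shows "\<forall>\<^sub>F n in sequentially. \<forall>m. real m \<le> T0 * real n \<longrightarrow> EE n m (\<lambda>x. \<bar>xdev n k m x\<bar>) \<le> \<epsilon>"
  using assms(1,3)
proof (induction k arbitrary: \<epsilon> rule: less_induct)
  case (less k)
  obtain C where C: "C \<ge> 0" "\<And>n m. n \<ge> 2 \<Longrightarrow> n \<ge> 2 * k \<Longrightarrow> real (Suc m) \<le> T0 * real n \<Longrightarrow>
    EE n (Suc m) (\<lambda>x. (xdev n k (Suc m) x)\<^sup>2) \<le>
    EE n m (\<lambda>x. (xdev n k m x)\<^sup>2 + (C / real n * (\<Sum>i\<in>{1..<k}. \<bar>xdev n i m x\<bar>) + C / (real n)\<^sup>2))"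
    using xdev_L2_step[OF less.prems(1) assms(2)] by blast
  \<comment> \<open>Makes the accumulated influence of the smaller sizes, C T0 k \<delta>, at most
    half of \<epsilon>^2.\<close>
  define \<delta> where "\<delta> = \<epsilon>\<^sup>2 / (2 * (C * T0 * real k + 1))"
  have den: "C * T0 * real k + 1 > 0" using C assms(2) by (simp add: add_nonneg_pos)
  then have \<delta>: "\<delta> > 0" using less.prems by (simp add: \<delta>_def)
  have C\<delta>: "C * T0 * real k * \<delta> \<le> \<epsilon>\<^sup>2 / 2"
  proof -
    have "C * T0 * real k * \<delta> \<le> (C * T0 * real k + 1) * \<delta>" using \<delta> by (intro mult_right_mono) auto
    also have "\<dots> = \<epsilon>\<^sup>2 / 2"
    proof -
      have "c * (e / (2 * c)) = e / 2" if "c > 0" for c e :: real using that by simp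
      from this[OF den] show ?thesis by (simp only: \<delta>_def)
    qed
    finally show ?thesis .
  qed
  have "\<forall>\<^sub>F n in sequentially. \<forall>i\<in>{1..<k}. \<forall>m. real m \<le> T0 * real n \<longrightarrow> EE n m (\<lambda>x. \<bar>xdev n i m x\<bar>) \<le> \<delta>"
    using less.IH \<delta> by (intro eventually_ball_finite) auto
  moreover have "\<forall>\<^sub>F n in sequentially. (C * T0) / real n \<le> \<epsilon>\<^sup>2 / 2"
    using less.prems by (intro eventually_const_over_n) simp
  ultimately show ?case
    using eventually_ge_at_top[of 2] eventually_ge_at_top[of "2 * k"]
  proof eventually_elim
    case (elim n)
    then have n: "n \<ge> 2" "n \<ge> 2 * k" by auto
    have ind: "EE n m (\<lambda>x. (xdev n k m x)\<^sup>2) \<le> real m * (C / real n * (real k * \<delta>) + C / (real n)\<^sup>2)"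
      if "real m \<le> T0 * real n" for m
      using that
    proof (induction m)
      case 0 then show ?case using xdev_0[OF n(1) less.prems(1)] by simp
    next
      case (Suc m)
      have m: "real m \<le> T0 * real n" using Suc.prems by simp
      have "EE n (Suc m) (\<lambda>x. (xdev n k (Suc m) x)\<^sup>2) \<le>
        EE n m (\<lambda>x. (xdev n k m x)\<^sup>2 + (C / real n * (\<Sum>i\<in>{1..<k}. \<bar>xdev n i m x\<bar>) + C / (real n)\<^sup>2))"
        by (rule C(2)[OF n Suc.prems])
      also have "\<dots> = EE n m (\<lambda>x. (xdev n k m x)\<^sup>2) +
          (C / real n * (\<Sum>i\<in>{1..<k}. EE n m (\<lambda>x. \<bar>xdev n i m x\<bar>)) + C / (real n)\<^sup>2)"
        by (simp add: EE_add[OF n(1)] EE_sum[OF n(1)] del: times_divide_eq_left)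
      also have "\<dots> \<le> real m * (C / real n * (real k * \<delta>) + C / (real n)\<^sup>2) +
          (C / real n * (real k * \<delta>) + C / (real n)\<^sup>2)"
      proof (intro add_mono mult_left_mono order_refl)
        show "EE n m (\<lambda>x. (xdev n k m x)\<^sup>2) \<le> real m * (C / real n * (real k * \<delta>) + C / (real n)\<^sup>2)"
          by (rule Suc.IH[OF m])
        have "(\<Sum>i\<in>{1..<k}. EE n m (\<lambda>x. \<bar>xdev n i m x\<bar>)) \<le> (\<Sum>i\<in>{1..<k}. \<delta>)"
          using elim(1) m by (intro sum_mono) auto
        also have "\<dots> \<le> real k * \<delta>" using \<delta> by (simp add: mult_right_mono)
        finally show "(\<Sum>i\<in>{1..<k}. EE n m (\<lambda>x. \<bar>xdev n i m x\<bar>)) \<le> real k * \<delta>" .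
      qed (use C n in auto)
      finally show ?case by (simp only: of_nat_Suc distrib_right mult_1_left add.commute)
    qed
    show ?case
    proof (intro allI impI)
      fix m assume m: "real m \<le> T0 * real n"
      have "real m * (C / real n * (real k * \<delta>) + C / (real n)\<^sup>2) \<le>
          (T0 * real n) * (C / real n * (real k * \<delta>) + C / (real n)\<^sup>2)"
        using C \<delta> n by (intro mult_right_mono m) auto
      also have "\<dots> = C * T0 * real k * \<delta> + (C * T0) / real n"
        using n by (simp add: field_simps power2_eq_square)
      also have "\<dots> \<le> \<epsilon>\<^sup>2" using C\<delta> elim(2) by linarith
      finally show "EE n m (\<lambda>x. \<bar>xdev n k m x\<bar>) \<le> \<epsilon>"
        using ind[OF m] less.prems by (intro EE_abs_le[OF n(1)]) auto
    qed
  qed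
qed

section \<open>Convergence of the integrated rate\<close>

definition adev :: "nat \<Rightarrow> nat \<Rightarrow> nat multigraph \<times> real \<Rightarrow> real" where
  "adev n m x = snd x - A (real m / real n)"

definition large :: "nat \<Rightarrow> nat \<Rightarrow> nat multigraph \<Rightarrow> real" where
  "large n K G = real (card {u \<in> treev G. K < csize G u}) / real n"

lemma tree_fraction_split:
  assumes "wf_graph G"
  shows "real (card (treev G)) / real n = (\<Sum>k\<in>{1..K}. yfrac n k G) + large n K G"
  unfolding card_treev_split[OF assms, of K] yfrac_def large_def
  by (simp add: add_divide_distrib sum_divide_distrib)

text \<open>The fraction \<open>\<Sum> xi k t exp (- 2 k a)\<close> of vertices in finite trees is decreasing in \<open>a\<close>, so the
  dynamics of \<open>a\<close> contracts the distance to \<open>A\<close>.\<close>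

lemma adev_square_step:
  assumes n: "n \<ge> 2" and x: "x \<in> set_pmf (augmented p n m)" and m: "real (Suc m) \<le> T0 * real n"
    and tail: "\<And>t. 0 \<le> t \<Longrightarrow> 1 - g t - (\<Sum>k\<in>{1..K}. xi k t * exp (- 2 * real k * A t)) \<le> \<epsilon>"
  defines "t \<equiv> real m / real n" and "h \<equiv> 1 / real n"
  shows "(adev n (Suc m) (G', snd x + merge_rate p (fst x) / (real n)\<^sup>2))\<^sup>2 \<le> (adev n m x)\<^sup>2 +
    (2 * T0 * h * (large n K (fst x) + (\<Sum>k\<in>{1..K}. \<bar>xdev n k m x\<bar>) + \<epsilon>)
     + 2 * T0 * h * (b t - b (t + h)) + 4 * h\<^sup>2)"
proof -
  note s = aug_support[OF n x]
  have wf: "wf_graph (fst x)" using s valid_graph_wf by blast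
  define a where "a = snd x"
  define r where "r = merge_rate p (fst x) / real n"
  define v where "v = real (card (treev (fst x))) / real n"
  define d where "d = adev n m x"
  \<comment> \<open>The excess of the Euler step h b(t) over the increment of A. It lies between 0
    and h (b t - b (t + h)) by \<open>A_secant\<close>, and these bounds telescope over
    time.\<close>
  define \<rho> where "\<rho> = h * b t - (A (t + h) - A t)"
  define SD where "SD = (\<Sum>k\<in>{1..K}. \<bar>xdev n k m x\<bar>)"
  let ?V = "large n K (fst x)"
  have h: "0 < h" using n by (simp add: h_def)
  have t: "0 \<le> t" by (simp add: t_def)
  have tT: "t \<le> T0" using m n by (simp add: t_def field_simps)
  have T0: "0 \<le> T0" using t tT by linarith
  have r: "0 \<le> r" "r \<le> 1" using merge_rate_bounds[OF s(2) p0 p_le_1] n by (auto simp: r_def)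
  have r_eq: "r = p + (1 - p) * v"
  proof -
    have "card (verts (fst x) - treev (fst x)) = n - card (treev (fst x))"
      using s(2) treev_subset[of "fst x"] by (simp add: card_Diff_subset finite_subset)
    then have "real (card (verts (fst x) - treev (fst x))) = real n - real (card (treev (fst x)))"
      using card_treev_le[OF s(2)] by (simp add: of_nat_diff)
    then show ?thesis unfolding r_def v_def merge_rate_def using n by (simp only:) (simp add: field_simps)
  qed
  have a: "0 \<le> a" "a \<le> t" using s unfolding a_def t_def by auto
  have d: "d = a - A t" by (simp add: d_def adev_def a_def t_def)
  have dT: "\<bar>d\<bar> \<le> T0" using d a A_range[OF t] tT by linarith
  have \<rho>: "0 \<le> \<rho>" "\<rho> \<le> h * (b t - b (t + h))"
    using A_secant[of t "t + h"] t h unfolding \<rho>_def by (auto simp: algebra_simps)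
  have bb: "b t - b (t + h) \<le> 1" using b_range[of t] b_range[of "t + h"] by linarith
  have "h * (b t - b (t + h)) \<le> h * 1" using bb h by (intro mult_left_mono) auto
  then have \<rho>h: "\<rho> \<le> h" using \<rho> by linarith
  have new: "adev n (Suc m) (G', snd x + merge_rate p (fst x) / (real n)\<^sup>2) = d + (h * (r - b t) + \<rho>)"
    unfolding adev_def d \<rho>_def a_def[symmetric] r_def h_def t_def
    by (simp add: power2_eq_square add_divide_distrib algebra_simps)
  have rb: "r - b t = (1 - p) * (v - (1 - g t))"
    unfolding r_eq b_def by (simp add: algebra_simps)
  have V0: "0 \<le> ?V" by (simp add: large_def)
  have SD0: "0 \<le> SD" unfolding SD_def by (intro sum_nonneg) auto
  define tl where "tl = 1 - g t - (\<Sum>k\<in>{1..K}. xi k t * exp (- 2 * real k * A t))"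
  have tl: "0 \<le> tl" "tl \<le> \<epsilon>" using tail[OF t] xi_sum_le[OF t, of K] by (auto simp: tl_def)
  \<comment> \<open>Four sources: vertices in large trees, deviations at the small sizes, the
    difference between a and A, and the limit mass beyond K. The third is the contracting
    one.\<close>
  have "v - (1 - g t) = ?V + (\<Sum>k\<in>{1..K}. exp (- 2 * real k * a) * xdev n k m x)
      + (\<Sum>k\<in>{1..K}. xi k t * (exp (- 2 * real k * a) - exp (- 2 * real k * A t))) - tl"
  proof -
    have "yfrac n k (fst x) = exp (- 2 * real k * a) * xdev n k m x + xi k t * exp (- 2 * real k * a)" for k
    proof -
      have "exp (- 2 * real k * a) * exp (2 * real k * a) = 1" by (simp flip: exp_add)
      then show ?thesis unfolding xdev_def xval_def a_def[symmetric] t_def[symmetric]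
        by (simp add: right_diff_distrib flip: mult.assoc)
    qed
    then show ?thesis unfolding v_def tree_fraction_split[OF wf, of n K] tl_def
      by (simp add: sum.distrib sum_subtractf right_diff_distrib)
  qed
  then have "d * (v - (1 - g t)) = d * (?V + (\<Sum>k\<in>{1..K}. exp (- 2 * real k * a) * xdev n k m x)
      + (\<Sum>k\<in>{1..K}. xi k t * (exp (- 2 * real k * a) - exp (- 2 * real k * A t))) - tl)"
    by (simp only:)
  also have "\<dots> = d * ?V + d * (\<Sum>k\<in>{1..K}. exp (- 2 * real k * a) * xdev n k m x)
      + d * (\<Sum>k\<in>{1..K}. xi k t * (exp (- 2 * real k * a) - exp (- 2 * real k * A t))) - d * tl"
    by (simp only: distrib_left right_diff_distrib)
  also have "\<dots> \<le> T0 * ?V + T0 * SD + 0 + T0 * \<epsilon>"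
  proof -
    have "d * ?V \<le> T0 * ?V" using dT V0 by (intro mult_right_mono) auto
    moreover have "d * (\<Sum>k\<in>{1..K}. exp (- 2 * real k * a) * xdev n k m x) \<le> T0 * SD"
    proof -
      have "\<bar>\<Sum>k\<in>{1..K}. exp (- 2 * real k * a) * xdev n k m x\<bar> \<le> SD"
        unfolding SD_def
      proof (intro order_trans[OF sum_abs sum_mono])
        fix k
        have "exp (- 2 * real k * a) \<le> 1" using a by simp
        then show "\<bar>exp (- 2 * real k * a) * xdev n k m x\<bar> \<le> \<bar>xdev n k m x\<bar>"
          by (simp add: abs_mult mult_left_le_one_le)
      qed
      then have "\<bar>d\<bar> * \<bar>\<Sum>k\<in>{1..K}. exp (- 2 * real k * a) * xdev n k m x\<bar> \<le> T0 * SD"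
        using dT T0 by (intro mult_mono) auto
      then show ?thesis unfolding abs_mult[symmetric] by (rule order_trans[OF abs_ge_self])
    qed
    moreover have "d * (\<Sum>k\<in>{1..K}. xi k t * (exp (- 2 * real k * a) - exp (- 2 * real k * A t))) \<le> 0"
      unfolding sum_distrib_left
    proof (rule sum_nonpos)
      fix k
      have "d * (exp (- 2 * real k * a) - exp (- 2 * real k * A t)) \<le> 0"
      proof (cases "a \<le> A t")
        case True
        then have "real k * a \<le> real k * A t" by (intro mult_left_mono) auto
        then have "exp (- 2 * real k * a) \<ge> exp (- 2 * real k * A t)" by simp
        then show ?thesis using True d by (intro mult_nonpos_nonneg) auto
      next
        case False
        then have "real k * A t \<le> real k * a" by (intro mult_left_mono) auto
        then have "exp (- 2 * real k * a) \<le> exp (- 2 * real k * A t)" by simp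
        then show ?thesis using False d by (intro mult_nonneg_nonpos) auto
      qed
      then have "xi k t * (d * (exp (- 2 * real k * a) - exp (- 2 * real k * A t))) \<le> 0"
        by (rule mult_nonneg_nonpos[OF xi_nonneg[OF t]])
      then show "d * (xi k t * (exp (- 2 * real k * a) - exp (- 2 * real k * A t))) \<le> 0"
        by (simp add: mult.left_commute)
    qed
    moreover have "- d * tl \<le> T0 * \<epsilon>"
      using dT tl T0 by (intro mult_mono) auto
    ultimately show ?thesis by linarith
  qed
  finally have main: "d * (v - (1 - g t)) \<le> T0 * (?V + SD + \<epsilon>)" by (simp add: algebra_simps)
  have R0: "0 \<le> T0 * (?V + SD + \<epsilon>)" using T0 V0 SD0 tl by (intro mult_nonneg_nonneg) auto
  have "d * (r - b t) \<le> T0 * (?V + SD + \<epsilon>)"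
  proof -
    have "d * (r - b t) = (1 - p) * (d * (v - (1 - g t)))" unfolding rb by simp
    also have "\<dots> \<le> (1 - p) * (T0 * (?V + SD + \<epsilon>))" using main p_le_1 by (intro mult_left_mono) auto
    also have "\<dots> \<le> 1 * (T0 * (?V + SD + \<epsilon>))" using R0 p_pos by (intro mult_right_mono) auto
    finally show ?thesis by simp
  qed
  then have 1: "2 * h * (d * (r - b t)) \<le> 2 * h * (T0 * (?V + SD + \<epsilon>))"
    using h by (intro mult_left_mono) auto
  have "d * \<rho> \<le> T0 * (h * (b t - b (t + h)))"
    using dT \<rho> T0 by (intro mult_mono) auto
  then have 2: "2 * (d * \<rho>) \<le> 2 * (T0 * (h * (b t - b (t + h))))" by simp
  have "\<bar>h * (r - b t)\<bar> \<le> h * 1"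
    unfolding abs_mult using r b_range[of t] h by (intro mult_mono) auto
  then have "\<bar>h * (r - b t) + \<rho>\<bar> \<le> 2 * h" using \<rho> \<rho>h by linarith
  from power_mono[OF this, of 2] have 3: "(h * (r - b t) + \<rho>)\<^sup>2 \<le> 4 * h\<^sup>2"
    by (simp add: power_mult_distrib)
  have "(d + (h * (r - b t) + \<rho>))\<^sup>2 =
      d\<^sup>2 + (2 * h * (d * (r - b t)) + 2 * (d * \<rho>) + (h * (r - b t) + \<rho>)\<^sup>2)"
    by (simp add: power2_eq_square algebra_simps)
  also have "\<dots> \<le> d\<^sup>2 + (2 * h * (T0 * (?V + SD + \<epsilon>)) + 2 * (T0 * (h * (b t - b (t + h)))) + 4 * h\<^sup>2)"
    using 1 2 3 by linarith
  finally show ?thesis unfolding new d_def[symmetric] SD_def by (simp add: mult_ac)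
qed

text \<open>Thanks to the contraction, the mean squares grow by at most the sum of the one-step
  errors. Large trees enter these errors summed over time, the form in which
  \<open>expectation_large_trees\<close> controls them.\<close>

proposition adev_converges:
  assumes "0 \<le> T0" "0 < \<epsilon>"
  shows "\<forall>\<^sub>F n in sequentially. \<forall>m. real m \<le> T0 * real n \<longrightarrow> EE n m (\<lambda>x. \<bar>adev n m x\<bar>) \<le> \<epsilon>"
proof -
  \<comment> \<open>Makes both 2 T0 \<delta> and 2 T0^2 \<delta> at most \<epsilon>^2 / 4.\<close>
  define \<delta> where "\<delta> = \<epsilon>\<^sup>2 / (8 * ((T0 + 1) * (T0 + 1)))"
  have \<delta>: "\<delta> > 0" using assms by (simp add: \<delta>_def)
  have \<delta>T: "2 * T0 * \<delta> \<le> \<epsilon>\<^sup>2 / 4" "2 * T0 * (T0 * \<delta>) \<le> \<epsilon>\<^sup>2 / 4"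
  proof -
    have e: "(T0 + 1) * (T0 + 1) * \<delta> = \<epsilon>\<^sup>2 / 8"
    proof -
      have "c * (e / (8 * c)) = e / 8" if "c > 0" for c e :: real using that by simp
      moreover have "(T0 + 1) * (T0 + 1) > 0" using assms by simp
      ultimately show ?thesis unfolding \<delta>_def by blast
    qed
    have "T0 * \<delta> \<le> (T0 + 1) * (T0 + 1) * \<delta>" using assms \<delta> by (intro mult_right_mono) (auto simp: algebra_simps)
    then show "2 * T0 * \<delta> \<le> \<epsilon>\<^sup>2 / 4" using e by simp
    have "T0 * T0 * \<delta> \<le> (T0 + 1) * (T0 + 1) * \<delta>" using assms \<delta> by (intro mult_right_mono mult_mono) auto
    then show "2 * T0 * (T0 * \<delta>) \<le> \<epsilon>\<^sup>2 / 4" using e by simp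
  qed
  obtain K0 where K0: "\<And>K t. K0 \<le> K \<Longrightarrow> 0 \<le> t \<Longrightarrow>
    1 - g t - (\<Sum>k\<in>{1..K}. xi k t * exp (- 2 * real k * A t)) \<le> \<delta> / 2"
    using xi_tail[of "\<delta> / 2"] \<delta> by auto
  obtain K1 where K1: "K1 \<ge> 1" "\<forall>\<^sub>F n in sequentially. \<forall>M. real M \<le> T0 * real n \<longrightarrow>
    (\<Sum>m<M. EE n m (\<lambda>x. real (card {u \<in> treev (fst x). K1 < csize (fst x) u}))) \<le> \<delta> * (real n)\<^sup>2"
    using expectation_large_trees[OF \<delta> assms(1)] by blast
  \<comment> \<open>Large enough both for the tail of the limit and for tightness, as the number of
    vertices in trees larger than K decreases in K.\<close>
  define K where "K = max K0 K1"
  \<comment> \<open>Shares \<delta> / 2 among the K sizes.\<close>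
  define \<eta> where "\<eta> = \<delta> / (2 * real (K + 1))"
  have \<eta>: "\<eta> > 0" using \<delta> by (simp add: \<eta>_def)
  have K\<eta>: "real K * \<eta> \<le> \<delta> / 2"
  proof -
    have "real K * \<eta> \<le> real (K + 1) * \<eta>" using \<eta> by (intro mult_right_mono) auto
    also have "\<dots> = \<delta> / 2"
    proof -
      have "c * (\<delta> / (2 * c)) = \<delta> / 2" if "c > 0" for c :: real using that by simp
      moreover have "real (K + 1) > 0" by simp
      ultimately show ?thesis unfolding \<eta>_def by blast
    qed
    finally show ?thesis .
  qed
  have tail: "1 - g t - (\<Sum>k\<in>{1..K}. xi k t * exp (- 2 * real k * A t)) \<le> \<delta> / 2" if "0 \<le> t" for t
    using that by (intro K0) (simp add: K_def)
  have "\<forall>\<^sub>F n in sequentially. \<forall>k\<in>{1..K}. \<forall>m. real m \<le> T0 * real n \<longrightarrow> EE n m (\<lambda>x. \<bar>xdev n k m x\<bar>) \<le> \<eta>"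
    using xval_converges[OF _ assms(1) \<eta>] by (intro eventually_ball_finite) auto
  moreover have "\<forall>\<^sub>F n in sequentially. (6 * T0) / real n \<le> \<epsilon>\<^sup>2 / 2"
    using assms by (intro eventually_const_over_n) simp
  ultimately show ?thesis using K1(2) eventually_ge_at_top[of 2]
  proof eventually_elim
    case (elim n)
    then have n: "n \<ge> 2" by simp
    define h where "h = 1 / real n"
    have h: "h > 0" using n by (simp add: h_def)
    let ?EV = "\<lambda>m. EE n m (\<lambda>x. large n K (fst x))"
    \<comment> \<open>The term with \<open>b 0\<close> is the telescoped sum of the increments of b.
      It is harmless, since b stays between 0 and 1.\<close>
    have ind: "EE n m (\<lambda>x. (adev n m x)\<^sup>2) \<le> 2 * T0 * h * (\<Sum>i<m. ?EV i) + real m * (2 * T0 * h * \<delta> + 4 * h\<^sup>2)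
        + 2 * T0 * h * (b 0 - b (real m / real n))"
      if "real m \<le> T0 * real n" for m
      using that
    proof (induction m)
      case 0 then show ?case by (simp add: adev_def)
    next
      case (Suc m)
      have m: "real m \<le> T0 * real n" using Suc.prems by simp
      let ?t = "real m / real n"
      have t': "?t + h = real (Suc m) / real n" by (simp add: h_def add_divide_distrib)
      have "EE n (Suc m) (\<lambda>x. (adev n (Suc m) x)\<^sup>2) \<le> EE n m (\<lambda>x. (adev n m x)\<^sup>2 +
        (2 * T0 * h * (large n K (fst x) + (\<Sum>k\<in>{1..K}. \<bar>xdev n k m x\<bar>) + \<delta> / 2)
         + 2 * T0 * h * (b ?t - b (?t + h)) + 4 * h\<^sup>2))"
      proof (rule EE_step_le[OF n], rule expectation_le_const[OF finite_set_pmf_frozen_step[OF n]])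
        fix x G' assume "x \<in> set_pmf (augmented p n m)"
        from adev_square_step[OF n this Suc.prems tail, of G']
        show "(adev n (Suc m) (G', snd x + merge_rate p (fst x) / (real n)\<^sup>2))\<^sup>2 \<le> (adev n m x)\<^sup>2 +
          (2 * T0 * h * (large n K (fst x) + (\<Sum>k\<in>{1..K}. \<bar>xdev n k m x\<bar>) + \<delta> / 2)
         + 2 * T0 * h * (b ?t - b (?t + h)) + 4 * h\<^sup>2)" by (simp add: h_def)
      qed
      also have "\<dots> = EE n m (\<lambda>x. (adev n m x)\<^sup>2) +
        (2 * T0 * h * (?EV m + (\<Sum>k\<in>{1..K}. EE n m (\<lambda>x. \<bar>xdev n k m x\<bar>)) + \<delta> / 2)
         + 2 * T0 * h * (b ?t - b (?t + h)) + 4 * h\<^sup>2)"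
        by (simp add: EE_add[OF n] EE_sum[OF n])
      also have "\<dots> \<le> EE n m (\<lambda>x. (adev n m x)\<^sup>2) +
        (2 * T0 * h * (?EV m + \<delta>) + 2 * T0 * h * (b ?t - b (?t + h)) + 4 * h\<^sup>2)"
      proof -
        have "(\<Sum>k\<in>{1..K}. EE n m (\<lambda>x. \<bar>xdev n k m x\<bar>)) \<le> (\<Sum>k\<in>{1..K}. \<eta>)"
          using elim(1) m by (intro sum_mono) auto
        then have "?EV m + (\<Sum>k\<in>{1..K}. EE n m (\<lambda>x. \<bar>xdev n k m x\<bar>)) + \<delta> / 2 \<le> ?EV m + \<delta>"
          using K\<eta> by simp
        then have "2 * T0 * h * (?EV m + (\<Sum>k\<in>{1..K}. EE n m (\<lambda>x. \<bar>xdev n k m x\<bar>)) + \<delta> / 2) \<le>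
            2 * T0 * h * (?EV m + \<delta>)"
          by (rule mult_left_mono) (use assms h in simp)
        then show ?thesis by linarith
      qed
      also have "\<dots> \<le> (2 * T0 * h * (\<Sum>i<m. ?EV i) + real m * (2 * T0 * h * \<delta> + 4 * h\<^sup>2)
          + 2 * T0 * h * (b 0 - b ?t)) +
        (2 * T0 * h * (?EV m + \<delta>) + 2 * T0 * h * (b ?t - b (?t + h)) + 4 * h\<^sup>2)"
        by (intro add_right_mono Suc.IH[OF m])
      also have "\<dots> = 2 * T0 * h * (\<Sum>i<Suc m. ?EV i) + real (Suc m) * (2 * T0 * h * \<delta> + 4 * h\<^sup>2)
          + 2 * T0 * h * (b 0 - b (?t + h))"
        unfolding sum.lessThan_Suc by (simp only: of_nat_Suc) (simp add: algebra_simps)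
      finally show ?case unfolding t' .
    qed
    show ?case
    proof (intro allI impI)
      fix m assume m: "real m \<le> T0 * real n"
      have mh: "real m * h \<le> T0" using m n by (simp add: h_def field_simps)
      have "(\<Sum>i<m. ?EV i) \<le> \<delta> * real n"
      proof -
        have "?EV i * real n \<le> EE n i (\<lambda>x. real (card {u \<in> treev (fst x). K1 < csize (fst x) u}))" for i
        proof -
          have "?EV i * real n = EE n i (\<lambda>x. real (card {u \<in> treev (fst x). K < csize (fst x) u}))"
            using n by (simp add: large_def)
          also have "\<dots> \<le> EE n i (\<lambda>x. real (card {u \<in> treev (fst x). K1 < csize (fst x) u}))"
          proof (rule EE_mono[OF n])
            fix x assume "x \<in> set_pmf (augmented p n i)"
            then have "finite (treev (fst x))"
              using aug_support(1)[OF n] valid_graph_wf finite_treev by blast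
            then show "real (card {u \<in> treev (fst x). K < csize (fst x) u}) \<le>
                real (card {u \<in> treev (fst x). K1 < csize (fst x) u})"
              by (intro of_nat_mono card_mono) (auto simp: K_def)
          qed
          finally show ?thesis .
        qed
        then have "(\<Sum>i<m. ?EV i) * real n \<le> \<delta> * (real n)\<^sup>2"
        proof -
          assume le: "?EV i * real n \<le> EE n i (\<lambda>x. real (card {u \<in> treev (fst x). K1 < csize (fst x) u}))" for i
          have "(\<Sum>i<m. ?EV i) * real n \<le>
              (\<Sum>i<m. EE n i (\<lambda>x. real (card {u \<in> treev (fst x). K1 < csize (fst x) u})))"
            unfolding sum_distrib_right by (rule sum_mono) (rule le)
          also have "\<dots> \<le> \<delta> * (real n)\<^sup>2" using elim(3) m by blast
          finally show ?thesis .
        qed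
        then show ?thesis using n by (simp add: power2_eq_square)
      qed
      then have "2 * T0 * h * (\<Sum>i<m. ?EV i) \<le> 2 * T0 * h * (\<delta> * real n)"
        using assms h by (intro mult_left_mono) auto
      also have "\<dots> = 2 * T0 * \<delta>" using n by (simp add: h_def)
      finally have 1: "2 * T0 * h * (\<Sum>i<m. ?EV i) \<le> \<epsilon>\<^sup>2 / 4" using \<delta>T by linarith
      have "real m * (2 * T0 * h * \<delta> + 4 * h\<^sup>2) = (real m * h) * (2 * T0 * \<delta> + 4 * h)"
        by (simp add: algebra_simps power2_eq_square)
      also have "\<dots> \<le> T0 * (2 * T0 * \<delta> + 4 * h)"
        using mh assms \<delta> h by (intro mult_right_mono) auto
      also have "\<dots> = 2 * T0 * (T0 * \<delta>) + 4 * T0 * h" by (simp add: algebra_simps)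
      finally have 2: "real m * (2 * T0 * h * \<delta> + 4 * h\<^sup>2) \<le> \<epsilon>\<^sup>2 / 4 + 4 * T0 * h"
        using \<delta>T by linarith
      have "2 * T0 * h * (b 0 - b (real m / real n)) \<le> 2 * T0 * h * 1"
        using b_range[of 0] b_range[of "real m / real n"] assms h by (intro mult_left_mono) auto
      then have "EE n m (\<lambda>x. (adev n m x)\<^sup>2) \<le> \<epsilon>\<^sup>2 / 4 + (\<epsilon>\<^sup>2 / 4 + 4 * T0 * h) + 2 * T0 * h"
        using ind[OF m] 1 2 by linarith
      also have "\<dots> = \<epsilon>\<^sup>2 / 2 + 6 * T0 / real n" by (simp add: h_def)
      also have "\<dots> \<le> \<epsilon>\<^sup>2" using elim(2) by simp
      finally show "EE n m (\<lambda>x. \<bar>adev n m x\<bar>) \<le> \<epsilon>" by (rule EE_abs_le[OF n assms(2)])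
    qed
  qed
qed

end

section \<open>Limits of the expected tree fractions\<close>

lemma exp_neg_diff_le:
  fixes x y :: real
  assumes "0 \<le> x" "0 \<le> y"
  shows "\<bar>exp (- x) - exp (- y)\<bar> \<le> \<bar>x - y\<bar>"
proof -
  have *: "exp (- x) - exp (- y) \<le> y - x" if "0 \<le> x" "x \<le> y" for x y :: real
  proof -
    have "exp (- x) - exp (- y) = exp (- x) * (1 - exp (- (y - x)))"
      by (simp add: algebra_simps flip: exp_add)
    also have "\<dots> \<le> 1 * (y - x)"
    proof (intro mult_mono)
      show "1 - exp (- (y - x)) \<le> y - x" using exp_ge_add_one_self[of "- (y - x)"] by linarith
    qed (use that in auto)
    finally show ?thesis by simp
  qed
  consider "x \<le> y" | "y \<le> x" by linarith
  then show ?thesis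
  proof cases
    case 1
    then show ?thesis using *[of x y] assms by simp
  next
    case 2
    then show ?thesis using *[of y x] assms by simp
  qed
qed

context frozen_parameter
begin

abbreviation clock :: "real \<Rightarrow> nat \<Rightarrow> nat" where
  "clock t n \<equiv> nat \<lfloor>real n * t\<rfloor>"

text \<open>For k \<ge> 1, the limiting fraction of vertices in trees of size k; by
  \<open>xi_exp_A\<close> it is 1 - g t times a Borel weight.\<close>

definition gamma :: "nat \<Rightarrow> real \<Rightarrow> real" where
  "gamma k t = xi k t * exp (- 2 * real k * A t)"

lemma clock_le: "0 \<le> t \<Longrightarrow> real (clock t n) \<le> t * real n"
  by (simp add: mult.commute)

lemma clock_tendsto:
  assumes "0 \<le> t"
  shows "(\<lambda>n. real (clock t n) / real n) \<longlonglongrightarrow> t"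
proof (rule real_tendsto_sandwich)
  show "(\<lambda>n. t - 1 / real n) \<longlonglongrightarrow> t"
  proof -
    have "(\<lambda>n. t - 1 / real n) \<longlonglongrightarrow> t - 0"
      by (intro tendsto_diff tendsto_const lim_1_over_n)
    then show ?thesis by simp
  qed
  show "\<forall>\<^sub>F n in sequentially. t - 1 / real n \<le> real (clock t n) / real n"
    using eventually_gt_at_top[of 0]
  proof eventually_elim
    case (elim n)
    have "real n * t - 1 \<le> real (clock t n)" using assms by (simp add: of_nat_nat)
    then have "(real n * t - 1) / real n \<le> real (clock t n) / real n"
      by (rule divide_right_mono) simp
    then show ?case using elim by (simp add: diff_divide_distrib)
  qed
  show "\<forall>\<^sub>F n in sequentially. real (clock t n) / real n \<le> t"
    using eventually_gt_at_top[of 0]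
  proof eventually_elim
    case (elim n)
    then show ?case using clock_le[OF assms, of n] by (simp add: field_simps)
  qed
qed (rule tendsto_const)

text \<open>Undoes the exponential weight of \<open>xval\<close>, at the price of the Lipschitz
  dependence of exp (- 2 k a) on a.\<close>

lemma yfrac_gamma:
  assumes n: "n \<ge> 2" and x: "x \<in> set_pmf (augmented p n m)" and m: "real m \<le> T0 * real n"
  shows "\<bar>yfrac n k (fst x) - gamma k (real m / real n)\<bar> \<le>
    \<bar>xdev n k m x\<bar> + 2 * real k * xi k T0 * \<bar>adev n m x\<bar>"
proof -
  note s = aug_support[OF n x]
  let ?t = "real m / real n"
  have t: "0 \<le> ?t" "?t \<le> T0" using m n by (auto simp: field_simps)
  have a: "0 \<le> snd x" using s by simp
  have A: "0 \<le> A ?t" using A_range[OF t(1)] by simp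
  have xiT: "0 \<le> xi k ?t" "xi k ?t \<le> xi k T0"
  proof -
    show "0 \<le> xi k ?t" by (rule xi_nonneg[OF t(1)])
    have "(2 * ?t) ^ (k - 1) \<le> (2 * T0) ^ (k - 1)"
      by (rule power_mono) (use t in linarith)+
    then show "xi k ?t \<le> xi k T0" unfolding xi_def using alpha_nonneg by (rule mult_left_mono)
  qed
  let ?e = "exp (- (2 * real k * snd x))" and ?f = "exp (- (2 * real k * A ?t))"
  have "yfrac n k (fst x) = ?e * xval n k x" by (simp add: xval_def exp_minus field_simps)
  then have "yfrac n k (fst x) - gamma k ?t = ?e * xdev n k m x + xi k ?t * (?e - ?f)"
    by (simp add: gamma_def xdev_def algebra_simps)
  also have "\<bar>\<dots>\<bar> \<le> \<bar>?e * xdev n k m x\<bar> + \<bar>xi k ?t * (?e - ?f)\<bar>" by (rule abs_triangle_ineq)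
  also have "\<dots> \<le> \<bar>xdev n k m x\<bar> + xi k T0 * (2 * real k * \<bar>adev n m x\<bar>)"
  proof (rule add_mono)
    show "\<bar>?e * xdev n k m x\<bar> \<le> \<bar>xdev n k m x\<bar>"
      using a by (simp add: abs_mult mult_left_le_one_le)
    have "\<bar>?e - ?f\<bar> \<le> \<bar>2 * real k * snd x - 2 * real k * A ?t\<bar>"
      using a A by (intro exp_neg_diff_le) auto
    also have "\<dots> = 2 * real k * \<bar>adev n m x\<bar>"
      unfolding adev_def right_diff_distrib[symmetric] by (simp add: abs_mult)
    finally show "\<bar>xi k ?t * (?e - ?f)\<bar> \<le> xi k T0 * (2 * real k * \<bar>adev n m x\<bar>)"
      unfolding abs_mult using xiT by (intro mult_mono) auto
  qed
  finally show ?thesis by (simp add: mult_ac)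
qed

lemma expectation_yfrac_gamma:
  assumes "1 \<le> k" "0 \<le> T0" "0 < \<epsilon>"
  shows "\<forall>\<^sub>F n in sequentially. \<forall>m. real m \<le> T0 * real n \<longrightarrow>
    EE n m (\<lambda>x. \<bar>yfrac n k (fst x) - gamma k (real m / real n)\<bar>) \<le> \<epsilon>"
proof -
  define c where "c = 2 * real k * xi k T0"
  have c: "0 \<le> c" using xi_nonneg[OF assms(2)] by (simp add: c_def)
  define \<delta> where "\<delta> = \<epsilon> / (2 * (c + 1))"
  have \<delta>: "\<delta> > 0" using assms c by (simp add: \<delta>_def)
  have c\<delta>: "c * \<delta> \<le> \<epsilon> / 2"
  proof -
    have "c * \<delta> \<le> (c + 1) * \<delta>" using \<delta> by (intro mult_right_mono) auto
    also have "\<dots> = \<epsilon> / 2" using c by (simp add: \<delta>_def field_simps)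
    finally show ?thesis .
  qed
  show ?thesis
    using xval_converges[OF assms(1,2) half_gt_zero[OF assms(3)]] adev_converges[OF assms(2) \<delta>]
      eventually_ge_at_top[of 2]
  proof eventually_elim
    case (elim n)
    show ?case
    proof (intro allI impI)
      fix m assume m: "real m \<le> T0 * real n"
      have "EE n m (\<lambda>x. \<bar>yfrac n k (fst x) - gamma k (real m / real n)\<bar>) \<le>
          EE n m (\<lambda>x. \<bar>xdev n k m x\<bar> + c * \<bar>adev n m x\<bar>)"
        using yfrac_gamma[OF elim(3) _ m] by (intro EE_mono[OF elim(3)]) (auto simp: c_def)
      also have "\<dots> = EE n m (\<lambda>x. \<bar>xdev n k m x\<bar>) + c * EE n m (\<lambda>x. \<bar>adev n m x\<bar>)"
        by (simp add: EE_add[OF elim(3)])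
      also have "\<dots> \<le> \<epsilon> / 2 + c * \<delta>"
        using elim(1,2) m c by (intro add_mono mult_left_mono) auto
      finally show "EE n m (\<lambda>x. \<bar>yfrac n k (fst x) - gamma k (real m / real n)\<bar>) \<le> \<epsilon>"
        using c\<delta> by simp
    qed
  qed
qed

lemma gamma_tendsto:
  assumes "0 \<le> t"
  shows "(\<lambda>n. gamma k (real (clock t n) / real n)) \<longlonglongrightarrow> gamma k t"
proof -
  let ?s = "\<lambda>n. real (clock t n) / real n"
  have s: "?s \<longlonglongrightarrow> t" by (rule clock_tendsto[OF assms])
  \<comment> \<open>The secant slopes of A lie between values of b, hence in [0, 1].\<close>
  have Lip: "\<bar>A x - A y\<bar> \<le> \<bar>x - y\<bar>" if "0 \<le> x" "x \<le> y" for x y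
  proof -
    have "0 \<le> b y * (y - x)" using b_range[of y] that by simp
    moreover have "b x * (y - x) \<le> 1 * (y - x)"
      by (rule mult_right_mono) (use b_range[of x] that in auto)
    ultimately show ?thesis using A_secant[OF that] that by simp
  qed
  have "(\<lambda>n. A (?s n)) \<longlonglongrightarrow> A t"
  proof (rule Lim_transform_bound[of "\<lambda>n. A (?s n) - A t" "\<lambda>n. ?s n - t", THEN LIM_zero_cancel])
    show "\<forall>\<^sub>F n in sequentially. norm (A (?s n) - A t) \<le> norm (?s n - t)"
      using eventually_gt_at_top[of 0]
    proof eventually_elim
      case (elim n)
      have "?s n \<le> t" using clock_le[OF assms, of n] elim by (simp add: field_simps)
      then show ?case using Lip[of "?s n" t] by simp
    qed
    show "(\<lambda>n. ?s n - t) \<longlonglongrightarrow> 0" using s by (simp add: LIM_zero)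
  qed
  then show ?thesis unfolding gamma_def xi_def by (intro tendsto_intros s)
qed

theorem expectation_yfrac_limit:
  assumes "0 \<le> t" "1 \<le> k"
  shows "(\<lambda>n. EE n (clock t n) (\<lambda>x. yfrac n k (fst x))) \<longlonglongrightarrow> gamma k t"
proof (rule LIM_zero_cancel, rule tendsto_rabs_zero_cancel, rule tendstoI)
  fix e :: real assume e: "0 < e"
  have "\<forall>\<^sub>F n in sequentially. dist (gamma k (real (clock t n) / real n)) (gamma k t) < e / 2"
    using gamma_tendsto[OF assms(1), of k] e by (intro tendstoD) auto
  moreover have "\<forall>\<^sub>F n in sequentially. \<forall>m. real m \<le> t * real n \<longrightarrow>
    EE n m (\<lambda>x. \<bar>yfrac n k (fst x) - gamma k (real m / real n)\<bar>) \<le> e / 3"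
    using assms e by (intro expectation_yfrac_gamma) auto
  ultimately show "\<forall>\<^sub>F n in sequentially. dist \<bar>EE n (clock t n) (\<lambda>x. yfrac n k (fst x)) - gamma k t\<bar> 0 < e"
    using eventually_ge_at_top[of 2]
  proof eventually_elim
    case (elim n)
    let ?m = "clock t n" and ?g = "gamma k (real (clock t n) / real n)"
    have "\<bar>EE n ?m (\<lambda>x. yfrac n k (fst x)) - ?g\<bar> = \<bar>EE n ?m (\<lambda>x. yfrac n k (fst x) - ?g)\<bar>"
      by (simp add: EE_diff[OF elim(3)])
    also have "\<dots> \<le> EE n ?m (\<lambda>x. \<bar>yfrac n k (fst x) - ?g\<bar>)" by (rule integral_abs_bound)
    also have "\<dots> \<le> e / 3" using elim(2) clock_le[OF assms(1), of n] by blast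
    finally have "\<bar>EE n ?m (\<lambda>x. yfrac n k (fst x)) - gamma k t\<bar> < e"
      using elim(1) e unfolding dist_real_def by linarith
    then show ?case by (simp add: dist_real_def)
  qed
qed

definition vfrac :: "nat \<Rightarrow> nat multigraph \<Rightarrow> real" where
  "vfrac n G = real (card (treev G)) / real n"

text \<open>Frozen vertices never become free again.\<close>

lemma EE_vfrac_antimono:
  assumes n: "n \<ge> 2" and "i \<le> j"
  shows "EE n j (\<lambda>x. vfrac n (fst x)) \<le> EE n i (\<lambda>x. vfrac n (fst x))"
  using assms(2)
proof (induction j rule: dec_induct)
  case (step j)
  have "EE n (Suc j) (\<lambda>x. vfrac n (fst x)) \<le> EE n j (\<lambda>x. vfrac n (fst x))"
  proof (rule EE_step_le[OF n], rule expectation_le_const[OF finite_set_pmf_frozen_step[OF n]])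
    fix x G' assume x: "x \<in> set_pmf (augmented p n j)" and G': "G' \<in> set_pmf (frozen_step p n (fst x))"
    note s = aug_support[OF n x]
    have "treev G' \<subseteq> treev (fst x)" by (rule frozen_step_support(3)[OF s(1,2) n G'])
    moreover have "finite (treev (fst x))" using s valid_graph_wf finite_treev by blast
    ultimately show "vfrac n (fst (G', snd x + merge_rate p (fst x) / (real n)\<^sup>2)) \<le> vfrac n (fst x)"
      by (simp add: vfrac_def divide_right_mono card_mono)
  qed
  then show ?case using step.IH by linarith
qed simp

lemma EE_vfrac_le_1: "n \<ge> 2 \<Longrightarrow> EE n m (\<lambda>x. vfrac n (fst x)) \<le> 1"
proof (rule expectation_le_const[OF finite_set_pmf_augmented], assumption)
  fix x assume "n \<ge> 2" "x \<in> set_pmf (augmented p n m)"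
  then show "vfrac n (fst x) \<le> 1"
    using card_treev_le[OF aug_support(2)] by (simp add: vfrac_def)
qed

lemma EE_vfrac_split:
  assumes n: "n \<ge> 2"
  shows "EE n m (\<lambda>x. vfrac n (fst x)) =
    (\<Sum>k\<in>{1..K}. EE n m (\<lambda>x. yfrac n k (fst x))) + EE n m (\<lambda>x. large n K (fst x))"
proof -
  have "EE n m (\<lambda>x. vfrac n (fst x)) = EE n m (\<lambda>x. (\<Sum>k\<in>{1..K}. yfrac n k (fst x)) + large n K (fst x))"
  proof (rule integral_cong_AE)
    show "AE x in measure_pmf (augmented p n m). vfrac n (fst x) = (\<Sum>k\<in>{1..K}. yfrac n k (fst x)) + large n K (fst x)"
      unfolding AE_measure_pmf_iff vfrac_def
      using tree_fraction_split aug_support(1)[OF n] valid_graph_wf by blast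
  qed auto
  then show ?thesis by (simp add: EE_add[OF n] EE_sum[OF n])
qed

lemma EE_large_nonneg: "0 \<le> EE n m (\<lambda>x. large n K (fst x))"
  by (rule expectation_nonneg) (simp add: large_def)

text \<open>Tightness is known only in the sum over time, so the bound is averaged over the steps
  between s n and t n, where g is at least g t - e. By monotonicity the value at the end is below
  each value in the window. The three e come from g, from the K small sizes and from the large
  trees.\<close>

lemma vfrac_upper:
  assumes t: "1 / 2 < t" and e: "0 < e"
  shows "\<forall>\<^sub>F n in sequentially. EE n (clock t n) (\<lambda>x. vfrac n (fst x)) \<le> 1 - g t + 3 * e"
proof -
  obtain s0 where s0: "s0 < t" "\<And>x. s0 < x \<Longrightarrow> g t - e \<le> g x" using g_left_continuous[OF e] by blast
  define s where "s = max s0 0"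
  have s: "0 \<le> s" "s < t" "\<And>x. s < x \<Longrightarrow> g t - e \<le> g x" using s0 t by (auto simp: s_def)
  have t0: "0 \<le> t" using t by simp
  \<comment> \<open>Spread over a window of at least (t - s) n / 2 steps, this total costs e per
    step.\<close>
  define \<eta> where "\<eta> = e * (t - s) / 2"
  have \<eta>: "\<eta> > 0" using e s by (simp add: \<eta>_def)
  obtain K where K: "\<forall>\<^sub>F n in sequentially. \<forall>M. real M \<le> t * real n \<longrightarrow>
    (\<Sum>m<M. EE n m (\<lambda>x. real (card {u \<in> treev (fst x). K < csize (fst x) u}))) \<le> \<eta> * (real n)\<^sup>2"
    using expectation_large_trees[OF \<eta> t0] by blast
  have "\<forall>\<^sub>F n in sequentially. \<forall>k\<in>{1..K}. \<forall>m. real m \<le> t * real n \<longrightarrow>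
    EE n m (\<lambda>x. \<bar>yfrac n k (fst x) - gamma k (real m / real n)\<bar>) \<le> e / (real K + 1)"
    using e t0 by (intro eventually_ball_finite ballI expectation_yfrac_gamma) auto
  moreover have "\<forall>\<^sub>F n in sequentially. 2 / real n \<le> (t - s) / 2"
    using s by (intro eventually_const_over_n) simp
  ultimately show ?thesis using K eventually_ge_at_top[of 2]
  proof eventually_elim
    case (elim n)
    then have n: "n \<ge> 2" by simp
    \<comment> \<open>The successor puts m / n strictly above s for all m \<ge> m0.\<close>
    define m0 where "m0 = Suc (clock s n)"
    define m1 where "m1 = clock t n"
    have m1: "real m1 \<le> t * real n" using clock_le[OF t0] by (simp add: m1_def)
    have m0: "real m0 > s * real n" "real m0 \<le> s * real n + 1"
      unfolding m0_def using s(1) clock_le[OF s(1), of n]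
        real_of_int_floor_add_one_gt[of "s * real n"]
      by (simp_all add: mult.commute add.commute)
    have m1': "real m1 \<ge> t * real n - 1"
      unfolding m1_def using t0 by (simp add: mult.commute)
    have "2 \<le> (t - s) / 2 * real n" using elim(2) n by (simp add: field_simps)
    then have len: "real m1 - real m0 \<ge> (t - s) / 2 * real n" 
    proof -
      have "y - 1 \<le> m \<Longrightarrow> m' \<le> x + 1 \<Longrightarrow> 2 \<le> (y - x) / 2 \<Longrightarrow> (y - x) / 2 \<le> m - m'"
        for x y m m' :: real by (simp add: field_simps)
      from this[OF m1' m0(2)] \<open>2 \<le> (t - s) / 2 * real n\<close> show ?thesis
        by (simp add: left_diff_distrib)
    qed
    then have len0: "real m1 - real m0 > 0" using s(2) n by (intro less_le_trans[OF _ len]) auto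
    then have m01: "m0 \<le> m1" by simp
    let ?v = "\<lambda>m. EE n m (\<lambda>x. vfrac n (fst x))" and ?L = "\<lambda>m. EE n m (\<lambda>x. large n K (fst x))"
    have bound: "?v m1 \<le> ?L m + (1 - g t + 2 * e)" if m: "m \<in> {m0..<m1}" for m
    proof -
      let ?s = "real m / real n"
      have mt: "real m \<le> t * real n" using m m1 by auto
      have "s * real n < real m" using m m0 by auto
      then have sm: "s < ?s" using n by (simp add: field_simps)
      have "EE n m (\<lambda>x. yfrac n k (fst x)) \<le> gamma k ?s + e / (real K + 1)" if "k \<in> {1..K}" for k
      proof -
        have "EE n m (\<lambda>x. yfrac n k (fst x)) \<le> EE n m (\<lambda>x. gamma k ?s + \<bar>yfrac n k (fst x) - gamma k ?s\<bar>)"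
          by (rule EE_mono[OF n]) linarith
        also have "\<dots> = gamma k ?s + EE n m (\<lambda>x. \<bar>yfrac n k (fst x) - gamma k ?s\<bar>)"
          by (simp add: EE_add[OF n])
        finally show ?thesis using elim(1) that mt by fastforce
      qed
      then have "(\<Sum>k\<in>{1..K}. EE n m (\<lambda>x. yfrac n k (fst x))) \<le> (\<Sum>k\<in>{1..K}. gamma k ?s + e / (real K + 1))"
        by (rule sum_mono)
      also have "\<dots> = (\<Sum>k\<in>{1..K}. gamma k ?s) + real K * (e / (real K + 1))" by (simp add: sum.distrib)
      also have "\<dots> \<le> (1 - g ?s) + e"
      proof (rule add_mono)
        show "(\<Sum>k\<in>{1..K}. gamma k ?s) \<le> 1 - g ?s" unfolding gamma_def by (rule xi_sum_le) simp
        have "real K * (e / (real K + 1)) \<le> (real K + 1) * (e / (real K + 1))"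
          using e by (intro mult_right_mono) auto
        also have "\<dots> = e" by (simp add: add_nonneg_eq_0_iff)
        finally show "real K * (e / (real K + 1)) \<le> e" .
      qed
      also have "\<dots> \<le> 1 - g t + 2 * e" using s(3)[OF sm] by simp
      finally have "?v m \<le> 1 - g t + 2 * e + ?L m" unfolding EE_vfrac_split[OF n, of m K] by simp
      moreover have "?v m1 \<le> ?v m" using m by (intro EE_vfrac_antimono[OF n]) auto
      ultimately show ?thesis by linarith
    qed
    have "(real m1 - real m0) * ?v m1 = (\<Sum>m\<in>{m0..<m1}. ?v m1)" using m01 by (simp add: of_nat_diff)
    also have "\<dots> \<le> (\<Sum>m\<in>{m0..<m1}. ?L m + (1 - g t + 2 * e))" using bound by (rule sum_mono)
    also have "\<dots> = (\<Sum>m\<in>{m0..<m1}. ?L m) + (real m1 - real m0) * (1 - g t + 2 * e)"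
      using m01 by (simp add: sum.distrib of_nat_diff)
    also have "(\<Sum>m\<in>{m0..<m1}. ?L m) \<le> (\<Sum>m<m1. ?L m)"
      using EE_large_nonneg by (intro sum_mono2) auto
    also have "(\<Sum>m<m1. ?L m) = (\<Sum>m<m1. EE n m (\<lambda>x. real (card {u \<in> treev (fst x). K < csize (fst x) u}))) / real n"
      by (simp add: large_def sum_divide_distrib)
    also have "\<dots> \<le> \<eta> * (real n)\<^sup>2 / real n" using elim(3) m1 by (intro divide_right_mono) auto
    also have "\<dots> = e * ((t - s) / 2 * real n)" using n by (simp add: \<eta>_def power2_eq_square)
    also have "\<dots> \<le> e * (real m1 - real m0)" using len e by (intro mult_left_mono) auto
    finally have "(real m1 - real m0) * ?v m1 \<le> (real m1 - real m0) * (1 - g t + 3 * e)"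
      by (simp add: algebra_simps)
    then show ?case using len0 unfolding m1_def by (simp only: mult_le_cancel_left_pos)
  qed
qed

text \<open>Finitely many sizes already give the lower bound; only the upper bound has to exclude
  escaping mass. Up to time 1 / 2 the upper bound is trivial, as g vanishes.\<close>

theorem expectation_vfrac_limit:
  assumes t: "0 \<le> t"
  shows "(\<lambda>n. EE n (clock t n) (\<lambda>x. vfrac n (fst x))) \<longlonglongrightarrow> 1 - g t"
proof (rule tendstoI)
  fix e :: real assume e: "0 < e"
  have upper: "\<forall>\<^sub>F n in sequentially. EE n (clock t n) (\<lambda>x. vfrac n (fst x)) \<le> 1 - g t + 3 * (e / 6)"
  proof (cases "t \<le> 1 / 2")
    case True
    show ?thesis using eventually_ge_at_top[of 2]
    proof eventually_elim
      case (elim n)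
      then show ?case using EE_vfrac_le_1[OF elim, of "clock t n"] e by (simp add: g_eq_0[OF True])
    qed
  next
    case False
    then show ?thesis using e by (intro vfrac_upper) auto
  qed
  obtain K where K: "1 - g t - (\<Sum>k\<in>{1..K}. xi k t * exp (- 2 * real k * A t)) \<le> e / 2"
  proof -
    obtain K0 where "\<And>K t. K0 \<le> K \<Longrightarrow> 0 \<le> t \<Longrightarrow>
      1 - g t - (\<Sum>k\<in>{1..K}. xi k t * exp (- 2 * real k * A t)) \<le> e / 2"
      using xi_tail[of "e / 2"] e by auto
    from that[OF this[OF order_refl t]] show ?thesis .
  qed
  have "(\<lambda>n. \<Sum>k\<in>{1..K}. EE n (clock t n) (\<lambda>x. yfrac n k (fst x))) \<longlonglongrightarrow> (\<Sum>k\<in>{1..K}. gamma k t)"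
    using t by (intro tendsto_sum expectation_yfrac_limit) auto
  then have "\<forall>\<^sub>F n in sequentially. (\<Sum>k\<in>{1..K}. EE n (clock t n) (\<lambda>x. yfrac n k (fst x))) > (\<Sum>k\<in>{1..K}. gamma k t) - e / 3"
    using e by (intro order_tendstoD) auto
  with upper show "\<forall>\<^sub>F n in sequentially. dist (EE n (clock t n) (\<lambda>x. vfrac n (fst x))) (1 - g t) < e"
    using eventually_ge_at_top[of 2]
  proof eventually_elim
    case (elim n)
    have "EE n (clock t n) (\<lambda>x. vfrac n (fst x)) > (\<Sum>k\<in>{1..K}. gamma k t) - e / 3"
      using elim(2) EE_large_nonneg[of n "clock t n" K] unfolding EE_vfrac_split[OF elim(3), of _ K] by linarith
    moreover have "(\<Sum>k\<in>{1..K}. gamma k t) \<ge> 1 - g t - e / 2" using K unfolding gamma_def by linarith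
    ultimately show ?case using elim(1) e by (auto simp: dist_real_def abs_less_iff)
  qed
qed

end

section \<open>Exchangeability and uniform forests\<close>

lemma verts_relabel [simp]: "verts (relabel \<sigma> G) = \<sigma> ` verts G"
  and edges_relabel [simp]: "edges (relabel \<sigma> G) = image_mset ((`) \<sigma>) (edges G)"
  by (simp_all add: relabel_def)

lemma relabel_cong:
  assumes "wf_graph G" "\<And>v. v \<in> verts G \<Longrightarrow> \<sigma> v = \<tau> v"
  shows "relabel \<sigma> G = relabel \<tau> G"
proof -
  have "\<sigma> ` e = \<tau> ` e" if "e \<in># edges G" for e
    using that assms by (intro image_cong) (auto simp: wf_graph_def)
  then show ?thesis using assms(2) by (auto simp: relabel_def intro!: image_mset_cong)
qed

lemma relabel_relabel: "relabel \<tau> (relabel \<sigma> G) = relabel (\<lambda>v. \<tau> (\<sigma> v)) G"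
  by (simp add: relabel_def image_image multiset.map_comp comp_def)

lemma relabel_id: "wf_graph G \<Longrightarrow> (\<And>v. v \<in> verts G \<Longrightarrow> \<sigma> v = v) \<Longrightarrow> relabel \<sigma> G = G"
proof -
  have "(`) (\<lambda>v. v) = (\<lambda>e :: 'a set. e)" by auto
  then have "relabel (\<lambda>v. v) G = G" by (simp add: relabel_def)
  then show "wf_graph G \<Longrightarrow> (\<And>v. v \<in> verts G \<Longrightarrow> \<sigma> v = v) \<Longrightarrow> relabel \<sigma> G = G"
    using relabel_cong[of G \<sigma> "\<lambda>v. v"] by simp
qed

lemma relabel_inv_into:
  assumes "wf_graph G" "inj_on \<sigma> (verts G)"
  shows "relabel (inv_into (verts G) \<sigma>) (relabel \<sigma> G) = G"
  unfolding relabel_relabel using assms by (intro relabel_id) auto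

lemma wf_relabel:
  assumes "wf_graph G" "inj_on \<sigma> (verts G)"
  shows "wf_graph (relabel \<sigma> G)"
proof -
  have "card (\<sigma> ` e) = 2" if "e \<in># edges G" for e
    using that assms by (subst card_image) (auto simp: wf_graph_def intro: inj_on_subset)
  then show ?thesis using assms by (auto simp: wf_graph_def)
qed

lemma adjacency_relabel: "(u, v) \<in> (adjacency G)\<^sup>* \<Longrightarrow> (\<sigma> u, \<sigma> v) \<in> (adjacency (relabel \<sigma> G))\<^sup>*"
proof (induction rule: rtrancl_induct)
  case (step y z)
  have "\<sigma> ` {y, z} \<in># edges (relabel \<sigma> G)"
    using step.hyps(2) by (auto simp: adjacency_def simp del: image_insert)
  then have "(\<sigma> y, \<sigma> z) \<in> adjacency (relabel \<sigma> G)" by (simp add: adjacency_def)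
  then show ?case using step.IH by auto
qed simp

lemma reach_relabel:
  assumes "wf_graph G" "inj_on \<sigma> (verts G)" "u \<in> verts G"
  shows "reach (relabel \<sigma> G) (\<sigma> u) = \<sigma> ` reach G u"
proof
  show "\<sigma> ` reach G u \<subseteq> reach (relabel \<sigma> G) (\<sigma> u)"
    using adjacency_relabel by (fastforce simp: reach_def)
  show "reach (relabel \<sigma> G) (\<sigma> u) \<subseteq> \<sigma> ` reach G u"
  proof
    fix w assume w: "w \<in> reach (relabel \<sigma> G) (\<sigma> u)"
    then obtain v where v: "v \<in> verts G" "w = \<sigma> v" by (auto simp: reach_def)
    let ?i = "inv_into (verts G) \<sigma>"
    have "(?i (\<sigma> u), ?i (\<sigma> v)) \<in> (adjacency (relabel ?i (relabel \<sigma> G)))\<^sup>*"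
      by (rule adjacency_relabel) (use w v in \<open>auto simp: reach_def\<close>)
    then have "(u, v) \<in> (adjacency G)\<^sup>*" using assms v by (simp add: relabel_inv_into)
    then show "w \<in> \<sigma> ` reach G u" using v by (auto simp: reach_def)
  qed
qed

lemma component_relabel:
  assumes "wf_graph G" "inj_on \<sigma> (verts G)" "u \<in> verts G"
  shows "component (relabel \<sigma> G) (\<sigma> u) = relabel \<sigma> (component G u)"
proof -
  have "\<sigma> ` e \<subseteq> \<sigma> ` reach G u \<longleftrightarrow> e \<subseteq> reach G u" if "e \<in># edges G" for e
    using that assms reach_subset[of G u]
    by (intro inj_on_image_subset_iff[OF assms(2)]) (auto simp: wf_graph_def)
  then have "filter_mset (\<lambda>e. \<sigma> ` e \<subseteq> \<sigma> ` reach G u) (edges G) = filter_mset (\<lambda>e. e \<subseteq> reach G u) (edges G)"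
    by (intro filter_mset_cong) auto
  then show ?thesis
    by (intro multigraph.expand)
       (simp add: reach_relabel[OF assms] edges_component filter_mset_image_mset comp_def)
qed

lemma connected_relabel: "connected_graph G \<Longrightarrow> connected_graph (relabel \<sigma> G)"
  using adjacency_relabel by (fastforce simp: connected_graph_def)

lemma is_tree_relabel:
  assumes "wf_graph G" "inj_on \<sigma> (verts G)"
  shows "is_tree (relabel \<sigma> G) \<longleftrightarrow> is_tree G"
proof -
  have "connected_graph G" if "connected_graph (relabel \<sigma> G)"
    using connected_relabel[OF that, of "inv_into (verts G) \<sigma>"] relabel_inv_into[OF assms] by simp
  then show ?thesis using assms connected_relabel[of G \<sigma>]
    by (auto simp: is_tree_def card_image wf_graph_def)
qed

lemma is_unicycle_relabel:
  assumes "wf_graph G" "inj_on \<sigma> (verts G)"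
  shows "is_unicycle (relabel \<sigma> G) \<longleftrightarrow> is_unicycle G"
proof -
  have "connected_graph G" if "connected_graph (relabel \<sigma> G)"
    using connected_relabel[OF that, of "inv_into (verts G) \<sigma>"] relabel_inv_into[OF assms] by simp
  then show ?thesis using assms connected_relabel[of G \<sigma>]
    by (auto simp: is_unicycle_def card_image wf_graph_def)
qed

text \<open>A permutation of the labels permutes the possible edges and preserves the type of each
  component, so every branch of the step is carried along.\<close>

lemma frozen_step_relabel:
  assumes \<sigma>: "\<sigma> permutes {1..n}" and G: "wf_graph G" "verts G = {1..n}" and n: "n \<ge> 2"
  shows "frozen_step p n (relabel \<sigma> G) = map_pmf (relabel \<sigma>) (frozen_step p n G)"
proof -
  have inj: "inj \<sigma>" using \<sigma> permutes_inj by blast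
  have "bij_betw ((`) \<sigma>) (possible_edges n) (possible_edges n)"
  proof (rule bij_betwI')
    show "(\<sigma> ` x = \<sigma> ` y) = (x = y)" for x y using inj by (simp add: inj_image_eq_iff)
    show "\<sigma> ` x \<in> possible_edges n" if "x \<in> possible_edges n" for x
    proof -
      have "card (\<sigma> ` x) = card x" using inj by (intro card_image) (rule inj_on_subset, auto)
      moreover have "\<sigma> ` x \<subseteq> \<sigma> ` {1..n}" using that unfolding possible_edges_def by blast
      ultimately show ?thesis using that permutes_image[OF \<sigma>] by (simp add: possible_edges_def)
    qed
    show "\<exists>x\<in>possible_edges n. y = \<sigma> ` x" if "y \<in> possible_edges n" for y
    proof (rule bexI[of _ "inv \<sigma> ` y"])
      have s': "inv \<sigma> permutes {1..n}" using \<sigma> by (rule permutes_inv)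
      show "y = \<sigma> ` inv \<sigma> ` y" using \<sigma> by (simp add: image_image permutes_inverses)
      show "inv \<sigma> ` y \<in> possible_edges n"
      proof -
        have "card (inv \<sigma> ` y) = card y"
          using permutes_inj[OF s'] by (intro card_image) (rule inj_on_subset, auto)
        moreover have "inv \<sigma> ` y \<subseteq> inv \<sigma> ` {1..n}" using that unfolding possible_edges_def by blast
        ultimately show ?thesis using that permutes_image[OF s'] by (simp add: possible_edges_def)
      qed
    qed
  qed
  then have eq: "pmf_of_set (possible_edges n) = map_pmf ((`) \<sigma>) (pmf_of_set (possible_edges n))"
    using map_pmf_of_set_bij_betw[of "(`) \<sigma>" "possible_edges n" "possible_edges n"] n
      possible_edges_nonempty by simp
  have "frozen_step p n (relabel \<sigma> G) = bind_pmf (pmf_of_set (possible_edges n)) (\<lambda>e.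
       if \<forall>v\<in>\<sigma> ` e. is_tree (component (relabel \<sigma> G) v) then return_pmf (add_edge (\<sigma> ` e) (relabel \<sigma> G))
       else if \<forall>v\<in>\<sigma> ` e. is_unicycle (component (relabel \<sigma> G) v) then return_pmf (relabel \<sigma> G)
       else map_pmf (\<lambda>b. if b then add_edge (\<sigma> ` e) (relabel \<sigma> G) else relabel \<sigma> G) (bernoulli_pmf p))"
    unfolding frozen_step_def by (subst eq, subst bind_map_pmf, rule refl)
  also have "\<dots> = bind_pmf (pmf_of_set (possible_edges n)) (\<lambda>e. map_pmf (relabel \<sigma>) (
       if \<forall>v\<in>e. is_tree (component G v) then return_pmf (add_edge e G)
       else if \<forall>v\<in>e. is_unicycle (component G v) then return_pmf G
       else map_pmf (\<lambda>b. if b then add_edge e G else G) (bernoulli_pmf p)))"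
  proof (rule bind_pmf_cong[OF refl])
    fix e assume "e \<in> set_pmf (pmf_of_set (possible_edges n))"
    then have "e \<in> possible_edges n" using possible_edges_nonempty[OF n] by simp
    then have "e \<subseteq> verts G" unfolding G(2) possible_edges_def by blast
    then have c: "component (relabel \<sigma> G) (\<sigma> v) = relabel \<sigma> (component G v)" if "v \<in> e" for v
      using that G inj by (intro component_relabel) (auto intro: inj_on_subset)
    have i: "inj_on \<sigma> (verts (component G v))" for v using inj by (rule inj_on_subset) simp
    have t: "is_tree (component (relabel \<sigma> G) (\<sigma> v)) \<longleftrightarrow> is_tree (component G v)"
      "is_unicycle (component (relabel \<sigma> G) (\<sigma> v)) \<longleftrightarrow> is_unicycle (component G v)" if "v \<in> e" for v
      unfolding c[OF that] using is_tree_relabel[OF wf_component[OF G(1)] i]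
        is_unicycle_relabel[OF wf_component[OF G(1)] i] by auto
    have a: "add_edge (\<sigma> ` e) (relabel \<sigma> G) = relabel \<sigma> (add_edge e G)"
      by (simp add: add_edge_def relabel_def)
    have iff: "(\<forall>v\<in>\<sigma> ` e. is_tree (component (relabel \<sigma> G) v)) \<longleftrightarrow> (\<forall>v\<in>e. is_tree (component G v))"
      "(\<forall>v\<in>\<sigma> ` e. is_unicycle (component (relabel \<sigma> G) v)) \<longleftrightarrow> (\<forall>v\<in>e. is_unicycle (component G v))"
      using t by auto
    show "(if \<forall>v\<in>\<sigma> ` e. is_tree (component (relabel \<sigma> G) v) then return_pmf (add_edge (\<sigma> ` e) (relabel \<sigma> G))
       else if \<forall>v\<in>\<sigma> ` e. is_unicycle (component (relabel \<sigma> G) v) then return_pmf (relabel \<sigma> G)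
       else map_pmf (\<lambda>b. if b then add_edge (\<sigma> ` e) (relabel \<sigma> G) else relabel \<sigma> G) (bernoulli_pmf p)) =
      map_pmf (relabel \<sigma>) (
       if \<forall>v\<in>e. is_tree (component G v) then return_pmf (add_edge e G)
       else if \<forall>v\<in>e. is_unicycle (component G v) then return_pmf G
       else map_pmf (\<lambda>b. if b then add_edge e G else G) (bernoulli_pmf p))"
      unfolding iff if_distrib[of "map_pmf (relabel \<sigma>)"] map_return_pmf map_pmf_comp
        if_distrib[of "relabel \<sigma>"] a ..
  qed
  also have "\<dots> = map_pmf (relabel \<sigma>) (frozen_step p n G)"
    unfolding frozen_step_def map_bind_pmf ..
  finally show ?thesis .
qed

lemma frozen_graph_support:
  assumes "n \<ge> 2" "G \<in> set_pmf (frozen_graph p n m)"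
  shows "valid_graph G" "verts G = {1..n}"
proof -
  have "valid_graph G \<and> verts G = {1..n}"
    using assms(2)
  proof (induction m arbitrary: G)
    case 0 then show ?case using valid_empty_graph by simp
  next
    case (Suc m)
    then obtain G0 where "G0 \<in> set_pmf (frozen_graph p n m)" "G \<in> set_pmf (frozen_step p n G0)"
      by auto
    then show ?case using Suc.IH[of G0] frozen_step_support(1,2)[OF _ _ assms(1), of G0 G p] by blast
  qed
  then show "valid_graph G" "verts G = {1..n}" by auto
qed

lemma finite_set_pmf_frozen_graph: "n \<ge> 2 \<Longrightarrow> finite (set_pmf (frozen_graph p n m))"
  by (induction m) (auto simp: finite_set_pmf_frozen_step)

lemma frozen_graph_exchangeable:
  assumes \<sigma>: "\<sigma> permutes {1..n}" and n: "n \<ge> 2"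
  shows "map_pmf (relabel \<sigma>) (frozen_graph p n m) = frozen_graph p n m"
proof (induction m)
  case 0
  have "\<sigma> ` {1..n} = {1..n}" using \<sigma> by (rule permutes_image)
  then show ?case by (simp add: relabel_def)
next
  case (Suc m)
  have "map_pmf (relabel \<sigma>) (frozen_graph p n (Suc m)) =
      bind_pmf (frozen_graph p n m) (\<lambda>G. map_pmf (relabel \<sigma>) (frozen_step p n G))"
    by (simp add: map_bind_pmf)
  also have "\<dots> = bind_pmf (frozen_graph p n m) (\<lambda>G. frozen_step p n (relabel \<sigma> G))"
  proof (rule bind_pmf_cong[OF refl])
    fix G assume "G \<in> set_pmf (frozen_graph p n m)"
    then show "map_pmf (relabel \<sigma>) (frozen_step p n G) = frozen_step p n (relabel \<sigma> G)"
      using frozen_step_relabel[OF \<sigma> _ _ n] frozen_graph_support[OF n] valid_graph_wf by metis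
  qed
  also have "\<dots> = bind_pmf (map_pmf (relabel \<sigma>) (frozen_graph p n m)) (frozen_step p n)"
    by (simp add: bind_map_pmf)
  finally show ?case using Suc by simp
qed

text \<open>Exchangeability under the transposition of u and v. The component itself gets renamed,
  whence the invariance required of P.\<close>

lemma prob_component_exchangeable:
  assumes n: "n \<ge> 2" and uv: "u \<in> {1..n}" "v \<in> {1..n}"
    and inv: "\<And>\<sigma> H. wf_graph H \<Longrightarrow> inj \<sigma> \<Longrightarrow> P (relabel \<sigma> H) \<longleftrightarrow> P H"
  shows "measure_pmf.prob (frozen_graph p n m) {G. P (component G u)} =
    measure_pmf.prob (frozen_graph p n m) {G. P (component G v)}"
proof -
  let ?\<sigma> = "Transposition.transpose u v"
  have \<sigma>: "?\<sigma> permutes {1..n}" using uv by (rule permutes_swap_id)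
  have "measure_pmf.prob (frozen_graph p n m) {G. P (component G v)} =
      measure_pmf.prob (map_pmf (relabel ?\<sigma>) (frozen_graph p n m)) {G. P (component G v)}"
    by (simp only: frozen_graph_exchangeable[OF \<sigma> n])
  also have "\<dots> = measure_pmf.prob (frozen_graph p n m) {G. P (component (relabel ?\<sigma> G) v)}"
    by (simp add: vimage_def)
  also have "\<dots> = measure_pmf.prob (frozen_graph p n m) {G. P (component G u)}"
  proof (rule measure_pmf.finite_measure_eq_AE)
    have "P (component (relabel ?\<sigma> G) v) \<longleftrightarrow> P (component G u)" if "G \<in> set_pmf (frozen_graph p n m)" for G
    proof -
      have wf: "wf_graph G" and V: "verts G = {1..n}"
        using frozen_graph_support[OF n that] valid_graph_wf by auto
      have "component (relabel ?\<sigma> G) (?\<sigma> u) = relabel ?\<sigma> (component G u)"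
        using uv V wf
        by (intro component_relabel) (auto intro: inj_on_subset[OF permutes_inj[OF \<sigma>]])
      then show ?thesis using inv[OF wf_component[OF wf] permutes_inj[OF \<sigma>]] by simp
    qed
    then show "AE G in measure_pmf (frozen_graph p n m).
      (G \<in> {G. P (component (relabel ?\<sigma> G) v)}) = (G \<in> {G. P (component G u)})"
      by (simp add: AE_measure_pmf_iff)
  qed auto
  finally show ?thesis ..
qed

lemma sum_prob_eq_expectation:
  assumes "n \<ge> 2"
  shows "(\<Sum>v\<in>{1..n}. measure_pmf.prob (frozen_graph p n m) {G. Q G v}) =
    measure_pmf.expectation (frozen_graph p n m) (\<lambda>G. real (card {v \<in> {1..n}. Q G v}))"
proof -
  have "(\<Sum>v\<in>{1..n}. measure_pmf.prob (frozen_graph p n m) {G. Q G v}) =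
      (\<Sum>v\<in>{1..n}. measure_pmf.expectation (frozen_graph p n m) (\<lambda>G. indicator {G. Q G v} G))"
    by simp
  also have "\<dots> = measure_pmf.expectation (frozen_graph p n m) (\<lambda>G. \<Sum>v\<in>{1..n}. indicator {G. Q G v} G)"
    using assms by (subst Bochner_Integration.integral_sum)
      (auto intro!: integrable_finite_pmf finite_set_pmf_frozen_graph)
  also have "\<dots> = measure_pmf.expectation (frozen_graph p n m) (\<lambda>G. real (card {v \<in> {1..n}. Q G v}))"
    by (simp add: indicator_def sum.If_cases Int_def)
  finally show ?thesis .
qed

section \<open>Interchanging forests on the same vertices\<close>

lemma component_disjoint_union:
  assumes wf1: "wf_graph (Multigraph S E)" and wf2: "wf_graph (Multigraph R F)"
    and dis: "S \<inter> R = {}" and v: "v \<in> S"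
  shows "component (Multigraph (S \<union> R) (E + F)) v = component (Multigraph S E) v"
proof -
  let ?G = "Multigraph (S \<union> R) (E + F)" and ?H = "Multigraph S E"
  have F: "e \<subseteq> R" "e \<noteq> {}" if "e \<in># F" for e
  proof -
    show "e \<subseteq> R" using that wf2 by (auto simp: wf_graph_def)
    have "card e = 2" using that wf2 by (auto simp: wf_graph_def)
    then show "e \<noteq> {}" by auto
  qed
  have E: "e \<subseteq> S" if "e \<in># E" for e using that wf1 by (auto simp: wf_graph_def)
  have sub: "adjacency ?H \<subseteq> adjacency ?G" by (auto simp: adjacency_def)
  have "(v, w) \<in> (adjacency ?H)\<^sup>* \<and> w \<in> S" if "(v, w) \<in> (adjacency ?G)\<^sup>*" for w
    using that
  proof (induction rule: rtrancl_induct)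
    case base then show ?case using v by simp
  next
    case (step y z)
    then have "{y, z} \<in># E + F" by (simp add: adjacency_def)
    then have "{y, z} \<in># E" using F step.IH dis by auto
    then have "z \<in> S" "(y, z) \<in> adjacency ?H" using E by (auto simp: adjacency_def)
    then show ?case using step.IH by auto
  qed
  then have r: "reach ?G v = reach ?H v"
    using rtrancl_mono[OF sub] E by (auto simp: reach_def)
  have "filter_mset (\<lambda>e. e \<subseteq> reach ?H v) F = {#}"
  proof -
    have "\<not> e \<subseteq> reach ?H v" if "e \<in># F" for e
      using F[OF that] reach_subset[of ?H v] dis by fastforce
    then have "filter_mset (\<lambda>e. e \<subseteq> reach ?H v) F = filter_mset (\<lambda>_. False) F"
      by (intro filter_mset_cong) auto
    then show ?thesis by simp
  qed
  then show ?thesis by (simp add: component_altdef r)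
qed

definition is_forest :: "'v multigraph \<Rightarrow> bool" where
  "is_forest G \<longleftrightarrow> wf_graph G \<and> (\<forall>v\<in>verts G. is_tree (component G v))"

definition del_edge :: "'v set \<Rightarrow> 'v multigraph \<Rightarrow> 'v multigraph" where
  "del_edge e G = Multigraph (verts G) (edges G - {#e#})"

lemma add_del_edge: "e \<in># edges G \<Longrightarrow> add_edge e (del_edge e G) = G"
  by (simp add: add_edge_def del_edge_def)

text \<open>The predecessor of a graph through an accepted edge is unique, so point probabilities
  obey a finite backward recursion.\<close>

lemma add_edge_eq_iff: "G = add_edge e G' \<longleftrightarrow> e \<in># edges G \<and> G' = del_edge e G"
  by (cases G, cases G') (auto simp: add_edge_def del_edge_def)

lemma forest_del_edge:
  assumes "is_forest G" "e \<in># edges G"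
  shows "is_forest (del_edge e G)" "e \<notin># edges (del_edge e G)"
    "\<forall>v\<in>e. is_tree (component (del_edge e G) v)"
proof -
  have wf: "wf_graph G" using assms by (simp add: is_forest_def)
  then have "card e = 2" "e \<subseteq> verts G" using assms by (auto simp: wf_graph_def)
  then obtain u v where e: "e = {u, v}" "u \<noteq> v" "u \<in> verts G" "v \<in> verts G"
    by (auto simp: card_2_iff)
  let ?G0 = "del_edge e G"
  have tu: "is_tree (component G u)" using assms e by (simp add: is_forest_def)
  have E: "{u, v} \<in># edges G" using assms e by simp
  note d = delete_tree_edge[OF wf E tu, folded e(1), folded del_edge_def]
  show "\<forall>v\<in>e. is_tree (component ?G0 v)" using d e by auto
  have wf0: "wf_graph ?G0" using wf by (auto simp: wf_graph_def del_edge_def dest: in_diffD)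
  show "e \<notin># edges ?G0" using d(1) reach_edge[of u v ?G0] wf0 e by auto
  have G: "add_edge {u, v} ?G0 = G" using add_del_edge assms e by metis
  have V: "verts ?G0 = verts G" by (simp add: del_edge_def)
  have "is_tree (component ?G0 w)" if w: "w \<in> verts G" for w
  proof (cases "w \<in> reach ?G0 u \<union> reach ?G0 v")
    case True
    then show ?thesis using d(2,3) component_eq by (metis UnE)
  next
    case False
    have "component (add_edge {u, v} ?G0) w = component ?G0 w"
      by (rule component_add_edge_merge(2)[OF wf0 _ _ d(1) _ False]) (use e w V in auto)
    then have "component ?G0 w = component G w" using G by simp
    then show ?thesis using assms(1) w unfolding is_forest_def by simp
  qed
  then show "is_forest ?G0" using wf0 V by (simp add: is_forest_def)
qed

text \<open>Deleting an edge of a forest leaves no second copy of it, so all multiplicities are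
  1.\<close>

lemma forest_card_edges:
  assumes "is_forest G"
  shows "card (set_mset (edges G)) = size (edges G)"
proof -
  have le1: "count (edges G) e \<le> 1" for e
    using forest_del_edge(2)[OF assms, of e]
    by (cases "e \<in># edges G") (auto simp: del_edge_def not_in_iff)
  then have "edges G = mset_set (set_mset (edges G))"
  proof (intro multiset_eqI)
    fix e
    show "count (edges G) e = count (mset_set (set_mset (edges G))) e"
      using le1[of e] by (cases "e \<in># edges G") (auto simp: count_mset_set' not_in_iff le_Suc_eq simp flip: count_greater_zero_iff)
  qed
  then show ?thesis by (metis size_mset_set)
qed

definition accept_prob :: "real \<Rightarrow> nat multigraph \<Rightarrow> nat set \<Rightarrow> real" where
  "accept_prob p G e = (if \<forall>v\<in>e. is_tree (component G v) then 1
     else if \<forall>v\<in>e. is_unicycle (component G v) then 0 else p)"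

lemma pmf_eq_expectation: "pmf M x = measure_pmf.expectation M (indicator {x})"
  by (simp add: pmf.rep_eq)

lemma pmf_frozen_step:
  assumes "n \<ge> 2" "0 \<le> p" "p \<le> 1"
  shows "pmf (frozen_step p n G') G = (\<Sum>e\<in>possible_edges n.
    accept_prob p G' e * indicator {add_edge e G'} G + (1 - accept_prob p G' e) * indicator {G'} G)
      / real (card (possible_edges n))"
  unfolding pmf_eq_expectation expectation_frozen_step[OF assms] edge_mean_def accept_prob_def
  by (intro arg_cong2[where f = "(/)"] sum.cong refl) (auto simp: indicator_def)

text \<open>The last proposed edge was either accepted, and then it is an edge of \<open>G\<close>,
  or rejected in the state \<open>G\<close> itself.\<close>

lemma pmf_frozen_graph_Suc:
  assumes "n \<ge> 2" "0 \<le> p" "p \<le> 1"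
  shows "pmf (frozen_graph p n (Suc m)) G = (\<Sum>e\<in>possible_edges n.
    (if e \<in># edges G then accept_prob p (del_edge e G) e * pmf (frozen_graph p n m) (del_edge e G) else 0)
    + (1 - accept_prob p G e) * pmf (frozen_graph p n m) G) / real (card (possible_edges n))"
proof -
  let ?M = "frozen_graph p n m"
  have int: "integrable (measure_pmf ?M) h" for h :: "_ \<Rightarrow> real"
    by (rule integrable_finite_pmf[OF finite_set_pmf_frozen_graph[OF assms(1)]])
  have point: "measure_pmf.expectation ?M (\<lambda>G'. h G' * indicator {H} G') = h H * pmf ?M H"
    for h :: "nat multigraph \<Rightarrow> real" and H
  proof -
    have "measure_pmf.expectation ?M (\<lambda>G'. h G' * indicator {H} G') =
        measure_pmf.expectation ?M (\<lambda>G'. h H * indicator {H} G')"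
      by (rule Bochner_Integration.integral_cong) (auto simp: indicator_def)
    then show ?thesis by (simp add: pmf.rep_eq)
  qed
  have "pmf (frozen_graph p n (Suc m)) G = measure_pmf.expectation ?M (\<lambda>G'. (\<Sum>e\<in>possible_edges n.
    accept_prob p G' e * indicator {add_edge e G'} G + (1 - accept_prob p G' e) * indicator {G'} G)
      / real (card (possible_edges n)))"
    by (simp add: pmf_bind pmf_frozen_step[OF assms])
  also have "\<dots> = (\<Sum>e\<in>possible_edges n.
      measure_pmf.expectation ?M (\<lambda>G'. accept_prob p G' e * indicator {add_edge e G'} G) +
      measure_pmf.expectation ?M (\<lambda>G'. (1 - accept_prob p G' e) * indicator {G'} G))
      / real (card (possible_edges n))"
    by (simp add: Bochner_Integration.integral_sum int Bochner_Integration.integral_add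
        del: mult_indicator_subset)
  also have "\<dots> = (\<Sum>e\<in>possible_edges n.
    (if e \<in># edges G then accept_prob p (del_edge e G) e * pmf ?M (del_edge e G) else 0)
    + (1 - accept_prob p G e) * pmf ?M G) / real (card (possible_edges n))"
  proof -
    have "measure_pmf.expectation ?M (\<lambda>G'. accept_prob p G' e * indicator {add_edge e G'} G) =
      (if e \<in># edges G then accept_prob p (del_edge e G) e * pmf ?M (del_edge e G) else 0)" for e
    proof -
      have "indicator {add_edge e G'} G = (if e \<in># edges G then indicator {del_edge e G} G' else (0::real))" for G'
        using add_edge_eq_iff[of G e G'] by (auto simp: indicator_def)
      then show ?thesis by (simp add: point)
    qed
    moreover have "measure_pmf.expectation ?M (\<lambda>G'. (1 - accept_prob p G' e) * indicator {G'} G) =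
      (1 - accept_prob p G e) * pmf ?M G" for e
    proof -
      have "indicator {G'} G = (indicator {G} G' :: real)" for G' by (auto simp: indicator_def)
      then show ?thesis by (simp add: point)
    qed
    ultimately show ?thesis by simp
  qed
  finally show ?thesis .
qed

text \<open>Induction on time over the last proposed edge. Every vertex of S is a tree vertex
  whatever the forest, so acceptance probabilities agree. If the last edge belongs to the forest,
  its removal leaves a forest with one edge less; all of these are equally likely by induction, and
  both forests have equally many edges to remove. Forests are the right generality because removing
  an edge disconnects a tree.\<close>

lemma pmf_frozen_graph_forest_swap:
  assumes n: "n \<ge> 2" and p: "0 \<le> p" "p \<le> 1" and S: "S \<subseteq> {1..n}"
    and "is_forest (Multigraph S E)" "is_forest (Multigraph S E')" "size E = size E'"
    and "wf_graph (Multigraph ({1..n} - S) H)"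
  shows "pmf (frozen_graph p n m) (Multigraph {1..n} (E + H)) =
    pmf (frozen_graph p n m) (Multigraph {1..n} (E' + H))"
  using assms(5-)
proof (induction m arbitrary: E E' H)
  case 0
  have "E + H = {#} \<longleftrightarrow> E' + H = {#}" using "0.prems"(3) by auto
  then show ?case by (auto simp: indicator_def)
next
  case (Suc m)
  let ?R = "{1..n} - S" and ?G = "\<lambda>E H. Multigraph {1..n} (E + H)"
  have Un: "S \<union> ?R = {1..n}" "?R \<union> S = {1..n}" using S by auto
  have comp: "component (?G E H) v = (if v \<in> S then component (Multigraph S E) v else component (Multigraph ?R H) v)"
    if "wf_graph (Multigraph S E)" "wf_graph (Multigraph ?R H)" "v \<in> {1..n}" for E H v
    using component_disjoint_union[OF that(1,2), of v] component_disjoint_union[OF that(2,1), of v]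
      that(3) Un by (auto simp: add.commute)
  have acc: "accept_prob p (?G E H) e = accept_prob p (?G E' H) e"
    if "is_forest (Multigraph S E)" "is_forest (Multigraph S E')" "wf_graph (Multigraph ?R H)" "e \<subseteq> {1..n}"
    for E E' H e
  proof -
    have t: "is_tree (component (?G E H) v) \<longleftrightarrow> is_tree (component (?G E' H) v)"
      "is_unicycle (component (?G E H) v) \<longleftrightarrow> is_unicycle (component (?G E' H) v)" if v: "v \<in> e" for v
    proof -
      have v': "v \<in> {1..n}" using v \<open>e \<subseteq> {1..n}\<close> by blast
      have "wf_graph (Multigraph S E)" "wf_graph (Multigraph S E')"
        using that(1) \<open>is_forest (Multigraph S E)\<close> \<open>is_forest (Multigraph S E')\<close> by (auto simp: is_forest_def)
      note c = comp[OF this(1) \<open>wf_graph (Multigraph ?R H)\<close> v'] comp[OF this(2) \<open>wf_graph (Multigraph ?R H)\<close> v']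
      have "v \<in> S \<Longrightarrow> is_tree (component (Multigraph S E) v) \<and> is_tree (component (Multigraph S E') v)"
        using \<open>is_forest (Multigraph S E)\<close> \<open>is_forest (Multigraph S E')\<close> by (auto simp: is_forest_def)
      then show "is_tree (component (?G E H) v) \<longleftrightarrow> is_tree (component (?G E' H) v)"
        "is_unicycle (component (?G E H) v) \<longleftrightarrow> is_unicycle (component (?G E' H) v)"
        unfolding c using not_tree_and_unicycle[of "component (Multigraph S E) v"]
          not_tree_and_unicycle[of "component (Multigraph S E') v"]
        by (simp_all split: if_split)
    qed
    then show ?thesis by (simp add: accept_prob_def)
  qed
  \<comment> \<open>An edge of the forest was accepted with probability 1, because before it was
    added both its endpoints were in trees.\<close>
  have edge_sum: "(\<Sum>e\<in>possible_edges n. if e \<in># edges (?G E H)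
      then accept_prob p (del_edge e (?G E H)) e * pmf (frozen_graph p n m) (del_edge e (?G E H)) else 0) =
    (\<Sum>e\<in>set_mset E. pmf (frozen_graph p n m) (?G (E - {#e#}) H)) +
    (\<Sum>e\<in>set_mset H. accept_prob p (?G E (H - {#e#})) e * pmf (frozen_graph p n m) (?G E (H - {#e#})))"
    if F: "is_forest (Multigraph S E)" and H: "wf_graph (Multigraph ?R H)" for E H
  proof -
    have wfE: "wf_graph (Multigraph S E)" using F by (simp add: is_forest_def)
    have eE: "e \<subseteq> S" "card e = 2" if "e \<in># E" for e using that wfE by (auto simp: wf_graph_def)
    have eH: "e \<subseteq> ?R" "card e = 2" if "e \<in># H" for e using that H by (auto simp: wf_graph_def)
    have ne: "e \<noteq> {}" if "card e = 2" for e :: "nat set" using that by auto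
    have disj: "set_mset E \<inter> set_mset H = {}"
    proof (rule ccontr)
      assume "set_mset E \<inter> set_mset H \<noteq> {}"
      then obtain e where e: "e \<in># E" "e \<in># H" by auto
      have "e \<subseteq> S" "e \<subseteq> ?R" using eE(1)[OF e(1)] eH(1)[OF e(2)] .
      then have "e = {}" by blast
      then show False using ne[OF eE(2)[OF e(1)]] by simp
    qed
    have sub: "set_mset E \<union> set_mset H \<subseteq> possible_edges n"
    proof
      fix e assume "e \<in> set_mset E \<union> set_mset H"
      then show "e \<in> possible_edges n"
        using eE[of e] eH[of e] S unfolding possible_edges_def by (elim UnE) auto
    qed
    let ?h = "\<lambda>e. accept_prob p (del_edge e (?G E H)) e * pmf (frozen_graph p n m) (del_edge e (?G E H))"
    have "(\<Sum>e\<in>possible_edges n. if e \<in># edges (?G E H) then ?h e else 0) = (\<Sum>e\<in>set_mset E \<union> set_mset H. ?h e)"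
      using sub by (intro sum.mono_neutral_cong_right) auto
    also have "\<dots> = (\<Sum>e\<in>set_mset E. ?h e) + (\<Sum>e\<in>set_mset H. ?h e)"
      by (rule sum.union_disjoint) (use disj in auto)
    also have "(\<Sum>e\<in>set_mset E. ?h e) = (\<Sum>e\<in>set_mset E. pmf (frozen_graph p n m) (?G (E - {#e#}) H))"
    proof (rule sum.cong[OF refl])
      fix e assume e: "e \<in># E"
      then have del: "del_edge e (?G E H) = ?G (E - {#e#}) H" by (simp add: del_edge_def)
      note d = forest_del_edge[OF F, of e, simplified del_edge_def, simplified, OF e]
      have "is_tree (component (?G (E - {#e#}) H) v)" if "v \<in> e" for v
      proof -
        have v: "v \<in> S" "v \<in> {1..n}" using that eE[OF e] S by auto
        have "wf_graph (Multigraph S (E - {#e#}))" using d(1) by (simp only: is_forest_def)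
        from comp[OF this H v(2)] v(1) show ?thesis using d(3) that by simp
      qed
      then show "?h e = pmf (frozen_graph p n m) (?G (E - {#e#}) H)"
        unfolding del by (simp add: accept_prob_def)
    qed
    also have "(\<Sum>e\<in>set_mset H. ?h e) =
        (\<Sum>e\<in>set_mset H. accept_prob p (?G E (H - {#e#})) e * pmf (frozen_graph p n m) (?G E (H - {#e#})))"
    proof (rule sum.cong[OF refl])
      fix e assume e: "e \<in># H"
      then have "e \<notin># E" using disj by blast
      then have "del_edge e (?G E H) = ?G E (H - {#e#})"
        using e by (auto simp: del_edge_def multiset_eq_iff not_in_iff)
      then show "?h e = accept_prob p (?G E (H - {#e#})) e * pmf (frozen_graph p n m) (?G E (H - {#e#}))"
        by simp
    qed
    finally show ?thesis .
  qed
  note F = Suc.prems(1) and F' = Suc.prems(2) and size = Suc.prems(3) and H = Suc.prems(4)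
  have stay: "(1 - accept_prob p (?G E H) e) * pmf (frozen_graph p n m) (?G E H) =
      (1 - accept_prob p (?G E' H) e) * pmf (frozen_graph p n m) (?G E' H)" if "e \<in> possible_edges n" for e
    using Suc.IH[OF Suc.prems] acc[OF F F' H, of e] that by (simp add: possible_edges_def)
  have sumH: "(\<Sum>e\<in>set_mset H. accept_prob p (?G E (H - {#e#})) e * pmf (frozen_graph p n m) (?G E (H - {#e#}))) =
      (\<Sum>e\<in>set_mset H. accept_prob p (?G E' (H - {#e#})) e * pmf (frozen_graph p n m) (?G E' (H - {#e#})))"
  proof (rule sum.cong[OF refl])
    fix e assume e: "e \<in># H"
    have H': "wf_graph (Multigraph ?R (H - {#e#}))" using H by (auto simp: wf_graph_def dest: in_diffD)
    have "e \<subseteq> {1..n}" using e H by (auto simp: wf_graph_def)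
    then show "accept_prob p (?G E (H - {#e#})) e * pmf (frozen_graph p n m) (?G E (H - {#e#})) =
        accept_prob p (?G E' (H - {#e#})) e * pmf (frozen_graph p n m) (?G E' (H - {#e#}))"
      using Suc.IH[OF F F' size H'] acc[OF F F' H', of e] by simp
  qed
  have sumE: "(\<Sum>e\<in>set_mset E. pmf (frozen_graph p n m) (?G (E - {#e#}) H)) =
      (\<Sum>e\<in>set_mset E'. pmf (frozen_graph p n m) (?G (E' - {#e#}) H))"
  proof (cases "E = {#}")
    case True
    then show ?thesis using size by simp
  next
    case False
    then obtain a where a: "a \<in># E" by auto
    let ?c = "pmf (frozen_graph p n m) (?G (E - {#a#}) H)"
    have fa: "is_forest (Multigraph S (E - {#a#}))"
      using forest_del_edge(1)[OF F, of a] a by (simp add: del_edge_def)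
    \<comment> \<open>All forests on S with one edge less are equally likely, whichever forest and
      edge they come from.\<close>
    have "pmf (frozen_graph p n m) (?G (E0 - {#e#}) H) = ?c"
      if "is_forest (Multigraph S E0)" "size E0 = size E" "e \<in># E0" for E0 e
    proof -
      have "is_forest (Multigraph S (E0 - {#e#}))"
        using forest_del_edge(1)[OF that(1), of e] that(3) by (simp add: del_edge_def)
      then show ?thesis using fa that a H by (intro Suc.IH) (auto simp: size_Diff_singleton)
    qed
    then have "(\<Sum>e\<in>set_mset E. pmf (frozen_graph p n m) (?G (E - {#e#}) H)) = (\<Sum>e\<in>set_mset E. ?c)"
      "(\<Sum>e\<in>set_mset E'. pmf (frozen_graph p n m) (?G (E' - {#e#}) H)) = (\<Sum>e\<in>set_mset E'. ?c)"
      using F F' size by (auto intro!: sum.cong)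
    then show ?thesis using forest_card_edges[OF F] forest_card_edges[OF F'] size by simp
  qed
  have "(\<Sum>e\<in>possible_edges n. (1 - accept_prob p (?G E H) e) * pmf (frozen_graph p n m) (?G E H)) =
      (\<Sum>e\<in>possible_edges n. (1 - accept_prob p (?G E' H) e) * pmf (frozen_graph p n m) (?G E' H))"
    by (rule sum.cong[OF refl stay])
  then show ?case
    unfolding pmf_frozen_graph_Suc[OF n p] sum.distrib edge_sum[OF F H] edge_sum[OF F' H] sumE sumH
    by simp
qed

section \<open>Labelled trees\<close>

definition trees_on :: "'v set \<Rightarrow> 'v multigraph set" where
  "trees_on S = {G. verts G = S \<and> wf_graph G \<and> is_tree G}"

lemma trees_onD:
  assumes "G \<in> trees_on S"
  shows "verts G = S" "wf_graph G" "is_tree G" "finite S" "S \<noteq> {}"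
    "v \<in> S \<Longrightarrow> component G v = G" "v \<in> S \<Longrightarrow> reach G v = S" "is_forest G"
proof -
  show *: "verts G = S" "wf_graph G" "is_tree G" using assms by (auto simp: trees_on_def)
  then show "finite S" "S \<noteq> {}" by (auto simp: is_tree_def connected_graph_def wf_graph_def)
  have con: "connected_graph G" using * by (simp add: is_tree_def)
  show c: "component G v = G" if "v \<in> S" for v
    using component_connected[OF *(2) con] that * by simp
  show "reach G v = S" if "v \<in> S" for v using c[OF that] * by (metis verts_component)
  show "is_forest G" using c * by (simp add: is_forest_def)
qed

lemma trees_on_relabel:
  assumes "G \<in> trees_on S" "inj_on \<sigma> S"
  shows "relabel \<sigma> G \<in> trees_on (\<sigma> ` S)"
  using assms wf_relabel[of G \<sigma>] is_tree_relabel[of G \<sigma>] by (auto simp: trees_on_def)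

text \<open>A tree has no doubled edge, so it is determined by a set of edges.\<close>

lemma finite_trees_on: "finite S \<Longrightarrow> finite (trees_on S)"
proof (rule finite_subset)
  show "trees_on S \<subseteq> (\<lambda>E. Multigraph S (mset_set E)) ` Pow (Pow S)"
  proof
    fix G assume G: "G \<in> trees_on S"
    note t = trees_onD[OF G]
    obtain r where r: "r \<in> verts G" using t by auto
    have e: "edges G = mset_set (set_mset (edges G))"
    proof (rule tree_parent_function[OF t(2,3) r])
      fix par :: "'a \<Rightarrow> 'a" and d :: "'a \<Rightarrow> nat"
      assume "edges G = mset_set ((\<lambda>v. {par v, v}) ` (verts G - {r}))"
      moreover have "finite ((\<lambda>v. {par v, v}) ` (verts G - {r}))" using t by simp
      ultimately show ?thesis by simp
    qed
    have "set_mset (edges G) \<in> Pow (Pow S)" using t by (auto simp: wf_graph_def)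
    moreover have "G = Multigraph S (mset_set (set_mset (edges G)))" using e t by (cases G) simp
    ultimately show "G \<in> (\<lambda>E. Multigraph S (mset_set E)) ` Pow (Pow S)" by blast
  qed
qed simp

lemma card_trees_on_image:
  assumes "inj_on \<sigma> S"
  shows "card (trees_on (\<sigma> ` S)) = card (trees_on S)"
proof -
  have "bij_betw (relabel \<sigma>) (trees_on S) (trees_on (\<sigma> ` S))"
  proof (rule bij_betw_byWitness[where f' = "relabel (inv_into S \<sigma>)"])
    show "\<forall>G\<in>trees_on S. relabel (inv_into S \<sigma>) (relabel \<sigma> G) = G"
      using relabel_inv_into trees_onD(1,2) assms by metis
    show "\<forall>G\<in>trees_on (\<sigma> ` S). relabel \<sigma> (relabel (inv_into S \<sigma>) G) = G"
    proof
      fix G assume G: "G \<in> trees_on (\<sigma> ` S)"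
      show "relabel \<sigma> (relabel (inv_into S \<sigma>) G) = G"
        unfolding relabel_relabel
        by (rule relabel_id[OF trees_onD(2)[OF G]]) (simp add: trees_onD(1)[OF G] f_inv_into_f)
    qed
    show "relabel \<sigma> ` trees_on S \<subseteq> trees_on (\<sigma> ` S)" using trees_on_relabel assms by blast
    show "relabel (inv_into S \<sigma>) ` trees_on (\<sigma> ` S) \<subseteq> trees_on S"
    proof
      fix H assume "H \<in> relabel (inv_into S \<sigma>) ` trees_on (\<sigma> ` S)"
      then obtain G where G: "G \<in> trees_on (\<sigma> ` S)" "H = relabel (inv_into S \<sigma>) G" by auto
      have "inj_on (inv_into S \<sigma>) (\<sigma> ` S)" by (rule inj_on_inv_into) simp
      moreover have "inv_into S \<sigma> ` \<sigma> ` S = S" using assms by (simp add: inv_into_image_cancel)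
      ultimately show "H \<in> trees_on S" using trees_on_relabel[OF G(1)] G(2) by metis
    qed
  qed
  then show ?thesis by (rule bij_betw_same_card[symmetric])
qed

section \<open>Counting labelled trees\<close>

definition num_trees :: "nat \<Rightarrow> nat" where
  "num_trees k = card (trees_on {1..k})"

lemma card_trees_on:
  assumes "finite (S :: 'a set)"
  shows "card (trees_on S) = num_trees (card S)"
proof -
  obtain \<sigma> :: "'a \<Rightarrow> nat" where s: "bij_betw \<sigma> S {1..card S}"
    using assms finite_same_card_bij[of S "{1..card S}"] by auto
  then show ?thesis
    using card_trees_on_image[of \<sigma> S] by (simp add: num_trees_def bij_betw_def)
qed

lemma wf_graph_edge:
  assumes "wf_graph G" "e \<in># edges G"
  shows "e \<subseteq> verts G" "card e = 2"
  using assms by (auto simp: wf_graph_def)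

lemma finite_edge_orientations:
  assumes "wf_graph G"
  shows "finite {(u, v). {u, v} \<in># edges G}"
proof (rule finite_subset)
  show "{(u, v). {u, v} \<in># edges G} \<subseteq> verts G \<times> verts G"
  proof clarify
    fix u v assume e: "{u, v} \<in># edges G"
    from wf_graph_edge(1)[OF assms e] show "u \<in> verts G \<and> v \<in> verts G" by simp
  qed
  show "finite (verts G \<times> verts G)" using assms by (simp add: wf_graph_def)
qed

lemma card_edge_orientations:
  assumes "wf_graph G" "is_forest G"
  shows "card {(u, v). {u, v} \<in># edges G} = 2 * size (edges G)"
proof -
  have fin: "finite {(u, v). {u, v} \<in># edges G}"
    by (rule finite_edge_orientations[OF assms(1)])
  have "card {(u, v). {u, v} \<in># edges G} = (\<Sum>x\<in>{(u, v). {u, v} \<in># edges G}. 1)" by simp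
  also have "\<dots> = (\<Sum>e\<in>set_mset (edges G).
      \<Sum>x\<in>{x\<in>{(u, v). {u, v} \<in># edges G}. (\<lambda>(u,v). {u,v}) x = e}. 1)"
    using fin by (intro sum.group[symmetric]) auto
  also have "\<dots> = (\<Sum>e\<in>set_mset (edges G). 2)"
  proof (rule sum.cong[OF refl])
    fix e assume e: "e \<in># edges G"
    then have "card e = 2" using assms(1) by (auto simp: wf_graph_def)
    then obtain a b where ab: "e = {a, b}" "a \<noteq> b" by (meson card_2_iff)
    have "{x\<in>{(u, v). {u, v} \<in># edges G}. (\<lambda>(u,v). {u,v}) x = e} = {(u, v). {u, v} = e}"
      using e by auto
    also have "\<dots> = {(a,b), (b,a)}" unfolding ab(1) by (auto simp: doubleton_eq_iff)
    finally have "{x\<in>{(u, v). {u, v} \<in># edges G}. (\<lambda>(u,v). {u,v}) x = e} = {(a,b), (b,a)}" .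
    then show "(\<Sum>x\<in>{x\<in>{(u, v). {u, v} \<in># edges G}. (\<lambda>(u,v). {u,v}) x = e}. 1) = (2::nat)"
      using ab by simp
  qed
  finally show ?thesis using forest_card_edges[OF assms(2)] by simp
qed

lemma wf_union:
  assumes "wf_graph G" "wf_graph H"
  shows "wf_graph (Multigraph (verts G \<union> verts H) (edges G + edges H))"
  using assms by (auto simp: wf_graph_def)

text \<open>Removing an oriented edge (u, v) from a tree leaves two trees on complementary sets,
  rooted at u and v. The orientation tells which of the two sets is A.\<close>

lemma tree_edge_splitting_bij:
  fixes S :: "'a set"
  assumes "finite S"
  shows "bij_betw (\<lambda>(A, (\<theta>, u), (\<theta>', v)). (add_edge {u, v} (Multigraph S (edges \<theta> + edges \<theta>')), (u, v)))
    (SIGMA A:Pow S. (trees_on A \<times> A) \<times> (trees_on (S - A) \<times> (S - A)))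
    (SIGMA \<theta>:trees_on S. {(u, v). {u, v} \<in># edges \<theta>})" (is "bij_betw ?f ?Q ?P")
proof (rule bij_betw_byWitness[where f' = "\<lambda>(\<theta>, (u, v)). let G = del_edge {u, v} \<theta> in
    (reach G u, (component G u, u), (component G v, v))"])
  let ?g = "\<lambda>(\<theta>, (u, v)). let G = del_edge {u, v} \<theta> in
    (reach G u, (component G u, u), (component G v, v))"
  have Q: "?f (A, (\<theta>, u), (\<theta>', v)) \<in> ?P \<and> ?g (?f (A, (\<theta>, u), (\<theta>', v))) = (A, (\<theta>, u), (\<theta>', v))"
    if "(A, (\<theta>, u), (\<theta>', v)) \<in> ?Q" for A \<theta> u \<theta>' v
  proof -
    from that have A: "A \<subseteq> S" and t: "\<theta> \<in> trees_on A" "\<theta>' \<in> trees_on (S - A)" and uv: "u \<in> A" "v \<in> S - A"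
      by auto
    note a = trees_onD[OF t(1)] and b = trees_onD[OF t(2)]
    let ?G = "Multigraph S (edges \<theta> + edges \<theta>')"
    have Un: "A \<union> (S - A) = S" "(S - A) \<union> A = S" using A by auto
    have wf: "wf_graph ?G" using wf_union[OF a(2) b(2)] a(1) b(1) Un by simp
    have eta: "Multigraph A (edges \<theta>) = \<theta>" "Multigraph (S - A) (edges \<theta>') = \<theta>'"
      using a(1) b(1) by (metis multigraph.collapse)+
    have cu: "component ?G u = \<theta>"
      using component_disjoint_union[of A "edges \<theta>" "S - A" "edges \<theta>'" u] eta a b uv Un by simp
    have cv: "component ?G v = \<theta>'"
      using component_disjoint_union[of "S - A" "edges \<theta>'" A "edges \<theta>" v] eta a b uv Un
      by (simp add: add.commute Int_commute Diff_disjoint)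
    have ru: "reach ?G u = A" using cu a(1) by (metis verts_component)
    have rv: "reach ?G v = S - A" using cv b(1) by (metis verts_component)
    have uS: "u \<in> verts ?G" "v \<in> verts ?G" "u \<noteq> v" using uv A by auto
    have nin: "v \<notin> reach ?G u" using ru uv by simp
    have tree: "is_tree (component (add_edge {u, v} ?G) u)"
      by (rule add_edge_two_trees(1)[OF wf uS nin]) (use cu cv a b ru uv in auto)
    have "reach (add_edge {u, v} ?G) u = S"
      using reach_add_edge_merge(1)[OF uS(1,2), of u] ru rv uv Un by simp
    moreover have wf': "wf_graph (add_edge {u, v} ?G)" by (rule wf_add_edge2[OF wf uS])
    moreover have "filter_mset (\<lambda>e. e \<subseteq> S) (edges (add_edge {u, v} ?G)) = edges (add_edge {u, v} ?G)"
      unfolding filter_mset_eq_conv using wf_graph_edge(1)[OF wf'] by simp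
    ultimately have "component (add_edge {u, v} ?G) u = add_edge {u, v} ?G"
      by (intro multigraph.expand) (simp only: verts_component edges_component verts_add_edge
          multigraph.sel simp_thms)
    then have "add_edge {u, v} ?G \<in> trees_on S" using tree wf' by (simp add: trees_on_def)
    moreover have "del_edge {u, v} (add_edge {u, v} ?G) = ?G" by (simp add: del_edge_def add_edge_def)
    ultimately show ?thesis using cu cv ru by (simp add: Let_def)
  qed
  have P: "?g (\<theta>, (u, v)) \<in> ?Q \<and> ?f (?g (\<theta>, (u, v))) = (\<theta>, (u, v))"
    if "(\<theta>, (u, v)) \<in> ?P" for \<theta> u v
  proof -
    from that have t: "\<theta> \<in> trees_on S" and e: "{u, v} \<in># edges \<theta>" by auto
    note a = trees_onD[OF t]
    let ?G = "del_edge {u, v} \<theta>"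
    have uS: "u \<in> S" "v \<in> S" using e a by (auto simp: wf_graph_def)
    have "card {u, v} = 2" using e a(2) by (auto simp: wf_graph_def)
    then have ne: "u \<noteq> v" by auto
    have wf: "wf_graph ?G" using a(2) by (auto simp: wf_graph_def del_edge_def dest: in_diffD)
    have V: "verts ?G = S" using a(1) by (simp add: del_edge_def)
    note d = delete_tree_edge[OF a(2) e, folded del_edge_def]
    have tu: "is_tree (component \<theta> u)" using a(3,6) uS by simp
    have add: "add_edge {u, v} ?G = \<theta>" by (rule add_del_edge[OF e])
    have "component \<theta> u = Multigraph (reach ?G u \<union> reach ?G v)
        (add_mset {u, v} (edges (component ?G u) + edges (component ?G v)))"
      using component_add_edge_merge(1)[OF wf, of u v u] uS V d(1)[OF tu] reach_self[of u ?G] add by simp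
    then have th: "\<theta> = Multigraph (reach ?G u \<union> reach ?G v)
        (add_mset {u, v} (edges (component ?G u) + edges (component ?G v)))" using a(6) uS by simp
    then have S: "S = reach ?G u \<union> reach ?G v" using a(1) by (metis multigraph.sel(1))
    have dis: "reach ?G u \<inter> reach ?G v = {}"
      using reach_disjoint d(1)[OF tu] reach_self[of v ?G] uS V by metis
    then have "S - reach ?G u = reach ?G v" using S by auto
    moreover have "component ?G u \<in> trees_on (reach ?G u)" "component ?G v \<in> trees_on (reach ?G v)"
      using d(2,3)[OF tu] wf_component[OF wf] by (auto simp: trees_on_def)
    ultimately have "?g (\<theta>, (u, v)) \<in> ?Q"
      using S uS V reach_self[of u ?G] reach_self[of v ?G] by (auto simp: Let_def)
    moreover have "add_edge {u, v} (Multigraph S (edges (component ?G u) + edges (component ?G v))) = \<theta>"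
      using th S by (simp add: add_edge_def)
    ultimately show ?thesis by (simp add: Let_def)
  qed
  show "\<forall>x\<in>?Q. ?g (?f x) = x" using Q by fastforce
  show "\<forall>x\<in>?P. ?f (?g x) = x" using P by fastforce
  show "?f ` ?Q \<subseteq> ?P" using Q by fastforce
  show "?g ` ?P \<subseteq> ?Q" using P by fastforce
qed

lemma sum_Pow_card:
  fixes F :: "nat \<Rightarrow> nat"
  assumes "finite S"
  shows "(\<Sum>A\<in>Pow S. F (card A)) = (\<Sum>i\<le>card S. (card S choose i) * F i)"
proof -
  have "(\<Sum>A\<in>Pow S. F (card A)) = (\<Sum>i\<in>{..card S}. \<Sum>A\<in>{A\<in>Pow S. card A = i}. F (card A))"
    using assms by (intro sum.group[symmetric]) (auto intro: card_mono)
  also have "\<dots> = (\<Sum>i\<le>card S. (card S choose i) * F i)"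
  proof (rule sum.cong[OF refl])
    fix i
    have "(\<Sum>A\<in>{A\<in>Pow S. card A = i}. F (card A)) = (\<Sum>A\<in>{A\<in>Pow S. card A = i}. F i)"
      by (rule sum.cong) auto
    then show "(\<Sum>A\<in>{A\<in>Pow S. card A = i}. F (card A)) = (card S choose i) * F i"
      using n_subsets[OF assms, of i] by simp
  qed
  finally show ?thesis .
qed

text \<open>Double counting of the trees on k vertices with a distinguished oriented edge.\<close>

lemma num_trees_recursion:
  "2 * (k - 1) * num_trees k = (\<Sum>i\<le>k. (k choose i) * ((num_trees i * i) * (num_trees (k - i) * (k - i))))"
proof -
  let ?S = "{1..k}"
  have "card (SIGMA \<theta>:trees_on ?S. {(u, v). {u, v} \<in># edges \<theta>}) = 2 * (k - 1) * num_trees k"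
  proof -
    have fin: "finite {(u, v). {u, v} \<in># edges \<theta>}" if "\<theta> \<in> trees_on ?S" for \<theta>
      by (rule finite_edge_orientations[OF trees_onD(2)[OF that]])
    have "card (SIGMA \<theta>:trees_on ?S. {(u, v). {u, v} \<in># edges \<theta>}) =
        (\<Sum>\<theta>\<in>trees_on ?S. card {(u, v). {u, v} \<in># edges \<theta>})"
      using fin finite_trees_on[of ?S] by (intro card_SigmaI) auto
    also have "\<dots> = (\<Sum>\<theta>\<in>trees_on ?S. 2 * (k - 1))"
    proof (rule sum.cong[OF refl])
      fix \<theta> assume t: "\<theta> \<in> trees_on ?S"
      have "size (edges \<theta>) + 1 = k" using trees_onD(1,3)[OF t] by (simp add: is_tree_def)
      then show "card {(u, v). {u, v} \<in># edges \<theta>} = 2 * (k - 1)"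
        using card_edge_orientations[OF trees_onD(2)[OF t] trees_onD(8)[OF t]] by simp
    qed
    finally show ?thesis by (simp add: num_trees_def)
  qed
  moreover have "card (SIGMA A:Pow ?S. (trees_on A \<times> A) \<times> (trees_on (?S - A) \<times> (?S - A))) =
      (\<Sum>i\<le>k. (k choose i) * ((num_trees i * i) * (num_trees (k - i) * (k - i))))"
  proof -
    have "card (SIGMA A:Pow ?S. (trees_on A \<times> A) \<times> (trees_on (?S - A) \<times> (?S - A))) =
        (\<Sum>A\<in>Pow ?S. card ((trees_on A \<times> A) \<times> (trees_on (?S - A) \<times> (?S - A))))"
    proof (rule card_SigmaI)
      show "\<forall>A\<in>Pow ?S. finite ((trees_on A \<times> A) \<times> (trees_on (?S - A) \<times> (?S - A)))"
        using finite_trees_on finite_subset by (metis PowD finite_Diff finite_SigmaI finite_atLeastAtMost)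
    qed simp
    also have "\<dots> = (\<Sum>A\<in>Pow ?S. (num_trees (card A) * card A) * (num_trees (k - card A) * (k - card A)))"
    proof (rule sum.cong[OF refl])
      fix A assume "A \<in> Pow ?S"
      then have A: "A \<subseteq> ?S" "finite A" by (auto intro: finite_subset)
      then have "card (?S - A) = k - card A" by (simp add: card_Diff_subset)
      then show "card ((trees_on A \<times> A) \<times> (trees_on (?S - A) \<times> (?S - A))) =
          (num_trees (card A) * card A) * (num_trees (k - card A) * (k - card A))"
        using A by (simp add: card_cartesian_product card_trees_on)
    qed
    also have "\<dots> = (\<Sum>i\<le>k. (k choose i) * ((num_trees i * i) * (num_trees (k - i) * (k - i))))"
      using sum_Pow_card[of ?S "\<lambda>i. (num_trees i * i) * (num_trees (k - i) * (k - i))"] by simp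
    finally show ?thesis .
  qed
  ultimately show ?thesis using bij_betw_same_card[OF tree_edge_splitting_bij[of ?S]] by simp
qed

lemma num_trees_1: "num_trees 1 = 1"
proof -
  have "trees_on {1..1::nat} = {Multigraph {1} {#}}"
  proof
    show "trees_on {1..1::nat} \<subseteq> {Multigraph {1} {#}}"
    proof
      fix G :: "nat multigraph" assume "G \<in> trees_on {1..1}"
      from trees_onD(1,3)[OF this] show "G \<in> {Multigraph {1} {#}}" by (cases G) (auto simp: is_tree_def)
    qed
    show "{Multigraph {1} {#}} \<subseteq> trees_on {1..1::nat}"
      by (auto simp: trees_on_def wf_graph_def is_tree_def connected_graph_def)
  qed
  then show ?thesis by (simp add: num_trees_def)
qed

text \<open>Once i times the number of trees of size i is known to be i^(i-1), the recursion is the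
  sum in \<open>cayley_convolution\<close>. The factor k on the left avoids the exponent k - 2 at k
  = 1.\<close>

theorem cayley_formula: "k \<ge> 1 \<Longrightarrow> real (num_trees k) * real k = real k ^ (k - 1)"
proof (induction k rule: less_induct)
  case (less k)
  show ?case
  proof (cases "k = 1")
    case True then show ?thesis using num_trees_1 by simp
  next
    case False
    then have k: "k \<ge> 2" using less.prems by simp
    have "2 * (real k - 1) * real (num_trees k) = real (2 * (k - 1) * num_trees k)"
      using k by (simp add: of_nat_diff)
    also have "\<dots> = (\<Sum>i\<le>k. real (k choose i) * ((real (num_trees i) * real i) * (real (num_trees (k - i)) * real (k - i))))"
      unfolding num_trees_recursion by simp
    \<comment> \<open>The terms with an empty part vanish through the factors i and k - i.\<close>
    also have "\<dots> = (\<Sum>i\<in>{1..<k}. real (k choose i) * ((real (num_trees i) * real i) * (real (num_trees (k - i)) * real (k - i))))"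
      by (intro sum.mono_neutral_right) auto
    also have "\<dots> = (\<Sum>i\<in>{1..<k}. real (k choose i) * real i ^ (i - 1) * real (k - i) ^ (k - i - 1))"
    proof (rule sum.cong[OF refl])
      fix i assume i: "i \<in> {1..<k}"
      have "real (num_trees i) * real i = real i ^ (i - 1)" using i by (intro less.IH) auto
      moreover have "real (num_trees (k - i)) * real (k - i) = real (k - i) ^ (k - i - 1)"
        using i by (intro less.IH) auto
      ultimately show "real (k choose i) * ((real (num_trees i) * real i) * (real (num_trees (k - i)) * real (k - i))) =
          real (k choose i) * real i ^ (i - 1) * real (k - i) ^ (k - i - 1)"
        by (simp only: mult.assoc)
    qed
    also have "\<dots> = 2 * (real k - 1) * real k ^ (k - 2)" by (rule cayley_convolution[OF k])
    finally have "real (num_trees k) = real k ^ (k - 2)" using k by simp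
    moreover have "k - 1 = Suc (k - 2)" using k by simp
    ultimately show ?thesis by simp
  qed
qed

section \<open>Uniformity of the tree component given its size\<close>

definition rank_in :: "nat set \<Rightarrow> nat \<Rightarrow> nat" where
  "rank_in S v = card {w \<in> S. w \<le> v}"

lemma relabel_increasing_eq: "relabel_increasing G = relabel (rank_in (verts G)) G"
  by (simp add: relabel_increasing_def rank_in_def[abs_def])

lemma rank_in_bij:
  assumes "finite S"
  shows "bij_betw (rank_in S) S {1..card S}"
proof -
  have "rank_in S v < rank_in S w" if "v \<in> S" "w \<in> S" "v < w" for v w
    unfolding rank_in_def
  proof (rule psubset_card_mono)
    have "w \<in> {x \<in> S. x \<le> w}" "w \<notin> {x \<in> S. x \<le> v}" using that by auto
    moreover have "{x \<in> S. x \<le> v} \<subseteq> {x \<in> S. x \<le> w}" using that by auto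
    ultimately show "{x \<in> S. x \<le> v} \<subset> {x \<in> S. x \<le> w}" by blast
  qed (use assms in simp)
  then have inj: "inj_on (rank_in S) S" by (metis (mono_tags) inj_onI linorder_neqE_nat order_less_irrefl)
  have "rank_in S v \<in> {1..card S}" if "v \<in> S" for v
  proof -
    have "{w \<in> S. w \<le> v} \<noteq> {}" "finite {w \<in> S. w \<le> v}" using that assms by auto
    then have "rank_in S v > 0" unfolding rank_in_def by (simp only: card_gt_0_iff) simp
    moreover have "rank_in S v \<le> card S" unfolding rank_in_def using assms by (intro card_mono) auto
    ultimately show ?thesis by simp
  qed
  then have "rank_in S ` S \<subseteq> {1..card S}" by blast
  moreover have "card (rank_in S ` S) = card {1..card S}" using card_image[OF inj] by simp
  ultimately have "rank_in S ` S = {1..card S}" by (intro card_subset_eq) auto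
  then show ?thesis using inj by (simp add: bij_betw_def)
qed

lemma relabel_increasing_props:
  assumes "wf_graph G"
  shows "wf_graph (relabel_increasing G)" "verts (relabel_increasing G) = {1..card (verts G)}"
    "is_tree (relabel_increasing G) \<longleftrightarrow> is_tree G" "card (verts (relabel_increasing G)) = card (verts G)"
proof -
  have b: "bij_betw (rank_in (verts G)) (verts G) {1..card (verts G)}"
    by (rule rank_in_bij[OF wf_graph_finite[OF assms]])
  then have i: "inj_on (rank_in (verts G)) (verts G)" by (simp add: bij_betw_def)
  show "wf_graph (relabel_increasing G)" unfolding relabel_increasing_eq by (rule wf_relabel[OF assms i])
  show v: "verts (relabel_increasing G) = {1..card (verts G)}"
    unfolding relabel_increasing_eq using b by (simp add: bij_betw_def)
  show "is_tree (relabel_increasing G) \<longleftrightarrow> is_tree G"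
    unfolding relabel_increasing_eq by (rule is_tree_relabel[OF assms i])
  show "card (verts (relabel_increasing G)) = card (verts G)" unfolding v by simp
qed

text \<open>\<open>inv_into S (rank_in S)\<close> is the increasing enumeration of S. If \<tau> has
  the right size, the component of vertex 1 is thus replaced by the tree on the same vertices whose
  increasing relabelling is \<tau>.\<close>

definition swap_component :: "nat \<Rightarrow> nat multigraph \<Rightarrow> nat multigraph \<Rightarrow> nat multigraph" where
  "swap_component n \<tau> G = (let S = reach G 1 in Multigraph {1..n}
     (edges (relabel (inv_into S (rank_in S)) \<tau>) + filter_mset (\<lambda>e. \<not> e \<subseteq> S) (edges G)))"

lemma swap_component_props:
  assumes n: "n \<ge> 2" and p: "0 \<le> p" "p \<le> 1"
    and t: "\<tau> \<in> trees_on {1..k}" and t': "\<tau>' \<in> trees_on {1..k}"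
    and G: "G \<in> set_pmf (frozen_graph p n m)" "relabel_increasing (component G 1) = \<tau>"
  defines "G' \<equiv> swap_component n \<tau>' G"
  shows "pmf (frozen_graph p n m) G' = pmf (frozen_graph p n m) G"
    "relabel_increasing (component G' 1) = \<tau>'" "swap_component n \<tau> G' = G"
proof -
  have wf: "wf_graph G" and V: "verts G = {1..n}"
    using frozen_graph_support[OF n G(1)] valid_graph_wf by auto
  define S where "S = reach G 1"
  define H where "H = filter_mset (\<lambda>e. \<not> e \<subseteq> S) (edges G)"
  define i where "i = inv_into S (rank_in S)"
  define \<theta>' where "\<theta>' = relabel i \<tau>'"
  let ?\<theta> = "component G 1"
  have 1: "1 \<in> verts G" using V n by simp
  have 1: "1 \<in> S" unfolding S_def by (rule reach_self[OF 1])
  have S: "S \<subseteq> {1..n}" "finite S" unfolding S_def using reach_subset[of G 1] V wf by auto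
  have wf\<theta>: "wf_graph ?\<theta>" by (rule wf_component[OF wf])
  have V\<theta>: "verts ?\<theta> = S" by (simp add: S_def)
  have b: "bij_betw (rank_in S) S {1..card S}" by (rule rank_in_bij[OF S(2)])
  have "card S = k"
    using relabel_increasing_props(4)[OF wf\<theta>] G(2) trees_onD(1)[OF t] V\<theta> by simp
  then have b: "bij_betw (rank_in S) S {1..k}" using b by simp
  then have rS: "rank_in S ` S = {1..k}" "inj_on (rank_in S) S" by (auto simp: bij_betw_def)
  have i: "inj_on i {1..k}" "i ` {1..k} = S"
    unfolding i_def using bij_betw_inv_into[OF b] by (auto simp: bij_betw_def)
  have \<theta>: "?\<theta> = relabel i \<tau>"
    unfolding G(2)[symmetric] relabel_increasing_eq V\<theta> i_def
    using relabel_inv_into[OF wf\<theta>, of "rank_in S"] rS V\<theta> by simp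
  have T: "?\<theta> \<in> trees_on S" using trees_on_relabel[OF t i(1)] \<theta> i(2) by simp
  have T': "\<theta>' \<in> trees_on S" using trees_on_relabel[OF t' i(1)] i(2) by (simp add: \<theta>'_def)
  have eta: "Multigraph S (edges ?\<theta>) = ?\<theta>" "Multigraph S (edges \<theta>') = \<theta>'"
    using trees_onD(1)[OF T] trees_onD(1)[OF T'] by (metis multigraph.collapse)+
  have edges_G: "edges G = edges ?\<theta> + H"
    unfolding H_def edges_component S_def by (rule multiset_partition)
  have G_eq: "G = Multigraph {1..n} (edges ?\<theta> + H)" using edges_G V by (metis multigraph.collapse)
  have G'_eq: "G' = Multigraph {1..n} (edges \<theta>' + H)"
    unfolding G'_def swap_component_def Let_def S_def[symmetric] \<theta>'_def i_def H_def ..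
  have eH: "e \<subseteq> {1..n} - S" if "e \<in># H" for e
  proof -
    have e: "e \<in># edges G" "\<not> e \<subseteq> S" using that by (auto simp: H_def)
    have "x \<notin> S" if "x \<in> e" for x
      using edge_subset_reach[OF wf e(1) that, of 1] e(2) unfolding S_def by blast
    then show ?thesis using wf_graph_edge(1)[OF wf e(1)] V by auto
  qed
  have wfH: "wf_graph (Multigraph ({1..n} - S) H)"
    using eH wf_graph_edge(2)[OF wf] by (auto simp: wf_graph_def H_def)
  have "pmf (frozen_graph p n m) (Multigraph {1..n} (edges ?\<theta> + H)) =
      pmf (frozen_graph p n m) (Multigraph {1..n} (edges \<theta>' + H))"
  proof (rule pmf_frozen_graph_forest_swap[OF n p S(1) _ _ _ wfH])
    show "is_forest (Multigraph S (edges ?\<theta>))" "is_forest (Multigraph S (edges \<theta>'))"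
      unfolding eta using trees_onD(8) T T' by auto
    have "size (edges ?\<theta>) + 1 = card S" "size (edges \<theta>') + 1 = card S"
      using trees_onD(1,3)[OF T] trees_onD(1,3)[OF T'] by (auto simp: is_tree_def)
    then show "size (edges ?\<theta>) = size (edges \<theta>')" by simp
  qed
  then show "pmf (frozen_graph p n m) G' = pmf (frozen_graph p n m) G"
    using G_eq G'_eq by simp
  have "component (Multigraph (S \<union> ({1..n} - S)) (edges \<theta>' + H)) 1 = component (Multigraph S (edges \<theta>')) 1"
    by (rule component_disjoint_union[OF _ wfH _ 1]) (use eta trees_onD(2)[OF T'] in auto)
  then have c': "component G' 1 = \<theta>'"
    using G'_eq S(1) eta trees_onD(6)[OF T' 1] by (simp add: Un_absorb1)
  have rank_i: "rank_in S (i v) = v" if "v \<in> {1..k}" for v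
    unfolding i_def using that rS by (intro f_inv_into_f) simp
  show "relabel_increasing (component G' 1) = \<tau>'"
    unfolding c' relabel_increasing_eq trees_onD(1)[OF T'] unfolding \<theta>'_def relabel_relabel
    by (rule relabel_id[OF trees_onD(2)[OF t']]) (simp add: trees_onD(1)[OF t'] rank_i)
  have r': "reach G' 1 = S" using c' trees_onD(1)[OF T'] by (metis verts_component)
  have "filter_mset (\<lambda>e. \<not> e \<subseteq> S) (edges G') = H"
  proof -
    have "filter_mset (\<lambda>e. \<not> e \<subseteq> S) (edges \<theta>') = filter_mset (\<lambda>_. False) (edges \<theta>')"
      using wf_graph_edge(1)[OF trees_onD(2)[OF T']] trees_onD(1)[OF T'] by (intro filter_mset_cong) auto
    also have "\<dots> = {#}" by simp
    finally have e: "filter_mset (\<lambda>e. \<not> e \<subseteq> S) (edges \<theta>') = {#}" .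
    have "filter_mset (\<lambda>e. \<not> e \<subseteq> S) H = H" by (simp add: H_def filter_filter_mset)
    then show ?thesis unfolding G'_eq multigraph.sel filter_union_mset e by simp
  qed
  then show "swap_component n \<tau> G' = G"
    unfolding swap_component_def Let_def r' i_def[symmetric] \<theta>[symmetric] using G_eq by simp
qed

lemma pmf_CC_star:
  assumes "n \<ge> 2"
  shows "pmf (CC_star p n m) \<tau> =
    (\<Sum>G | G \<in> set_pmf (frozen_graph p n m) \<and> relabel_increasing (component G 1) = \<tau>.
      pmf (frozen_graph p n m) G)"
proof -
  let ?M = "frozen_graph p n m"
  let ?K = "{G. G \<in> set_pmf ?M \<and> relabel_increasing (component G 1) = \<tau>}"
  have "pmf (CC_star p n m) \<tau> = measure_pmf.prob ?M ((\<lambda>G. relabel_increasing (component G 1)) -` {\<tau>})"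
    by (simp add: CC_star_def pmf_map)
  also have "\<dots> = measure_pmf.prob ?M (((\<lambda>G. relabel_increasing (component G 1)) -` {\<tau>}) \<inter> set_pmf ?M)"
    by (simp add: measure_Int_set_pmf)
  also have "((\<lambda>G. relabel_increasing (component G 1)) -` {\<tau>}) \<inter> set_pmf ?M = ?K" by auto
  also have "measure_pmf.prob ?M ?K = (\<Sum>G\<in>?K. pmf ?M G)"
    by (rule measure_measure_pmf_finite)
       (rule finite_subset[OF _ finite_set_pmf_frozen_graph[OF assms, of p m]], auto)
  finally show ?thesis .
qed

text \<open>Swapping the component of vertex 1 is a probability-preserving bijection between the
  graphs that yield the two trees.\<close>

lemma CC_star_uniform:
  assumes n: "n \<ge> 2" and p: "0 \<le> p" "p \<le> 1"
    and t: "\<tau> \<in> trees_on {1..k}" and t': "\<tau>' \<in> trees_on {1..k}"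
  shows "pmf (CC_star p n m) \<tau> = pmf (CC_star p n m) \<tau>'"
  unfolding pmf_CC_star[OF n]
proof (rule sum.reindex_bij_witness[where i = "swap_component n \<tau>" and j = "swap_component n \<tau>'"])
  have supp: "G' \<in> set_pmf (frozen_graph p n m)"
    if "pmf (frozen_graph p n m) G' = pmf (frozen_graph p n m) G" "G \<in> set_pmf (frozen_graph p n m)" for G G'
    using that by (simp add: set_pmf_iff)
  fix G assume "G \<in> {G. G \<in> set_pmf (frozen_graph p n m) \<and> relabel_increasing (component G 1) = \<tau>}"
  then have G: "G \<in> set_pmf (frozen_graph p n m)" "relabel_increasing (component G 1) = \<tau>" by auto
  note s = swap_component_props[OF n p t t' G]
  show "swap_component n \<tau> (swap_component n \<tau>' G) = G" by (rule s(3))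
  show "swap_component n \<tau>' G \<in> {G. G \<in> set_pmf (frozen_graph p n m) \<and> relabel_increasing (component G 1) = \<tau>'}"
    using s(2) supp[OF s(1) G(1)] by simp
  show "pmf (frozen_graph p n m) (swap_component n \<tau>' G) = pmf (frozen_graph p n m) G" by (rule s(1))
next
  have supp: "G' \<in> set_pmf (frozen_graph p n m)"
    if "pmf (frozen_graph p n m) G' = pmf (frozen_graph p n m) G" "G \<in> set_pmf (frozen_graph p n m)" for G G'
    using that by (simp add: set_pmf_iff)
  fix G assume "G \<in> {G. G \<in> set_pmf (frozen_graph p n m) \<and> relabel_increasing (component G 1) = \<tau>'}"
  then have G: "G \<in> set_pmf (frozen_graph p n m)" "relabel_increasing (component G 1) = \<tau>'" by auto
  note s = swap_component_props[OF n p t' t G]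
  show "swap_component n \<tau>' (swap_component n \<tau> G) = G" by (rule s(3))
  show "swap_component n \<tau> G \<in> {G. G \<in> set_pmf (frozen_graph p n m) \<and> relabel_increasing (component G 1) = \<tau>}"
    using s(2) supp[OF s(1) G(1)] by simp
qed

lemma CC_star_support:
  assumes "n \<ge> 2" "\<tau> \<in> set_pmf (CC_star p n m)"
  shows "wf_graph \<tau>" "verts \<tau> = {1..card (verts \<tau>)}"
proof -
  obtain G where G: "G \<in> set_pmf (frozen_graph p n m)" "\<tau> = relabel_increasing (component G 1)"
    using assms(2) by (auto simp: CC_star_def)
  have wf: "wf_graph (component G 1)"
    by (rule wf_component[OF valid_graph_wf[OF frozen_graph_support(1)[OF assms(1) G(1)]]])
  show "wf_graph \<tau>" unfolding G(2) by (rule relabel_increasing_props(1)[OF wf])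
  show "verts \<tau> = {1..card (verts \<tau>)}"
    unfolding G(2) relabel_increasing_props(4)[OF wf] by (rule relabel_increasing_props(2)[OF wf])
qed

lemma prob_CC_star_tree_size:
  assumes n: "n \<ge> 2" and p: "0 \<le> p" "p \<le> 1" and t: "\<tau> \<in> trees_on {1..k}"
  shows "measure_pmf.prob (CC_star p n m) {G. is_tree G \<and> card (verts G) = k} =
    real (num_trees k) * pmf (CC_star p n m) \<tau>"
proof -
  have "measure_pmf.prob (CC_star p n m) {G. is_tree G \<and> card (verts G) = k} =
      measure_pmf.prob (CC_star p n m) (trees_on {1..k})"
  proof (rule measure_pmf.finite_measure_eq_AE)
    have "(G \<in> {G. is_tree G \<and> card (verts G) = k}) = (G \<in> trees_on {1..k})"
      if "G \<in> set_pmf (CC_star p n m)" for G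
    proof
      assume "G \<in> {G. is_tree G \<and> card (verts G) = k}"
      then show "G \<in> trees_on {1..k}" using CC_star_support[OF n that] by (simp add: trees_on_def)
    next
      assume "G \<in> trees_on {1..k}"
      then show "G \<in> {G. is_tree G \<and> card (verts G) = k}" by (simp add: trees_on_def)
    qed
    then show "AE G in measure_pmf (CC_star p n m). (G \<in> {G. is_tree G \<and> card (verts G) = k}) = (G \<in> trees_on {1..k})"
      by (simp add: AE_measure_pmf_iff)
  qed auto
  also have "\<dots> = (\<Sum>G\<in>trees_on {1..k}. pmf (CC_star p n m) G)"
    by (rule measure_measure_pmf_finite[OF finite_trees_on]) simp
  also have "\<dots> = (\<Sum>G\<in>trees_on {1..k}. pmf (CC_star p n m) \<tau>)"
    by (rule sum.cong[OF refl]) (rule CC_star_uniform[OF n p _ t])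
  finally show ?thesis by (simp add: num_trees_def)
qed

section \<open>From vertex averages to the component of vertex 1\<close>

context frozen_parameter
begin

text \<open>By exchangeability the probability at vertex 1 is the average over all vertices, that
  is, the mean fraction of vertices whose component satisfies P.\<close>

lemma prob_CC_star_eq:
  assumes n: "n \<ge> 2"
    and inv: "\<And>\<sigma> H. wf_graph H \<Longrightarrow> inj_on \<sigma> (verts H) \<Longrightarrow> P (relabel \<sigma> H) \<longleftrightarrow> P H"
  shows "measure_pmf.prob (CC_star p n m) {G. P G} =
    EE n m (\<lambda>x. real (card {v \<in> {1..n}. P (component (fst x) v)})) / real n"
proof -
  let ?M = "frozen_graph p n m"
  have "measure_pmf.prob (CC_star p n m) {G. P G} =
      measure_pmf.prob ?M {G. P (relabel_increasing (component G 1))}"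
    by (simp add: CC_star_def vimage_def)
  also have "\<dots> = measure_pmf.prob ?M {G. P (component G 1)}"
  proof (rule measure_pmf.finite_measure_eq_AE)
    have "P (relabel_increasing (component G 1)) \<longleftrightarrow> P (component G 1)" if "G \<in> set_pmf ?M" for G
    proof -
      have wf: "wf_graph (component G 1)"
        by (rule wf_component[OF valid_graph_wf[OF frozen_graph_support(1)[OF n that]]])
      show ?thesis unfolding relabel_increasing_eq
        using rank_in_bij[OF wf_graph_finite[OF wf]] by (intro inv[OF wf]) (simp add: bij_betw_def)
    qed
    then show "AE G in measure_pmf ?M. (G \<in> {G. P (relabel_increasing (component G 1))}) = (G \<in> {G. P (component G 1)})"
      by (simp add: AE_measure_pmf_iff)
  qed auto
  finally have 1: "measure_pmf.prob (CC_star p n m) {G. P G} = measure_pmf.prob ?M {G. P (component G 1)}" .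
  have "real n * measure_pmf.prob (CC_star p n m) {G. P G} =
      (\<Sum>v\<in>{1..n}. measure_pmf.prob ?M {G. P (component G 1)})" using 1 by simp
  also have "\<dots> = (\<Sum>v\<in>{1..n}. measure_pmf.prob ?M {G. P (component G v)})"
  proof (rule sum.cong[OF refl])
    fix v assume "v \<in> {1..n}"
    then show "measure_pmf.prob ?M {G. P (component G 1)} = measure_pmf.prob ?M {G. P (component G v)}"
      using n by (intro prob_component_exchangeable[OF n]) (auto intro!: inv intro: inj_on_subset)
  qed
  also have "\<dots> = measure_pmf.expectation ?M (\<lambda>G. real (card {v \<in> {1..n}. P (component G v)}))"
    by (rule sum_prob_eq_expectation[OF n])
  also have "\<dots> = EE n m (\<lambda>x. real (card {v \<in> {1..n}. P (component (fst x) v)}))"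
    unfolding map_fst_augmented[symmetric] by simp
  finally show ?thesis using n by (simp add: field_simps)
qed

lemma prob_CC_star_tree_of_size:
  assumes n: "n \<ge> 2"
  shows "measure_pmf.prob (CC_star p n m) {G. is_tree G \<and> card (verts G) = k} = EE n m (\<lambda>x. yfrac n k (fst x))"
proof -
  have "measure_pmf.prob (CC_star p n m) {G. is_tree G \<and> card (verts G) = k} =
    EE n m (\<lambda>x. real (card {v \<in> {1..n}. is_tree (component (fst x) v) \<and> card (verts (component (fst x) v)) = k})) / real n"
    by (rule prob_CC_star_eq[OF n]) (simp add: is_tree_relabel card_image)
  also have "\<dots> = EE n m (\<lambda>x. real (card {v \<in> {1..n}. is_tree (component (fst x) v) \<and> card (verts (component (fst x) v)) = k}) / real n)"
    by simp
  also have "\<dots> = EE n m (\<lambda>x. yfrac n k (fst x))"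
  proof (rule integral_cong_AE)
    have "{v \<in> {1..n}. is_tree (component (fst x) v) \<and> card (verts (component (fst x) v)) = k} =
        {u \<in> treev (fst x). csize (fst x) u = k}" if "x \<in> set_pmf (augmented p n m)" for x
      using aug_support(2)[OF n that] by (auto simp: treev_def csize_def)
    then show "AE x in measure_pmf (augmented p n m). real (card {v \<in> {1..n}. is_tree (component (fst x) v) \<and>
        card (verts (component (fst x) v)) = k}) / real n = yfrac n k (fst x)"
      by (simp add: AE_measure_pmf_iff yfrac_def tree_count_def)
  qed auto
  finally show ?thesis .
qed

lemma prob_CC_star_tree:
  assumes n: "n \<ge> 2"
  shows "measure_pmf.prob (CC_star p n m) {G. is_tree G} = EE n m (\<lambda>x. vfrac n (fst x))"
proof -
  have "measure_pmf.prob (CC_star p n m) {G. is_tree G} =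
    EE n m (\<lambda>x. real (card {v \<in> {1..n}. is_tree (component (fst x) v)})) / real n"
    by (rule prob_CC_star_eq[OF n]) (simp add: is_tree_relabel)
  also have "\<dots> = EE n m (\<lambda>x. real (card {v \<in> {1..n}. is_tree (component (fst x) v)}) / real n)"
    by simp
  also have "\<dots> = EE n m (\<lambda>x. vfrac n (fst x))"
  proof (rule integral_cong_AE)
    have "{v \<in> {1..n}. is_tree (component (fst x) v)} = treev (fst x)"
      if "x \<in> set_pmf (augmented p n m)" for x
      using aug_support(2)[OF n that] by (auto simp: treev_def)
    then show "AE x in measure_pmf (augmented p n m). real (card {v \<in> {1..n}. is_tree (component (fst x) v)}) / real n
        = vfrac n (fst x)"
      by (simp add: AE_measure_pmf_iff vfrac_def)
  qed auto
  finally show ?thesis .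
qed

end

section \<open>The Galton--Watson tree\<close>

lemma card_bij_funcset:
  assumes "finite A" "finite B" "card A = card B"
  shows "card {f \<in> A \<rightarrow>\<^sub>E B. bij_betw f A B} = fact (card A)"
proof -
  have "{f \<in> A \<rightarrow>\<^sub>E B. bij_betw f A B} = {f \<in> A \<rightarrow>\<^sub>E B. inj_on f A}"
  proof -
    have "f ` A = B" if "f \<in> A \<rightarrow>\<^sub>E B" "inj_on f A" for f
      using that assms card_image[OF that(2)] by (intro card_subset_eq) auto
    then show ?thesis by (auto simp: bij_betw_def)
  qed
  moreover have "card {f \<in> A \<rightarrow>\<^sub>E B. inj_on f A} = prod ((-) (card B)) {0..<card A}"
    using card_inj_on_subset_funcset[OF assms(1,2), of A] by simp
  ultimately show ?thesis using assms(3) by (simp add: fact_prod_rev)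
qed

lemma plane_tree_Nil [simp]: "[] \<in> plane_tree K"
  by (simp add: plane_tree_def)

lemma plane_tree_snoc: "u @ [i] \<in> plane_tree K \<longleftrightarrow> u \<in> plane_tree K \<and> i < K u"
  by (auto simp: plane_tree_def nth_append less_Suc_eq)

text \<open>Only the offspring numbers on the tree itself matter. Prescribing a finite tree
  therefore fixes finitely many coordinates of K, and its probability is a finite product.\<close>

lemma plane_tree_eq_iff: "plane_tree K = plane_tree K' \<longleftrightarrow> (\<forall>u\<in>plane_tree K'. K u = K' u)"
proof
  assume eq: "plane_tree K = plane_tree K'"
  show "\<forall>u\<in>plane_tree K'. K u = K' u"
  proof
    fix u assume u: "u \<in> plane_tree K'"
    have "i < K u \<longleftrightarrow> i < K' u" for i
      using plane_tree_snoc[of u i K] plane_tree_snoc[of u i K'] u eq by auto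
    then show "K u = K' u" by (meson less_irrefl linorder_neqE_nat)
  qed
next
  assume eq: "\<forall>u\<in>plane_tree K'. K u = K' u"
  have "u \<in> plane_tree K \<longleftrightarrow> u \<in> plane_tree K'" for u
  proof (induction u rule: rev_induct)
    case (snoc i u)
    then show ?case using eq by (auto simp: plane_tree_snoc)
  qed simp
  then show "plane_tree K = plane_tree K'" by blast
qed

lemma nonroot_split: "u \<noteq> [] \<Longrightarrow> u \<in> plane_tree K \<Longrightarrow>
    butlast u \<in> plane_tree K \<and> last u < K (butlast u) \<and> u = butlast u @ [last u]"
  using plane_tree_snoc[of "butlast u" "last u" K] by simp

text \<open>Every vertex other than the root is a child exactly once.\<close>

lemma sum_offspring:
  assumes "finite (plane_tree K)"
  shows "(\<Sum>u\<in>plane_tree K. K u) = card (plane_tree K) - 1"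
proof -
  have "bij_betw (\<lambda>(u, i). u @ [i]) (SIGMA u:plane_tree K. {..<K u}) (plane_tree K - {[]})"
    by (rule bij_betw_byWitness[where f' = "\<lambda>u. (butlast u, last u)"])
       (auto simp: plane_tree_snoc dest: nonroot_split)
  from bij_betw_same_card[OF this] show ?thesis using assms by (simp add: card_Diff_singleton)
qed

lemma plane_tree_cylinder:
  "{K. plane_tree K = plane_tree K'} = prod_emb UNIV (\<lambda>_. measure_pmf \<mu>) (plane_tree K') (\<Pi>\<^sub>E u\<in>plane_tree K'. {K' u})"
  by (auto simp: plane_tree_eq_iff prod_emb_def PiE_iff restrict_def extensional_def)

lemma emeasure_plane_tree:
  assumes "finite (plane_tree K')"
  shows "emeasure (GW_offspring \<mu>) {K. plane_tree K = plane_tree K'} = (\<Prod>u\<in>plane_tree K'. pmf \<mu> (K' u))"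
    "{K. plane_tree K = plane_tree K'} \<in> sets (GW_offspring \<mu>)"
proof -
  have "emeasure (GW_offspring \<mu>) {K. plane_tree K = plane_tree K'} =
      (\<Prod>u\<in>plane_tree K'. emeasure (measure_pmf \<mu>) {K' u})"
    unfolding GW_offspring_def plane_tree_cylinder[of K' \<mu>]
    by (rule emeasure_PiM_emb) (use assms in \<open>auto intro: measure_pmf.prob_space_axioms\<close>)
  also have "\<dots> = (\<Prod>u\<in>plane_tree K'. pmf \<mu> (K' u))"
    by (simp add: emeasure_pmf_single prod_ennreal)
  finally show "emeasure (GW_offspring \<mu>) {K. plane_tree K = plane_tree K'} = (\<Prod>u\<in>plane_tree K'. pmf \<mu> (K' u))" .
  show "{K. plane_tree K = plane_tree K'} \<in> sets (GW_offspring \<mu>)"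
    unfolding GW_offspring_def plane_tree_cylinder[of K' \<mu>] using assms by (intro sets_PiM_I) auto
qed

lemma space_GW_offspring: "space (GW_offspring \<mu>) = UNIV"
  by (simp add: GW_offspring_def space_PiM)

lemma prob_space_GW_offspring: "prob_space (GW_offspring \<mu>)"
  unfolding GW_offspring_def by (intro prob_space_PiM measure_pmf.prob_space_axioms)

text \<open>Infinite trees are sent to \<open>{}\<close>, so that the map takes countably many values.\<close>

definition finite_tree :: "(nat list \<Rightarrow> nat) \<Rightarrow> nat list set" where
  "finite_tree K = (if finite (plane_tree K) then plane_tree K else {})"

text \<open>There are countably many finite sets of words, so preimages of singletons suffice; that
  of \<open>{}\<close> is the complement of all others.\<close>

lemma finite_tree_measurable:
  "finite_tree \<in> measurable (GW_offspring \<mu>) (count_space (Collect finite))"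
proof -
  have fin: "finite_tree -` {T} \<inter> space (GW_offspring \<mu>) \<in> sets (GW_offspring \<mu>)" if "finite T" "T \<noteq> {}" for T
  proof (cases "\<exists>K'. T = plane_tree K'")
    case True
    then obtain K' where K': "T = plane_tree K'" by blast
    have "finite_tree -` {T} \<inter> space (GW_offspring \<mu>) = {K. plane_tree K = plane_tree K'}"
    proof -
      have "finite_tree K = T \<longleftrightarrow> plane_tree K = T" for K
        using that unfolding finite_tree_def by (cases "finite (plane_tree K)") auto
      then show ?thesis unfolding space_GW_offspring K'[symmetric] by auto
    qed
    then show ?thesis using emeasure_plane_tree(2) that(1) K' by simp
  next
    case False
    then have "finite_tree -` {T} \<inter> space (GW_offspring \<mu>) = {}"
      using that by (auto simp: finite_tree_def split: if_splits)
    then show ?thesis by simp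
  qed
  have "finite_tree -` {{}} \<inter> space (GW_offspring \<mu>) =
      space (GW_offspring \<mu>) - (\<Union>T\<in>{T. finite T \<and> T \<noteq> {}}. finite_tree -` {T} \<inter> space (GW_offspring \<mu>))"
  proof -
    have "finite (finite_tree K)" for K by (simp add: finite_tree_def)
    then show ?thesis by (auto simp: space_GW_offspring)
  qed
  moreover have "countable {T :: nat list set. finite T \<and> T \<noteq> {}}"
    by (rule countable_subset[OF _ countable_Collect_finite]) auto
  then have "(\<Union>T\<in>{T. finite T \<and> T \<noteq> {}}. finite_tree -` {T} \<inter> space (GW_offspring \<mu>)) \<in> sets (GW_offspring \<mu>)"
    by (rule sets.countable_UN') (use fin in blast)
  ultimately have empty: "finite_tree -` {{}} \<inter> space (GW_offspring \<mu>) \<in> sets (GW_offspring \<mu>)"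
    by (simp only: sets.Diff[OF sets.top])
  have "finite_tree -` {T} \<inter> space (GW_offspring \<mu>) \<in> sets (GW_offspring \<mu>)" if "finite T" for T
    using fin[OF that] empty by (cases "T = {}") auto
  then show ?thesis
    by (subst measurable_count_space_eq_countable[OF countable_Collect_finite])
       (auto simp: finite_tree_def)
qed

lemma random_labelling_measurable:
  "(\<lambda>K. measure_pmf (random_labelling (plane_tree K))) \<in>
     measurable (GW_offspring \<mu>) (subprob_algebra (count_space UNIV))"
proof -
  let ?g = "\<lambda>T. if T = {} then measure_pmf (return_pmf (Multigraph {} {#})) else measure_pmf (random_labelling T)"
  have "?g \<in> measurable (count_space (Collect finite)) (subprob_algebra (count_space UNIV))"
    by (simp add: measurable_count_space_eq1 Pi_iff measure_pmf_in_subprob_algebra)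
  from measurable_compose[OF finite_tree_measurable this]
  have "(\<lambda>K. ?g (finite_tree K)) \<in> measurable (GW_offspring \<mu>) (subprob_algebra (count_space UNIV))" .
  \<comment> \<open>A plane tree contains the root, so \<open>{}\<close> stands for infinite trees
    only, which \<open>random_labelling\<close> sends to the empty graph as well.\<close>
  moreover have "?g (finite_tree K) = measure_pmf (random_labelling (plane_tree K))" for K
  proof -
    have "plane_tree K \<noteq> {}" using plane_tree_Nil[of K] by blast
    then show ?thesis by (simp add: finite_tree_def random_labelling_def)
  qed
  ultimately show ?thesis by simp
qed

text \<open>The root label is fixed because \<tau> itself is unrooted. Extensionality of \<sigma>
  makes each labelling count once.\<close>

definition labelled_plane_trees :: "nat multigraph \<Rightarrow> nat \<Rightarrow> (nat list set \<times> (nat list \<Rightarrow> nat)) set" where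
  "labelled_plane_trees \<tau> r = {(T, \<sigma>). T \<in> range plane_tree \<and> \<sigma> \<in> T \<rightarrow>\<^sub>E verts \<tau> \<and> bij_betw \<sigma> T (verts \<tau>)
      \<and> relabel \<sigma> (underlying_graph T) = \<tau> \<and> \<sigma> [] = r}"

text \<open>The orientation towards the root is unique. If the edge joining v to its parent x were,
  in the second orientation, the edge above x, then induction at x, where \<open>d\<close> is
  smaller, would make v the parent of x in the first one too.\<close>

lemma parent_function_unique:
  fixes d d' :: "'v \<Rightarrow> nat"
  assumes p: "\<And>v. v \<in> V - {r} \<Longrightarrow> par v \<in> V \<and> d (par v) < d v"
    and p': "\<And>v. v \<in> V - {r} \<Longrightarrow> par' v \<in> V \<and> d' (par' v) < d' v"
    and eq: "(\<lambda>v. {par v, v}) ` (V - {r}) = (\<lambda>v. {par' v, v}) ` (V - {r})"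
  shows "v \<in> V - {r} \<Longrightarrow> par v = par' v"
proof (induction "d v" arbitrary: v rule: less_induct)
  case less
  have "{par v, v} \<in> (\<lambda>v. {par' v, v}) ` (V - {r})" using eq less.prems by blast
  then obtain x where x: "x \<in> V - {r}" "{par v, v} = {par' x, x}" by auto
  show ?case
  proof (cases "x = v")
    case True
    then show ?thesis using x(2) by (metis doubleton_eq_iff)
  next
    case False
    then have x': "x = par v" "v = par' x" using x(2) by (auto simp: doubleton_eq_iff)
    have dx: "d x < d v" using p[OF less.prems] unfolding x'(1) by blast
    have "par x = v" using less.hyps[OF dx x(1)] x'(2)[symmetric] by (rule trans)
    then have "d v < d x" using p[OF x(1)] by blast
    then show ?thesis using dx by simp
  qed
qed

section \<open>Plane trees above a rooted labelled tree\<close>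

locale rooted_tree =
  fixes \<tau> :: "nat multigraph" and r :: nat and par :: "nat \<Rightarrow> nat" and d :: "nat \<Rightarrow> nat"
  assumes finV: "finite (verts \<tau>)" and rV: "r \<in> verts \<tau>"
    and par: "\<And>v. v \<in> verts \<tau> - {r} \<Longrightarrow> par v \<in> verts \<tau> \<and> d (par v) < d v"
    and edges: "edges \<tau> = mset_set ((\<lambda>v. {par v, v}) ` (verts \<tau> - {r}))"
begin

abbreviation "V \<equiv> verts \<tau>"

definition children :: "nat \<Rightarrow> nat set" where
  "children v = {w \<in> V - {r}. par w = v}"

definition orderings :: "(nat \<Rightarrow> nat \<Rightarrow> nat) set" where
  "orderings = (\<Pi>\<^sub>E v\<in>V. {\<omega> \<in> {..<card (children v)} \<rightarrow>\<^sub>E children v. bij_betw \<omega> {..<card (children v)} (children v)})"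

text \<open>Reads a word as successive choices of children from the root:
  \<open>\<omega> v i\<close> is the i-th child of v.\<close>

definition walk :: "(nat \<Rightarrow> nat \<Rightarrow> nat) \<Rightarrow> nat list \<Rightarrow> nat" where
  "walk \<omega> u = foldl \<omega> r u"

definition unfold_tree :: "(nat \<Rightarrow> nat \<Rightarrow> nat) \<Rightarrow> nat list set" where
  "unfold_tree \<omega> = plane_tree (\<lambda>u. card (children (walk \<omega> u)))"

lemma finite_children [simp]: "finite (children v)"
  using finV by (simp add: children_def)

lemma walk_Nil [simp]: "walk \<omega> [] = r"
  by (simp add: walk_def)

lemma walk_snoc [simp]: "walk \<omega> (u @ [i]) = \<omega> (walk \<omega> u) i"
  by (simp add: walk_def)

lemma unfold_tree_snoc: "u @ [i] \<in> unfold_tree \<omega> \<longleftrightarrow> u \<in> unfold_tree \<omega> \<and> i < card (children (walk \<omega> u))"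
  by (simp add: unfold_tree_def plane_tree_snoc)

lemma unfold_tree_Nil [simp]: "[] \<in> unfold_tree \<omega>"
  by (simp add: unfold_tree_def)

lemma card_orderings: "card orderings = (\<Prod>v\<in>V. fact (card (children v)))"
  unfolding orderings_def using finV by (subst card_PiE) (auto simp: card_bij_funcset)

context
  fixes \<omega> assumes \<omega>: "\<omega> \<in> orderings"
begin

lemma ordering_bij: "v \<in> V \<Longrightarrow> bij_betw (\<omega> v) {..<card (children v)} (children v)"
  using \<omega> by (auto simp: orderings_def PiE_iff)

lemma walk_in: "u \<in> unfold_tree \<omega> \<Longrightarrow> walk \<omega> u \<in> V"
proof (induction u rule: rev_induct)
  case (snoc i u)
  then have "\<omega> (walk \<omega> u) i \<in> children (walk \<omega> u)"
    using ordering_bij[of "walk \<omega> u"] by (auto simp: unfold_tree_snoc bij_betw_def)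
  then show ?case by (simp add: children_def)
qed (simp add: rV)

lemma walk_snoc_props:
  assumes "u @ [i] \<in> unfold_tree \<omega>"
  shows "walk \<omega> (u @ [i]) \<in> V - {r}" "par (walk \<omega> (u @ [i])) = walk \<omega> u"
proof -
  have "u \<in> unfold_tree \<omega>" "i < card (children (walk \<omega> u))" using assms by (auto simp: unfold_tree_snoc)
  then have "\<omega> (walk \<omega> u) i \<in> children (walk \<omega> u)"
    using ordering_bij[OF walk_in[of u]] by (auto simp: bij_betw_def)
  then show "walk \<omega> (u @ [i]) \<in> V - {r}" "par (walk \<omega> (u @ [i])) = walk \<omega> u"
    by (auto simp: children_def)
qed

lemma walk_inj: "u \<in> unfold_tree \<omega> \<Longrightarrow> u' \<in> unfold_tree \<omega> \<Longrightarrow> walk \<omega> u = walk \<omega> u' \<Longrightarrow> u = u'"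
proof (induction u arbitrary: u' rule: rev_induct)
  case Nil
  show ?case
  proof (cases u' rule: rev_cases)
    case (snoc w j)
    then show ?thesis using walk_snoc_props(1)[of w j] Nil by auto
  qed simp
next
  case (snoc i u)
  show ?case
  proof (cases u' rule: rev_cases)
    case Nil
    then show ?thesis using walk_snoc_props(1)[of u i] snoc.prems by auto
  next
    case (snoc w j)
    note w = this
    have u: "u \<in> unfold_tree \<omega>" "i < card (children (walk \<omega> u))"
      and w': "w \<in> unfold_tree \<omega>" "j < card (children (walk \<omega> w))"
      using snoc.prems w by (auto simp: unfold_tree_snoc)
    have "walk \<omega> u = walk \<omega> w"
      using walk_snoc_props(2)[of u i] walk_snoc_props(2)[of w j] snoc.prems w by metis
    then have eq: "u = w" using snoc.IH u(1) w'(1) by blast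
    have "\<omega> (walk \<omega> u) i = \<omega> (walk \<omega> u) j" using snoc.prems w eq by simp
    then have "i = j"
      using ordering_bij[OF walk_in[OF u(1)]] u(2) w'(2) eq by (auto simp: bij_betw_def inj_on_def)
    then show ?thesis using w eq by simp
  qed
qed

lemma walk_surj: "v \<in> V \<Longrightarrow> \<exists>u\<in>unfold_tree \<omega>. walk \<omega> u = v"
proof (induction "d v" arbitrary: v rule: less_induct)
  case less
  show ?case
  proof (cases "v = r")
    case True
    then show ?thesis using unfold_tree_Nil walk_Nil by blast
  next
    case False
    then have v: "v \<in> V - {r}" using less.prems by simp
    then obtain u where u: "u \<in> unfold_tree \<omega>" "walk \<omega> u = par v" using less.hyps par by blast
    have "v \<in> children (walk \<omega> u)" using v u by (simp add: children_def)
    then have "v \<in> \<omega> (walk \<omega> u) ` {..<card (children (walk \<omega> u))}"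
      using ordering_bij[OF walk_in[OF u(1)]] by (simp add: bij_betw_def)
    then obtain i where i: "i < card (children (walk \<omega> u))" "\<omega> (walk \<omega> u) i = v" by auto
    then have "u @ [i] \<in> unfold_tree \<omega>" "walk \<omega> (u @ [i]) = v" using u by (auto simp: unfold_tree_snoc)
    then show ?thesis by blast
  qed
qed

lemma walk_bij: "bij_betw (walk \<omega>) (unfold_tree \<omega>) V"
  unfolding bij_betw_def
proof
  show "inj_on (walk \<omega>) (unfold_tree \<omega>)" using walk_inj by (intro inj_onI)
  show "walk \<omega> ` unfold_tree \<omega> = V"
  proof
    show "V \<subseteq> walk \<omega> ` unfold_tree \<omega>" using walk_surj by (metis image_eqI subsetI)
  qed (use walk_in in auto)
qed

lemma relabel_unfold: "relabel (restrict (walk \<omega>) (unfold_tree \<omega>)) (underlying_graph (unfold_tree \<omega>)) = \<tau>"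
proof -
  let ?T = "unfold_tree \<omega>" and ?\<sigma> = "restrict (walk \<omega>) (unfold_tree \<omega>)"
  let ?E = "(\<lambda>u. {butlast u, u}) ` (?T - {[]})"
  have b: "bij_betw ?\<sigma> ?T V" using walk_bij by (simp cong: bij_betw_cong)
  have bl: "butlast u \<in> ?T" if "u \<in> ?T" for u
    using that nonroot_split[of u] unfolding unfold_tree_def by (cases "u = []") auto
  have "inj_on ((`) ?\<sigma>) ?E"
  proof (rule inj_on_subset)
    show "inj_on ((`) ?\<sigma>) (Pow ?T)" using b by (simp add: bij_betw_def inj_on_image_Pow)
    show "?E \<subseteq> Pow ?T" using bl by auto
  qed
  then have "image_mset ((`) ?\<sigma>) (mset_set ?E) = mset_set ((`) ?\<sigma> ` ?E)" by (rule image_mset_mset_set)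
  also have "(`) ?\<sigma> ` ?E = (\<lambda>v. {par v, v}) ` (V - {r})"
  proof -
    have "(`) ?\<sigma> ` ?E = (\<lambda>u. {walk \<omega> (butlast u), walk \<omega> u}) ` (?T - {[]})"
      unfolding image_image using bl by (intro image_cong) auto
    also have "\<dots> = (\<lambda>u. {par (walk \<omega> u), walk \<omega> u}) ` (?T - {[]})"
    proof (rule image_cong[OF refl])
      fix u assume u: "u \<in> ?T - {[]}"
      then have "u = butlast u @ [last u]" by simp
      then have "par (walk \<omega> u) = walk \<omega> (butlast u)" using walk_snoc_props(2)[of "butlast u" "last u"] u by simp
      then show "{walk \<omega> (butlast u), walk \<omega> u} = {par (walk \<omega> u), walk \<omega> u}" by simp
    qed
    also have "\<dots> = (\<lambda>v. {par v, v}) ` (walk \<omega> ` (?T - {[]}))" by (simp add: image_image)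
    also have "walk \<omega> ` (?T - {[]}) = V - {r}"
    proof -
      have "walk \<omega> ` (?T - {[]}) = walk \<omega> ` ?T - walk \<omega> ` {[]}"
        using walk_bij by (intro inj_on_image_set_diff[of _ ?T]) (auto simp: bij_betw_def)
      then show ?thesis using walk_bij by (simp add: bij_betw_def)
    qed
    finally show ?thesis .
  qed
  finally have "image_mset ((`) ?\<sigma>) (mset_set ?E) = mset_set ((\<lambda>v. {par v, v}) ` (V - {r}))" .
  then have "image_mset ((`) ?\<sigma>) (mset_set ?E) = edges \<tau>" unfolding edges .
  moreover have "?\<sigma> ` ?T = V" using b by (simp add: bij_betw_def)
  ultimately show ?thesis
    unfolding relabel_def underlying_graph_def multigraph.sel by (simp only: multigraph.collapse)
qed

lemma unfold_in_labelled: "(unfold_tree \<omega>, restrict (walk \<omega>) (unfold_tree \<omega>)) \<in> labelled_plane_trees \<tau> r"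
proof -
  let ?T = "unfold_tree \<omega>"
  have "bij_betw (restrict (walk \<omega>) ?T) ?T V" using walk_bij by (simp cong: bij_betw_cong)
  moreover have "restrict (walk \<omega>) ?T \<in> ?T \<rightarrow>\<^sub>E V" using walk_in by auto
  moreover have "?T \<in> range plane_tree" by (simp add: unfold_tree_def)
  ultimately show ?thesis using relabel_unfold by (simp add: labelled_plane_trees_def)
qed

end

text \<open>Transporting \<open>butlast\<close> by the labelling gives a second parent function with
  the same root and edges. By uniqueness it is \<open>par\<close>, so children in the plane tree
  carry exactly the labels of children in \<tau>.\<close>

lemma labelled_plane_tree_props:
  assumes T: "(plane_tree K, \<sigma>) \<in> labelled_plane_trees \<tau> r"
  shows "u @ [i] \<in> plane_tree K \<Longrightarrow> \<sigma> (u @ [i]) \<in> children (\<sigma> u)"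
    and "u \<in> plane_tree K \<Longrightarrow> bij_betw (\<lambda>i. \<sigma> (u @ [i])) {..<K u} (children (\<sigma> u))"
    and "u \<in> plane_tree K \<Longrightarrow> K u = card (children (\<sigma> u))"
proof -
  let ?T = "plane_tree K"
  have b: "bij_betw \<sigma> ?T V" and rel: "relabel \<sigma> (underlying_graph ?T) = \<tau>" and root: "\<sigma> [] = r"
    using T by (auto simp: labelled_plane_trees_def)
  have fin: "finite ?T" using b finV bij_betw_finite by blast
  have inj: "inj_on \<sigma> ?T" and im: "\<sigma> ` ?T = V" using b by (auto simp: bij_betw_def)
  let ?i = "inv_into ?T \<sigma>"
  have iT: "?i v \<in> ?T" "\<sigma> (?i v) = v" if "v \<in> V" for v
    using that im by (auto intro: inv_into_into f_inv_into_f)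
  have ii: "?i (\<sigma> u) = u" if "u \<in> ?T" for u using inj that by (rule inv_into_f_f)
  have inonroot: "?i v \<noteq> []" if "v \<in> V - {r}" for v using iT[of v] that root by auto
  define par' where "par' v = \<sigma> (butlast (?i v))" for v
  define d' where "d' v = length (?i v)" for v
  have bl: "butlast u \<in> ?T" if "u \<in> ?T" for u
    using that nonroot_split[of u] by (cases "u = []") auto
  have p': "par' v \<in> V \<and> d' (par' v) < d' v" if v: "v \<in> V - {r}" for v
  proof -
    have "?i v \<in> ?T" using iT v by blast
    then have "butlast (?i v) \<in> ?T" by (rule bl)
    then show ?thesis using im ii[of "butlast (?i v)"] inonroot[OF v] by (auto simp: par'_def d'_def)
  qed
  have edges': "(\<lambda>v. {par' v, v}) ` (V - {r}) = (\<lambda>v. {par v, v}) ` (V - {r})"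
  proof -
    let ?E = "(\<lambda>u. {butlast u, u}) ` (?T - {[]})"
    have e: "mset_set ((\<lambda>v. {par v, v}) ` (V - {r})) = image_mset ((`) \<sigma>) (mset_set ?E)"
      using arg_cong[OF rel, of multigraph.edges] unfolding edges by (simp add: underlying_graph_def)
    have "(`) \<sigma> ` ?E = (\<lambda>v. {par v, v}) ` (V - {r})"
      using arg_cong[OF e, of set_mset] fin finV by simp
    moreover have "(`) \<sigma> ` ?E = (\<lambda>v. {par' v, v}) ` (\<sigma> ` (?T - {[]}))"
      unfolding image_image using ii by (intro image_cong) (auto simp: par'_def)
    moreover have "\<sigma> ` (?T - {[]}) = V - {r}"
      using inj_on_image_set_diff[OF inj, of ?T "{[]}"] im root by simp
    ultimately show ?thesis by simp
  qed
  have par_eq: "par v = par' v" if "v \<in> V - {r}" for v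
    by (rule parent_function_unique[where d = d and d' = d', OF par p' edges'[symmetric] that])
  show child: "\<sigma> (u @ [i]) \<in> children (\<sigma> u)" if "u @ [i] \<in> ?T" for u i
  proof -
    have "\<sigma> (u @ [i]) \<in> V" using that im by blast
    moreover have "\<sigma> (u @ [i]) \<noteq> r"
    proof
      assume "\<sigma> (u @ [i]) = r"
      then have "u @ [i] = []" using inj_onD[OF inj, of "u @ [i]" "[]"] root that by simp
      then show False by simp
    qed
    ultimately show ?thesis using par_eq[of "\<sigma> (u @ [i])"] ii[OF that] by (simp add: children_def par'_def)
  qed
  show bij: "bij_betw (\<lambda>i. \<sigma> (u @ [i])) {..<K u} (children (\<sigma> u))" if u: "u \<in> ?T" for u
    unfolding bij_betw_def
  proof
    have uT: "u @ [i] \<in> ?T" if "i < K u" for i using u that by (simp add: plane_tree_snoc)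
    show "inj_on (\<lambda>i. \<sigma> (u @ [i])) {..<K u}"
      using inj uT by (auto simp: inj_on_def)
    show "(\<lambda>i. \<sigma> (u @ [i])) ` {..<K u} = children (\<sigma> u)"
    proof
      show "(\<lambda>i. \<sigma> (u @ [i])) ` {..<K u} \<subseteq> children (\<sigma> u)" using child uT by auto
      show "children (\<sigma> u) \<subseteq> (\<lambda>i. \<sigma> (u @ [i])) ` {..<K u}"
      proof
        fix w assume w: "w \<in> children (\<sigma> u)"
        then have wV: "w \<in> V - {r}" "par w = \<sigma> u" by (auto simp: children_def)
        have iw: "?i w \<in> ?T" "\<sigma> (?i w) = w" using iT wV by auto
        have bw: "butlast (?i w) \<in> ?T" by (rule bl[OF iw(1)])
        have "\<sigma> (butlast (?i w)) = \<sigma> u"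
          using par_eq[OF wV(1)] wV(2) unfolding par'_def by (rule trans[OF sym])
        then have "butlast (?i w) = u" by (rule inj_onD[OF inj _ bw u])
        then have "?i w = u @ [last (?i w)]" "last (?i w) < K u"
          using nonroot_split[OF inonroot[OF wV(1)] iw(1)] by simp_all
        then show "w \<in> (\<lambda>i. \<sigma> (u @ [i])) ` {..<K u}"
          using iw(2) by (intro image_eqI[of _ _ "last (?i w)"]) simp_all
      qed
    qed
  qed
  show "K u = card (children (\<sigma> u))" if u: "u \<in> ?T"
    using bij_betw_same_card[OF bij[OF u]] by simp
qed

text \<open>A labelled plane tree that gives \<tau> amounts to an order on the children of every
  vertex. Conversely, the i-th child of v is the label of the i-th child of the word labelled
  v.\<close>

lemma unfold_bij:
  "bij_betw (\<lambda>\<omega>. (unfold_tree \<omega>, restrict (walk \<omega>) (unfold_tree \<omega>))) orderings (labelled_plane_trees \<tau> r)"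
proof (rule bij_betw_byWitness[where f' = "\<lambda>(T, \<sigma>). \<lambda>v\<in>V. \<lambda>i\<in>{..<card (children v)}. \<sigma> (inv_into T \<sigma> v @ [i])"])
  let ?\<Psi> = "\<lambda>T \<sigma>. \<lambda>v\<in>V. \<lambda>i\<in>{..<card (children v)}. \<sigma> (inv_into T \<sigma> v @ [i])"
  have \<Psi>: "?\<Psi> T \<sigma> \<in> orderings \<and> (unfold_tree (?\<Psi> T \<sigma>), restrict (walk (?\<Psi> T \<sigma>)) (unfold_tree (?\<Psi> T \<sigma>))) = (T, \<sigma>)"
    if T\<sigma>: "(T, \<sigma>) \<in> labelled_plane_trees \<tau> r" for T \<sigma>
  proof -
    obtain K where T: "T = plane_tree K" using T\<sigma> by (auto simp: labelled_plane_trees_def)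
    note props = labelled_plane_tree_props[OF T\<sigma>[unfolded T], folded T]
    have b: "bij_betw \<sigma> T V" and ext: "\<sigma> \<in> T \<rightarrow>\<^sub>E V" and root: "\<sigma> [] = r"
      using T\<sigma> by (auto simp: labelled_plane_trees_def)
    have inj: "inj_on \<sigma> T" and im: "\<sigma> ` T = V" using b by (auto simp: bij_betw_def)
    let ?\<omega> = "?\<Psi> T \<sigma>"
    have val: "?\<omega> (\<sigma> u) i = \<sigma> (u @ [i])" if "u \<in> T" "i < K u" for u i
      using that inj im props(3)[OF that(1)] by auto
    have "?\<omega> v \<in> {\<omega> \<in> {..<card (children v)} \<rightarrow>\<^sub>E children v. bij_betw \<omega> {..<card (children v)} (children v)}"
      if "v \<in> V" for v
    proof -
      obtain u where u: "u \<in> T" "v = \<sigma> u" using \<open>v \<in> V\<close> im by blast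
      have "bij_betw (?\<omega> v) {..<K u} (children v)"
      proof -
        have "bij_betw (?\<omega> (\<sigma> u)) {..<K u} (children (\<sigma> u)) \<longleftrightarrow>
            bij_betw (\<lambda>i. \<sigma> (u @ [i])) {..<K u} (children (\<sigma> u))"
          by (rule bij_betw_cong) (rule val[OF u(1)], simp)
        then show ?thesis using props(2)[OF u(1)] unfolding u(2) by blast
      qed
      then have "bij_betw (?\<omega> v) {..<card (children v)} (children v)" using props(3)[OF u(1)] u(2) by simp
      moreover have "?\<omega> v \<in> extensional {..<card (children v)}" using \<open>v \<in> V\<close> by simp
      ultimately show ?thesis by (auto simp: PiE_iff bij_betw_def)
    qed
    then have ord: "?\<omega> \<in> orderings" unfolding orderings_def by (intro PiE_I) auto
    have walk: "walk ?\<omega> u = \<sigma> u" if "u \<in> T" for u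
      using that
    proof (induction u rule: rev_induct)
      case Nil then show ?case using root by simp
    next
      case (snoc i u)
      then have u: "u \<in> T" "i < K u" by (auto simp: T plane_tree_snoc)
      show ?case by (simp only: walk_snoc snoc.IH[OF u(1)] val[OF u])
    qed
    have uT: "unfold_tree ?\<omega> = T"
      unfolding unfold_tree_def T plane_tree_eq_iff using props(3) walk by (simp add: T)
    have "restrict (walk ?\<omega>) T = \<sigma>"
      using walk ext by (auto simp: restrict_def fun_eq_iff PiE_iff extensional_def)
    then show ?thesis using ord uT by simp
  qed
  show "\<forall>x\<in>labelled_plane_trees \<tau> r. (\<lambda>\<omega>. (unfold_tree \<omega>, restrict (walk \<omega>) (unfold_tree \<omega>)))
      ((\<lambda>(T, \<sigma>). ?\<Psi> T \<sigma>) x) = x"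
    using \<Psi> by fast
  show "(\<lambda>(T, \<sigma>). ?\<Psi> T \<sigma>) ` labelled_plane_trees \<tau> r \<subseteq> orderings" using \<Psi> by fast
  show "(\<lambda>\<omega>. (unfold_tree \<omega>, restrict (walk \<omega>) (unfold_tree \<omega>))) ` orderings \<subseteq> labelled_plane_trees \<tau> r"
    using unfold_in_labelled by auto
  show "\<forall>\<omega>\<in>orderings. (\<lambda>(T, \<sigma>). ?\<Psi> T \<sigma>) (unfold_tree \<omega>, restrict (walk \<omega>) (unfold_tree \<omega>)) = \<omega>"
  proof
    fix \<omega> assume \<omega>: "\<omega> \<in> orderings"
    let ?T = "unfold_tree \<omega>" and ?\<sigma> = "restrict (walk \<omega>) (unfold_tree \<omega>)"
    have inj: "inj_on ?\<sigma> ?T" and im: "?\<sigma> ` ?T = V" using walk_bij[OF \<omega>] by (auto simp: bij_betw_def)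
    have "?\<Psi> ?T ?\<sigma> v i = \<omega> v i" for v i
    proof (cases "v \<in> V \<and> i < card (children v)")
      case True
      let ?u = "inv_into ?T ?\<sigma> v"
      have u: "?u \<in> ?T" "walk \<omega> ?u = v"
        using True im inv_into_into[of v ?\<sigma> ?T] f_inv_into_f[of v ?\<sigma> ?T] by auto
      then have "?u @ [i] \<in> ?T" using True by (simp add: unfold_tree_snoc)
      then show ?thesis using True u by simp
    next
      case False
      then show ?thesis using \<omega> by (auto simp: orderings_def PiE_iff extensional_def)
    qed
    then show "(\<lambda>(T, \<sigma>). ?\<Psi> T \<sigma>) (?T, ?\<sigma>) = \<omega>" by (simp add: fun_eq_iff)
  qed
qed

lemma labelled_plane_trees_weight:
  assumes "(plane_tree K, \<sigma>) \<in> labelled_plane_trees \<tau> r"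
  shows "(\<Prod>u\<in>plane_tree K. fact (K u)) = (\<Prod>v\<in>V. fact (card (children v)) :: real)"
proof -
  have b: "bij_betw \<sigma> (plane_tree K) V" using assms by (auto simp: labelled_plane_trees_def)
  have "(\<Prod>u\<in>plane_tree K. fact (K u)) = (\<Prod>u\<in>plane_tree K. fact (card (children (\<sigma> u))) :: real)"
    using labelled_plane_tree_props(3)[OF assms] by (intro prod.cong) auto
  also have "\<dots> = (\<Prod>v\<in>V. fact (card (children v)))"
    by (rule prod.reindex_bij_betw[OF b])
  finally show ?thesis .
qed

lemma finite_labelled_plane_trees: "finite (labelled_plane_trees \<tau> r)"
proof -
  have "card orderings > 0" unfolding card_orderings by (simp add: prod_pos)
  then show ?thesis using bij_betw_finite[OF unfold_bij] card_ge_0_finite by blast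
qed

lemma card_labelled_plane_trees:
  "card (labelled_plane_trees \<tau> r) = (\<Prod>v\<in>V. fact (card (children v)))"
  using bij_betw_same_card[OF unfold_bij] card_orderings by simp

end

section \<open>The law of the Galton-Watson tree\<close>

lemma pmf_poisson_law: "0 \<le> l \<Longrightarrow> pmf (poisson_law l) k = l ^ k / fact k * exp (- l)"
  by (cases "l = 0") (auto simp: poisson_law_def indicator_def power_0_left)

lemma labelled_plane_trees_finite:
  assumes "(T, \<sigma>) \<in> labelled_plane_trees \<tau> r" "finite (verts \<tau>)"
  shows "finite T" "card T = card (verts \<tau>)"
proof -
  have b: "bij_betw \<sigma> T (verts \<tau>)" using assms by (auto simp: labelled_plane_trees_def)
  show "finite T" using bij_betw_finite[OF b] assms by simp
  show "card T = card (verts \<tau>)" by (rule bij_betw_same_card[OF b])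
qed

text \<open>All terms are equal, and their number is the product of the factorials in the Poisson
  denominators. Hence the total depends on \<tau> through k alone.\<close>

lemma labelled_plane_trees_total:
  assumes t: "\<tau> \<in> trees_on {1..k}" and r: "r \<in> {1..k}" and l: "0 \<le> l"
  shows "finite (labelled_plane_trees \<tau> r)"
    "(\<Sum>(T, \<sigma>)\<in>labelled_plane_trees \<tau> r. measure (GW_offspring (poisson_law l)) {K. plane_tree K = T}) =
      exp (- real k * l) * l ^ (k - 1)"
proof -
  note tree = trees_onD[OF t]
  have rV: "r \<in> verts \<tau>" using r tree by simp
  obtain par and d :: "nat \<Rightarrow> nat" where
    "\<And>v. v \<in> verts \<tau> - {r} \<Longrightarrow> par v \<in> verts \<tau> \<and> d (par v) < d v"
    "edges \<tau> = mset_set ((\<lambda>v. {par v, v}) ` (verts \<tau> - {r}))"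
    using tree_parent_function[OF tree(2,3) rV] by blast
  then interpret rooted_tree \<tau> r par d
    using tree rV by unfold_locales auto
  show fin: "finite (labelled_plane_trees \<tau> r)" by (rule finite_labelled_plane_trees)
  define w where "w = (\<Prod>v\<in>V. fact (card (children v)) :: real)"
  have w: "w > 0" unfolding w_def by (intro prod_pos) simp
  have "measure (GW_offspring (poisson_law l)) {K. plane_tree K = T} = exp (- real k * l) * l ^ (k - 1) / w"
    if T: "(T, \<sigma>) \<in> labelled_plane_trees \<tau> r" for T \<sigma>
  proof -
    obtain K where K: "T = plane_tree K" using T by (auto simp: labelled_plane_trees_def)
    have f: "finite (plane_tree K)" "card (plane_tree K) = k"
      using labelled_plane_trees_finite[OF T] tree K by auto
    have "emeasure (GW_offspring (poisson_law l)) {K'. plane_tree K' = plane_tree K} =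
        ennreal (\<Prod>u\<in>plane_tree K. pmf (poisson_law l) (K u))"
      using emeasure_plane_tree(1)[OF f(1)] by simp
    then have "measure (GW_offspring (poisson_law l)) {K'. plane_tree K' = plane_tree K} =
        (\<Prod>u\<in>plane_tree K. pmf (poisson_law l) (K u))"
      by (simp add: measure_def prod_nonneg)
    also have "\<dots> = (\<Prod>u\<in>plane_tree K. l ^ K u / fact (K u) * exp (- l))"
      by (simp add: pmf_poisson_law[OF l])
    also have "\<dots> = (\<Prod>u\<in>plane_tree K. l ^ K u) / (\<Prod>u\<in>plane_tree K. fact (K u)) * exp (- l) ^ k"
      using f by (simp add: prod.distrib prod_dividef)
    \<comment> \<open>The exponents are the offspring numbers, which add up to the k - 1 vertices
      other than the root.\<close>
    also have "(\<Prod>u\<in>plane_tree K. l ^ K u) = l ^ (k - 1)"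
      using sum_offspring[OF f(1)] f(2) by (simp flip: power_sum)
    also have "(\<Prod>u\<in>plane_tree K. fact (K u)) = w"
      unfolding w_def using labelled_plane_trees_weight T K by blast
    also have "exp (- l) ^ k = exp (- real k * l)" by (simp flip: exp_of_nat_mult)
    finally show ?thesis unfolding K by simp
  qed
  then have "(\<Sum>(T, \<sigma>)\<in>labelled_plane_trees \<tau> r. measure (GW_offspring (poisson_law l)) {K. plane_tree K = T}) =
      (\<Sum>x\<in>labelled_plane_trees \<tau> r. exp (- real k * l) * l ^ (k - 1) / w)"
    by (intro sum.cong) auto
  also have "\<dots> = exp (- real k * l) * l ^ (k - 1)"
    using w card_labelled_plane_trees by (simp add: w_def)
  finally show "(\<Sum>(T, \<sigma>)\<in>labelled_plane_trees \<tau> r. measure (GW_offspring (poisson_law l)) {K. plane_tree K = T}) =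
      exp (- real k * l) * l ^ (k - 1)" .
qed

text \<open>The labellings that produce \<tau> are partitioned by the label of the root;
  \<open>fact k\<close> is the number of all labellings of a tree of size k.\<close>

lemma pmf_random_labelling:
  assumes t: "\<tau> \<in> trees_on {1..k}"
  shows "pmf (random_labelling (plane_tree K)) \<tau> =
    (\<Sum>r\<in>{1..k}. \<Sum>(T, \<sigma>)\<in>labelled_plane_trees \<tau> r. indicator {T} (plane_tree K)) / fact k"
proof -
  note tree = trees_onD[OF t]
  have finL: "finite (labelled_plane_trees \<tau> r)" if "r \<in> {1..k}" for r
    using labelled_plane_trees_total(1)[OF t that, of 0] by simp
  let ?T = "plane_tree K"
  let ?B = "\<lambda>r. {\<sigma>. (?T, \<sigma>) \<in> labelled_plane_trees \<tau> r}"
  have sum1: "(\<Sum>(T, \<sigma>)\<in>labelled_plane_trees \<tau> r. indicator {T} ?T) = real (card (?B r))"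
    if r: "r \<in> {1..k}" for r
  proof -
    have "(\<Sum>(T, \<sigma>)\<in>labelled_plane_trees \<tau> r. indicator {T} ?T) =
        (\<Sum>x\<in>labelled_plane_trees \<tau> r. if fst x = ?T then 1 else (0::real))"
      by (intro sum.cong) (auto simp: indicator_def)
    also have "\<dots> = real (card {x \<in> labelled_plane_trees \<tau> r. fst x = ?T})"
      using finL[OF r] by (simp add: sum.If_cases Int_def)
    also have "{x \<in> labelled_plane_trees \<tau> r. fst x = ?T} = Pair ?T ` ?B r" by (auto simp: image_iff)
    also have "card (Pair ?T ` ?B r) = card (?B r)" by (intro card_image) (auto simp: inj_on_def)
    finally show ?thesis .
  qed
  have finB: "finite (?B r)" if "r \<in> {1..k}" for r
  proof -
    have "finite (snd ` labelled_plane_trees \<tau> r)" using finL[OF that] by simp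
    then show ?thesis by (rule rev_finite_subset) force
  qed
  have "(\<Sum>r\<in>{1..k}. real (card (?B r))) = real (card (\<Union>r\<in>{1..k}. ?B r))"
    using finB by (subst card_UN_disjoint) (auto simp: labelled_plane_trees_def)
  then have sum2: "(\<Sum>r\<in>{1..k}. \<Sum>(T, \<sigma>)\<in>labelled_plane_trees \<tau> r. indicator {T} ?T) =
      real (card (\<Union>r\<in>{1..k}. ?B r))"
    using sum1 by simp
  have UB: "(\<Union>r\<in>{1..k}. ?B r) =
      {\<sigma> \<in> ?T \<rightarrow>\<^sub>E {1..k}. bij_betw \<sigma> ?T {1..k} \<and> relabel \<sigma> (underlying_graph ?T) = \<tau>}"
    using tree(1) plane_tree_Nil[of K] by (auto simp: labelled_plane_trees_def PiE_iff)
  show ?thesis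
  proof (cases "finite ?T \<and> card ?T = k")
    case True
    let ?S = "{\<sigma> \<in> ?T \<rightarrow>\<^sub>E {1..card ?T}. bij_betw \<sigma> ?T {1..card ?T}}"
    have cS: "card ?S = fact k" using card_bij_funcset[of ?T "{1..card ?T}"] True by simp
    have "card ?S > 0" unfolding cS by simp
    then have S: "finite ?S" "?S \<noteq> {}" unfolding card_gt_0_iff by blast+
    have "pmf (random_labelling ?T) \<tau> = measure_pmf.prob (pmf_of_set ?S) ((\<lambda>\<sigma>. relabel \<sigma> (underlying_graph ?T)) -` {\<tau>})"
      using True by (simp add: random_labelling_def pmf_map)
    also have "\<dots> = real (card (?S \<inter> (\<lambda>\<sigma>. relabel \<sigma> (underlying_graph ?T)) -` {\<tau>})) / real (card ?S)"
      by (rule measure_pmf_of_set[OF S(2,1)])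
    also have "?S \<inter> (\<lambda>\<sigma>. relabel \<sigma> (underlying_graph ?T)) -` {\<tau>} = (\<Union>r\<in>{1..k}. ?B r)"
      unfolding UB using True by auto
    finally show ?thesis unfolding sum2 cS by simp
  next
    case False
    have "(\<Union>r\<in>{1..k}. ?B r) = {}"
    proof (rule ccontr)
      assume "(\<Union>r\<in>{1..k}. ?B r) \<noteq> {}"
      then obtain \<sigma> r where "(?T, \<sigma>) \<in> labelled_plane_trees \<tau> r" by auto
      from labelled_plane_trees_finite[OF this] show False using tree False by simp
    qed
    then have 0: "real (card (\<Union>r\<in>{1..k}. ?B r)) = 0" by simp
    \<comment> \<open>A plane tree of another size, or an infinite one, cannot produce
      \<tau>.\<close>
    have "\<tau> \<notin> set_pmf (random_labelling ?T)"
    proof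
      assume a: "\<tau> \<in> set_pmf (random_labelling ?T)"
      show False
      proof (cases "finite ?T")
        case True
        let ?S = "{\<sigma> \<in> ?T \<rightarrow>\<^sub>E {1..card ?T}. bij_betw \<sigma> ?T {1..card ?T}}"
        have cS: "card ?S = fact (card ?T)" using card_bij_funcset[of ?T "{1..card ?T}"] True by simp
        have "card ?S > 0" unfolding cS by simp
        then have S: "finite ?S" "?S \<noteq> {}" unfolding card_gt_0_iff by blast+
        from a obtain \<sigma> where s: "\<sigma> \<in> ?S" "\<tau> = relabel \<sigma> (underlying_graph ?T)"
          using True S by (auto simp: random_labelling_def)
        then have "{1..card ?T} = verts \<tau>" by (auto simp: underlying_graph_def bij_betw_def)
        then have "{1..card ?T} = {1..k}" using tree(1) by (rule trans)
        then have "card {1..card ?T} = card {1..k}" by (simp only:)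
        then show False using False True by simp
      next
        case False
        then have "\<tau> = Multigraph {} {#}" using a by (simp add: random_labelling_def)
        then show False using tree(1,5) by simp
      qed
    qed
    then have "pmf (random_labelling ?T) \<tau> = 0" by (simp add: set_pmf_iff)
    then show ?thesis unfolding sum2 0 by simp
  qed
qed

lemma sets_GW: "sets (GW \<mu>) = UNIV"
proof -
  have "sets (GW \<mu>) = sets (count_space UNIV)"
    unfolding GW_def by (rule sets_bind) (simp_all add: space_GW_offspring)
  then show ?thesis by simp
qed

lemma emeasure_GW:
  "emeasure (GW \<mu>) X = (\<integral>\<^sup>+K. emeasure (measure_pmf (random_labelling (plane_tree K))) X \<partial>GW_offspring \<mu>)"
  unfolding GW_def
  by (rule emeasure_bind[OF _ random_labelling_measurable]) (simp_all add: space_GW_offspring)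

lemma prob_space_GW: "prob_space (GW \<mu>)"
proof
  have "space (GW \<mu>) = UNIV" using sets_GW[of \<mu>] by (metis UNIV_I sets.sets_into_space top.extremum_uniqueI)
  then show "emeasure (GW \<mu>) (space (GW \<mu>)) = 1"
    using prob_space.emeasure_space_1[OF prob_space_GW_offspring[of \<mu>]] measure_pmf.emeasure_space_1
    by (simp add: emeasure_GW)
qed

text \<open>The k possible root labels contribute equally, which turns \<open>fact k\<close> into
  \<open>fact (k - 1)\<close>.\<close>

theorem measure_GW_tree:
  assumes t: "\<tau> \<in> trees_on {1..k}" and l: "0 \<le> l" and k: "1 \<le> k"
  shows "measure (GW (poisson_law l)) {\<tau>} = exp (- real k * l) * l ^ (k - 1) / fact (k - 1)"
proof -
  let ?M = "GW_offspring (poisson_law l)"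
  interpret P: prob_space ?M by (rule prob_space_GW_offspring)
  have cyl: "{K. plane_tree K = T} \<in> sets ?M" if "(T, \<sigma>) \<in> labelled_plane_trees \<tau> r" for T \<sigma> r
    using that labelled_plane_trees_finite[OF that] trees_onD(1,4)[OF t] emeasure_plane_tree(2)
    by (auto simp: labelled_plane_trees_def)
  have int: "(\<integral>K. indicator {T} (plane_tree K) \<partial>?M) = measure ?M {K. plane_tree K = T}"
    "integrable ?M (\<lambda>K. indicator {T} (plane_tree K) :: real)"
    if "(T, \<sigma>) \<in> labelled_plane_trees \<tau> r" for T \<sigma> r
  proof -
    have e: "(\<lambda>K. indicator {T} (plane_tree K) :: real) = indicator {K. plane_tree K = T}"
      by (auto simp: indicator_def)
    show "(\<integral>K. indicator {T} (plane_tree K) \<partial>?M) = measure ?M {K. plane_tree K = T}"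
      unfolding e by (simp add: space_GW_offspring)
    show "integrable ?M (\<lambda>K. indicator {T} (plane_tree K) :: real)"
      unfolding e using cyl[OF that] by (intro integrable_real_indicator) (auto simp: P.emeasure_eq_measure)
  qed
  let ?F = "\<lambda>K. (\<Sum>r\<in>{1..k}. \<Sum>(T, \<sigma>)\<in>labelled_plane_trees \<tau> r. indicator {T} (plane_tree K)) / fact k :: real"
  have intF: "integrable ?M ?F"
    using int(2) by (intro integrable_divide_zero Bochner_Integration.integrable_sum) (auto simp: case_prod_beta)
  have "emeasure (GW (poisson_law l)) {\<tau>} = (\<integral>\<^sup>+K. ennreal (?F K) \<partial>?M)"
    unfolding emeasure_GW by (simp add: emeasure_pmf_single pmf_random_labelling[OF t])
  also have "\<dots> = ennreal (\<integral>K. ?F K \<partial>?M)"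
    using intF by (intro nn_integral_eq_integral) (auto intro!: divide_nonneg_nonneg sum_nonneg)
  finally have "measure (GW (poisson_law l)) {\<tau>} = (\<integral>K. ?F K \<partial>?M)"
    by (simp add: measure_def integral_nonneg_AE sum_nonneg case_prod_beta)
  also have "\<dots> = (\<Sum>r\<in>{1..k}. \<Sum>(T, \<sigma>)\<in>labelled_plane_trees \<tau> r. measure ?M {K. plane_tree K = T}) / fact k"
  proof -
    have "(\<integral>K. (\<Sum>(T, \<sigma>)\<in>labelled_plane_trees \<tau> r. indicator {T} (plane_tree K)) \<partial>?M) =
        (\<Sum>(T, \<sigma>)\<in>labelled_plane_trees \<tau> r. measure ?M {K. plane_tree K = T})" for r
      unfolding case_prod_beta using int
      by (subst Bochner_Integration.integral_sum) (auto intro!: sum.cong)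
    moreover have "integrable ?M (\<lambda>K. \<Sum>(T, \<sigma>)\<in>labelled_plane_trees \<tau> r. indicator {T} (plane_tree K) :: real)" for r
      unfolding case_prod_beta using int(2) by (intro Bochner_Integration.integrable_sum) auto
    ultimately show ?thesis by (simp add: Bochner_Integration.integral_sum)
  qed
  also have "\<dots> = (\<Sum>r\<in>{1..k}. exp (- real k * l) * l ^ (k - 1)) / fact k"
    by (intro arg_cong2[where f = "(/)"] sum.cong refl labelled_plane_trees_total(2)[OF t _ l])
  also have "\<dots> = exp (- real k * l) * l ^ (k - 1) / fact (k - 1)"
    using k by (simp add: fact_reduce[of k])
  finally show ?thesis .
qed

text \<open>With \<open>measure_GW_tree\<close>, Cayley's formula identifies the size of the
  Galton-Watson tree as Borel distributed.\<close>

lemma num_trees_borel_mass: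
  assumes "1 \<le> k"
  shows "real (num_trees k) * (exp (- real k * l) * l ^ (k - 1) / fact (k - 1)) = borel_mass l k"
proof -
  have "alpha k = real (num_trees k) * real k / fact k"
    using cayley_formula[OF assms] by (simp add: alpha_def)
  also have "\<dots> = real (num_trees k) / fact (k - 1)"
    using assms by (simp add: fact_reduce[of k])
  finally show ?thesis by (simp add: borel_mass_def)
qed

section \<open>Convergence in distribution\<close>

lemma num_trees_pos: "1 \<le> k \<Longrightarrow> num_trees k > 0"
  using cayley_formula[of k] by (cases "num_trees k = 0") auto

text \<open>Outside F the integrand is at most B in absolute value, and the remaining mass is 1
  minus that of F.\<close>

lemma integral_finite_approx:
  fixes h :: "'a \<Rightarrow> real"
  assumes N: "prob_space N" "sets N = UNIV" and F: "finite F" and h: "\<And>x. \<bar>h x\<bar> \<le> B"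
  shows "\<bar>(\<integral>x. h x \<partial>N) - (\<Sum>x\<in>F. h x * measure N {x})\<bar> \<le> B * (1 - (\<Sum>x\<in>F. measure N {x}))"
proof -
  interpret prob_space N by fact
  have sp: "space N = UNIV" using N(2) by (metis UNIV_I sets.sets_into_space top.extremum_uniqueI)
  have meas: "q \<in> borel_measurable N" for q :: "'a \<Rightarrow> real"
    using N(2) by (auto simp: measurable_def sp)
  have B0: "0 \<le> B" using h[of undefined] by linarith
  have bint: "integrable N q" if "\<And>x. \<bar>q x\<bar> \<le> B" for q :: "'a \<Rightarrow> real"
    using that meas by (intro integrable_const_bound[where B = B]) auto
  have h1: "integrable N h" using h by (rule bint)
  have h2: "integrable N (\<lambda>x. h x * indicator (- F) x)"
    using h B0 by (intro bint) (auto simp: indicator_def)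
  have ind: "integrable N (indicator A :: 'a \<Rightarrow> real)" for A
    using N(2) by (intro integrable_real_indicator) (auto simp: emeasure_eq_measure)
  have split: "h x = (\<Sum>y\<in>F. h y * indicator {y} x) + h x * indicator (- F) x" for x
  proof -
    have "(\<Sum>y\<in>F. h y * indicator {y} x) = (if x \<in> F then h x else 0)"
      using F by (simp add: indicator_def if_distrib sum.delta cong: if_cong)
    then show ?thesis by (simp add: indicator_def)
  qed
  have "(\<integral>x. h x \<partial>N) = (\<integral>x. (\<Sum>y\<in>F. h y * indicator {y} x) + h x * indicator (- F) x \<partial>N)"
    using split by simp
  also have "\<dots> = (\<Sum>y\<in>F. h y * measure N {y}) + (\<integral>x. h x * indicator (- F) x \<partial>N)"
    using ind h2 by (subst Bochner_Integration.integral_add)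
      (auto simp: Bochner_Integration.integral_sum sp intro!: Bochner_Integration.integrable_sum)
  finally have "(\<integral>x. h x \<partial>N) - (\<Sum>x\<in>F. h x * measure N {x}) = (\<integral>x. h x * indicator (- F) x \<partial>N)" by simp
  also have "\<bar>\<dots>\<bar> \<le> (\<integral>x. \<bar>h x * indicator (- F) x\<bar> \<partial>N)" by (rule integral_abs_bound)
  also have "\<dots> \<le> (\<integral>x. B * indicator (- F) x \<partial>N)"
  proof (rule integral_mono)
    show "integrable N (\<lambda>x. \<bar>h x * indicator (- F) x\<bar>)" by (rule integrable_abs[OF h2])
    show "integrable N (\<lambda>x. B * indicator (- F) x)" by (intro integrable_mult_right ind)
    show "\<bar>h x * indicator (- F) x\<bar> \<le> B * indicator (- F) x" for x
      using h by (simp add: indicator_def)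
  qed
  also have "\<dots> = B * measure N (- F)" by (simp add: sp)
  also have "measure N (- F) = 1 - measure N F"
    using prob_compl[of F] N(2) by (simp add: sp Compl_eq_Diff_UNIV)
  also have "measure N F = (\<Sum>x\<in>F. measure N {x})"
    using F N(2) by (intro finite_measure_eq_sum_singleton) auto
  finally show ?thesis .
qed

text \<open>Scheffe's argument: pointwise convergence on a set carrying the whole limit mass
  prevents escape of mass, since the mass of a large finite F converges too.\<close>

lemma converges_in_distribution_pointwise:
  assumes N: "prob_space N" "sets N = UNIV"
    and lim: "\<And>x. x \<in> X \<Longrightarrow> (\<lambda>n. pmf (P n) x) \<longlonglongrightarrow> measure N {x}"
    and mass: "\<And>\<epsilon>. 0 < \<epsilon> \<Longrightarrow> \<exists>F. finite F \<and> F \<subseteq> X \<and> 1 - (\<Sum>x\<in>F. measure N {x}) \<le> \<epsilon>"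
  shows "converges_in_distribution (\<lambda>n. measure_pmf (P n)) N"
  unfolding converges_in_distribution_def
proof (intro allI impI)
  fix h :: "'a \<Rightarrow> real" assume "bounded (range h)"
  then obtain B0 where B0: "\<And>x. \<bar>h x\<bar> \<le> B0" by (auto simp: bounded_iff)
  define B where "B = \<bar>B0\<bar> + 1"
  have B: "\<bar>h x\<bar> \<le> B" "B > 0" for x using B0[of x] by (auto simp: B_def)
  show "(\<lambda>n. \<integral>x. h x \<partial>measure_pmf (P n)) \<longlonglongrightarrow> (\<integral>x. h x \<partial>N)"
  proof (rule tendstoI)
    fix e :: real assume e: "0 < e"
    \<comment> \<open>With this \<delta> the tail of the limit costs e / 4, the tail of
      \<open>P n\<close> costs e / 2 and the finite sum e / 4.\<close>
    define \<delta> where "\<delta> = e / (4 * B)"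
    have \<delta>: "\<delta> > 0" "B * \<delta> = e / 4" using e B(2) by (auto simp: \<delta>_def)
    obtain F where F: "finite F" "F \<subseteq> X" "1 - (\<Sum>x\<in>F. measure N {x}) \<le> \<delta>" using mass[OF \<delta>(1)] by blast
    let ?S = "\<lambda>n. \<Sum>x\<in>F. h x * pmf (P n) x" and ?SN = "\<Sum>x\<in>F. h x * measure N {x}"
    have "?S \<longlonglongrightarrow> ?SN" using F lim by (intro tendsto_intros) auto
    then have "\<forall>\<^sub>F n in sequentially. dist (?S n) ?SN < e / 4" using e by (intro tendstoD) auto
    moreover have "(\<lambda>n. B * (1 - (\<Sum>x\<in>F. pmf (P n) x))) \<longlonglongrightarrow> B * (1 - (\<Sum>x\<in>F. measure N {x}))"
      using F lim by (intro tendsto_intros) auto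
    then have "\<forall>\<^sub>F n in sequentially. B * (1 - (\<Sum>x\<in>F. pmf (P n) x)) < B * (1 - (\<Sum>x\<in>F. measure N {x})) + e / 4"
      using e by (intro order_tendstoD) auto
    ultimately show "\<forall>\<^sub>F n in sequentially. dist (\<integral>x. h x \<partial>measure_pmf (P n)) (\<integral>x. h x \<partial>N) < e"
    proof eventually_elim
      case (elim n)
      have 1: "\<bar>(\<integral>x. h x \<partial>measure_pmf (P n)) - ?S n\<bar> \<le> B * (1 - (\<Sum>x\<in>F. pmf (P n) x))"
        using integral_finite_approx[OF measure_pmf.prob_space_axioms _ F(1) B(1), of "P n"]
        by (simp add: measure_pmf_single)
      have 2: "\<bar>(\<integral>x. h x \<partial>N) - ?SN\<bar> \<le> B * (1 - (\<Sum>x\<in>F. measure N {x}))"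
        by (rule integral_finite_approx[OF N F(1) B(1)])
      have 3: "B * (1 - (\<Sum>x\<in>F. measure N {x})) \<le> e / 4"
        using mult_left_mono[OF F(3), of B] B(2) \<delta>(2) by simp
      have 4: "\<bar>?S n - ?SN\<bar> < e / 4" using elim(1) by (simp add: dist_real_def)
      have "\<bar>x - y\<bar> < e" if "\<bar>x - u\<bar> \<le> c" "c < c' + e / 4" "\<bar>y - w\<bar> \<le> c'" "c' \<le> e / 4" "\<bar>u - w\<bar> < e / 4"
        for x y u w c c' :: real using that by argo
      from this[OF 1 elim(2) 2 3 4] show ?case by (simp add: dist_real_def)
    qed
  qed
qed

context frozen_parameter
begin

text \<open>By uniformity the probability of \<tau> is that of its size divided by the number of
  trees. Conditioning divides by a quantity tending to 1 - g t > 0, which cancels the same factor in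
  \<open>gamma\<close>.\<close>

lemma cond_CC_star_limit:
  assumes t: "0 \<le> t" and k: "1 \<le> k" and \<tau>: "\<tau> \<in> trees_on {1..k}"
  shows "(\<lambda>n. pmf (cond_pmf (CC_star p n (clock t n)) {G. is_tree G}) \<tau>) \<longlonglongrightarrow>
    measure (GW (poisson_law (2 * t * (1 - g t)))) {\<tau>}"
proof -
  let ?l = "2 * t * (1 - g t)"
  let ?Y = "\<lambda>n. EE n (clock t n) (\<lambda>x. yfrac n k (fst x))" and ?V = "\<lambda>n. EE n (clock t n) (\<lambda>x. vfrac n (fst x))"
  have l: "0 \<le> ?l" using t g_range[of t] by simp
  have V: "?V \<longlonglongrightarrow> 1 - g t" by (rule expectation_vfrac_limit[OF t])
  have Y: "?Y \<longlonglongrightarrow> gamma k t" by (rule expectation_yfrac_limit[OF t k])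
  have pos: "1 - g t > 0" using g_range[of t] by simp
  have N: "real (num_trees k) > 0" using num_trees_pos[OF k] by simp
  have "(\<lambda>n. ?Y n / real (num_trees k) / ?V n) \<longlonglongrightarrow> gamma k t / real (num_trees k) / (1 - g t)"
    using V Y pos N by (intro tendsto_intros) auto
  also have "gamma k t / real (num_trees k) / (1 - g t) = borel_mass ?l k / real (num_trees k)"
    unfolding gamma_def xi_exp_A[OF k] using pos by simp
  also have "\<dots> = measure (GW (poisson_law ?l)) {\<tau>}"
    unfolding measure_GW_tree[OF \<tau> l k] num_trees_borel_mass[OF k, symmetric] using N by simp
  finally have lim: "(\<lambda>n. ?Y n / real (num_trees k) / ?V n) \<longlonglongrightarrow> measure (GW (poisson_law ?l)) {\<tau>}" .
  have "\<forall>\<^sub>F n in sequentially. ?V n > 0" using V pos by (rule order_tendstoD)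
  then have "\<forall>\<^sub>F n in sequentially. ?Y n / real (num_trees k) / ?V n =
      pmf (cond_pmf (CC_star p n (clock t n)) {G. is_tree G}) \<tau>"
    using eventually_ge_at_top[of 2]
  proof eventually_elim
    case (elim n)
    have v: "measure_pmf.prob (CC_star p n (clock t n)) {G. is_tree G} = ?V n"
      by (rule prob_CC_star_tree[OF elim(2)])
    \<comment> \<open>\<open>cond_pmf\<close> is meaningful only for an event of positive
      probability, which this one is for large n.\<close>
    have "set_pmf (CC_star p n (clock t n)) \<inter> {G. is_tree G} \<noteq> {}"
      using elim(1) v measure_pmf_zero_iff[of "CC_star p n (clock t n)" "{G. is_tree G}"] by auto
    then have "pmf (cond_pmf (CC_star p n (clock t n)) {G. is_tree G}) \<tau> = pmf (CC_star p n (clock t n)) \<tau> / ?V n"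
      using trees_onD(3)[OF \<tau>] v by (simp add: pmf_cond)
    moreover have "?Y n = real (num_trees k) * pmf (CC_star p n (clock t n)) \<tau>"
      using prob_CC_star_tree_size[OF elim(2) p0 p_le_1 \<tau>] prob_CC_star_tree_of_size[OF elim(2)] by metis
    ultimately show ?case using N by simp
  qed
  from Lim_transform_eventually[OF lim this] show ?thesis .
qed

text \<open>The offspring mean is at most 1, so the tree is almost surely finite: the Borel weights
  have total mass 1, and finitely many sizes nearly exhaust it.\<close>

lemma GW_mass:
  assumes t: "0 \<le> t" and e: "0 < \<epsilon>"
  defines "N \<equiv> GW (poisson_law (2 * t * (1 - g t)))"
  shows "\<exists>F. finite F \<and> F \<subseteq> (\<Union>k\<in>{1..}. trees_on {1..k}) \<and> 1 - (\<Sum>x\<in>F. measure N {x}) \<le> \<epsilon>"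
proof -
  let ?l = "2 * t * (1 - g t)"
  have l: "0 \<le> ?l" "?l \<le> 1" using t g_range[of t] mult_g_le_1[OF t] by auto
  have "(\<lambda>K. \<Sum>k<K. borel_mass ?l (Suc k)) \<longlonglongrightarrow> 1"
    using borel_mass_sums[OF l] by (simp add: sums_def)
  then have "\<forall>\<^sub>F K in sequentially. (\<Sum>k<K. borel_mass ?l (Suc k)) > 1 - \<epsilon>"
    using e by (intro order_tendstoD) auto
  then obtain K where K: "(\<Sum>k<K. borel_mass ?l (Suc k)) > 1 - \<epsilon>"
    by (meson eventually_sequentially order_refl)
  let ?F = "\<Union>k\<in>{1..K}. trees_on {1..k}"
  have "(\<Sum>x\<in>?F. measure N {x}) = (\<Sum>k\<in>{1..K}. \<Sum>x\<in>trees_on {1..k}. measure N {x})"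
  proof (rule sum.UNION_disjoint)
    show "\<forall>i\<in>{1..K}. \<forall>j\<in>{1..K}. i \<noteq> j \<longrightarrow> trees_on {1..i} \<inter> trees_on {1..j} = {}"
    proof (intro ballI impI)
      fix i j :: nat assume "i \<noteq> j"
      show "trees_on {1..i} \<inter> trees_on {1..j} = {}"
      proof (rule ccontr)
        assume "trees_on {1..i} \<inter> trees_on {1..j} \<noteq> {}"
        then have "card {1..i} = card {1..j}" using trees_onD(1) by (metis disjoint_iff)
        then show False using \<open>i \<noteq> j\<close> by simp
      qed
    qed
  qed (auto intro: finite_trees_on)
  also have "\<dots> = (\<Sum>k\<in>{1..K}. borel_mass ?l k)"
  proof (rule sum.cong[OF refl])
    fix k assume "k \<in> {1..K}"
    then have k: "1 \<le> k" by simp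
    have "(\<Sum>x\<in>trees_on {1..k}. measure N {x}) =
        (\<Sum>x\<in>trees_on {1..k}. exp (- real k * ?l) * ?l ^ (k - 1) / fact (k - 1))"
      unfolding N_def by (rule sum.cong[OF refl]) (rule measure_GW_tree[OF _ l(1) k])
    also have "\<dots> = real (num_trees k) * (exp (- real k * ?l) * ?l ^ (k - 1) / fact (k - 1))"
      by (simp add: num_trees_def)
    finally show "(\<Sum>x\<in>trees_on {1..k}. measure N {x}) = borel_mass ?l k"
      by (simp only: num_trees_borel_mass[OF k])
  qed
  also have "\<dots> = (\<Sum>k<K. borel_mass ?l (Suc k))" by (simp add: sum.atLeast1_atMost_eq)
  finally have "1 - (\<Sum>x\<in>?F. measure N {x}) \<le> \<epsilon>" using K by simp
  moreover have "finite ?F" by (auto intro: finite_trees_on)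
  moreover have "?F \<subseteq> (\<Union>k\<in>{1..}. trees_on {1..k})" by auto
  ultimately show ?thesis by blast
qed

lemma CC_star_converges:
  assumes t: "0 \<le> t"
  shows "converges_in_distribution
      (\<lambda>n. measure_pmf (cond_pmf (CC_star p n (clock t n)) {G. is_tree G}))
      (GW (poisson_law (2 * t * (1 - g t))))"
  by (rule converges_in_distribution_pointwise[OF prob_space_GW sets_GW _ GW_mass[OF t]])
     (elim UN_E, rule cond_CC_star_limit[OF t], simp_all only: atLeast_iff)

lemma CC_star_tree_size_limit:
  assumes t: "0 \<le> t" and k: "1 \<le> k"
  shows "(\<lambda>n. measure_pmf.prob (CC_star p n (clock t n)) {G. is_tree G \<and> card (verts G) = k})
      \<longlonglongrightarrow> real k * t_fun p k t"
proof -
  have "(\<lambda>n. EE n (clock t n) (\<lambda>x. yfrac n k (fst x))) \<longlonglongrightarrow> real k * t_fun p k t"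
    using expectation_yfrac_limit[OF t k] unfolding gamma_def xi_exp_A_eq_t_fun[OF k] .
  moreover have "\<forall>\<^sub>F n in sequentially. EE n (clock t n) (\<lambda>x. yfrac n k (fst x)) =
      measure_pmf.prob (CC_star p n (clock t n)) {G. is_tree G \<and> card (verts G) = k}"
    using eventually_ge_at_top[of 2]
    by eventually_elim (rule prob_CC_star_tree_of_size[symmetric])
  ultimately show ?thesis by (rule Lim_transform_eventually)
qed

end

theorem corollary1p8:
  fixes p t :: real
  assumes "0 < p" and "p \<le> 1" and "0 \<le> t"
  shows "converges_in_distribution
           (\<lambda>n. measure_pmf (cond_pmf (CC_star p n (nat \<lfloor>real n * t\<rfloor>)) {G. is_tree G}))
           (GW (poisson_law (2 * t * (1 - g_fun p t))))
       \<and> (\<forall>k::nat. 1 \<le> k \<longrightarrow>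
           (\<lambda>n. measure_pmf.prob (CC_star p n (nat \<lfloor>real n * t\<rfloor>))
                  {G. is_tree G \<and> card (verts G) = k})
           \<longlonglongrightarrow> real k * t_fun p k t)"
proof -
  interpret frozen_parameter p using assms by unfold_locales
  show ?thesis using CC_star_converges[OF assms(3)] CC_star_tree_size_limit[OF assms(3)] by blast
qed

end
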